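(* Let $n\geq 2$ and $d\geq 1$ be integers, let $R$ be a commutative ring, and let $F^{\{1\}},\ldots,F^{\{n\}}\in R[x_1,\ldots,x_n]$ be homogeneous polynomials of the same degree $d$ such that for every $i\in\{1,\ldots,n\}$ and every permutation $\sigma\in\mathfrak{S}_n$, $$F^{\{i\}}(x_{\sigma(1)},x_{\sigma(2)},\ldots,x_{\sigma(n)})=F^{\{\sigma(i)\}}(x_1,x_2,\ldots,x_n).$$ Let $F^{I}$, $F_\lambda^{I}$, $m_\lambda$, $l(\lambda)$ and $\mathrm{Res}$ be as defined in the context. Then the following equalities hold in $R$. (1) If $d\geq n$, then $$\mathrm{Res}\left(F^{\{1\}},\ldots,F^{\{n\}}\right)=\prod_{\lambda\vdash n}\mathrm{Res}\left(F_\lambda^{\{1\}},F_\lambda^{\{1,2\}},\ldots,F_\lambda^{\{1,2,\ldots,l(\lambda)-1\}},F_\lambda^{\{1,2,\ldots,l(\lambda)\}}\right)^{m_\lambda}.$$ (2) If $d<n$, then $$\mathrm{Res}\left(F^{\{1\}},\ldots,F^{\{n\}}\right)=\left(F^{\{1,\ldots,d+1\}}\right)^{m_0}\times\prod_{\substack{\lambda\vdash n\\ l(\lambda)\leq d}}\mathrm{Res}\left(F_\lambda^{\{1\}},F_\lambda^{\{1,2\}},\ldots,F_\lambda^{\{1,2,\ldots,l(\lambda)-1\}},F_\lambda^{\{1,2,\ldots,l(\lambda)\}}\right)^{m_\lambda},$$ where $$m_0:=nd^{n-1}-\sum_{\substack{\lambda\vdash n\\ l(\lambda)\leq d}}m_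\lambda\left(\sum_{j=1}^{l(\lambda)}\frac{d(d-1)\cdots(d-l(\lambda)+1)}{d-j+1}\right).$$
   Context: Notation: $[p]=\{1,\ldots,p\}$. Divided differences. Let $A$ be a commutative ring and let $P^{\{1\}},\ldots,P^{\{m\}}\in A[x_1,\ldots,x_m]$ be homogeneous of the same degree $d\ge 1$ such that $P^{\{i\}}-P^{\{j\}}$ is divisible by $x_i-x_j$ for all $i,j\in[m]$. For any subset $\{i_1,\ldots,i_k\}\subset[m]$ of $k\geq 2$ distinct elements, the divided difference $P^{\{i_1,\ldots,i_k\}}$ is the unique homogeneous polynomial of degree $d-k+1$ (it is $0$ if $k>d+1$) such that $\prod_{1\le s<r\le k}(x_{i_r}-x_{i_s})\cdot P^{\{i_1,\ldots,i_k\}}$ equals the determinant of the $k\times k$ matrix whose $r$-th row is $(1,x_{i_r},\ldots,x_{i_r}^{k-2},P^{\{i_r\}})$. It does not depend on the order of $i_1,\ldots,i_k$. For $m=1$ only $P^{\{1\}}$ itself occurs. The equivariance hypothesis implies the divisibility condition, so the $F^{\{i\}}$ have divided differences $F^{I}$, $I\subset[n]$. When $d<n$, $F^{\{1,\ldots,d+1\}}$ has degree $0$, i.e. is an element of $R$. Partitions. A partition $\lambda\vdash n$ is a weakly decreasing sequence $\lambda_1\geq\cdots\geq\lambda_{k}>0$ of integers of sum $n$; $l(\lambda)=k$ is its length. Let $\rho_\lambda:R[x_1,\ldots,x_n]\to R[y_1,\ldots,y_{l(\lambda)}]$ be the $R$-algebra morphism sending the first $\lambda_1$ variables to $y_1$,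 the next $\lambda_2$ variables to $y_2$, ..., the last $\lambda_{l(\lambda)}$ variables to $y_{l(\lambda)}$. For $i\in[l(\lambda)]$ set $F_\lambda^{\{i\}}(y_1,\ldots,y_{l(\lambda)}):=\rho_\lambda(F^{\{j\}})$ for any $j\in[n]$ with $\rho_\lambda(x_j)=y_i$ (this is independent of the choice of $j$). The polynomials $F_\lambda^{\{1\}},\ldots,F_\lambda^{\{l(\lambda)\}}$ in $R[y_1,\ldots,y_{l(\lambda)}]$ again satisfy that $F_\lambda^{\{i\}}-F_\lambda^{\{j\}}$ is divisible by $y_i-y_j$; their divided differences are denoted $F_\lambda^{I}$, $I\subset[l(\lambda)]$. The integer $m_\lambda$ is $$m_\lambda:=\frac{1}{\prod_{j=1}^n s_j!}\cdot\frac{n!}{\lambda_1!\lambda_2!\cdots\lambda_{l(\lambda)}!},$$ where $s_j$ is the number of indices $i$ with $\lambda_i=j$. Resultant. For $m\ge1$ and positive integers $d_1,\ldots,d_m$, let $f_i=\sum_{|\alpha|=d_i}u_{i,\alpha}x^\alpha$ ($i=1,\ldots,m$) be the generic homogeneous polynomials of degrees $d_1,\dots,d_m$ in $m$ variables $x_1,\dots,x_m$, over $\mathbb{U}=\mathbb{Z}[u_{i,\alpha}]$. The degree zero part of the ideal $(f_1,\ldots,f_m):(x_1,\ldots,x_m)^\infty$ is a principal ideal of $\mathbb{U}$; the universal resultant is its unique generator whose specialization at $f_i=x_i^{d_i}$ for all $i$ is $1$. For homogeneous polynomials $g_1,\ldots,g_m$ of degrees $d_1,\ldots,d_m$ in $m$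 variables over any commutative ring $S$, $\mathrm{Res}(g_1,\ldots,g_m)\in S$ is the image of the universal resultant under the specialization of the $u_{i,\alpha}$ to the coefficients of the $g_i$. *)

theory Defs
  imports "Jordan_Normal_Form.Determinant" "HOL-Library.Poly_Mapping"
begin

section \<open>Polynomials\<close>

text \<open>Exponent vectors are finitely supported maps from indeterminates to \<^typ>\<open>nat\<close>, and
  multiplication of \<^type>\<open>poly_mapping\<close> is the convolution product, so the type below is
  the polynomial ring in all indeterminates of type \<open>'v\<close>. A polynomial ring in fewer
  indeterminates, such as \<open>A[x_1, ..., x_m]\<close>, is the subset \<open>polys {1..m}\<close>.\<close>

type_synonym ('v, 'a) mpoly = "('v \<Rightarrow>\<^sub>0 nat) \<Rightarrow>\<^sub>0 'a"

definition Var :: "'v \<Rightarrow> ('v, 'a::comm_ring_1) mpoly" where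
  "Var x = Poly_Mapping.single (Poly_Mapping.single x 1) 1"

definition Const :: "'a::comm_ring_1 \<Rightarrow> ('v, 'a) mpoly" where
  "Const c = Poly_Mapping.single 0 c"

definition polys :: "'v set \<Rightarrow> ('v, 'a::comm_ring_1) mpoly set" where
  "polys V = {p. \<forall>t \<in> Poly_Mapping.keys p. Poly_Mapping.keys t \<subseteq> V}"

definition mdeg :: "('v \<Rightarrow>\<^sub>0 nat) \<Rightarrow> nat" where
  "mdeg t = (\<Sum>x\<in>Poly_Mapping.keys t. Poly_Mapping.lookup t x)"

text \<open>The zero polynomial is homogeneous of every degree.\<close>

definition homogeneous :: "nat \<Rightarrow> ('v, 'a::comm_ring_1) mpoly \<Rightarrow> bool" where
  "homogeneous e p \<longleftrightarrow> (\<forall>t \<in> Poly_Mapping.keys p. mdeg t = e)"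

text \<open>For a ring morphism \<open>\<phi>\<close>, \<open>mp_eval \<phi> v\<close> is the ring morphism that acts as \<open>\<phi>\<close> on
  coefficients and sends each indeterminate \<open>x\<close> to \<open>v x\<close>.\<close>

definition mp_eval :: "('a::comm_ring_1 \<Rightarrow> 'b::comm_ring_1) \<Rightarrow> ('v \<Rightarrow> 'b) \<Rightarrow> ('v, 'a) mpoly \<Rightarrow> 'b" where
  "mp_eval \<phi> v p = (\<Sum>t\<in>Poly_Mapping.keys p.
     \<phi> (Poly_Mapping.lookup p t) * (\<Prod>x\<in>Poly_Mapping.keys t. v x ^ Poly_Mapping.lookup t x))"

definition subst_vars :: "('v \<Rightarrow> 'w) \<Rightarrow> ('v, 'a::comm_ring_1) mpoly \<Rightarrow> ('w, 'a) mpoly" where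
  "subst_vars f = mp_eval Const (\<lambda>x. Var (f x))"


section \<open>Divided differences\<close>

text \<open>The indices in \<open>I\<close> are taken in increasing order; matrix rows and columns are numbered
  from \<open>0\<close>.\<close>

definition divdiff ::
  "nat \<Rightarrow> nat \<Rightarrow> (nat \<Rightarrow> (nat, 'a::comm_ring_1) mpoly) \<Rightarrow> nat set \<Rightarrow> (nat, 'a) mpoly" where
  "divdiff m d P I =
    (let k = card I; is = sorted_list_of_set I in
     if k = 1 then P (is ! 0)
     else (THE q. q \<in> polys {1..m} \<and> homogeneous (d + 1 - k) q \<and> (k > d + 1 \<longrightarrow> q = 0) \<and>
       (\<Prod>r<k. \<Prod>s<r. Var (is ! r) - Var (is ! s)) * q =
       det (mat k k (\<lambda>(r, s). if s < k - 1 then Var (is ! r) ^ s else P (is ! r)))))"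


section \<open>Partitions\<close>

definition partitions :: "nat \<Rightarrow> nat list set" where
  "partitions n = {\<mu>. sorted_wrt (\<ge>) \<mu> \<and> (\<forall>p\<in>set \<mu>. p > 0) \<and> sum_list \<mu> = n}"

text \<open>For \<open>1 \<le> j \<le> sum_list \<mu>\<close>, \<open>block \<mu> j\<close> is the \<open>i\<close> for which the morphism attached to \<open>\<mu>\<close>
  sends \<open>x_j\<close> to \<open>y_i\<close>: the first \<open>\<mu> ! 0\<close> indices are sent to \<open>1\<close>, the next \<open>\<mu> ! 1\<close> to \<open>2\<close>,
  and so on.\<close>

definition block :: "nat list \<Rightarrow> nat \<Rightarrow> nat" where
  "block \<mu> j = (LEAST i. j \<le> sum_list (take i \<mu>))"

definition rho :: "nat list \<Rightarrow> (nat, 'a::comm_ring_1) mpoly \<Rightarrow> (nat, 'a) mpoly" where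
  "rho \<mu> = subst_vars (block \<mu>)"

definition F_part ::
  "nat list \<Rightarrow> (nat \<Rightarrow> (nat, 'a::comm_ring_1) mpoly) \<Rightarrow> nat \<Rightarrow> (nat, 'a) mpoly" where
  "F_part \<mu> F i = rho \<mu> (F (SOME j. j \<in> {1..sum_list \<mu>} \<and> block \<mu> j = i))"

text \<open>The division is exact: the quotient is the number of set partitions of an
  \<open>n\<close>-element set whose block sizes are the parts of \<open>\<mu>\<close>.\<close>

definition m_part :: "nat list \<Rightarrow> nat" where
  "m_part \<mu> = fact (sum_list \<mu>) div
     ((\<Prod>j=1..sum_list \<mu>. fact (count_list \<mu> j)) * (\<Prod>i<length \<mu>. fact (\<mu> ! i)))"

definition m_zero :: "nat \<Rightarrow> nat \<Rightarrow> rat" where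
  "m_zero n d = of_nat n * of_nat d ^ (n - 1) -
     (\<Sum>\<mu> | \<mu> \<in> partitions n \<and> length \<mu> \<le> d. of_nat (m_part \<mu>) *
       (\<Sum>j=1..length \<mu>. (\<Prod>i<length \<mu>. of_nat d - of_nat i) / (of_nat d - of_nat j + 1)))"


section \<open>Ideals in a subring\<close>

text \<open>\<open>S\<close> is the carrier of a subring of \<open>'a\<close>; ideals are ideals of \<open>S\<close>.\<close>

definition gen_ideal :: "'a::comm_ring_1 set \<Rightarrow> 'a set \<Rightarrow> 'a set" where
  "gen_ideal S G = {\<Sum>g\<in>H. c g * g | H c. finite H \<and> H \<subseteq> G \<and> (\<forall>g\<in>H. c g \<in> S)}"

primrec ideal_power :: "'a::comm_ring_1 set \<Rightarrow> 'a set \<Rightarrow> nat \<Rightarrow> 'a set" where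
  "ideal_power S J 0 = S"
| "ideal_power S J (Suc k) = gen_ideal S {a * b | a b. a \<in> J \<and> b \<in> ideal_power S J k}"

definition saturation :: "'a::comm_ring_1 set \<Rightarrow> 'a set \<Rightarrow> 'a set \<Rightarrow> 'a set" where
  "saturation S I J = {p \<in> S. \<exists>k. \<forall>q \<in> ideal_power S J k. p * q \<in> I}"


section \<open>Resultants\<close>

text \<open>Throughout, \<open>m\<close> is the number of polynomials and of indeterminates, and \<open>d i\<close> is the
  degree of the \<open>i\<close>-th polynomial, for \<open>i \<in> {1..m}\<close>. The degrees have to be given explicitly,
  since a polynomial that vanishes does not determine its degree. The indeterminate \<open>(i, \<alpha>)\<close>
  is the coefficient of \<open>x^\<alpha>\<close> in the \<open>i\<close>-th generic polynomial.\<close>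

type_synonym coeff_ring = "(nat \<times> (nat \<Rightarrow>\<^sub>0 nat), int) mpoly"

definition exponents :: "nat \<Rightarrow> nat \<Rightarrow> (nat \<Rightarrow>\<^sub>0 nat) set" where
  "exponents m e = {\<alpha>. Poly_Mapping.keys \<alpha> \<subseteq> {1..m} \<and> mdeg \<alpha> = e}"

definition U_ring :: "nat \<Rightarrow> (nat \<Rightarrow> nat) \<Rightarrow> coeff_ring set" where
  "U_ring m d = polys (SIGMA i:{1..m}. exponents m (d i))"

definition Ux_ring :: "nat \<Rightarrow> (nat \<Rightarrow> nat) \<Rightarrow> (nat, coeff_ring) mpoly set" where
  "Ux_ring m d = {p \<in> polys {1..m}. \<forall>t. Poly_Mapping.lookup p t \<in> U_ring m d}"

definition generic_poly :: "nat \<Rightarrow> (nat \<Rightarrow> nat) \<Rightarrow> nat \<Rightarrow> (nat, coeff_ring) mpoly" where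
  "generic_poly m d i = (\<Sum>\<alpha>\<in>exponents m (d i). Poly_Mapping.single \<alpha> (Var (i, \<alpha>)))"

text \<open>The degree zero part of \<open>(f_1, ..., f_m) : (x_1, ..., x_m)^\<infinity>\<close>.\<close>

definition inertia_deg0 :: "nat \<Rightarrow> (nat \<Rightarrow> nat) \<Rightarrow> coeff_ring set" where
  "inertia_deg0 m d = {a \<in> U_ring m d. Const a \<in>
     saturation (Ux_ring m d)
       (gen_ideal (Ux_ring m d) (generic_poly m d ` {1..m}))
       (gen_ideal (Ux_ring m d) (Var ` {1..m}))}"

definition specialize :: "(nat \<Rightarrow> (nat, 'a::comm_ring_1) mpoly) \<Rightarrow> coeff_ring \<Rightarrow> 'a" where
  "specialize g = mp_eval of_int (\<lambda>(i, \<alpha>). Poly_Mapping.lookup (g i) \<alpha>)"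

definition universal_Res :: "nat \<Rightarrow> (nat \<Rightarrow> nat) \<Rightarrow> coeff_ring" where
  "universal_Res m d = (THE r. r \<in> U_ring m d \<and>
     inertia_deg0 m d = gen_ideal (U_ring m d) {r} \<and>
     specialize (\<lambda>i. Var i ^ d i :: (nat, int) mpoly) r = 1)"

definition Res ::
  "nat \<Rightarrow> (nat \<Rightarrow> nat) \<Rightarrow> (nat \<Rightarrow> (nat, 'a::comm_ring_1) mpoly) \<Rightarrow> 'a" where
  "Res m d g = specialize g (universal_Res m d)"

text \<open>For a partition \<open>\<mu>\<close> with \<open>l\<close> parts, the resultant of the divided differences
  on \<open>{1}, {1, 2}, ..., {1, ..., l}\<close>, whose degrees are \<open>d, d - 1, ..., d - l + 1\<close>.\<close>

definition Res_part :: "nat \<Rightarrow> (nat \<Rightarrow> (nat, 'a::comm_ring_1) mpoly) \<Rightarrow> nat list \<Rightarrow> 'a" where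
  "Res_part d F \<mu> = Res (length \<mu>) (\<lambda>k. d + 1 - k)
     (\<lambda>k. divdiff (length \<mu>) d (F_part \<mu> F) {1..k})"

end

theory Submission
  imports Defs
    "HOL-Library.Product_Lexorder"
    "HOL-Computational_Algebra.Polynomial"
    "HOL-Computational_Algebra.Fraction_Field"
    "HOL-Computational_Algebra.Primes"
    "HOL-Combinatorics.Permutations"
begin

text \<open>Take the equations \<open>F 1, ..., F n\<close> one after the other. When the indeterminates seen so far
  have been grouped into blocks with representatives \<open>a_1, ..., a_k\<close>, the next equation \<open>F p\<close> can be
  replaced by its difference with the equation of \<open>a_1\<close>, which is the product of \<open>x_p - x_(a_1)\<close>
  and a divided difference. By multiplicativity the resultant splits: in one factor \<open>p\<close> joins the block
  of \<open>a_1\<close>, and in the other the divided difference is compared with that of \<open>a_2\<close>, and so on, until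
  \<open>p\<close> opens a new block or, if \<open>k = d\<close>, only the constant \<open>d\<close>-th divided difference remains. The
  leaves of this tree are the set partitions of \<open>{1..n}\<close> with at most \<open>d\<close> blocks. At a leaf the linear
  equations identify the indeterminates of each block, and equivariance together with the symmetry of
  divided differences shows that the remaining resultant depends only on the block sizes. The exponent of
  the constant follows from conservation of total degree along the tree.

  The properties of the resultant that this needs come from the inertia forms of the generic system:
  these are the polynomials vanishing at a generic zero, hence form a prime ideal; it contains a Macaulay
  determinant, and since no nonzero inertia form is free of the coefficient of \<open>x_j ^ d j\<close>, it is
  principal.\<close>

section \<open>Polynomials and their morphisms\<close>

text \<open>Nothing can be cancelled over an arbitrary commutative ring, so the properties of the
  resultant are proved for indeterminate coefficients over the integers and then specialized. The
  usual scheme: a zero of one generic system yields a zero of another, so the universal resultant of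
  the first, being prime, divides the resultant of the second; comparing the degrees in the
  coefficients of each equation shows the cofactor to be an integer; a test system built from powers
  of linear forms shows it to be 1. The obstacle is that this needs the exact degrees. The Macaulay
  determinant bounds them from above only; the lower bound comes from splitting degree 1 off an
  equation, which reduces it to linear forms. Primality rests on factorization in polynomial rings
  over the integers, developed first. A second obstacle is a sign. The tree numbers blocks by their
  least elements, partitions by decreasing size, and exchanging two indeterminates may change the
  sign of a resultant. Here it does not: adjacent divided differences have consecutive degrees, one
  of which is even.\<close>

lemma pm_sum_single: "p = (\<Sum>t\<in>Poly_Mapping.keys p. Poly_Mapping.single t (Poly_Mapping.lookup p t))"
  by (rule poly_mapping_eqI) (auto simp: lookup_sum lookup_single when_def in_keys_iff)

lemma pm_single_induct [case_names single add]:
  assumes "\<And>t c. P (Poly_Mapping.single t c)"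
    and "\<And>p q. P p \<Longrightarrow> P q \<Longrightarrow> P (p + q)"
  shows "P (p :: 'a \<Rightarrow>\<^sub>0 'b::comm_monoid_add)"
proof -
  have "P (\<Sum>t\<in>A. Poly_Mapping.single t (Poly_Mapping.lookup p t))" if "finite A" for A
    using that
  proof induction
    case empty
    show ?case using assms(1)[of undefined 0] by simp
  next
    case (insert x F)
    then show ?case using assms by simp
  qed
  from this[of "Poly_Mapping.keys p"] show ?thesis
    by (simp flip: pm_sum_single)
qed

section \<open>Evaluation of polynomials and ring morphisms\<close>

definition mon_eval :: "('v \<Rightarrow> 'b::comm_ring_1) \<Rightarrow> ('v \<Rightarrow>\<^sub>0 nat) \<Rightarrow> 'b" where
  "mon_eval v t = (\<Prod>x\<in>Poly_Mapping.keys t. v x ^ Poly_Mapping.lookup t x)"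

lemma mon_eval_superset:
  assumes "finite X" "Poly_Mapping.keys t \<subseteq> X"
  shows "mon_eval v t = (\<Prod>x\<in>X. v x ^ Poly_Mapping.lookup t x)"
  unfolding mon_eval_def
  by (rule prod.mono_neutral_left) (use assms in \<open>auto simp: in_keys_iff\<close>)

lemma mon_eval_0 [simp]: "mon_eval v 0 = 1"
  by (simp add: mon_eval_def)

lemma mon_eval_single [simp]: "mon_eval v (Poly_Mapping.single x k) = v x ^ k"
  by (simp add: mon_eval_def)

lemma mon_eval_add: "mon_eval v (s + t) = mon_eval v s * mon_eval v t"
proof -
  let ?X = "Poly_Mapping.keys s \<union> Poly_Mapping.keys t"
  have "Poly_Mapping.keys (s + t) \<subseteq> ?X"
    by (rule keys_add)
  then show ?thesis
    by (simp add: mon_eval_superset[of ?X] lookup_add power_add prod.distrib)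
qed

lemma mp_eval_superset:
  assumes "finite X" "Poly_Mapping.keys p \<subseteq> X" "\<phi> 0 = 0"
  shows "mp_eval \<phi> v p = (\<Sum>t\<in>X. \<phi> (Poly_Mapping.lookup p t) * mon_eval v t)"
  unfolding mp_eval_def mon_eval_def[symmetric]
  by (rule sum.mono_neutral_left) (use assms in \<open>auto simp: in_keys_iff\<close>)

lemma mp_eval_keys: "mp_eval \<phi> v p = (\<Sum>t\<in>Poly_Mapping.keys p. \<phi> (Poly_Mapping.lookup p t) * mon_eval v t)"
  by (simp add: mp_eval_def mon_eval_def)

context comm_ring_hom
begin

lemma mp_eval_add: "mp_eval hom v (p + q) = mp_eval hom v p + mp_eval hom v q"
proof -
  let ?X = "Poly_Mapping.keys p \<union> Poly_Mapping.keys q"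
  have "Poly_Mapping.keys (p + q) \<subseteq> ?X"
    by (rule keys_add)
  then show ?thesis
    by (simp add: mp_eval_superset[of ?X] lookup_add hom_add algebra_simps sum.distrib)
qed

lemma mp_eval_single: "mp_eval hom v (Poly_Mapping.single t c) = hom c * mon_eval v t"
  by (simp add: mp_eval_keys)

lemma mp_eval_mult: "mp_eval hom v (p * q) = mp_eval hom v p * mp_eval hom v q"
proof (induction p rule: pm_single_induct)
  case (single s a)
  show ?case
    by (induction q rule: pm_single_induct)
       (simp_all add: mult_single mp_eval_single mp_eval_add mon_eval_add hom_mult algebra_simps)
next
  case (add p q)
  then show ?case by (simp add: algebra_simps mp_eval_add)
qed

lemma mp_eval_Const [simp]: "mp_eval hom v (Const c) = hom c"
  by (simp add: Const_def mp_eval_single)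

lemma mp_eval_Var [simp]: "mp_eval hom v (Var x) = v x"
  by (simp add: Var_def mp_eval_single)

lemma comm_ring_hom_mp_eval: "comm_ring_hom (mp_eval hom v)"
proof
  show "mp_eval hom v 0 = 0" by (simp add: mp_eval_def)
  show "mp_eval hom v 1 = 1" using mp_eval_single[of v 0 1] by simp
qed (simp_all add: mp_eval_add mp_eval_mult)

end

lemma comm_ring_hom_id: "comm_ring_hom (\<lambda>x::'a::comm_ring_1. x)"
  by unfold_locales auto

lemma comm_ring_hom_of_int: "comm_ring_hom (of_int :: int \<Rightarrow> 'a::comm_ring_1)"
  by unfold_locales auto

lemma Const_0 [simp]: "Const 0 = 0" and Const_1 [simp]: "Const 1 = 1"
  and Const_add: "Const (a + b) = Const a + Const b"
  and Const_mult: "Const (a * b) = Const a * Const b"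
  and Const_uminus: "Const (- a) = - Const a"
  and Const_diff: "Const (a - b) = Const a - Const b"
  by (simp_all add: Const_def single_add mult_single single_uminus single_diff)

lemma comm_ring_hom_Const: "comm_ring_hom (Const :: 'a::comm_ring_1 \<Rightarrow> ('v, 'a) mpoly)"
  by unfold_locales (auto simp: Const_add Const_mult)

lemma comm_ring_hom_compose:
  "comm_ring_hom f \<Longrightarrow> comm_ring_hom g \<Longrightarrow> comm_ring_hom (\<lambda>x. g (f x))"
proof -
  assume "comm_ring_hom f" "comm_ring_hom g"
  then interpret f: comm_ring_hom f + g: comm_ring_hom g by simp_all
  show ?thesis
    by unfold_locales (simp_all add: f.hom_add g.hom_add f.hom_mult g.hom_mult)
qed

lemmas comm_ring_hom_mp_eval_of_int = comm_ring_hom.comm_ring_hom_mp_eval[OF comm_ring_hom_of_int]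
lemmas comm_ring_hom_mp_eval_Const = comm_ring_hom.comm_ring_hom_mp_eval[OF comm_ring_hom_Const]

lemma Var_power: "Var x ^ k = Poly_Mapping.single (Poly_Mapping.single x k) 1"
  by (induction k) (simp_all add: Var_def mult_single single_add[symmetric] add.commute)

lemma single_mon_eval: "Poly_Mapping.single t c = Const c * mon_eval Var t"
proof -
  have *: "mon_eval Var t = Poly_Mapping.single t (1 :: 'b)"
  proof (induction t rule: pm_single_induct)
    case (single x k)
    show ?case by (simp add: Var_power)
  next
    case (add s t)
    then show ?case by (simp add: mon_eval_add mult_single)
  qed
  show ?thesis by (simp add: * Const_def mult_single)
qed

lemma mpoly_induct [case_names Const Var add mult]:
  assumes "\<And>c. P (Const c)" "\<And>x. P (Var x)"
    and "\<And>p q. P p \<Longrightarrow> P q \<Longrightarrow> P (p + q)" "\<And>p q. P p \<Longrightarrow> P q \<Longrightarrow> P (p * q)"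
  shows "P (p :: ('v, 'a::comm_ring_1) mpoly)"
proof (induction p rule: pm_single_induct)
  case (single t c)
  have pow: "P (Var x ^ k)" for x k
    by (induction k) (use assms(1)[of 1] assms in auto)
  have "P (mon_eval Var t)"
  proof (induction t rule: pm_single_induct)
    case (single x k)
    show ?case using pow by simp
  qed (simp add: mon_eval_add assms)
  then show ?case using assms by (simp add: single_mon_eval)
qed (simp add: assms)

lemma mpoly_hom_eqI:
  assumes "comm_ring_hom f" "comm_ring_hom g"
    and "\<And>c. f (Const c) = g (Const c)" "\<And>x. f (Var x) = g (Var x)"
  shows "f p = g (p :: ('v, 'a::comm_ring_1) mpoly)"
proof -
  interpret f: comm_ring_hom f by fact
  interpret g: comm_ring_hom g by fact
  show ?thesis
    by (induction p rule: mpoly_induct) (simp_all add: assms f.hom_add g.hom_add f.hom_mult g.hom_mult)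
qed

lemma hom_mon_eval: "comm_ring_hom f \<Longrightarrow> f (mon_eval v t) = mon_eval (\<lambda>x. f (v x)) t"
proof -
  assume "comm_ring_hom f"
  then interpret comm_ring_hom f .
  show ?thesis by (simp add: mon_eval_def hom_prod hom_power)
qed

lemma hom_mp_eval:
  assumes "comm_ring_hom f"
  shows "f (mp_eval \<phi> v p) = mp_eval (\<lambda>c. f (\<phi> c)) (\<lambda>x. f (v x)) p"
proof -
  interpret comm_ring_hom f by fact
  show ?thesis by (simp add: mp_eval_keys hom_sum hom_mult hom_mon_eval[OF assms])
qed

lemma hom_of_int_eq: "comm_ring_hom f \<Longrightarrow> (\<lambda>c. f (of_int c)) = of_int"
proof -
  assume "comm_ring_hom f"
  then interpret comm_ring_hom f .
  show ?thesis by (simp add: hom_of_int)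
qed

lemma Const_of_int: "Const (of_int c) = of_int c"
  by (simp add: comm_ring_hom_Const ring_hom.hom_of_int comm_ring_hom.axioms)

lemma mp_eval_cong:
  assumes "p \<in> polys V" "\<And>x. x \<in> V \<Longrightarrow> v x = w x"
  shows "mp_eval \<phi> v p = mp_eval \<phi> w p"
  unfolding mp_eval_def
proof (intro sum.cong arg_cong2[where f = "(*)"] prod.cong refl)
  fix t x assume "t \<in> Poly_Mapping.keys p" "x \<in> Poly_Mapping.keys t"
  then have "x \<in> V"
    using assms(1) by (auto simp: polys_def)
  then show "v x ^ Poly_Mapping.lookup t x = w x ^ Poly_Mapping.lookup t x"
    by (simp add: assms(2))
qed

lemma mp_eval_Const_Var [simp]: "mp_eval Const Var p = p"
  using mpoly_hom_eqI[OF comm_ring_hom_mp_eval_Const comm_ring_hom_id, of Var p]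
  by (simp add: comm_ring_hom.mp_eval_Const[OF comm_ring_hom_Const] comm_ring_hom.mp_eval_Var[OF comm_ring_hom_Const])

lemma mp_eval_of_int_Var [simp]: "mp_eval of_int Var p = p"
  using mpoly_hom_eqI[OF comm_ring_hom_mp_eval_of_int comm_ring_hom_id, of Var p]
  by (simp add: comm_ring_hom.mp_eval_Const[OF comm_ring_hom_of_int]
      comm_ring_hom.mp_eval_Var[OF comm_ring_hom_of_int] Const_of_int[of "_::int", symmetric])

section \<open>Polynomials in a given set of indeterminates\<close>

lemma subset_UNIV_polys [simp]: "p \<in> polys UNIV" by (simp add: polys_def)

lemma polys_mono: "V \<subseteq> W \<Longrightarrow> polys V \<subseteq> polys W"
  by (auto simp: polys_def)

lemma polys_0 [simp]: "0 \<in> polys V"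
  by (simp add: polys_def)

lemma polys_single: "Poly_Mapping.keys t \<subseteq> V \<Longrightarrow> Poly_Mapping.single t c \<in> polys V"
  by (simp add: polys_def)

lemma polys_Const [simp]: "Const c \<in> polys V"
  by (simp add: Const_def polys_single)

lemma polys_1 [simp]: "1 \<in> polys V"
  using polys_Const[of 1] by (simp del: polys_Const)

lemma polys_Var: "x \<in> V \<Longrightarrow> Var x \<in> polys V"
  by (simp add: Var_def polys_single)

lemma polys_add: "p \<in> polys V \<Longrightarrow> q \<in> polys V \<Longrightarrow> p + q \<in> polys V"
  using keys_add[of p q] by (auto simp: polys_def)

lemma polys_mult: "p \<in> polys V \<Longrightarrow> q \<in> polys V \<Longrightarrow> p * q \<in> polys V"
proof -
  assume *: "p \<in> polys V" "q \<in> polys V"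
  show ?thesis
    unfolding polys_def
  proof (intro CollectI ballI)
    fix t assume "t \<in> Poly_Mapping.keys (p * q)"
    then obtain a b where "t = a + b" "a \<in> Poly_Mapping.keys p" "b \<in> Poly_Mapping.keys q"
      using keys_mult[of p q] by auto
    then show "Poly_Mapping.keys t \<subseteq> V"
      using keys_add[of a b] * by (auto simp: polys_def)
  qed
qed

lemma polys_uminus: "p \<in> polys V \<Longrightarrow> - p \<in> polys V"
  by (simp add: polys_def in_keys_iff)

lemma polys_diff: "p \<in> polys V \<Longrightarrow> q \<in> polys V \<Longrightarrow> p - q \<in> polys V"
  using polys_add[OF _ polys_uminus, of p V q] by simp

lemma polys_sum: "(\<And>i. i \<in> A \<Longrightarrow> f i \<in> polys V) \<Longrightarrow> sum f A \<in> polys V"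
  by (induction A rule: infinite_finite_induct) (auto intro: polys_add)

lemma polys_prod: "(\<And>i. i \<in> A \<Longrightarrow> f i \<in> polys V) \<Longrightarrow> prod f A \<in> polys V"
  by (induction A rule: infinite_finite_induct) (auto intro: polys_mult)

lemma polys_power: "p \<in> polys V \<Longrightarrow> p ^ k \<in> polys V"
  by (induction k) (auto intro: polys_mult)

lemma polys_mp_eval:
  assumes "p \<in> polys V" "\<And>x. x \<in> V \<Longrightarrow> v x \<in> polys W" "\<And>c. \<phi> c \<in> polys W"
  shows "mp_eval \<phi> v p \<in> polys W"
  unfolding mp_eval_def
  by (intro polys_sum polys_mult assms polys_prod polys_power) (use assms(1) in \<open>auto simp: polys_def\<close>)

lemma polys_ex_finite: "\<exists>V. finite V \<and> p \<in> polys V"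
  by (rule exI[of _ "\<Union>t\<in>Poly_Mapping.keys p. Poly_Mapping.keys t"]) (auto simp: polys_def)

section \<open>Degree and homogeneity\<close>

lemma mdeg_superset:
  assumes "finite X" "Poly_Mapping.keys t \<subseteq> X"
  shows "mdeg t = (\<Sum>x\<in>X. Poly_Mapping.lookup t x)"
  unfolding mdeg_def
  by (rule sum.mono_neutral_left) (use assms in \<open>auto simp: in_keys_iff\<close>)

lemma mdeg_0 [simp]: "mdeg 0 = 0" by (simp add: mdeg_def)

lemma mdeg_single [simp]: "mdeg (Poly_Mapping.single x k) = k"
  by (simp add: mdeg_def)

lemma mdeg_add: "mdeg (s + t) = mdeg s + mdeg t"
proof -
  let ?X = "Poly_Mapping.keys s \<union> Poly_Mapping.keys t"
  have "Poly_Mapping.keys (s + t) \<subseteq> ?X"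
    by (rule keys_add)
  then show ?thesis
    by (simp add: mdeg_superset[of ?X] lookup_add sum.distrib)
qed

lemma mdeg_eq_0_iff: "mdeg t = 0 \<longleftrightarrow> t = 0"
proof
  assume "mdeg t = 0"
  then have "\<forall>x\<in>Poly_Mapping.keys t. Poly_Mapping.lookup t x = 0"
    by (simp add: mdeg_def)
  then have "\<forall>x. Poly_Mapping.lookup t x = 0"
    by (auto simp: in_keys_iff)
  then show "t = 0"
    by (intro poly_mapping_eqI) simp
qed simp

lemma homogeneous_0 [simp]: "homogeneous e 0"
  by (simp add: homogeneous_def)

lemma homogeneous_single: "mdeg t = e \<Longrightarrow> homogeneous e (Poly_Mapping.single t c)"
  by (simp add: homogeneous_def)

lemma homogeneous_Const [simp]: "homogeneous 0 (Const c)"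
  by (simp add: Const_def homogeneous_single)

lemma homogeneous_1 [simp]: "homogeneous 0 1"
  using homogeneous_Const[of 1] by (simp del: homogeneous_Const)

lemma homogeneous_Var [simp]: "homogeneous (Suc 0) (Var x)"
  by (simp add: Var_def homogeneous_single)

lemma homogeneous_add: "homogeneous e p \<Longrightarrow> homogeneous e q \<Longrightarrow> homogeneous e (p + q)"
  using keys_add[of p q] by (auto simp: homogeneous_def)

lemma homogeneous_uminus: "homogeneous e p \<Longrightarrow> homogeneous e (- p)"
  by (simp add: homogeneous_def in_keys_iff)

lemma homogeneous_diff: "homogeneous e p \<Longrightarrow> homogeneous e q \<Longrightarrow> homogeneous e (p - q)"
  using homogeneous_add[OF _ homogeneous_uminus, of e p q] by simp

lemma homogeneous_mult:
  assumes "homogeneous e p" "homogeneous f q"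
  shows "homogeneous (e + f) (p * q)"
  unfolding homogeneous_def
proof
  fix t assume "t \<in> Poly_Mapping.keys (p * q)"
  then obtain a b where "t = a + b" "a \<in> Poly_Mapping.keys p" "b \<in> Poly_Mapping.keys q"
    using keys_mult[of p q] by auto
  then show "mdeg t = e + f"
    using assms by (auto simp: homogeneous_def mdeg_add)
qed

lemma homogeneous_power: "homogeneous e p \<Longrightarrow> homogeneous (e * k) (p ^ k)"
  by (induction k) (auto dest: homogeneous_mult)

lemma homogeneous_sum: "(\<And>i. i \<in> A \<Longrightarrow> homogeneous e (f i)) \<Longrightarrow> homogeneous e (sum f A)"
  by (induction A rule: infinite_finite_induct) (auto intro: homogeneous_add)

lemma homogeneous_prod:
  "(\<And>i. i \<in> A \<Longrightarrow> homogeneous (e i) (f i)) \<Longrightarrow> homogeneous (sum e A) (prod f A)"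
  by (induction A rule: infinite_finite_induct) (auto intro: homogeneous_mult)

lemma homogeneous_mp_eval:
  assumes "homogeneous e p" "\<And>x. homogeneous 1 (v x)" "\<And>c. homogeneous 0 (\<phi> c)"
  shows "homogeneous e (mp_eval \<phi> v p)"
  unfolding mp_eval_def
proof (rule homogeneous_sum)
  fix t assume t: "t \<in> Poly_Mapping.keys p"
  have "homogeneous (\<Sum>x\<in>Poly_Mapping.keys t. 1 * Poly_Mapping.lookup t x) (\<Prod>x\<in>Poly_Mapping.keys t. v x ^ Poly_Mapping.lookup t x)"
    by (intro homogeneous_prod homogeneous_power assms)
  moreover have "(\<Sum>x\<in>Poly_Mapping.keys t. 1 * Poly_Mapping.lookup t x) = e"
    using assms(1) t by (simp add: homogeneous_def mdeg_def)
  ultimately show "homogeneous e (\<phi> (Poly_Mapping.lookup p t) * (\<Prod>x\<in>Poly_Mapping.keys t. v x ^ Poly_Mapping.lookup t x))"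
    using homogeneous_mult[OF assms(3), of e _ "Poly_Mapping.lookup p t"] by simp
qed

section \<open>Change of coefficients\<close>

definition map_coeffs :: "('a::comm_ring_1 \<Rightarrow> 'b::comm_ring_1) \<Rightarrow> ('v, 'a) mpoly \<Rightarrow> ('v, 'b) mpoly" where
  "map_coeffs \<phi> = mp_eval (\<lambda>c. Const (\<phi> c)) Var"

lemma lookup_map_coeffs:
  assumes "\<phi> 0 = 0"
  shows "Poly_Mapping.lookup (map_coeffs \<phi> p) t = \<phi> (Poly_Mapping.lookup p t)"
proof -
  have "map_coeffs \<phi> p = (\<Sum>t\<in>Poly_Mapping.keys p. Poly_Mapping.single t (\<phi> (Poly_Mapping.lookup p t)))"
    by (simp add: map_coeffs_def mp_eval_keys single_mon_eval[symmetric])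
  then show ?thesis
    using assms by (auto simp: lookup_sum lookup_single when_def in_keys_iff)
qed

lemma comm_ring_hom_map_coeffs: "comm_ring_hom \<phi> \<Longrightarrow> comm_ring_hom (map_coeffs \<phi>)"
  unfolding map_coeffs_def
  by (intro comm_ring_hom.comm_ring_hom_mp_eval comm_ring_hom_compose[OF _ comm_ring_hom_Const])

lemma map_coeffs_Var [simp]: "comm_ring_hom \<phi> \<Longrightarrow> map_coeffs \<phi> (Var x) = Var x"
  unfolding map_coeffs_def
  by (rule comm_ring_hom.mp_eval_Var[OF comm_ring_hom_compose[OF _ comm_ring_hom_Const]])

lemma map_coeffs_Const [simp]: "comm_ring_hom \<phi> \<Longrightarrow> map_coeffs \<phi> (Const c) = Const (\<phi> c)"
  unfolding map_coeffs_def
  by (rule comm_ring_hom.mp_eval_Const[OF comm_ring_hom_compose[OF _ comm_ring_hom_Const]])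

lemma keys_map_coeffs: "\<phi> 0 = 0 \<Longrightarrow> Poly_Mapping.keys (map_coeffs \<phi> p) \<subseteq> Poly_Mapping.keys p"
  by (auto simp: in_keys_iff lookup_map_coeffs)

lemma polys_map_coeffs: "\<phi> 0 = 0 \<Longrightarrow> p \<in> polys V \<Longrightarrow> map_coeffs \<phi> p \<in> polys V"
  using keys_map_coeffs[of \<phi> p] by (auto simp: polys_def)

text \<open>The degree for which the indeterminate \<open>x\<close> has degree \<open>w x\<close>, read off from the morphism
  that multiplies \<open>x\<close> by \<open>T ^ w x\<close> for a new indeterminate \<open>T\<close>; since that is a ring morphism,
  the degree is additive on products.\<close>

definition wscale :: "('v \<Rightarrow> nat) \<Rightarrow> ('v, 'a::comm_ring_1) mpoly \<Rightarrow> ('v, 'a) mpoly poly" where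
  "wscale w = mp_eval (\<lambda>c. [:Const c:]) (\<lambda>x. monom (Var x) (w x))"

definition wt :: "('v \<Rightarrow> nat) \<Rightarrow> ('v \<Rightarrow>\<^sub>0 nat) \<Rightarrow> nat" where
  "wt w t = (\<Sum>x\<in>Poly_Mapping.keys t. w x * Poly_Mapping.lookup t x)"

definition wdeg :: "('v \<Rightarrow> nat) \<Rightarrow> ('v, 'a::comm_ring_1) mpoly \<Rightarrow> nat" where
  "wdeg w p = Polynomial.degree (wscale w p)"

lemma comm_ring_hom_pConst: "comm_ring_hom (\<lambda>c::'a::comm_ring_1. [:f c :: 'b::comm_ring_1:])" if "comm_ring_hom f"
proof -
  interpret comm_ring_hom f by fact
  show ?thesis by unfold_locales (simp_all add: hom_add hom_mult)
qed

lemma comm_ring_hom_wscale: "comm_ring_hom (wscale w)"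
  unfolding wscale_def
  by (intro comm_ring_hom.comm_ring_hom_mp_eval comm_ring_hom_pConst comm_ring_hom_Const)

lemma wscale_Const [simp]: "wscale w (Const c) = [:Const c:]"
  and wscale_Var [simp]: "wscale w (Var x) = monom (Var x) (w x)"
  unfolding wscale_def
  by (rule comm_ring_hom.mp_eval_Const comm_ring_hom.mp_eval_Var; intro comm_ring_hom_pConst comm_ring_hom_Const)+

lemma monom_power: "monom c k ^ n = monom (c ^ n) (k * n)"
  by (induction n) (simp_all add: mult_monom one_pCons monom_0)

lemma prod_monom: "(\<Prod>i\<in>A. monom (f i) (g i)) = monom (\<Prod>i\<in>A. f i) (\<Sum>i\<in>A. g i)"
  by (induction A rule: infinite_finite_induct) (simp_all add: mult_monom one_pCons monom_0)

lemma wscale_keys: "wscale w p = (\<Sum>t\<in>Poly_Mapping.keys p. monom (Poly_Mapping.single t (Poly_Mapping.lookup p t)) (wt w t))"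
  by (simp add: wscale_def mp_eval_def monom_power prod_monom single_mon_eval mon_eval_def wt_def
      smult_monom)

lemma coeff_wscale: "Polynomial.coeff (wscale w p) N =
    (\<Sum>t | t \<in> Poly_Mapping.keys p \<and> wt w t = N. Poly_Mapping.single t (Poly_Mapping.lookup p t))"
  by (simp add: wscale_keys coeff_sum sum.If_cases Int_def conj_commute)

lemma lookup_coeff_wscale: "Poly_Mapping.lookup (Polynomial.coeff (wscale w p) N) t =
    (if wt w t = N then Poly_Mapping.lookup p t else 0)"
  by (auto simp: coeff_wscale lookup_sum lookup_single when_def in_keys_iff)

lemma wdeg_le_iff: "wdeg w p \<le> N \<longleftrightarrow> (\<forall>t\<in>Poly_Mapping.keys p. wt w t \<le> N)"
proof
  assume *: "wdeg w p \<le> N"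
  show "\<forall>t\<in>Poly_Mapping.keys p. wt w t \<le> N"
  proof (rule ballI, rule ccontr)
    fix t assume t: "t \<in> Poly_Mapping.keys p" "\<not> wt w t \<le> N"
    then have "Polynomial.coeff (wscale w p) (wt w t) = 0"
      using * by (intro coeff_eq_0) (simp add: wdeg_def)
    then show False
      using lookup_coeff_wscale[of w p "wt w t" t] t by (simp add: in_keys_iff)
  qed
next
  assume *: "\<forall>t\<in>Poly_Mapping.keys p. wt w t \<le> N"
  show "wdeg w p \<le> N"
    unfolding wdeg_def
  proof (intro degree_le allI impI poly_mapping_eqI)
    fix i t assume "i > N"
    then have "wt w t = i \<Longrightarrow> t \<notin> Poly_Mapping.keys p"
      using * by auto
    then show "Poly_Mapping.lookup (Polynomial.coeff (wscale w p) i) t = Poly_Mapping.lookup 0 t"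
      by (auto simp: lookup_coeff_wscale in_keys_iff)
  qed
qed

lemma wt_le_wdeg: "t \<in> Poly_Mapping.keys p \<Longrightarrow> wt w t \<le> wdeg w p"
  using wdeg_le_iff[of w p "wdeg w p"] by simp

lemma wscale_inj: "wscale w p = 0 \<Longrightarrow> p = 0"
proof (rule poly_mapping_eqI)
  fix t assume "wscale w p = 0"
  then show "Poly_Mapping.lookup p t = Poly_Mapping.lookup 0 t"
    using lookup_coeff_wscale[of w p "wt w t" t] by simp
qed

text \<open>Degrees of univariate polynomials add over a domain. The order on the indeterminates is
  what makes \<open>mpoly\<close> an instance of \<open>idom\<close>; for the coefficient
  indeterminates, which are pairs, it is the lexicographic one.\<close>

lemma wdeg_mult:
  assumes "p \<noteq> 0" "q \<noteq> 0"
  shows "wdeg w (p * q) = wdeg w p + wdeg w (q :: ('v::linorder, 'a::idom) mpoly)"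
proof -
  interpret s: comm_ring_hom "wscale w :: ('v, 'a) mpoly \<Rightarrow> _" by (rule comm_ring_hom_wscale)
  have "wscale w (p * q) = wscale w p * wscale w q"
    by (rule s.hom_mult)
  then show ?thesis
    unfolding wdeg_def using assms wscale_inj by (metis degree_mult_eq)
qed

lemma wdeg_mp_eval_le:
  assumes "\<And>x. wdeg w (v x) \<le> w' x" "\<And>c. wdeg w (\<phi> c) = 0"
  shows "wdeg w (mp_eval \<phi> v p :: ('v, 'a::comm_ring_1) mpoly) \<le> wdeg w' p"
proof -
  interpret s: comm_ring_hom "wscale w :: ('v, 'a) mpoly \<Rightarrow> _" by (rule comm_ring_hom_wscale)
  have "Polynomial.degree (wscale w (\<phi> (Poly_Mapping.lookup p t) *
      (\<Prod>x\<in>Poly_Mapping.keys t. v x ^ Poly_Mapping.lookup t x))) \<le> wdeg w' p"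
    if t: "t \<in> Poly_Mapping.keys p" for t
  proof -
    have "Polynomial.degree (wscale w (\<phi> (Poly_Mapping.lookup p t) *
        (\<Prod>x\<in>Poly_Mapping.keys t. v x ^ Poly_Mapping.lookup t x)))
      \<le> Polynomial.degree (wscale w (\<phi> (Poly_Mapping.lookup p t))) +
        Polynomial.degree (\<Prod>x\<in>Poly_Mapping.keys t. wscale w (v x) ^ Poly_Mapping.lookup t x)"
      unfolding s.hom_mult s.hom_prod s.hom_power by (rule degree_mult_le)
    also have "Polynomial.degree (wscale w (\<phi> (Poly_Mapping.lookup p t))) = 0"
      using assms(2) by (simp add: wdeg_def)
    also have "Polynomial.degree (\<Prod>x\<in>Poly_Mapping.keys t. wscale w (v x) ^ Poly_Mapping.lookup t x)
       \<le> (\<Sum>x\<in>Poly_Mapping.keys t. Polynomial.degree (wscale w (v x) ^ Poly_Mapping.lookup t x))"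
      using degree_prod_sum_le[of "Poly_Mapping.keys t" "\<lambda>x. wscale w (v x) ^ Poly_Mapping.lookup t x"] 
      by (simp add: o_def)
    also have "\<dots> \<le> (\<Sum>x\<in>Poly_Mapping.keys t. w' x * Poly_Mapping.lookup t x)"
      by (intro sum_mono order.trans[OF degree_power_le])
         (use assms(1) in \<open>auto simp: wdeg_def intro: mult_right_mono\<close>)
    also have "\<dots> \<le> wdeg w' p"
      using wt_le_wdeg[OF t, of w'] by (simp add: wt_def)
    finally show ?thesis by simp
  qed
  then show ?thesis
    unfolding wdeg_def[of w] mp_eval_def s.hom_sum by (intro degree_sum_le) auto
qed

lemma wdeg_Const [simp]: "wdeg w (Const c) = 0"
  by (simp add: wdeg_def)

lemma wdeg_Var: "wdeg w (Var x :: ('v, 'a::comm_ring_1) mpoly) = w x"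
proof -
  have "Var x \<noteq> (0 :: ('v, 'a) mpoly)"
    using lookup_single_eq[of "Poly_Mapping.single x 1" "1::'a"] by (metis Var_def lookup_zero zero_neq_one)
  then show ?thesis by (simp add: wdeg_def degree_monom_eq)
qed

lemma wdeg_add_le: "wdeg w (p + q) \<le> N" if "wdeg w p \<le> N" "wdeg w q \<le> N"
  using that keys_add[of p q] by (auto simp: wdeg_le_iff)

lemma wdeg_mult_le: "wdeg w (p * q) \<le> wdeg w p + wdeg w q"
proof -
  interpret s: comm_ring_hom "wscale w :: ('a, 'b) mpoly \<Rightarrow> _" by (rule comm_ring_hom_wscale)
  show ?thesis unfolding wdeg_def s.hom_mult by (rule degree_mult_le)
qed

lemma wdeg_0 [simp]: "wdeg w 0 = 0"
  using wdeg_Const[of w 0] by (simp del: wdeg_Const)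

lemma wdeg_sum_le: "(\<And>i. i \<in> A \<Longrightarrow> wdeg w (f i) \<le> N) \<Longrightarrow> wdeg w (sum f A) \<le> N"
  by (induction A rule: infinite_finite_induct) (auto intro: wdeg_add_le)

lemma wdeg_0_imp_polys:
  assumes "wdeg w p = 0"
  shows "p \<in> polys {x. w x = 0}"
proof -
  have "wt w t = 0" if "t \<in> Poly_Mapping.keys p" for t
    using wt_le_wdeg[OF that, of w] assms by simp
  then show ?thesis
    by (auto simp: polys_def wt_def in_keys_iff)
qed

lemma polys_imp_wdeg_0: "p \<in> polys V \<Longrightarrow> (\<And>x. x \<in> V \<Longrightarrow> w x = 0) \<Longrightarrow> wdeg w p = 0"
  using wdeg_le_iff[of w p 0] by (fastforce simp: polys_def wt_def)

lemma polys_empty: "p \<in> polys {} \<Longrightarrow> p = Const (Poly_Mapping.lookup p 0)"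
  by (rule poly_mapping_eqI)
     (auto simp: polys_def Const_def lookup_single when_def in_keys_iff)

text \<open>Give weight 1 to the indeterminates outside \<open>V\<close> and 0 to the others: a
  nonzero product of degree 0 has factors of degree 0.\<close>

lemma polys_factor:
  assumes "p * q \<in> polys V" "p * q \<noteq> 0"
  shows "p \<in> polys V" "(q :: ('v::linorder, 'a::idom) mpoly) \<in> polys V"
proof -
  let ?w = "\<lambda>x. if x \<in> V then 0 else 1 :: nat"
  have "wdeg ?w (p * q) = 0"
    by (rule polys_imp_wdeg_0[OF assms(1)]) auto
  then have "wdeg ?w p = 0" "wdeg ?w q = 0"
    using wdeg_mult[of p q ?w] assms(2) by auto
  moreover have "{x. ?w x = 0} = V" by auto
  ultimately show "p \<in> polys V" "q \<in> polys V"
    using wdeg_0_imp_polys[of ?w] by metis+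
qed

section \<open>Factorization in polynomial rings over the integers\<close>

text \<open>The coefficients stay in the full polynomial type although they do not involve
  \<open>v\<close> (\<open>coeff_upoly_polys\<close>), so an induction on the set of indeterminates
  never changes the type.\<close>

definition upoly :: "'v \<Rightarrow> ('v, 'a::comm_ring_1) mpoly \<Rightarrow> ('v, 'a) mpoly poly" where
  "upoly v = mp_eval (\<lambda>c. [:Const c:]) (\<lambda>x. if x = v then [:0, 1:] else [:Var x:])"

definition vdeg :: "'v \<Rightarrow> ('v, 'a::comm_ring_1) mpoly \<Rightarrow> nat" where
  "vdeg v p = Polynomial.degree (upoly v p)"

definition vlc :: "'v \<Rightarrow> ('v, 'a::comm_ring_1) mpoly \<Rightarrow> ('v, 'a) mpoly" where
  "vlc v p = lead_coeff (upoly v p)"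

lemma comm_ring_hom_upoly: "comm_ring_hom (upoly v)"
  unfolding upoly_def
  by (intro comm_ring_hom.comm_ring_hom_mp_eval comm_ring_hom_pConst comm_ring_hom_Const)

lemma upoly_Const [simp]: "upoly v (Const c) = [:Const c:]"
  and upoly_Var: "upoly v (Var x) = (if x = v then [:0, 1:] else [:Var x:])"
  unfolding upoly_def
  by (rule comm_ring_hom.mp_eval_Const comm_ring_hom.mp_eval_Var; intro comm_ring_hom_pConst comm_ring_hom_Const)+

lemma poly_upoly [simp]: "poly (upoly v p) (Var v) = p"
proof -
  have 1: "comm_ring_hom (\<lambda>q::('a, 'b) mpoly poly. poly q (Var v))"
    by unfold_locales simp_all
  show ?thesis
    by (rule mpoly_hom_eqI[OF comm_ring_hom_compose[OF comm_ring_hom_upoly 1] comm_ring_hom_id])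
       (auto simp: upoly_Var)
qed

lemma upoly_eq_0_iff [simp]: "upoly v p = 0 \<longleftrightarrow> p = 0"
proof
  assume "upoly v p = 0"
  then have "poly (upoly v p) (Var v) = 0" by simp
  then show "p = 0" by simp
next
  interpret comm_ring_hom "upoly v :: ('a, 'b) mpoly \<Rightarrow> _" by (rule comm_ring_hom_upoly)
  show "p = 0 \<Longrightarrow> upoly v p = 0" by simp
qed

lemma upoly_free:
  assumes "p \<in> polys V" "v \<notin> V"
  shows "upoly v p = [:p:]"
proof -
  have "upoly v p = mp_eval (\<lambda>c. [:Const c:]) (\<lambda>x. [:Var x:]) p"
    unfolding upoly_def by (rule mp_eval_cong[OF assms(1)]) (use assms(2) in auto)
  also have "\<dots> = [:p:]"
    using comm_ring_hom.comm_ring_hom_mp_eval[OF comm_ring_hom_pConst[OF comm_ring_hom_Const]]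
    by (rule mpoly_hom_eqI) (auto simp: comm_ring_hom.mp_eval_Const[OF comm_ring_hom_pConst[OF comm_ring_hom_Const]]
       comm_ring_hom.mp_eval_Var[OF comm_ring_hom_pConst[OF comm_ring_hom_Const]] intro: comm_ring_hom_pConst comm_ring_hom_id)
  finally show ?thesis .
qed

text \<open>The univariate polynomials with all coefficients in \<open>polys (V - {v})\<close> are
  closed under sums and products and contain the images of the constants and of the indeterminates
  in \<open>V\<close>.\<close>

lemma coeff_upoly_polys:
  assumes "p \<in> polys V"
  shows "Polynomial.coeff (upoly v p) i \<in> polys (V - {v})"
proof -
  define S :: "('a, 'b) mpoly poly set" where
    "S = {q. \<forall>i. Polynomial.coeff q i \<in> polys (V - {v})}"
  have add: "p + q \<in> S" if "p \<in> S" "q \<in> S" for p q :: "('a, 'b) mpoly poly"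
    using that by (simp add: S_def polys_add)
  have mult: "p * q \<in> S" if "p \<in> S" "q \<in> S" for p q :: "('a, 'b) mpoly poly"
    using that by (simp add: S_def coeff_mult polys_sum polys_mult)
  have const: "[:c:] \<in> S" if "c \<in> polys (V - {v})" for c :: "('a, 'b) mpoly"
    using that by (auto simp: S_def coeff_pCons split: nat.splits)
  have one: "1 \<in> S"
    using const[of 1] by (simp add: one_pCons)
  have pow: "p ^ k \<in> S" if "p \<in> S" for p :: "('a, 'b) mpoly poly" and k
    by (induction k) (use that one mult in auto)
  have prod: "prod f A \<in> S" if "\<And>i. i \<in> A \<Longrightarrow> f i \<in> S" for f :: "'a \<Rightarrow> ('a, 'b) mpoly poly" and A
    using that by (induction A rule: infinite_finite_induct) (auto simp: one intro: mult)
  have sum: "sum f A \<in> S" if "\<And>i. i \<in> A \<Longrightarrow> f i \<in> S" for f :: "('a \<Rightarrow>\<^sub>0 nat) \<Rightarrow> ('a, 'b) mpoly poly" and A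
    using that const[of 0] by (induction A rule: infinite_finite_induct) (auto intro: add)
  have X: "[:0, 1:] \<in> S"
    by (auto simp: S_def coeff_pCons split: nat.splits)
  have "upoly v p \<in> S"
    unfolding upoly_def mp_eval_def
  proof (intro sum mult prod pow const polys_Const)
    fix t x assume "t \<in> Poly_Mapping.keys p" "x \<in> Poly_Mapping.keys t"
    then have "x \<in> V"
      using assms by (auto simp: polys_def)
    then show "(if x = v then [:0, 1:] else [:Var x:]) \<in> S"
      by (auto intro: const polys_Var X)
  qed
  then show ?thesis by (simp add: S_def)
qed

lemma vlc_polys: "p \<in> polys V \<Longrightarrow> vlc v p \<in> polys (V - {v})"
  by (simp add: vlc_def coeff_upoly_polys)

lemma vlc_eq_0_iff [simp]: "vlc v p = 0 \<longleftrightarrow> p = 0"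
  by (simp add: vlc_def)

lemma vdeg_0_polys:
  assumes "vdeg v p = 0" "p \<in> polys V"
  shows "p \<in> polys (V - {v})"
proof -
  obtain c where c: "upoly v p = [:c:]"
    using assms(1) by (auto simp: vdeg_def elim: degree_eq_zeroE)
  have "poly (upoly v p) (Var v) = c"
    by (simp add: c)
  then have "p = c" by simp
  moreover have "c = Polynomial.coeff (upoly v p) 0" by (simp add: c)
  ultimately show ?thesis using coeff_upoly_polys[OF assms(2), of v 0] by simp
qed

lemma vdeg_free: "p \<in> polys V \<Longrightarrow> v \<notin> V \<Longrightarrow> vdeg v p = 0"
  by (simp add: vdeg_def upoly_free)

lemma vlc_free: "p \<in> polys V \<Longrightarrow> v \<notin> V \<Longrightarrow> vlc v p = p"
  by (simp add: vlc_def upoly_free)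

context
  fixes v :: "'v::linorder" and dummy :: "'a::idom"
begin

interpretation u: comm_ring_hom "upoly v :: ('v, 'a) mpoly \<Rightarrow> _" by (rule comm_ring_hom_upoly)

lemma vdeg_mult: "(p::('v, 'a) mpoly) \<noteq> 0 \<Longrightarrow> q \<noteq> 0 \<Longrightarrow> vdeg v (p * q) = vdeg v p + vdeg v q"
  by (simp add: vdeg_def u.hom_mult degree_mult_eq)

lemma vlc_mult: "vlc v (p * q) = vlc v p * vlc v (q::('v, 'a) mpoly)"
  by (simp add: vlc_def u.hom_mult lead_coeff_mult)

text \<open>The leading coefficient of \<open>W\<close> has no inverse, so each round multiplies
  \<open>a\<close> by it before the top term is cancelled.\<close>

lemma pseudo_division:
  fixes a W :: "('v, 'a) mpoly"
  assumes "W \<in> polys U" "W \<noteq> 0" "v \<in> U" "a \<in> polys U"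
  shows "\<exists>k T R. T \<in> polys U \<and> R \<in> polys U \<and> vlc v W ^ k * a = T * W + R \<and>
           (R = 0 \<or> vdeg v R < vdeg v W)"
  using assms(4)
proof (induction "vdeg v a" arbitrary: a rule: less_induct)
  case less
  show ?case
  proof (cases "a = 0 \<or> vdeg v a < vdeg v W")
    case True
    then show ?thesis
      using less.prems by (intro exI[of _ 0] exI[of _ a]) auto
  next
    case False
    define n where "n = vdeg v a - vdeg v W"
    define c where "c = vlc v a * Var v ^ n"
    define a' where "a' = vlc v W * a - c * W"
    have lcU: "vlc v W \<in> polys U" "vlc v a \<in> polys U"
      using vlc_polys[OF assms(1), of v] vlc_polys[OF less.prems, of v]
        polys_mono[of "U - {v}" U] by auto
    have free: "upoly v (vlc v W) = [:vlc v W:]" "upoly v (vlc v a) = [:vlc v a:]"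
      by (rule upoly_free[OF vlc_polys[of _ UNIV]]; simp)+
    have ua': "upoly v a' = smult (vlc v W) (upoly v a) - monom (vlc v a) n * upoly v W"
      by (simp add: a'_def c_def u.hom_minus u.hom_mult u.hom_power free upoly_Var
          flip: monom_altdef)
    have cU: "c \<in> polys U"
      unfolding c_def by (intro polys_mult polys_power polys_Var lcU assms)
    have a'U: "a' \<in> polys U"
      unfolding a'_def by (intro polys_diff polys_mult lcU less.prems cU assms)
    have *: "a' = 0 \<or> vdeg v a' < vdeg v a"
    proof (cases "vdeg v a = 0")
      case True
      \<comment> \<open>No smaller degree is left here; instead \<open>a'\<close> vanishes, because
        \<open>a\<close> and \<open>W\<close> are their own leading coefficients.\<close>
      then have 0: "vdeg v W = 0" "n = 0" using False by (auto simp: n_def)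
      have "a \<in> polys (UNIV - {v})" "W \<in> polys (UNIV - {v})"
        by (rule vdeg_0_polys; use 0 True in simp)+
      then have "vlc v W = W" "vlc v a = a"
        by (auto intro!: vlc_free)
      then show ?thesis
        by (simp add: a'_def c_def 0)
    next
      case pos: False
      have d1: "Polynomial.degree (smult (vlc v W) (upoly v a)) \<le> vdeg v a"
        by (simp add: vdeg_def)
      have nz: "monom (vlc v a) n \<noteq> 0" "upoly v W \<noteq> 0"
        using False assms by simp_all
      have d2: "Polynomial.degree (monom (vlc v a) n * upoly v W) \<le> vdeg v a"
        using False nz by (simp add: degree_mult_eq degree_monom_eq n_def vdeg_def)
      have "Polynomial.coeff (upoly v a') (vdeg v a) = 0"
        using False by (simp add: ua' coeff_monom_mult n_def vlc_def vdeg_def)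
      moreover have "Polynomial.degree (upoly v a') \<le> vdeg v a"
        unfolding ua' by (intro degree_diff_le d1 d2)
      ultimately have "Polynomial.degree (upoly v a') < vdeg v a \<or> upoly v a' = 0"
        by (metis le_less leading_coeff_0_iff)
      then show ?thesis by (auto simp: vdeg_def)
    qed
    have "\<exists>k T R. T \<in> polys U \<and> R \<in> polys U \<and> vlc v W ^ k * a' = T * W + R \<and>
           (R = 0 \<or> vdeg v R < vdeg v W)"
    proof (cases "a' = 0")
      case True
      then show ?thesis by (intro exI[of _ 0]) auto
    next
      case False
      with * less.hyps a'U show ?thesis by blast
    qed
    then obtain k T R where kTR: "T \<in> polys U" "R \<in> polys U" "vlc v W ^ k * a' = T * W + R"
           "R = 0 \<or> vdeg v R < vdeg v W" by blast
    have "vlc v W ^ Suc k * a = (T + vlc v W ^ k * c) * W + R"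
      using kTR(3) by (simp add: a'_def algebra_simps)
    moreover have "T + vlc v W ^ k * c \<in> polys U"
      by (intro polys_add polys_mult polys_power kTR lcU cU)
    ultimately show ?thesis using kTR by blast
  qed
qed

text \<open>A substitute for the greatest common divisor over the fraction field. \<open>W\<close>
  has least degree in \<open>v\<close> among the nonzero combinations of \<open>p\<close> and
  \<open>a\<close>; the remainder of a pseudo-division of \<open>p\<close> or \<open>a\<close> by
  \<open>W\<close> is again such a combination, hence 0.\<close>

lemma elimination:
  fixes p a :: "('v, 'a) mpoly"
  assumes "p \<in> polys U" "p \<noteq> 0" "v \<in> U" "a \<in> polys U"
  obtains W s t T T' k k' where "W \<noteq> 0" "s \<in> polys U" "t \<in> polys U" "W = s * p + t * a"
    "W \<in> polys U" "T \<in> polys U" "T' \<in> polys U" "vlc v W ^ k * p = T * W" "vlc v W ^ k' * a = T' * W"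
proof -
  define P where "P W \<longleftrightarrow> W \<noteq> 0 \<and> (\<exists>s\<in>polys U. \<exists>t\<in>polys U. W = s * p + t * a)" for W
  have "P p"
    unfolding P_def by (intro conjI assms bexI[of _ 1] bexI[of _ 0]) auto
  then have "\<exists>W. P W \<and> (\<forall>W'. P W' \<longrightarrow> vdeg v W \<le> vdeg v W')"
    using ex_has_least_nat[of P p "vdeg v"] by auto
  then obtain W where W: "P W" and least: "\<And>W'. P W' \<Longrightarrow> vdeg v W \<le> vdeg v W'" by blast
  from W obtain s t where st: "s \<in> polys U" "t \<in> polys U" "W = s * p + t * a" and W0: "W \<noteq> 0"
    by (auto simp: P_def)
  have WU: "W \<in> polys U"
    unfolding st(3) by (intro polys_add polys_mult st assms)
  have lcU: "vlc v W \<in> polys U"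
    using vlc_polys[OF WU, of v] polys_mono[of "U - {v}" U] by auto
  have div: "\<exists>k T. T \<in> polys U \<and> vlc v W ^ k * b = T * W"
    if b: "b = s' * p + t' * a" "s' \<in> polys U" "t' \<in> polys U" for b s' t'
  proof -
    have "b \<in> polys U" unfolding b(1) by (intro polys_add polys_mult b assms)
    from pseudo_division[OF WU W0 assms(3) this] obtain k T R where
      *: "T \<in> polys U" "R \<in> polys U" "vlc v W ^ k * b = T * W + R"
           "R = 0 \<or> vdeg v R < vdeg v W" by blast
    have R: "R = (vlc v W ^ k * s' - T * s) * p + (vlc v W ^ k * t' - T * t) * a"
      using *(3) by (simp add: st(3) b(1) algebra_simps)
    have "R = 0"
    proof (rule ccontr)
      assume "R \<noteq> 0"
      moreover have "vlc v W ^ k * s' - T * s \<in> polys U" "vlc v W ^ k * t' - T * t \<in> polys U"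
        by (intro polys_diff polys_mult polys_power lcU b * st)+
      ultimately have "P R" unfolding P_def using R by blast
      then show False using least[of R] *(4) \<open>R \<noteq> 0\<close> by auto
    qed
    then show ?thesis using * by auto
  qed
  obtain k T where 1: "T \<in> polys U" "vlc v W ^ k * p = T * W"
    using div[of p 1 0] by auto
  obtain k' T' where 2: "T' \<in> polys U" "vlc v W ^ k' * a = T' * W"
    using div[of a 0 1] by auto
  show ?thesis
    by (rule that[OF W0 st WU 1(1) 2(1) 1(2) 2(2)])
qed

end

text \<open>If a prime \<open>q\<close> divides \<open>p * x\<close> but not \<open>p\<close>, it
  divides \<open>x\<close> and can be cancelled from both sides.\<close>

lemma cancel_primes:
  fixes p b :: "'a::idom"
  assumes "\<forall>q\<in>#A. prime_elem q \<and> \<not> q dvd p" "p dvd prod_mset A * b"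
  shows "p dvd b"
  using assms
proof (induction A)
  case empty
  then show ?case by simp
next
  case (add q A)
  from add.prems(2) have "p dvd q * (prod_mset A * b)"
    by (simp add: mult.assoc)
  then obtain x where x: "q * (prod_mset A * b) = p * x"
    by (elim dvdE)
  have "q dvd p * x" by (metis x dvd_triv_left)
  then have "q dvd x" using add.prems(1) prime_elem_dvd_mult_iff by auto
  then obtain y where "x = q * y" by auto
  with x have "q * (prod_mset A * b) = q * (p * y)" by (simp add: algebra_simps)
  moreover have "q \<noteq> 0" using add.prems(1) by auto
  ultimately have "prod_mset A * b = p * y" by simp
  then show ?case using add by auto
qed

text \<open>Each prime of \<open>A\<close> divides \<open>T\<close> or \<open>W\<close> and is
  cancelled there; \<open>t\<close> and \<open>w\<close> collect what has been taken out of
  each.\<close>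

lemma distribute_primes:
  fixes p T W :: "'a::idom"
  assumes "\<forall>q\<in>#A. prime_elem q" "prod_mset A * p = T * W"
  shows "\<exists>T1 W1 t w. T = t * T1 \<and> W = w * W1 \<and> p = T1 * W1 \<and> t * w = prod_mset A"
  using assms
proof (induction A arbitrary: T W)
  case empty
  then show ?case by (intro exI[of _ T] exI[of _ W] exI[of _ 1]) simp
next
  case (add q A)
  have q: "prime_elem q" "q \<noteq> 0" using add.prems by auto
  have eq: "q * (prod_mset A * p) = T * W" using add.prems by (simp add: algebra_simps)
  then have "q dvd T * W" by (metis dvd_triv_left)
  with q consider T' where "T = q * T'" | W' where "W = q * W'"
    by (auto simp: prime_elem_dvd_mult_iff)
  then show ?case
  proof cases
    case 1
    with eq have "q * (prod_mset A * p) = q * (T' * W)" by (simp add: algebra_simps)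
    with q have "prod_mset A * p = T' * W" by simp
    from add.IH[OF _ this] add.prems obtain T1 W1 t w where
      "T' = t * T1" "W = w * W1" "p = T1 * W1" "t * w = prod_mset A" by auto
    then show ?thesis using 1
      by (intro exI[of _ T1] exI[of _ W1] exI[of _ "q * t"] exI[of _ w]) (simp add: algebra_simps)
  next
    case 2
    with eq have "q * (prod_mset A * p) = q * (T * W')" by (simp add: algebra_simps)
    with q have "prod_mset A * p = T * W'" by simp
    from add.IH[OF _ this] add.prems obtain T1 W1 t w where
      "T = t * T1" "W' = w * W1" "p = T1 * W1" "t * w = prod_mset A" by auto
    then show ?thesis using 2
      by (intro exI[of _ T1] exI[of _ W1] exI[of _ t] exI[of _ "q * w"]) (simp add: algebra_simps)
  qed
qed

text \<open>Factors are required to be prime rather than irreducible, which spares any statement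
  about uniqueness of factorizations.\<close>

definition prime_product :: "'a::idom \<Rightarrow> bool" where
  "prime_product p \<longleftrightarrow> (\<exists>u A. u dvd 1 \<and> (\<forall>q\<in>#A. prime_elem q) \<and> p = u * prod_mset A)"

lemma prime_product_mult: "prime_product p \<Longrightarrow> prime_product q \<Longrightarrow> prime_product (p * q)"
proof -
  assume "prime_product p" "prime_product q"
  then obtain u A u' A' where "u dvd 1" "\<forall>q\<in>#A. prime_elem q" "p = u * prod_mset A"
    "u' dvd 1" "\<forall>q\<in>#A'. prime_elem q" "q = u' * prod_mset A'"
    by (auto simp: prime_product_def)
  then show ?thesis
    unfolding prime_product_def
    by (intro exI[of _ "u * u'"] exI[of _ "A + A'"]) (auto simp: algebra_simps is_unit_mult_iff)
qed

lemma prime_product_prime: "prime_elem p \<Longrightarrow> prime_product p"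
  unfolding prime_product_def by (intro exI[of _ 1] exI[of _ "{#p#}"]) auto

lemma prime_product_dvd: "prime_product p \<Longrightarrow> \<not> p dvd 1 \<Longrightarrow> \<exists>q. prime_elem q \<and> q dvd p"
proof -
  assume "prime_product p" and nu: "\<not> p dvd 1"
  then obtain u A where *: "u dvd 1" "\<forall>q\<in>#A. prime_elem q" "p = u * prod_mset A"
    by (auto simp: prime_product_def)
  with nu obtain q where "q \<in># A"
    by (cases A) auto
  with * show ?thesis
    by (intro exI[of _ q]) (auto intro: dvd_mult dvd_prod_mset)
qed

text \<open>Primality inside a polynomial ring in finitely many indeterminates; it persists when
  indeterminates are added.\<close>

definition rel_prime :: "'v set \<Rightarrow> ('v::linorder, 'a::idom) mpoly \<Rightarrow> bool" where
  "rel_prime V p \<longleftrightarrow> p \<in> polys V \<and> p \<noteq> 0 \<and> \<not> p dvd 1 \<and>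
     (\<forall>a\<in>polys V. \<forall>b\<in>polys V. p dvd a * b \<longrightarrow> p dvd a \<or> p dvd b)"

text \<open>With respect to \<open>v\<close> the polynomial \<open>p\<close> is a constant, so
  multiplication by \<open>p\<close> acts coefficientwise.\<close>

lemma dvd_upoly_iff:
  fixes p a :: "('v::linorder, 'a::idom) mpoly"
  assumes "p \<in> polys (- {v})"
  shows "p dvd a \<longleftrightarrow> (\<forall>i. p dvd Polynomial.coeff (upoly v a) i)"
proof
  interpret u: comm_ring_hom "upoly v :: ('v, 'a) mpoly \<Rightarrow> _" by (rule comm_ring_hom_upoly)
  assume "p dvd a"
  then obtain b where "a = p * b" by auto
  then have "upoly v a = smult p (upoly v b)"
    by (simp add: u.hom_mult upoly_free[OF assms])
  then show "\<forall>i. p dvd Polynomial.coeff (upoly v a) i" by simp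
next
  assume *: "\<forall>i. p dvd Polynomial.coeff (upoly v a) i"
  have "a = poly (upoly v a) (Var v)" by simp
  also have "\<dots> = (\<Sum>i\<le>Polynomial.degree (upoly v a). Polynomial.coeff (upoly v a) i * Var v ^ i)"
    by (rule poly_altdef)
  finally show "p dvd a"
    using * by (metis (no_types, lifting) dvd_mult2 dvd_sum)
qed

text \<open>Gauss's lemma. Let \<open>i\<close> and \<open>j\<close> be the least indices of
  coefficients of \<open>a\<close> and \<open>b\<close> in \<open>v\<close> that \<open>p\<close>
  does not divide; modulo \<open>p\<close> the coefficient of index \<open>i + j\<close> of
  \<open>a * b\<close> is the product of these two.\<close>

lemma rel_prime_insert:
  assumes "rel_prime V p" "v \<notin> V"
  shows "rel_prime (insert v V) p"
proof -
  interpret u: comm_ring_hom "upoly v :: ('a, 'b) mpoly \<Rightarrow> _" by (rule comm_ring_hom_upoly)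
  from assms(1) have p: "p \<in> polys V" "p \<noteq> 0" "\<not> p dvd 1"
    and pr: "\<And>a b. a \<in> polys V \<Longrightarrow> b \<in> polys V \<Longrightarrow> p dvd a * b \<Longrightarrow> p dvd a \<or> p dvd b"
    unfolding rel_prime_def by blast+
  have "polys V \<subseteq> (polys (- {v}) :: ('a, 'b) mpoly set)"
    by (rule polys_mono) (use assms(2) in auto)
  with p(1) have pv: "p \<in> polys (- {v})" by (rule subsetD[rotated])
  have "p dvd a \<or> p dvd b" if ab: "a \<in> polys (insert v V)" "b \<in> polys (insert v V)" "p dvd a * b" for a b
  proof (rule ccontr)
    assume "\<not> (p dvd a \<or> p dvd b)"
    then have ex: "\<exists>i. \<not> p dvd Polynomial.coeff (upoly v a) i" "\<exists>j. \<not> p dvd Polynomial.coeff (upoly v b) j"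
      using dvd_upoly_iff[OF pv, of a] dvd_upoly_iff[OF pv, of b] by simp_all
    define i where "i = (LEAST i. \<not> p dvd Polynomial.coeff (upoly v a) i)"
    define j where "j = (LEAST j. \<not> p dvd Polynomial.coeff (upoly v b) j)"
    have i: "\<not> p dvd Polynomial.coeff (upoly v a) i"
        "\<And>i'. i' < i \<Longrightarrow> p dvd Polynomial.coeff (upoly v a) i'"
      unfolding i_def using LeastI_ex[OF ex(1)] not_less_Least by blast+
    have j: "\<not> p dvd Polynomial.coeff (upoly v b) j"
        "\<And>j'. j' < j \<Longrightarrow> p dvd Polynomial.coeff (upoly v b) j'"
      unfolding j_def using LeastI_ex[OF ex(2)] not_less_Least by blast+
    have co: "Polynomial.coeff (upoly v a) i \<in> polys V" "Polynomial.coeff (upoly v b) j \<in> polys V"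
      using coeff_upoly_polys[OF ab(1), of v i] coeff_upoly_polys[OF ab(2), of v j] assms(2) by auto
    have "p dvd Polynomial.coeff (upoly v (a * b)) (i + j)"
      using ab(3) dvd_upoly_iff[OF pv, of "a * b"] by simp
    also have "Polynomial.coeff (upoly v (a * b)) (i + j) =
      (\<Sum>k\<le>i + j. Polynomial.coeff (upoly v a) k * Polynomial.coeff (upoly v b) (i + j - k))"
      by (simp add: u.hom_mult coeff_mult)
    also have "\<dots> = Polynomial.coeff (upoly v a) i * Polynomial.coeff (upoly v b) j +
      (\<Sum>k\<in>{..i + j} - {i}. Polynomial.coeff (upoly v a) k * Polynomial.coeff (upoly v b) (i + j - k))"
      by (subst sum.remove[of _ i]) auto
    also have "p dvd \<dots> \<longleftrightarrow> p dvd Polynomial.coeff (upoly v a) i * Polynomial.coeff (upoly v b) j"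
    proof (rule dvd_add_left_iff, rule dvd_sum)
      fix k assume k: "k \<in> {..i + j} - {i}"
      show "p dvd Polynomial.coeff (upoly v a) k * Polynomial.coeff (upoly v b) (i + j - k)"
      proof (cases "k < i")
        case True
        then show ?thesis using i(2) by auto
      next
        case False
        then have "i + j - k < j" using k by auto
        then show ?thesis using j(2) by auto
      qed
    qed
    finally show False using pr[OF co] i(1) j(1) by blast
  qed
  moreover have "p \<in> polys (insert v V)"
    using p(1) polys_mono[of V "insert v V"] by auto
  ultimately show ?thesis
    unfolding rel_prime_def using p by blast
qed

lemma rel_prime_imp_prime_elem:
  assumes "rel_prime V p" "finite V"
  shows "prime_elem p"
proof (rule prime_elemI)
  from assms(1) show "p \<noteq> 0" "\<not> p dvd 1" by (auto simp: rel_prime_def)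
next
  fix a b assume ab: "p dvd a * b"
  obtain Va Vb where V: "finite Va" "a \<in> polys Va" "finite Vb" "b \<in> polys Vb"
    using polys_ex_finite by metis
  have "rel_prime (V \<union> W) p" if "finite W" for W
    using that
  proof induction
    case (insert x F)
    then show ?case
      using rel_prime_insert[of "V \<union> F" p x] by (cases "x \<in> V") (auto simp: insert_absorb)
  qed (use assms in simp)
  from this[of "Va \<union> Vb"] V have "rel_prime (V \<union> (Va \<union> Vb)) p" by simp
  moreover have "a \<in> polys (V \<union> (Va \<union> Vb))" "b \<in> polys (V \<union> (Va \<union> Vb))"
    using V polys_mono[of Va "V \<union> (Va \<union> Vb)"] polys_mono[of Vb "V \<union> (Va \<union> Vb)"] by auto
  ultimately show "p dvd a \<or> p dvd b" using ab unfolding rel_prime_def by blast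
qed

text \<open>Evaluation at 0 reduces divisibility of constants to divisibility of integers, which
  settles the case of no indeterminates; \<open>rel_prime_imp_prime_elem\<close> adds the
  others.\<close>

lemma prime_elem_Const_int:
  assumes "prime_elem (q::int)"
  shows "prime_elem (Const q :: ('v::linorder, int) mpoly)"
proof (rule rel_prime_imp_prime_elem)
  have dvd: "c dvd d" if cd: "Const c dvd (Const d :: ('v, int) mpoly)" for c d :: int
  proof -
    obtain b where "(Const d :: ('v, int) mpoly) = Const c * b" using cd by auto
    then have "mp_eval (\<lambda>x. x) (\<lambda>_. 0) (Const d :: ('v, int) mpoly) = mp_eval (\<lambda>x. x) (\<lambda>_. 0) (Const c * b)"
      by simp
    then have "d = c * mp_eval (\<lambda>x. x) (\<lambda>_. 0) b"
      by (simp add: comm_ring_hom.mp_eval_mult[OF comm_ring_hom_id] comm_ring_hom.mp_eval_Const[OF comm_ring_hom_id])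
    then show ?thesis by simp
  qed
  have dvd': "Const c dvd (Const d :: ('v, int) mpoly)" if "c dvd d" for c d :: int
    using that by (auto simp: Const_mult)
  have "\<not> Const q dvd (1 :: ('v, int) mpoly)"
    using dvd[of q 1] assms by auto
  moreover have "Const q \<noteq> (0 :: ('v, int) mpoly)"
    using dvd[of 0 q] assms by auto
  ultimately show "rel_prime {} (Const q :: ('v, int) mpoly)"
    unfolding rel_prime_def
  proof (intro conjI ballI impI)
    fix a b :: "('v, int) mpoly" assume "a \<in> polys {}" "b \<in> polys {}"
    then obtain c d where [simp]: "a = Const c" "b = Const d" using polys_empty by metis
    assume "Const q dvd a * b"
    then have "q dvd c * d" by (intro dvd) (simp add: Const_mult)
    then show "Const q dvd a \<or> Const q dvd b"
      using assms dvd' by (auto simp: prime_elem_dvd_mult_iff)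
  qed auto
qed auto

lemma prime_product_int:
  assumes "c \<noteq> 0"
  shows "prime_product (Const c :: ('v::linorder, int) mpoly)"
proof -
  define A where "A = prime_factorization c"
  interpret comm_ring_hom "Const :: int \<Rightarrow> ('v, int) mpoly" by (rule comm_ring_hom_Const)
  have "c = sgn c * prod_mset A"
    using assms by (simp add: A_def prod_mset_prime_factorization sgn_mult_abs)
  then have "(Const c :: ('v, int) mpoly) = Const (sgn c * prod_mset A)"
    by simp
  then have 1: "(Const c :: ('v, int) mpoly) = Const (sgn c) * prod_mset (image_mset Const A)"
    unfolding Const_mult hom_prod_mset .
  have "Const (sgn c) * Const (sgn c) = (1 :: ('v, int) mpoly)"
    using assms by (simp add: Const_mult[symmetric] sgn_if del: prod_mset_image)
  then have 2: "Const (sgn c) dvd (1 :: ('v, int) mpoly)"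
    by (metis dvd_triv_left)
  have 3: "\<forall>q\<in>#image_mset (Const :: int \<Rightarrow> ('v, int) mpoly) A. prime_elem q"
  proof
    fix q :: "('v, int) mpoly" assume "q \<in># image_mset Const A"
    then obtain z where "z \<in># A" "q = Const z" by auto
    then show "prime_elem q"
      unfolding A_def using prime_elem_Const_int[OF prime_imp_prime_elem[OF in_prime_factors_imp_prime]] by simp
  qed
  from 1 2 3 show ?thesis unfolding prime_product_def by blast
qed

text \<open>Induction on the degree in \<open>v\<close>: if \<open>p\<close> is not a product of two
  polynomials of positive degree in \<open>v\<close>, then it is itself prime. For
  \<open>p dvd a * b\<close>, the polynomial \<open>W\<close> of \<open>elimination\<close> plays
  the greatest common divisor of \<open>p\<close> and \<open>a\<close>.\<close>

lemma prime_product_primitive: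
  fixes p :: "('v::linorder, int) mpoly"
  assumes V: "finite V" "v \<notin> V" and IH: "\<And>c :: ('v, int) mpoly. c \<in> polys V \<Longrightarrow> c \<noteq> 0 \<Longrightarrow> prime_product c"
    and "p \<in> polys (insert v V)" "p \<noteq> 0" "\<And>q. prime_elem q \<Longrightarrow> q \<in> polys V \<Longrightarrow> \<not> q dvd p"
  shows "prime_product p"
  using assms(4-6)
proof (induction "vdeg v p" arbitrary: p rule: less_induct)
  case less
  let ?U = "insert v V"
  have VU: "?U - {v} = V" using V by auto
  have factor: "f \<in> polys ?U" "f \<noteq> 0" "\<And>q. prime_elem q \<Longrightarrow> q \<in> polys V \<Longrightarrow> \<not> q dvd f"
    if "f dvd p" for f
  proof -
    from that obtain g where g: "p = f * g" by auto
    then show "f \<in> polys ?U" "f \<noteq> 0"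
      using polys_factor(1)[of f g ?U] less.prems by auto
    show "\<not> q dvd f" if "prime_elem q" "q \<in> polys V" for q
      using less.prems(3)[OF that] \<open>f dvd p\<close> dvd_trans by blast
  qed
  show ?case
  proof (cases "vdeg v p = 0")
    case True
    then show ?thesis using vdeg_0_polys[OF True less.prems(1)] IH less.prems(2) by (simp add: VU)
  next
    case pos: False
    show ?thesis
    proof (cases "\<exists>f g. p = f * g \<and> vdeg v f > 0 \<and> vdeg v g > 0")
      case True
      then obtain f g where fg: "p = f * g" "vdeg v f > 0" "vdeg v g > 0" by blast
      have "vdeg v p = vdeg v f + vdeg v g"
        unfolding fg(1) using fg(1) less.prems(2) by (intro vdeg_mult) auto
      then have lt: "vdeg v f < vdeg v p" "vdeg v g < vdeg v p" using fg by auto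
      have dvd: "f dvd p" "g dvd p" using fg(1) by auto
      have "prime_product f" "prime_product g"
        using less.hyps[OF lt(1) factor(1)[OF dvd(1)] factor(2)[OF dvd(1)] factor(3)[OF dvd(1)]]
          less.hyps[OF lt(2) factor(1)[OF dvd(2)] factor(2)[OF dvd(2)] factor(3)[OF dvd(2)]] by blast+
      then show ?thesis
        unfolding fg(1) by (rule prime_product_mult)
    next
      case irred: False
      \<comment> \<open>A nonunit factor of degree 0 in \<open>v\<close> would contribute a prime
        factor free of \<open>v\<close>.\<close>
      have small_unit: "f dvd 1" if f: "f dvd p" "vdeg v f = 0" for f
      proof (rule ccontr)
        assume nu: "\<not> f dvd 1"
        have fV: "f \<in> polys V"
          using vdeg_0_polys[OF f(2) factor(1)[OF f(1)]] by (simp add: VU)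
        then obtain q where q: "prime_elem q" "q dvd f"
          using prime_product_dvd[OF IH nu] factor(2)[OF f(1)] by blast
        then obtain h where "f = q * h" by auto
        then have "q \<in> polys V" using polys_factor(1)[of q h V] fV factor(2)[OF f(1)] by auto
        then show False using factor(3)[OF f(1) q(1)] q(2) by blast
      qed
      \<comment> \<open>The primes of \<open>c\<close> are free of \<open>v\<close>, so none of them
        divides \<open>p\<close> and all can be cancelled.\<close>
      have coprime: "p dvd b" if c: "c \<in> polys V" "c \<noteq> 0" "p dvd c * b" for c b
      proof -
        obtain u A where A: "u dvd 1" "\<forall>q\<in>#A. prime_elem q" "c = u * prod_mset A"
          using IH[OF c(1,2)] by (auto simp: prime_product_def)
        have "q \<in> polys V" if q: "q \<in># A" for q
        proof -
          have "q dvd c" unfolding A(3) using q by (simp add: dvd_mult dvd_prod_mset)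
          then obtain h where "c = q * h" by auto
          then show ?thesis using polys_factor(1)[of q h V] c by auto
        qed
        then have "\<forall>q\<in>#A. prime_elem q \<and> \<not> q dvd p"
          using A(2) less.prems(3) by blast
        moreover have "p dvd prod_mset A * b"
        proof -
          have "p dvd u * (prod_mset A * b)" using c(3) A(3) by (simp add: mult.assoc)
          with A(1) show ?thesis by (simp add: dvd_mult_unit_iff')
        qed
        ultimately show ?thesis by (rule cancel_primes)
      qed
      have "rel_prime ?U p"
        unfolding rel_prime_def
      proof (intro conjI ballI impI)
        show "p \<in> polys ?U" "p \<noteq> 0" by fact+
        show "\<not> p dvd 1"
        proof
          assume "p dvd 1"
          then obtain g where g: "1 = p * g" by (elim dvdE)
          then have "p \<in> polys {}" using polys_factor(1)[of p g "{}"] by auto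
          then show False using vdeg_free[of p "{}" v] pos by auto
        qed
        fix a b assume ab: "a \<in> polys ?U" "b \<in> polys ?U" "p dvd a * b"
        show "p dvd a \<or> p dvd b"
        proof (rule disjCI)
          assume npb: "\<not> p dvd b"
          obtain W s t T T' k k' where W: "W \<noteq> 0" "W = s * p + t * a" "W \<in> polys ?U"
            and T: "vlc v W ^ k * p = T * W" "vlc v W ^ k' * a = T' * W"
            using elimination[OF less.prems(1,2) _ ab(1), of v] by (metis insertI1)
          have lc: "vlc v W \<in> polys V" "vlc v W \<noteq> 0"
            using vlc_polys[OF W(3), of v] W(1) by (simp_all add: VU)
          show "p dvd a"
          proof (cases "vdeg v W = 0")
            case True
            then have WV: "W \<in> polys V" using vdeg_0_polys[OF True W(3)] by (simp add: VU)
            \<comment> \<open>Here \<open>p\<close> and \<open>a\<close> have no common factor of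
              positive degree; \<open>p dvd W * b\<close> then gives \<open>p dvd b\<close>,
              contrary to the assumption.\<close>
            have "W * b = p * (s * b) + t * (a * b)" by (simp add: W(2) algebra_simps)
            then have "p dvd W * b" using ab(3) by (simp add: dvd_mult)
            then show ?thesis using coprime[OF WV W(1)] npb by blast
          next
            case Wpos: False
            have lck: "vlc v W ^ k \<in> polys V" "vlc v W ^ k \<noteq> 0" for k
              using lc by (auto intro: polys_power)
            obtain u A where A: "u dvd 1" "\<forall>q\<in>#A. prime_elem q" "vlc v W ^ k = u * prod_mset A"
              using IH[OF lck, of k] unfolding prime_product_def by blast
            obtain u' where u': "u * u' = 1" using A(1) by (metis dvdE)
            have "u' * (vlc v W ^ k * p) = u' * (T * W)" by (simp add: T(1))
            then have "(u * u') * (prod_mset A * p) = (u' * T) * W"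
              by (simp add: A(3) algebra_simps)
            then have "prod_mset A * p = (u' * T) * W" by (simp add: u')
            \<comment> \<open>Without the primes of the leading coefficient the relation becomes
              \<open>p = T1 * W1\<close>, where \<open>W1\<close> has positive degree in
              \<open>v\<close>. Hence \<open>T1\<close> has degree 0 and is a unit, and
              \<open>p\<close> divides \<open>W\<close>.\<close>
            from distribute_primes[OF A(2) this] obtain T1 W1 t1 w where
              d: "W = w * W1" "p = T1 * W1" "t1 * w = prod_mset A" by blast
            have "w dvd vlc v W ^ k"
              unfolding A(3) d(3)[symmetric] by (simp add: dvd_mult)
            then obtain w' where w': "vlc v W ^ k = w * w'" by auto
            then have wV: "w \<in> polys V" using lck[of k] polys_factor(1)[of w w' V] by simp
            have nz: "T1 \<noteq> 0" "W1 \<noteq> 0" "w \<noteq> 0" using d(1,2) less.prems(2) W(1) by auto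
            have "vdeg v W = vdeg v w + vdeg v W1"
              unfolding d(1) using nz by (rule_tac vdeg_mult) auto
            then have "vdeg v W1 > 0" using vdeg_free[OF wV V(2)] Wpos by simp
            moreover have "\<not> (vdeg v T1 > 0 \<and> vdeg v W1 > 0)" using irred d(2) by blast
            ultimately have "vdeg v T1 = 0" by simp
            then have "T1 dvd 1" using small_unit[of T1] d(2) by simp
            then have "p dvd W1" unfolding d(2) by (simp add: mult_unit_dvd_iff')
            then have "p dvd W" unfolding d(1) by (rule dvd_mult)
            then have "p dvd vlc v W ^ k' * a" unfolding T(2) by (rule dvd_mult)
            then show ?thesis using coprime[OF lck] by blast
          qed
        qed
      qed
      then have "prime_elem p" by (rule rel_prime_imp_prime_elem) (use V in simp)
      then show ?thesis by (rule prime_product_prime)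
    qed
  qed
qed

text \<open>Induction on the indeterminates. In \<open>main\<close> prime factors free of
  \<open>v\<close> are split off until \<open>prime_product_primitive\<close> applies; each uses up
  one prime of the leading coefficient in \<open>v\<close>, so \<open>size A\<close>
  decreases.\<close>

theorem prime_product_mpoly:
  assumes "p \<noteq> (0 :: ('v::linorder, int) mpoly)"
  shows "prime_product p"
proof -
  have "p \<in> polys V \<Longrightarrow> p \<noteq> 0 \<Longrightarrow> prime_product p" if "finite V" for V
    using that
  proof (induction V arbitrary: p)
    case empty
    then obtain c where "p = Const c" using polys_empty by blast
    then show ?case using empty prime_product_int[of c] by (cases "c = 0") auto
  next
    case (insert v V)
    have VU: "insert v V - {v} = V" using insert by auto
    have main: "prime_product p"
      if "p \<in> polys (insert v V)" "p \<noteq> 0" "u dvd 1" "\<forall>q\<in>#A. prime_elem q" "vlc v p = u * prod_mset A"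
      for p u :: "('v, int) mpoly" and A
      using that
    proof (induction "size A" arbitrary: p u A rule: less_induct)
      case less
      show ?case
      proof (cases "\<exists>q. prime_elem q \<and> q \<in> polys V \<and> q dvd p")
        case False
        then show ?thesis
          using prime_product_primitive[OF insert.hyps, of p] insert.IH less.prems by blast
      next
        case True
        then obtain q p' where q: "prime_elem q" "q \<in> polys V" "p = q * p'" by (auto elim: dvdE)
        then have p': "p' \<in> polys (insert v V)" "p' \<noteq> 0"
          using polys_factor(2)[of q p' "insert v V"] less.prems by auto
        have lc: "vlc v p = q * vlc v p'"
          using vlc_mult[of v q p'] vlc_free[OF q(2) insert.hyps(2)] q(3) by simp
        have "q dvd u * prod_mset A" using lc less.prems by (metis dvd_triv_left)
        moreover have "\<not> q dvd u" using q(1) less.prems(3) by (meson dvd_trans prime_elem_not_unit)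
        ultimately have "q dvd prod_mset A" using q(1) by (auto simp: prime_elem_dvd_mult_iff)
        then obtain a where a: "a \<in># A" "q dvd a"
          using prime_elem_dvd_prod_mset[OF q(1)] by blast
        then obtain x where x: "a = q * x" by auto
        have "irreducible a" using a(1) less.prems(4) by (auto intro: prime_elem_imp_irreducible)
        then have xu: "x dvd 1" using x q(1) irreducibleD[of a q x] prime_elem_not_unit by blast
        have "prod_mset A = a * prod_mset (A - {#a#})" using a(1) by (metis insert_DiffM prod_mset.add_mset)
        then have "q * vlc v p' = u * (q * x * prod_mset (A - {#a#}))"
          using less.prems(5) unfolding lc x by simp
        then have "q * vlc v p' = q * ((u * x) * prod_mset (A - {#a#}))"
          by (simp add: mult_ac del: mult_cancel_left)
        then have lc': "vlc v p' = (u * x) * prod_mset (A - {#a#})"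
          using q(1) by (metis mult_cancel_left prime_elem_not_zeroI)
        have "prime_product p'"
        proof (rule less.hyps[OF _ p' _ _ lc'])
          show "size (A - {#a#}) < size A" using a(1) by (simp add: size_Diff1_less)
          show "u * x dvd 1" using xu less.prems(3) by (simp add: is_unit_mult_iff)
          show "\<forall>q\<in>#A - {#a#}. prime_elem q" using less.prems(4) by (meson in_diffD)
        qed
        then show ?thesis unfolding q(3) by (rule prime_product_mult[OF prime_product_prime[OF q(1)]])
      qed
    qed
    have "prime_product (vlc v p)"
      using vlc_polys[OF insert.prems(1), of v] insert.prems(2) by (intro insert.IH) (simp_all add: VU)
    then show ?case using main[OF insert.prems] by (auto simp: prime_product_def)
  qed
  then show ?thesis using polys_ex_finite[of p] assms by blast
qed

section \<open>The generic zero and inertia forms\<close>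

declare One_nat_def [simp del]

lemma comm_ring_hom_to_fract: "comm_ring_hom (to_fract :: 'a::idom \<Rightarrow> 'a fract)"
  by unfold_locales simp_all

lemma Var_neq_0 [simp]: "Var x \<noteq> (0 :: ('v, 'a::comm_ring_1) mpoly)"
proof
  assume "Var x = (0 :: ('v, 'a) mpoly)"
  then have "Poly_Mapping.lookup (Var x :: ('v, 'a) mpoly) (Poly_Mapping.single x 1) = 0" by simp
  then show False by (simp add: Var_def)
qed

lemma finite_exponents [simp]: "finite (exponents m e)"
proof (rule inj_on_finite[of "\<lambda>\<alpha>. restrict (Poly_Mapping.lookup \<alpha>) {1..m}" _ "{1..m} \<rightarrow>\<^sub>E {..e}"])
  show "inj_on (\<lambda>\<alpha>. restrict (Poly_Mapping.lookup \<alpha>) {1..m}) (exponents m e)"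
  proof (rule inj_onI)
    fix \<alpha> \<beta> assume ab: "\<alpha> \<in> exponents m e" "\<beta> \<in> exponents m e"
      and eq: "restrict (Poly_Mapping.lookup \<alpha>) {1..m} = restrict (Poly_Mapping.lookup \<beta>) {1..m}"
    show "\<alpha> = \<beta>"
    proof (rule poly_mapping_eqI)
      fix x
      show "Poly_Mapping.lookup \<alpha> x = Poly_Mapping.lookup \<beta> x"
      proof (cases "x \<in> {1..m}")
        case True
        then show ?thesis using fun_cong[OF eq, of x] by simp
      next
        case False
        then have "x \<notin> Poly_Mapping.keys \<alpha>" "x \<notin> Poly_Mapping.keys \<beta>"
          using ab unfolding exponents_def by blast+
        then show ?thesis by (simp add: in_keys_iff)
      qed
    qed
  qed
next
  have "Poly_Mapping.lookup \<alpha> x \<le> e" if "\<alpha> \<in> exponents m e" "x \<in> {1..m}" for \<alpha> x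
  proof -
    have "mdeg \<alpha> = (\<Sum>x\<in>{1..m}. Poly_Mapping.lookup \<alpha> x)" "mdeg \<alpha> = e"
      using that(1) by (auto simp: exponents_def intro: mdeg_superset)
    then show ?thesis using member_le_sum[of x "{1..m}" "Poly_Mapping.lookup \<alpha>"] that(2) by auto
  qed
  then show "(\<lambda>\<alpha>. restrict (Poly_Mapping.lookup \<alpha>) {1..m}) ` exponents m e \<subseteq> {1..m} \<rightarrow>\<^sub>E {..e}"
    by auto
qed (auto intro: finite_PiE)

lemma single_in_exponents [simp]: "i \<in> {1..m} \<Longrightarrow> Poly_Mapping.single i e \<in> exponents m e"
  by (auto simp: exponents_def)

lemma lookup_generic_poly: "Poly_Mapping.lookup (generic_poly m d i) \<alpha> =
    (if \<alpha> \<in> exponents m (d i) then Var (i, \<alpha>) else 0)"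
  by (simp add: generic_poly_def lookup_sum lookup_single when_def)

lemma keys_generic_poly: "Poly_Mapping.keys (generic_poly m d i) \<subseteq> exponents m (d i)"
  by (auto simp: in_keys_iff lookup_generic_poly split: if_splits)

lemma generic_poly_polys: "generic_poly m d i \<in> polys {1..m}"
  using keys_generic_poly[of m d i] by (auto simp: polys_def exponents_def)

lemma homogeneous_generic_poly: "homogeneous (d i) (generic_poly m d i)"
  using keys_generic_poly[of m d i] by (auto simp: homogeneous_def exponents_def)

text \<open>Ideal membership in the full ring, with coefficients indexed by equations rather than
  attached to a set of generators; \<open>gen_ideal_G_iff\<close> relates it to the ideal of the
  subring.\<close>

definition in_span :: "nat \<Rightarrow> (nat \<Rightarrow> 'a::comm_ring_1) \<Rightarrow> 'a \<Rightarrow> bool" where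
  "in_span m g p \<longleftrightarrow> (\<exists>c. p = (\<Sum>i\<in>{1..m}. c i * g i))"

lemma in_span_0 [simp]: "in_span m g 0"
  unfolding in_span_def by (rule exI[of _ "\<lambda>_. 0"]) simp

lemma in_span_add: "in_span m g p \<Longrightarrow> in_span m g q \<Longrightarrow> in_span m g (p + q)"
proof -
  assume "in_span m g p" "in_span m g q"
  then obtain c c' where "p = (\<Sum>i\<in>{1..m}. c i * g i)" "q = (\<Sum>i\<in>{1..m}. c' i * g i)"
    by (auto simp: in_span_def)
  then show ?thesis
    unfolding in_span_def by (intro exI[of _ "\<lambda>i. c i + c' i"]) (simp add: distrib_right sum.distrib)
qed

lemma in_span_mult: "in_span m g p \<Longrightarrow> in_span m g (q * p)"
proof -
  assume "in_span m g p"
  then obtain c where "p = (\<Sum>i\<in>{1..m}. c i * g i)"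
    by (auto simp: in_span_def)
  then show ?thesis
    unfolding in_span_def by (intro exI[of _ "\<lambda>i. q * c i"]) (simp add: sum_distrib_left mult.assoc)
qed

lemma in_span_generator: "i \<in> {1..m} \<Longrightarrow> in_span m g (g i)"
  unfolding in_span_def
  by (rule exI[of _ "\<lambda>k. if k = i then 1 else 0"]) (simp add: if_distrib[of "\<lambda>c. c * _"] cong: if_cong)

lemma in_span_sum: "(\<And>x. x \<in> A \<Longrightarrow> in_span m g (f x)) \<Longrightarrow> in_span m g (sum f A)"
  by (induction A rule: infinite_finite_induct) (auto intro: in_span_add)

locale degree_vector =
  fixes m :: nat and d :: "nat \<Rightarrow> nat"
  assumes m_pos: "m \<ge> 1" and d_pos: "\<And>i. i \<in> {1..m} \<Longrightarrow> d i \<ge> 1"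
begin

abbreviation G where "G \<equiv> generic_poly m d"

abbreviation top_var :: "nat \<Rightarrow> nat \<Rightarrow> nat \<times> (nat \<Rightarrow>\<^sub>0 nat)" where
  "top_var j i \<equiv> (i, Poly_Mapping.single j (d i))"

definition tail :: "nat \<Rightarrow> nat \<Rightarrow> (nat, coeff_ring) mpoly" where
  "tail j i = (\<Sum>\<alpha>\<in>exponents m (d i) - {Poly_Mapping.single j (d i)}. Poly_Mapping.single \<alpha> (Var (i, \<alpha>)))"

lemma G_eq_tail:
  assumes "j \<in> {1..m}"
  shows "G i = Const (Var (top_var j i)) * Var j ^ d i + tail j i"
proof -
  have "G i = Poly_Mapping.single (Poly_Mapping.single j (d i)) (Var (top_var j i)) + tail j i"
    unfolding generic_poly_def tail_def
    by (rule sum.remove) (use assms in auto)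
  then show ?thesis by (simp add: single_mon_eval)
qed

text \<open>The generic zero of the generic system: the coordinates are indeterminates, and the \<open>i\<close>-th
  equation is solved for the coefficient of \<open>x_j ^ d i\<close>.\<close>

definition zero_coeff :: "nat \<Rightarrow> coeff_ring \<Rightarrow> (nat, coeff_ring) mpoly fract" where
  "zero_coeff j = mp_eval of_int (\<lambda>z. if fst z \<in> {1..m} \<and> z = top_var j (fst z)
     then - (to_fract (tail j (fst z)) / to_fract (Var j ^ d (fst z))) else to_fract (Const (Var z)))"

definition zero_eval :: "nat \<Rightarrow> (nat, coeff_ring) mpoly \<Rightarrow> (nat, coeff_ring) mpoly fract" where
  "zero_eval j = mp_eval (zero_coeff j) (\<lambda>x. to_fract (Var x))"

lemma comm_ring_hom_zero_coeff: "comm_ring_hom (zero_coeff j)"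
  unfolding zero_coeff_def by (rule comm_ring_hom_mp_eval_of_int)

lemma comm_ring_hom_zero_eval: "comm_ring_hom (zero_eval j)"
  unfolding zero_eval_def by (rule comm_ring_hom.comm_ring_hom_mp_eval[OF comm_ring_hom_zero_coeff])

lemma zero_coeff_Var: "zero_coeff j (Var z) = (if fst z \<in> {1..m} \<and> z = top_var j (fst z)
     then - (to_fract (tail j (fst z)) / to_fract (Var j ^ d (fst z))) else to_fract (Const (Var z)))"
  unfolding zero_coeff_def by (rule comm_ring_hom.mp_eval_Var[OF comm_ring_hom_of_int])

lemma zero_eval_Const [simp]: "zero_eval j (Const a) = zero_coeff j a"
  and zero_eval_Var [simp]: "zero_eval j (Var x) = to_fract (Var x)"
  unfolding zero_eval_def
  by (rule comm_ring_hom.mp_eval_Const comm_ring_hom.mp_eval_Var, rule comm_ring_hom_zero_coeff)+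

lemma zero_eval_tail: "zero_eval j (tail j i) = to_fract (tail j i)"
proof -
  interpret e: comm_ring_hom "zero_eval j" by (rule comm_ring_hom_zero_eval)
  interpret f: comm_ring_hom "to_fract :: (nat, coeff_ring) mpoly \<Rightarrow> _" by (rule comm_ring_hom_to_fract)
  show ?thesis
    unfolding tail_def e.hom_sum f.hom_sum
    by (intro sum.cong refl)
       (auto simp: single_mon_eval e.hom_mult hom_mon_eval[OF comm_ring_hom_zero_eval]
         hom_mon_eval[OF comm_ring_hom_to_fract] zero_coeff_Var)
qed

lemma to_fract_power: "to_fract (a ^ n) = to_fract (a :: 'b :: idom) ^ n"
proof -
  interpret f: comm_ring_hom "to_fract :: 'b \<Rightarrow> _" by (rule comm_ring_hom_to_fract)
  show ?thesis by (rule f.hom_power)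
qed

lemma zero_eval_G:
  assumes "j \<in> {1..m}" "i \<in> {1..m}"
  shows "zero_eval j (G i) = 0"
proof -
  interpret e: comm_ring_hom "zero_eval j" by (rule comm_ring_hom_zero_eval)
  show ?thesis
    using assms by (simp add: G_eq_tail[OF assms(1)] e.hom_add e.hom_mult e.hom_power
        zero_coeff_Var zero_eval_tail to_fract_power)
qed

lemma zero_eval_in_span:
  assumes "j \<in> {1..m}" "in_span m G p"
  shows "zero_eval j p = 0"
proof -
  interpret e: comm_ring_hom "zero_eval j" by (rule comm_ring_hom_zero_eval)
  show ?thesis
    using assms by (auto simp: in_span_def e.hom_sum e.hom_mult zero_eval_G)
qed

text \<open>The same \<open>N\<close> is a remainder of \<open>a * x_j ^ k\<close> modulo the
  equations and the numerator of the value of \<open>a\<close> at the generic zero. So if that value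
  is 0, then \<open>a * x_j ^ k\<close> lies in the ideal.\<close>

definition clears :: "nat \<Rightarrow> coeff_ring \<Rightarrow> nat \<Rightarrow> (nat, coeff_ring) mpoly \<Rightarrow> bool" where
  "clears j a k N \<longleftrightarrow> in_span m G (Const a * Var j ^ k - N) \<and>
     zero_coeff j a * to_fract (Var j) ^ k = to_fract N"

lemma clear_denominators:
  assumes j: "j \<in> {1..m}"
  shows "\<exists>k N. clears j a k N"
proof (induction a rule: mpoly_induct)
  case (Const c)
  have "comm_ring_hom (\<lambda>c::int. to_fract (Const (Const c :: coeff_ring) :: (nat, coeff_ring) mpoly))"
    by (intro comm_ring_hom_compose[OF _ comm_ring_hom_to_fract] comm_ring_hom_compose[OF _ comm_ring_hom_Const] comm_ring_hom_Const)
  from fun_cong[OF hom_of_int_eq[OF this], of c]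
  have "zero_coeff j (Const c) = to_fract (Const (Const c))"
    unfolding zero_coeff_def comm_ring_hom.mp_eval_Const[OF comm_ring_hom_of_int] by simp
  then have "clears j (Const c) 0 (Const (Const c))"
    by (simp add: clears_def)
  then show ?case by blast
next
  case (Var z)
  show ?case
  proof (cases "fst z \<in> {1..m} \<and> z = top_var j (fst z)")
    case True
    define i where "i = fst z"
    have z: "z = top_var j i" "i \<in> {1..m}" using True by (auto simp: i_def)
    have "clears j (Var z) (d i) (- tail j i)"
      unfolding clears_def
    proof
      have "Const (Var z) * Var j ^ d i - (- tail j i) = G i"
        using G_eq_tail[OF j, of i] by (simp add: z)
      then show "in_span m G (Const (Var z) * Var j ^ d i - (- tail j i))"
        using z(2) in_span_generator[of i m G] by simp
      show "zero_coeff j (Var z) * to_fract (Var j) ^ d i = to_fract (- tail j i)"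
        unfolding zero_coeff_Var using z by (simp add: to_fract_power)
    qed
    then show ?thesis by blast
  next
    case False
    have "clears j (Var z) 0 (Const (Var z))"
      unfolding clears_def zero_coeff_Var if_not_P[OF False] by simp
    then show ?thesis by blast
  qed
next
  case (add p q)
  then obtain k N k' N' where *: "clears j p k N" "clears j q k' N'" by blast
  interpret z: comm_ring_hom "zero_coeff j" by (rule comm_ring_hom_zero_coeff)
  have "Const (p + q) * Var j ^ (k + k') - (N * Var j ^ k' + N' * Var j ^ k)
      = Var j ^ k' * (Const p * Var j ^ k - N) + Var j ^ k * (Const q * Var j ^ k' - N')"
    by (simp add: Const_add power_add algebra_simps)
  moreover have "zero_coeff j (p + q) * to_fract (Var j) ^ (k + k')
      = (zero_coeff j p * to_fract (Var j) ^ k) * to_fract (Var j) ^ k' +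
        (zero_coeff j q * to_fract (Var j) ^ k') * to_fract (Var j) ^ k"
    by (simp add: z.hom_add power_add algebra_simps)
  ultimately have "clears j (p + q) (k + k') (N * Var j ^ k' + N' * Var j ^ k)"
    using * unfolding clears_def by (auto intro!: in_span_add in_span_mult simp: to_fract_power)
  then show ?case by blast
next
  case (mult p q)
  then obtain k N k' N' where *: "clears j p k N" "clears j q k' N'" by blast
  interpret z: comm_ring_hom "zero_coeff j" by (rule comm_ring_hom_zero_coeff)
  have "Const (p * q) * Var j ^ (k + k') - N * N'
      = (Const p * Var j ^ k) * (Const q * Var j ^ k' - N') + N' * (Const p * Var j ^ k - N)"
    by (simp add: Const_mult power_add algebra_simps)
  moreover have "zero_coeff j (p * q) * to_fract (Var j) ^ (k + k')
      = (zero_coeff j p * to_fract (Var j) ^ k) * (zero_coeff j q * to_fract (Var j) ^ k')"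
    by (simp add: z.hom_mult power_add algebra_simps)
  ultimately have "clears j (p * q) (k + k') (N * N')"
    using * unfolding clears_def by (auto intro!: in_span_add in_span_mult)
  then show ?case by blast
qed

definition inertia :: "coeff_ring \<Rightarrow> bool" where
  "inertia a \<longleftrightarrow> (\<forall>j\<in>{1..m}. \<exists>k. in_span m G (Const a * Var j ^ k))"

lemma in_span_imp_zero_coeff:
  assumes "j \<in> {1..m}" "l \<in> {1..m}" "in_span m G (Const a * Var l ^ k)"
  shows "zero_coeff j a = 0"
proof -
  interpret e: comm_ring_hom "zero_eval j" by (rule comm_ring_hom_zero_eval)
  show ?thesis
    using zero_eval_in_span[OF assms(1,3)] by (simp add: e.hom_mult e.hom_power)
qed

text \<open>One chart decides for all: if \<open>a\<close> vanishes at the generic zero of chart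
  \<open>j\<close>, then \<open>a * x_j ^ k\<close> is in the ideal, hence vanishes at the generic
  zero of every chart \<open>l\<close>, where \<open>x_j\<close> is not 0.\<close>

lemma inertia_iff:
  assumes j: "j \<in> {1..m}"
  shows "inertia a \<longleftrightarrow> zero_coeff j a = 0"
proof
  assume "inertia a"
  then show "zero_coeff j a = 0"
    using in_span_imp_zero_coeff[OF j j] j unfolding inertia_def by blast
next
  have ex: "\<exists>k. in_span m G (Const a * Var l ^ k)" if "zero_coeff l a = 0" "l \<in> {1..m}" for l
  proof -
    obtain k N where "clears l a k N" using clear_denominators[OF \<open>l \<in> {1..m}\<close>] by blast
    with that show ?thesis by (auto simp: clears_def)
  qed
  assume "zero_coeff j a = 0"
  from ex[OF this j] show "inertia a"
    unfolding inertia_def using in_span_imp_zero_coeff j ex by blast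
qed

text \<open>The morphism \<open>h\<close> stands for a zero of the system with some nonzero
  coordinate; its values lie in a domain, so the power of that coordinate can be cancelled.\<close>

lemma inertia_vanish:
  assumes "inertia a" "comm_ring_hom h" "\<And>i. i \<in> {1..m} \<Longrightarrow> h (G i) = 0"
    and "j \<in> {1..m}" "h (Var j) \<noteq> (0 :: 'b::idom)"
  shows "h (Const a) = 0"
proof -
  interpret h: comm_ring_hom h by fact
  obtain k where "in_span m G (Const a * Var j ^ k)"
    using assms(1,4) unfolding inertia_def by blast
  then obtain c where "Const a * Var j ^ k = (\<Sum>i\<in>{1..m}. c i * G i)"
    by (auto simp: in_span_def)
  then have "h (Const a * Var j ^ k) = 0"
    by (simp add: h.hom_sum h.hom_mult assms(3))
  then show ?thesis using assms(5) by (simp add: h.hom_mult h.hom_power)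
qed

lemma inertia_mult_left: "inertia a \<Longrightarrow> inertia (b * a)"
proof -
  assume a: "inertia a"
  have "\<exists>k. in_span m G (Const (b * a) * Var j ^ k)" if j: "j \<in> {1..m}" for j
  proof -
    obtain k where "in_span m G (Const a * Var j ^ k)" using a j unfolding inertia_def by blast
    then have "in_span m G (Const b * (Const a * Var j ^ k))" by (rule in_span_mult)
    then show ?thesis by (auto simp: Const_mult mult.assoc)
  qed
  then show ?thesis by (simp add: inertia_def)
qed

lemma inertia_add: "inertia a \<Longrightarrow> inertia b \<Longrightarrow> inertia (a + b)"
proof -
  have one: "1 \<in> {1..m}" using m_pos by simp
  interpret z: comm_ring_hom "zero_coeff 1" by (rule comm_ring_hom_zero_coeff)
  show "inertia a \<Longrightarrow> inertia b \<Longrightarrow> inertia (a + b)"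
    by (simp add: inertia_iff[OF one] z.hom_add)
qed

lemma inertia_prime: "inertia (a * b) \<Longrightarrow> inertia a \<or> inertia b"
proof -
  have one: "1 \<in> {1..m}" using m_pos by simp
  interpret z: comm_ring_hom "zero_coeff 1" by (rule comm_ring_hom_zero_coeff)
  show "inertia (a * b) \<Longrightarrow> inertia a \<or> inertia b"
    by (simp add: inertia_iff[OF one] z.hom_mult)
qed

lemma not_inertia_1: "\<not> inertia 1"
proof -
  have one: "1 \<in> {1..m}" using m_pos by simp
  interpret z: comm_ring_hom "zero_coeff 1" by (rule comm_ring_hom_zero_coeff)
  show ?thesis by (simp add: inertia_iff[OF one])
qed

text \<open>The morphism that kills all indeterminates outside the universal ring is a retraction onto
  it, so membership in the ideal can be decided in the full polynomial ring.\<close>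

definition retract_coeff :: "coeff_ring \<Rightarrow> coeff_ring" where
  "retract_coeff = mp_eval of_int (\<lambda>z. if z \<in> (SIGMA i:{1..m}. exponents m (d i)) then Var z else 0)"

definition retract :: "(nat, coeff_ring) mpoly \<Rightarrow> (nat, coeff_ring) mpoly" where
  "retract p = map_coeffs retract_coeff (mp_eval Const (\<lambda>x. if x \<in> {1..m} then Var x else 0) p)"

lemma comm_ring_hom_retract_coeff: "comm_ring_hom retract_coeff"
  unfolding retract_coeff_def by (rule comm_ring_hom_mp_eval_of_int)

lemma comm_ring_hom_retract: "comm_ring_hom retract"
  unfolding retract_def
  by (intro comm_ring_hom_compose[OF comm_ring_hom_mp_eval_Const] comm_ring_hom_map_coeffs comm_ring_hom_retract_coeff)

lemma retract_coeff_U: "retract_coeff a \<in> U_ring m d"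
  unfolding retract_coeff_def U_ring_def
proof (rule polys_mp_eval[of a UNIV])
  show "of_int c \<in> polys (SIGMA i:{1..m}. exponents m (d i))" for c
    using polys_Const[of "of_int c"] by (simp only: Const_of_int)
qed (auto intro: polys_Var)

lemma retract_coeff_id: "a \<in> U_ring m d \<Longrightarrow> retract_coeff a = a"
proof -
  assume "a \<in> U_ring m d"
  then have "retract_coeff a = mp_eval of_int Var a"
    unfolding retract_coeff_def U_ring_def by (rule mp_eval_cong) auto
  then show ?thesis by simp
qed

lemma U_ring_iff: "a \<in> U_ring m d \<longleftrightarrow> retract_coeff a = a"
  using retract_coeff_U retract_coeff_id by metis

lemma retract_coeff_0: "retract_coeff 0 = 0"
proof -
  interpret comm_ring_hom retract_coeff by (rule comm_ring_hom_retract_coeff)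
  show ?thesis by simp
qed

lemma Ux_ring_iff: "p \<in> Ux_ring m d \<longleftrightarrow> retract p = p"
proof
  assume *: "p \<in> Ux_ring m d"
  then have "mp_eval Const (\<lambda>x. if x \<in> {1..m} then Var x else 0) p = mp_eval Const Var p"
    by (intro mp_eval_cong[of p "{1..m}"]) (auto simp: Ux_ring_def)
  then have "retract p = map_coeffs retract_coeff p"
    by (simp add: retract_def)
  also have "\<dots> = p"
    using * by (intro poly_mapping_eqI)
      (simp add: lookup_map_coeffs retract_coeff_0 Ux_ring_def retract_coeff_id)
  finally show "retract p = p" .
next
  have "mp_eval Const (\<lambda>x. if x \<in> {1..m} then Var x else 0) p \<in> polys {1..m}"
    by (rule polys_mp_eval[of p UNIV]) (auto intro: polys_Var)
  then have "retract p \<in> Ux_ring m d"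
    unfolding retract_def Ux_ring_def
    by (simp add: polys_map_coeffs retract_coeff_0 lookup_map_coeffs retract_coeff_U)
  then show "retract p = p \<Longrightarrow> p \<in> Ux_ring m d" by simp
qed

lemma retract_Ux: "retract p \<in> Ux_ring m d"
proof -
  have "mp_eval Const (\<lambda>x. if x \<in> {1..m} then Var x else 0) p \<in> polys {1..m}"
    by (rule polys_mp_eval[of p UNIV]) (auto intro: polys_Var)
  then show "retract p \<in> Ux_ring m d"
    unfolding retract_def Ux_ring_def
    by (simp add: polys_map_coeffs retract_coeff_0 lookup_map_coeffs retract_coeff_U)
qed

lemma Ux_ring_mult: "p \<in> Ux_ring m d \<Longrightarrow> q \<in> Ux_ring m d \<Longrightarrow> p * q \<in> Ux_ring m d"
proof -
  interpret comm_ring_hom retract by (rule comm_ring_hom_retract)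
  show "p \<in> Ux_ring m d \<Longrightarrow> q \<in> Ux_ring m d \<Longrightarrow> p * q \<in> Ux_ring m d"
    by (simp add: Ux_ring_iff hom_mult)
qed

lemma Ux_ring_add: "p \<in> Ux_ring m d \<Longrightarrow> q \<in> Ux_ring m d \<Longrightarrow> p + q \<in> Ux_ring m d"
proof -
  interpret comm_ring_hom retract by (rule comm_ring_hom_retract)
  show "p \<in> Ux_ring m d \<Longrightarrow> q \<in> Ux_ring m d \<Longrightarrow> p + q \<in> Ux_ring m d"
    by (simp add: Ux_ring_iff hom_add)
qed

lemma Ux_ring_1: "1 \<in> Ux_ring m d" and Ux_ring_0: "0 \<in> Ux_ring m d"
proof -
  interpret comm_ring_hom retract by (rule comm_ring_hom_retract)
  show "1 \<in> Ux_ring m d" "0 \<in> Ux_ring m d" by (simp_all add: Ux_ring_iff)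
qed

lemma Ux_ring_sum: "(\<And>x. x \<in> A \<Longrightarrow> f x \<in> Ux_ring m d) \<Longrightarrow> sum f A \<in> Ux_ring m d"
  by (induction A rule: infinite_finite_induct) (auto intro: Ux_ring_add Ux_ring_0)

lemma Ux_ring_Var: "x \<in> {1..m} \<Longrightarrow> Var x \<in> Ux_ring m d"
  by (simp add: Ux_ring_iff retract_def comm_ring_hom.mp_eval_Var[OF comm_ring_hom_Const] comm_ring_hom_retract_coeff)

lemma Ux_ring_Const: "a \<in> U_ring m d \<Longrightarrow> Const a \<in> Ux_ring m d"
  by (simp add: Ux_ring_iff retract_def comm_ring_hom.mp_eval_Const[OF comm_ring_hom_Const] comm_ring_hom_retract_coeff
     retract_coeff_id)

lemma Ux_ring_G: "i \<in> {1..m} \<Longrightarrow> G i \<in> Ux_ring m d"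
  by (auto simp: Ux_ring_def generic_poly_polys lookup_generic_poly U_ring_def intro: polys_Var)

lemma gen_ideal_G_iff:
  "p \<in> gen_ideal (Ux_ring m d) (G ` {1..m}) \<longleftrightarrow> p \<in> Ux_ring m d \<and> in_span m G p"
proof
  assume "p \<in> gen_ideal (Ux_ring m d) (G ` {1..m})"
  then obtain H c where H: "finite H" "H \<subseteq> G ` {1..m}" "\<forall>g\<in>H. c g \<in> Ux_ring m d" "p = (\<Sum>g\<in>H. c g * g)"
    by (auto simp: gen_ideal_def)
  then show "p \<in> Ux_ring m d \<and> in_span m G p"
    by (auto intro!: Ux_ring_sum in_span_sum Ux_ring_mult in_span_mult Ux_ring_G in_span_generator)
next
  interpret r: comm_ring_hom retract by (rule comm_ring_hom_retract)
  assume *: "p \<in> Ux_ring m d \<and> in_span m G p"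
  then obtain c where c: "p = (\<Sum>i\<in>{1..m}. c i * G i)" by (auto simp: in_span_def)
  have "p = retract p" using * by (simp add: Ux_ring_iff)
  also have "\<dots> = (\<Sum>i\<in>{1..m}. retract (c i) * G i)"
    unfolding c r.hom_sum r.hom_mult
    by (intro sum.cong refl arg_cong2[where f = "(*)"]) (use Ux_ring_G Ux_ring_iff in blast)
  \<comment> \<open>\<open>gen_ideal\<close> sums over a set of generators, so the coefficients are
    regrouped by the value of \<open>G i\<close>.\<close>
  also have "\<dots> = (\<Sum>g\<in>G ` {1..m}. \<Sum>i | i \<in> {1..m} \<and> G i = g. retract (c i) * G i)"
    by (rule sum.image_gen) simp
  also have "\<dots> = (\<Sum>g\<in>G ` {1..m}. (\<Sum>i | i \<in> {1..m} \<and> G i = g. retract (c i)) * g)"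
    by (intro sum.cong refl) (simp add: sum_distrib_right)
  finally show "p \<in> gen_ideal (Ux_ring m d) (G ` {1..m})"
    unfolding gen_ideal_def
    by (intro CollectI exI[of _ "G ` {1..m}"] exI[of _ "\<lambda>g. \<Sum>i | i \<in> {1..m} \<and> G i = g. retract (c i)"])
       (auto intro!: Ux_ring_sum retract_Ux)
qed

lemma keys_mult_mdeg_ge:
  assumes "\<And>t. t \<in> Poly_Mapping.keys p \<Longrightarrow> k \<le> mdeg t" "\<And>t. t \<in> Poly_Mapping.keys q \<Longrightarrow> l \<le> mdeg t"
    and "t \<in> Poly_Mapping.keys (p * q)"
  shows "k + l \<le> mdeg t"
proof -
  obtain a b where "t = a + b" "a \<in> Poly_Mapping.keys p" "b \<in> Poly_Mapping.keys q"
    using keys_mult[of p q] assms(3) by auto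
  then show ?thesis using assms(1)[of a] assms(2)[of b] by (simp add: mdeg_add)
qed

lemma keys_sum_subset: "t \<in> Poly_Mapping.keys (sum f A) \<Longrightarrow> \<exists>x\<in>A. t \<in> Poly_Mapping.keys (f x)"
  by (auto simp: in_keys_iff lookup_sum elim: sum.not_neutral_contains_not_neutral)

abbreviation irrelevant where "irrelevant \<equiv> gen_ideal (Ux_ring m d) (Var ` {1..m})"

lemma irrelevant_Ux: "p \<in> irrelevant \<Longrightarrow> p \<in> Ux_ring m d"
  by (auto simp: gen_ideal_def intro!: Ux_ring_sum Ux_ring_mult Ux_ring_Var)

text \<open>The lower bound on the degrees of monomials is all that \<open>inertia_deg0_iff\<close>
  needs to know about this power.\<close>

lemma ideal_power_irrelevant:
  assumes "q \<in> ideal_power (Ux_ring m d) irrelevant k"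
  shows "q \<in> Ux_ring m d \<and> (\<forall>t\<in>Poly_Mapping.keys q. k \<le> mdeg t)"
  using assms
proof (induction k arbitrary: q)
  case 0
  then show ?case by simp
next
  case (Suc k)
  have irr: "1 \<le> mdeg t" if p: "p \<in> irrelevant" "t \<in> Poly_Mapping.keys p" for p t
  proof -
    obtain H c where H: "H \<subseteq> Var ` {1..m}" "p = (\<Sum>g\<in>H. c g * g)"
      using p(1) unfolding gen_ideal_def by blast
    then obtain g where "g \<in> H" "t \<in> Poly_Mapping.keys (c g * g)"
      using keys_sum_subset[of t "\<lambda>g. c g * g" H] p(2) by blast
    then obtain x where "t \<in> Poly_Mapping.keys (c g * Var x)" using H(1) by blast
    then have "0 + 1 \<le> mdeg t"
      by (rule keys_mult_mdeg_ge[rotated -1]) (auto simp: Var_def)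
    then show ?thesis by simp
  qed
  obtain H c where H: "finite H" "H \<subseteq> {a * b | a b. a \<in> irrelevant \<and> b \<in> ideal_power (Ux_ring m d) irrelevant k}"
    "\<forall>g\<in>H. c g \<in> Ux_ring m d" "q = (\<Sum>g\<in>H. c g * g)"
    using Suc.prems unfolding ideal_power.simps gen_ideal_def[of _ "{a * b |a b. _ a b}"] by blast
  have "g \<in> Ux_ring m d \<and> (\<forall>t\<in>Poly_Mapping.keys g. Suc k \<le> mdeg t)" if gH: "g \<in> H" for g
  proof -
    obtain a b where g: "g = a * b" "a \<in> irrelevant" "b \<in> ideal_power (Ux_ring m d) irrelevant k"
      using gH H by blast
    have "1 + k \<le> mdeg t" if "t \<in> Poly_Mapping.keys (a * b)" for t
      using Suc.IH[OF g(3)] irr[OF g(2)] that by (intro keys_mult_mdeg_ge[of a 1 b k t]) auto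
    then have "\<forall>t\<in>Poly_Mapping.keys g. Suc k \<le> mdeg t" unfolding g(1) by fastforce
    then show ?thesis using g Suc.IH[OF g(3)] by (auto intro: Ux_ring_mult irrelevant_Ux)
  qed note g = this
  have "Suc k \<le> mdeg t" if tq: "t \<in> Poly_Mapping.keys q" for t
  proof -
    obtain x where "x \<in> H" "t \<in> Poly_Mapping.keys (c x * x)"
      using tq keys_sum_subset[of t "\<lambda>g. c g * g" H] unfolding H(4) by blast
    then have "0 + Suc k \<le> mdeg t"
      using g by (intro keys_mult_mdeg_ge[of "c x" 0 x "Suc k" t]) auto
    then show ?thesis by simp
  qed
  then show ?case using g H by (auto intro!: Ux_ring_sum Ux_ring_mult)
qed

lemma Var_power_irrelevant:
  assumes "j \<in> {1..m}"
  shows "Var j ^ k \<in> ideal_power (Ux_ring m d) irrelevant k"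
proof (induction k)
  case 0
  then show ?case by (simp add: Ux_ring_1)
next
  case (Suc k)
  have "Var j \<in> irrelevant"
    unfolding gen_ideal_def
    by (intro CollectI exI[of _ "{Var j}"] exI[of _ "\<lambda>_. 1"]) (use assms in \<open>auto intro: Ux_ring_1\<close>)
  then show ?case
    unfolding ideal_power.simps gen_ideal_def[of _ "{a * b |a b. _ a b}"]
    by (intro CollectI exI[of _ "{Var j * Var j ^ k}"] exI[of _ "\<lambda>_. 1"]) (use Suc in \<open>auto intro: Ux_ring_1\<close>)
qed

theorem inertia_deg0_iff: "a \<in> inertia_deg0 m d \<longleftrightarrow> a \<in> U_ring m d \<and> inertia a"
proof
  assume "a \<in> inertia_deg0 m d"
  then obtain k where "a \<in> U_ring m d" and
    k: "\<forall>q\<in>ideal_power (Ux_ring m d) irrelevant k. Const a * q \<in> gen_ideal (Ux_ring m d) (G ` {1..m})"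
    by (auto simp: inertia_deg0_def saturation_def)
  then show "a \<in> U_ring m d \<and> inertia a"
    using Var_power_irrelevant[of _ k] unfolding inertia_def gen_ideal_G_iff by blast
next
  assume *: "a \<in> U_ring m d \<and> inertia a"
  then obtain k where k: "\<forall>j\<in>{1..m}. in_span m G (Const a * Var j ^ k j)"
    by (auto simp: inertia_def bchoice_iff)
  \<comment> \<open>By the pigeonhole principle a monomial of degree at least \<open>N\<close> is
    divisible by some \<open>x_j ^ k j\<close>.\<close>
  define N where "N = (\<Sum>j\<in>{1..m}. k j) + 1"
  have "Const a * q \<in> gen_ideal (Ux_ring m d) (G ` {1..m})"
    if q: "q \<in> ideal_power (Ux_ring m d) irrelevant N" for q
  proof -
    have q: "q \<in> Ux_ring m d" "\<forall>t\<in>Poly_Mapping.keys q. N \<le> mdeg t"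
      using ideal_power_irrelevant[OF q] by auto
    have "in_span m G (Const a * Poly_Mapping.single t c)" if t: "t \<in> Poly_Mapping.keys q" for t c
    proof -
      have keys: "Poly_Mapping.keys t \<subseteq> {1..m}" using q t by (auto simp: Ux_ring_def polys_def)
      have "\<exists>j\<in>{1..m}. k j \<le> Poly_Mapping.lookup t j"
      proof (rule ccontr)
        assume "\<not> (\<exists>j\<in>{1..m}. k j \<le> Poly_Mapping.lookup t j)"
        then have "(\<Sum>j\<in>{1..m}. Poly_Mapping.lookup t j) \<le> (\<Sum>j\<in>{1..m}. k j)"
          by (intro sum_mono) (auto simp: not_le intro: less_imp_le)
        then show False using q(2) t mdeg_superset[OF _ keys] by (auto simp: N_def)
      qed
      then obtain j where j: "j \<in> {1..m}" "k j \<le> Poly_Mapping.lookup t j" by blast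
      define t' where "t' = t - Poly_Mapping.single j (k j)"
      have "t = Poly_Mapping.single j (k j) + t'"
        by (rule poly_mapping_eqI) (use j in \<open>auto simp: t'_def lookup_add lookup_minus lookup_single when_def\<close>)
      then have "Const a * Poly_Mapping.single t c = Const c * mon_eval Var t' * (Const a * Var j ^ k j)"
        by (simp add: single_mon_eval mon_eval_add)
      moreover have "in_span m G (Const a * Var j ^ k j)" using k j by blast
      ultimately show ?thesis by (simp only: in_span_mult)
    qed
    then have "in_span m G (Const a * (\<Sum>t\<in>Poly_Mapping.keys q. Poly_Mapping.single t (Poly_Mapping.lookup q t)))"
      unfolding sum_distrib_left by (intro in_span_sum) auto
    then have "in_span m G (Const a * q)" by (simp flip: pm_sum_single)
    then show ?thesis using q * by (auto simp: gen_ideal_G_iff intro: Ux_ring_mult Ux_ring_Const)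
  qed
  then show "a \<in> inertia_deg0 m d"
    using * by (auto simp: inertia_deg0_def saturation_def Ux_ring_Const)
qed

end

section \<open>Leading forms, and independence of all coefficients but one\<close>

lemma coeff_mult_le:
  assumes "Polynomial.degree p \<le> a" "Polynomial.degree q \<le> b"
  shows "Polynomial.coeff (p * q) (a + b) = Polynomial.coeff p a * Polynomial.coeff q b"
proof -
  have "Polynomial.coeff (p * q) (a + b) =
      (\<Sum>i\<le>a + b. Polynomial.coeff p i * Polynomial.coeff q (a + b - i))"
    by (rule coeff_mult)
  also have "\<dots> = (\<Sum>i\<in>{a}. Polynomial.coeff p i * Polynomial.coeff q (a + b - i))"
  proof (rule sum.mono_neutral_right)
    show "\<forall>i\<in>{..a + b} - {a}. Polynomial.coeff p i * Polynomial.coeff q (a + b - i) = 0"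
    proof
      fix i assume "i \<in> {..a + b} - {a}"
      then consider "i > a" | "a + b - i > b" by fastforce
      then show "Polynomial.coeff p i * Polynomial.coeff q (a + b - i) = 0"
        using assms by cases (auto simp: coeff_eq_0)
    qed
  qed auto
  finally show ?thesis by simp
qed

text \<open>The weights only bound the degrees, since the coefficients of degree \<open>w x\<close>
  may vanish.\<close>

lemma mon_eval_poly:
  assumes "\<And>x. x \<in> Poly_Mapping.keys t \<Longrightarrow> Polynomial.degree (f x) \<le> w x"
  shows "Polynomial.degree (mon_eval f t) \<le> wt w t \<and>
    Polynomial.coeff (mon_eval f t) (wt w t) = mon_eval (\<lambda>x. Polynomial.coeff (f x) (w x)) t"
proof -
  have pow: "Polynomial.degree (f x ^ k) \<le> w x * k \<and>
      Polynomial.coeff (f x ^ k) (w x * k) = Polynomial.coeff (f x) (w x) ^ k" if "x \<in> Poly_Mapping.keys t" for x k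
  proof (induction k)
    case (Suc k)
    then show ?case
      using coeff_mult_le[of "f x" "w x" "f x ^ k" "w x * k"] assms[OF that]
        degree_mult_le[of "f x" "f x ^ k"] by auto
  qed simp
  have "Polynomial.degree (\<Prod>x\<in>X. f x ^ Poly_Mapping.lookup t x) \<le> (\<Sum>x\<in>X. w x * Poly_Mapping.lookup t x) \<and>
      Polynomial.coeff (\<Prod>x\<in>X. f x ^ Poly_Mapping.lookup t x) (\<Sum>x\<in>X. w x * Poly_Mapping.lookup t x)
      = (\<Prod>x\<in>X. Polynomial.coeff (f x) (w x) ^ Poly_Mapping.lookup t x)"
    if "finite X" "X \<subseteq> Poly_Mapping.keys t" for X
    using that
  proof induction
    case (insert x X)
    have px: "Polynomial.degree (f x ^ Poly_Mapping.lookup t x) \<le> w x * Poly_Mapping.lookup t x"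
      using pow[of x] insert by auto
    show ?case
      using px insert coeff_mult_le[of "f x ^ Poly_Mapping.lookup t x" "w x * Poly_Mapping.lookup t x"
           "\<Prod>x\<in>X. f x ^ Poly_Mapping.lookup t x" "\<Sum>x\<in>X. w x * Poly_Mapping.lookup t x"] pow[of x]
        order.trans[OF degree_mult_le add_mono, of "f x ^ Poly_Mapping.lookup t x" _ "\<Prod>x\<in>X. f x ^ Poly_Mapping.lookup t x"] by auto
  qed simp
  from this[of "Poly_Mapping.keys t"] show ?thesis
    by (simp add: mon_eval_def wt_def)
qed

text \<open>Compare coefficients in the degree \<open>wdeg w p\<close>: only the monomials of top
  weight reach it, each with the product of the top coefficients.\<close>

lemma leading_form_eq_0:
  fixes f :: "'v \<Rightarrow> 'a::comm_ring_1 poly"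
  assumes "p \<in> polys V" "\<And>x. x \<in> V \<Longrightarrow> Polynomial.degree (f x) \<le> w x"
    and "mp_eval of_int f p = 0"
  shows "(\<Sum>t | t \<in> Poly_Mapping.keys p \<and> wt w t = wdeg w p.
     of_int (Poly_Mapping.lookup p t) * mon_eval (\<lambda>x. Polynomial.coeff (f x) (w x)) t) = 0"
proof -
  have deg: "Polynomial.degree (mon_eval f t) \<le> wt w t"
    and lc: "Polynomial.coeff (mon_eval f t) (wt w t) = mon_eval (\<lambda>x. Polynomial.coeff (f x) (w x)) t"
    if "t \<in> Poly_Mapping.keys p" for t
    using mon_eval_poly[of t f w] that assms(1,2) by (auto simp: polys_def)
  have "Polynomial.coeff (mon_eval f t) (wdeg w p) =
      (if wt w t = wdeg w p then mon_eval (\<lambda>x. Polynomial.coeff (f x) (w x)) t else 0)"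
    if "t \<in> Poly_Mapping.keys p" for t
    using deg[OF that] lc[OF that] wt_le_wdeg[OF that, of w] by (auto intro: coeff_eq_0)
  moreover have "Polynomial.coeff (of_int c * q) n = of_int c * Polynomial.coeff q n" for c n and q :: "'a poly"
    by (simp add: of_int_poly)
  ultimately have "Polynomial.coeff (mp_eval of_int f p) (wdeg w p) =
    (\<Sum>t\<in>Poly_Mapping.keys p. of_int (Poly_Mapping.lookup p t) *
       (if wt w t = wdeg w p then mon_eval (\<lambda>x. Polynomial.coeff (f x) (w x)) t else 0))"
    by (simp add: mp_eval_keys coeff_sum)
  also have "\<dots> = (\<Sum>t | t \<in> Poly_Mapping.keys p \<and> wt w t = wdeg w p.
     of_int (Poly_Mapping.lookup p t) * mon_eval (\<lambda>x. Polynomial.coeff (f x) (w x)) t)"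
    by (intro sum.mono_neutral_cong_right) auto
  finally show ?thesis using assms(3) by simp
qed

definition mon_subst :: "('v \<Rightarrow> ('w \<Rightarrow>\<^sub>0 nat)) \<Rightarrow> ('v \<Rightarrow>\<^sub>0 nat) \<Rightarrow> ('w \<Rightarrow>\<^sub>0 nat)" where
  "mon_subst \<mu> t = (\<Sum>x\<in>Poly_Mapping.keys t. \<Sum>k<Poly_Mapping.lookup t x. \<mu> x)"

lemma lookup_mon_subst: "Poly_Mapping.lookup (mon_subst \<mu> t) y =
    (\<Sum>x\<in>Poly_Mapping.keys t. Poly_Mapping.lookup t x * Poly_Mapping.lookup (\<mu> x) y)"
  by (simp add: mon_subst_def lookup_sum)

lemma mon_eval_single_subst:
  "mon_eval (\<lambda>x. Poly_Mapping.single (\<mu> x) (\<epsilon> x)) t = Poly_Mapping.single (mon_subst \<mu> t) (mon_eval \<epsilon> t)"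
proof -
  have pow: "Poly_Mapping.single a b ^ k = Poly_Mapping.single (\<Sum>i<k. a) (b ^ k)" for a b k
    by (induction k) (simp_all add: mult_single add.commute)
  have "(\<Prod>x\<in>X. Poly_Mapping.single (g x) (h x)) = Poly_Mapping.single (\<Sum>x\<in>X. g x) (\<Prod>x\<in>X. h x)" for X g h
    by (induction X rule: infinite_finite_induct) (simp_all add: mult_single)
  then show ?thesis
    by (simp add: mon_eval_def mon_subst_def pow)
qed

context degree_vector
begin

text \<open>The degree, in the scaling indeterminate of the univariate polynomials, of the images
  under \<open>inj_image\<close>. Scaled are the coefficients of \<open>x_i ^ d i\<close> in the
  equations \<open>i\<close> other than \<open>j\<close>, and through them the coefficients for
  which these equations are solved.\<close>

definition inj_weight :: "nat \<Rightarrow> nat \<times> (nat \<Rightarrow>\<^sub>0 nat) \<Rightarrow> nat" where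
  "inj_weight j z = (if fst z \<in> {1..m} - {j} \<and> (snd z = Poly_Mapping.single (fst z) (d (fst z)) \<or> snd z = Poly_Mapping.single j (d (fst z))) then 1 else 0)"

definition inj_base :: "nat \<Rightarrow> nat \<times> (nat \<Rightarrow>\<^sub>0 nat) \<Rightarrow> coeff_ring poly" where
  "inj_base j z = (if fst z \<in> {1..m} - {j} \<and> snd z = Poly_Mapping.single (fst z) (d (fst z)) then monom (Var z) 1 else [:Var z:])"

text \<open>The point at which all equations are made to vanish. Its coordinates reuse the
  indeterminates \<open>top_var j x\<close>, which are free because \<open>inj_image\<close>
  replaces these coefficients.\<close>

definition inj_point :: "nat \<Rightarrow> nat \<Rightarrow> coeff_ring poly" where
  "inj_point j x = (if x = j then 1 else [:Var (top_var j x):])"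

text \<open>The \<open>i\<close>-th equation is solved at \<open>inj_point j\<close> for the
  coefficient of \<open>x_j ^ d i\<close>; this is possible without denominators since the
  \<open>j\<close>-th coordinate is 1.\<close>

definition inj_image :: "nat \<Rightarrow> nat \<times> (nat \<Rightarrow>\<^sub>0 nat) \<Rightarrow> coeff_ring poly" where
  "inj_image j z = (if fst z \<in> {1..m} \<and> snd z = Poly_Mapping.single j (d (fst z))
     then - (\<Sum>\<beta>\<in>exponents m (d (fst z)) - {Poly_Mapping.single j (d (fst z))}.
        inj_base j (fst z, \<beta>) * mon_eval (inj_point j) \<beta>)
     else inj_base j z)"

lemma single_eq_single_iff: "Poly_Mapping.single a (k::nat) = Poly_Mapping.single b k \<longleftrightarrow> a = b \<or> k = 0"
  by (metis keys_single keys_zero single_zero singleton_inject)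

lemma mon_eval_inj_point: "Polynomial.degree (mon_eval (inj_point j) \<beta>) = 0"
  using mon_eval_poly[of \<beta> "inj_point j" "\<lambda>_. 0"] by (auto simp: inj_point_def wt_def)

text \<open>In the sum that replaces a solved coefficient, only the term of \<open>x_i ^ d i\<close>
  involves the scaling indeterminate, so the top coefficient is a single monomial.\<close>

lemma inj_image_lead:
  assumes "j \<in> {1..m}" "z \<noteq> top_var j j"
  shows "Polynomial.degree (inj_image j z) \<le> inj_weight j z"
    and "Polynomial.coeff (inj_image j z) (inj_weight j z) =
      (if fst z \<in> {1..m} - {j} \<and> snd z = Poly_Mapping.single j (d (fst z))
       then - (Var (top_var (fst z) (fst z)) * Var z ^ d (fst z)) else Var z)"
proof -
  obtain i \<alpha> where z: "z = (i, \<alpha>)" by (cases z)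
  show "Polynomial.degree (inj_image j z) \<le> inj_weight j z"
  proof (cases "i \<in> {1..m} \<and> \<alpha> = Poly_Mapping.single j (d i)")
    case True
    then have ij: "i \<noteq> j" using assms by (auto simp: z)
    have "Polynomial.degree (inj_base j (i, \<beta>)) \<le> 1" for \<beta>
      by (simp add: inj_base_def degree_monom_le)
    then have deg: "Polynomial.degree (inj_base j (i, \<beta>) * mon_eval (inj_point j) \<beta>) \<le> 1" for \<beta>
      by (rule order.trans[OF degree_mult_le[of "inj_base j (i, \<beta>)" "mon_eval (inj_point j) \<beta>",
        unfolded mon_eval_inj_point add_0_right]])
    have "inj_image j z = - (\<Sum>\<beta>\<in>exponents m (d i) - {Poly_Mapping.single j (d i)}.
        inj_base j (i, \<beta>) * mon_eval (inj_point j) \<beta>)"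
      using True by (simp add: inj_image_def z)
    then have "Polynomial.degree (inj_image j z) \<le> 1"
      by (simp only: degree_minus, intro degree_sum_le deg finite_Diff finite_exponents)
    then show ?thesis using True ij by (simp add: inj_weight_def z)
  next
    case False
    have "inj_image j z = inj_base j z"
      unfolding inj_image_def z fst_conv snd_conv by (rule if_not_P[OF False])
    moreover have "Polynomial.degree (inj_base j z) \<le> inj_weight j z"
      by (simp add: inj_base_def inj_weight_def degree_monom_le)
    ultimately show ?thesis by simp
  qed
  show "Polynomial.coeff (inj_image j z) (inj_weight j z) =
      (if fst z \<in> {1..m} - {j} \<and> snd z = Poly_Mapping.single j (d (fst z))
       then - (Var (top_var (fst z) (fst z)) * Var z ^ d (fst z)) else Var z)"
  proof (cases "i \<in> {1..m} \<and> \<alpha> = Poly_Mapping.single j (d i)")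
    case True
    then have ij: "i \<noteq> j" using assms by (auto simp: z)
    have di: "d i \<noteq> 0" using d_pos[of i] True by auto
    have co: "Polynomial.coeff (inj_base j (i, \<beta>) * mon_eval (inj_point j) \<beta>) 1 =
      (if \<beta> = Poly_Mapping.single i (d i) then Var (top_var i i) * Var z ^ d i else 0)"
      if "\<beta> \<noteq> Poly_Mapping.single j (d i)" for \<beta>
    proof (cases "\<beta> = Poly_Mapping.single i (d i)")
      case eq: True
      then have "inj_base j (i, \<beta>) * mon_eval (inj_point j) \<beta> = monom (Var (top_var i i)) 1 * [:Var (top_var j i) ^ d i:]"
        using True ij by (simp add: inj_base_def inj_point_def poly_const_pow)
      then show ?thesis using eq True by (simp add: coeff_monom_mult z)
    next
      case False
      have "Polynomial.degree (inj_base j (i, \<beta>) * mon_eval (inj_point j) \<beta>) \<le> 0"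
        using degree_mult_le[of "inj_base j (i, \<beta>)" "mon_eval (inj_point j) \<beta>"] False
        by (auto simp: inj_base_def mon_eval_inj_point)
      then show ?thesis using False by (simp add: coeff_eq_0)
    qed
    have "Poly_Mapping.single i (d i) \<in> exponents m (d i) - {Poly_Mapping.single j (d i)}"
      using True ij di by (simp add: single_eq_single_iff)
    then have "Polynomial.coeff (inj_image j z) 1 = - (Var (top_var i i) * Var z ^ d i)"
      using True by (simp add: inj_image_def coeff_sum co z)
    then show ?thesis using True ij by (simp add: inj_weight_def z)
  next
    case False
    have "inj_image j z = inj_base j z"
      unfolding inj_image_def z fst_conv snd_conv by (rule if_not_P[OF False])
    moreover have "inj_weight j z = (if i \<in> {1..m} - {j} \<and> \<alpha> = Poly_Mapping.single i (d i) then 1 else 0)"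
      using False by (auto simp: inj_weight_def z)
    moreover have "\<not> (fst z \<in> {1..m} - {j} \<and> snd z = Poly_Mapping.single j (d (fst z)))"
      using False by (auto simp: z)
    ultimately show ?thesis
      unfolding inj_base_def by (auto simp: z)
  qed
qed

text \<open>Any \<open>m - 1\<close> of the generic polynomials together with all coefficients of the remaining one,
  except the coefficient of \<open>x_j ^ d j\<close>, are unconstrained by the existence of a zero.\<close>

theorem inertia_free_eq_0:
  assumes j: "j \<in> {1..m}" and "inertia a" "a \<in> polys (- {top_var j j})"
  shows "a = 0"
proof (rule ccontr)
  assume "a \<noteq> 0"
  define \<chi> :: "coeff_ring \<Rightarrow> coeff_ring poly" where "\<chi> = mp_eval of_int (inj_image j)"
  have \<chi>: "comm_ring_hom \<chi>" unfolding \<chi>_def by (rule comm_ring_hom_mp_eval_of_int)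
  have \<chi>_Var: "\<chi> (Var z) = inj_image j z" for z
    unfolding \<chi>_def by (rule comm_ring_hom.mp_eval_Var[OF comm_ring_hom_of_int])
  define h where "h = mp_eval \<chi> (inj_point j)"
  have h: "comm_ring_hom h" unfolding h_def by (rule comm_ring_hom.comm_ring_hom_mp_eval[OF \<chi>])
  have h_simps: "h (Const c) = \<chi> c" "h (Var x) = inj_point j x" for c x
    unfolding h_def by (rule comm_ring_hom.mp_eval_Const[OF \<chi>] comm_ring_hom.mp_eval_Var[OF \<chi>])+
  interpret h: comm_ring_hom h by (rule h)
  \<comment> \<open>Under \<open>h\<close> the generic system acquires the zero
    \<open>inj_point j\<close>.\<close>
  have "h (Const a) = 0"
  proof (rule inertia_vanish[OF assms(2) h])
    show "h (Var j) \<noteq> 0" by (simp add: h_simps inj_point_def)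
    fix i assume i: "i \<in> {1..m}"
    have "h (tail j i) = (\<Sum>\<beta>\<in>exponents m (d i) - {Poly_Mapping.single j (d i)}.
        inj_base j (i, \<beta>) * mon_eval (inj_point j) \<beta>)"
      unfolding tail_def h.hom_sum
      by (intro sum.cong refl)
        (auto simp: single_mon_eval h.hom_mult hom_mon_eval[OF h] h_simps \<chi>_Var inj_image_def)
    also have "\<dots> = - h (Const (Var (top_var j i)) * Var j ^ d i)"
      using i by (simp add: h.hom_mult h.hom_power h_simps \<chi>_Var inj_image_def inj_point_def)
    finally show "h (G i) = 0"
      unfolding G_eq_tail[OF j] h.hom_add by simp
  qed (use j in auto)
  then have 0: "mp_eval of_int (inj_image j) a = 0"
    by (simp add: h_simps \<chi>_def)
  \<comment> \<open>Exponent \<open>\<mu> z\<close> and sign \<open>\<epsilon> z\<close> of the top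
    coefficient of the image of \<open>z\<close>.\<close>
  define \<mu> where "\<mu> z = (if fst z \<in> {1..m} - {j} \<and> snd z = Poly_Mapping.single j (d (fst z))
    then Poly_Mapping.single (top_var (fst z) (fst z)) 1 + Poly_Mapping.single z (d (fst z))
    else Poly_Mapping.single z 1)" for z
  define \<epsilon> :: "nat \<times> (nat \<Rightarrow>\<^sub>0 nat) \<Rightarrow> int"
    where "\<epsilon> z = (if fst z \<in> {1..m} - {j} \<and> snd z = Poly_Mapping.single j (d (fst z)) then - 1 else 1)" for z
  have lead: "Polynomial.coeff (inj_image j z) (inj_weight j z) = Poly_Mapping.single (\<mu> z) (\<epsilon> z)"
    if "z \<noteq> top_var j j" for z
  proof -
    have mono: "- (Var a * Var b ^ k) = Poly_Mapping.single (Poly_Mapping.single a 1 + Poly_Mapping.single b k) (- 1 :: int)"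
      for a b :: "nat \<times> (nat \<Rightarrow>\<^sub>0 nat)" and k
      by (simp add: Var_power Var_def[of a] mult_single single_uminus)
    show ?thesis
      unfolding inj_image_lead(2)[OF j that] mono \<mu>_def \<epsilon>_def
      by (cases "fst z \<in> {1..m} - {j} \<and> snd z = Poly_Mapping.single j (d (fst z))")
        (simp_all only: if_True if_False simp_thms Var_def)
  qed
  \<comment> \<open>The exponent at \<open>top_var j i\<close> is multiplied by \<open>d i\<close>,
    the one at \<open>top_var i i\<close> grows by the exponent at \<open>top_var j i\<close>, and
    all others persist. So a monomial can be recovered from its image.\<close>
  have inj: "s = t" if eq: "mon_subst \<mu> s = mon_subst \<mu> t" for s t
  proof (rule poly_mapping_eqI)
    have base: "Poly_Mapping.lookup (mon_subst \<mu> t) z = (if fst z \<in> {1..m} - {j} \<and> snd z = Poly_Mapping.single j (d (fst z))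
        then d (fst z) * Poly_Mapping.lookup t z
        else if fst z \<in> {1..m} - {j} \<and> snd z = Poly_Mapping.single (fst z) (d (fst z))
        then Poly_Mapping.lookup t z + Poly_Mapping.lookup t (top_var j (fst z))
        else Poly_Mapping.lookup t z)" for z t
    proof -
      let ?i = "fst z"
      have d0: "d ?i \<noteq> 0" if "?i \<in> {1..m} - {j}" using d_pos[of ?i] that by auto
      have *: "Poly_Mapping.lookup (\<mu> x) z = (if fst z \<in> {1..m} - {j} \<and> snd z = Poly_Mapping.single j (d (fst z))
        then (if x = z then d ?i else 0)
        else if fst z \<in> {1..m} - {j} \<and> snd z = Poly_Mapping.single (fst z) (d (fst z))
        then (if x = z then 1 else 0) + (if x = top_var j ?i then 1 else 0)
        else (if x = z then 1 else 0))" for x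
        using d0 by (cases x, cases z) (auto simp: \<mu>_def lookup_add lookup_single when_def single_eq_single_iff)
      have sel: "(\<Sum>x\<in>Poly_Mapping.keys t. Poly_Mapping.lookup t x * (if x = y then c else 0))
         = c * Poly_Mapping.lookup t y" for y c
        by (simp add: if_distrib[of "\<lambda>c. _ * c"] in_keys_iff cong: if_cong)
      show ?thesis unfolding lookup_mon_subst *
        by (cases "fst z \<in> {1..m} - {j} \<and> snd z = Poly_Mapping.single j (d (fst z))";
            cases "fst z \<in> {1..m} - {j} \<and> snd z = Poly_Mapping.single (fst z) (d (fst z))")
          (simp_all only: if_True if_False simp_thms sel distrib_left sum.distrib mult_1)
    qed
    fix z
    have tv: "Poly_Mapping.lookup s (top_var j i) = Poly_Mapping.lookup t (top_var j i)" if "i \<in> {1..m} - {j}" for i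
      using arg_cong[OF eq, of "\<lambda>u. Poly_Mapping.lookup u (top_var j i)"] that d_pos[of i] by (simp add: base)
    show "Poly_Mapping.lookup s z = Poly_Mapping.lookup t z"
    proof (cases "fst z \<in> {1..m} - {j} \<and> snd z = Poly_Mapping.single j (d (fst z))")
      case True
      then have "z = top_var j (fst z)" by (simp add: prod_eq_iff)
      then show ?thesis using tv[of "fst z"] True by metis
    next
      case False
      then show ?thesis
        using arg_cong[OF eq, of "\<lambda>u. Poly_Mapping.lookup u z"] tv[of "fst z"]
        unfolding base if_not_P[OF False] by (auto split: if_splits)
    qed
  qed
  let ?K = "{t \<in> Poly_Mapping.keys a. wt (inj_weight j) t = wdeg (inj_weight j) a}"
  have aV: "a \<in> polys (- {top_var j j})" by fact
  have "(\<Sum>t\<in>?K. of_int (Poly_Mapping.lookup a t) *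
      mon_eval (\<lambda>x. Polynomial.coeff (inj_image j x) (inj_weight j x)) t) = 0"
    by (rule leading_form_eq_0[OF aV _ 0]) (use inj_image_lead(1)[OF j] in auto)
  moreover have "mon_eval (\<lambda>x. Polynomial.coeff (inj_image j x) (inj_weight j x)) t =
      Poly_Mapping.single (mon_subst \<mu> t) (mon_eval \<epsilon> t)" if t: "t \<in> ?K" for t
  proof -
    have "mon_eval (\<lambda>x. Polynomial.coeff (inj_image j x) (inj_weight j x)) t = mon_eval (\<lambda>x. Poly_Mapping.single (\<mu> x) (\<epsilon> x)) t"
      unfolding mon_eval_def
    proof (intro prod.cong refl)
      fix x assume "x \<in> Poly_Mapping.keys t"
      then have "x \<noteq> top_var j j" using aV t unfolding polys_def by blast
      from lead[OF this] show "Polynomial.coeff (inj_image j x) (inj_weight j x) ^ Poly_Mapping.lookup t x =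
          Poly_Mapping.single (\<mu> x) (\<epsilon> x) ^ Poly_Mapping.lookup t x"
        by (rule arg_cong)
    qed
    then show ?thesis by (simp only: mon_eval_single_subst)
  qed
  moreover have "of_int c * Poly_Mapping.single u e = Poly_Mapping.single u (c * e)"
    for c e :: int and u :: "nat \<times> (nat \<Rightarrow>\<^sub>0 nat) \<Rightarrow>\<^sub>0 nat"
    by (simp add: single_of_int[symmetric] mult_single del: single_of_int)
  ultimately have sum0: "(\<Sum>t\<in>?K. Poly_Mapping.single (mon_subst \<mu> t) (Poly_Mapping.lookup a t * mon_eval \<epsilon> t)) = 0"
    by simp
  have "\<exists>t. t \<in> ?K"
  proof (rule ccontr)
    assume "\<not> (\<exists>t. t \<in> ?K)"
    then have "?K = {}" by blast
    then have "Polynomial.coeff (wscale (inj_weight j) a) (wdeg (inj_weight j) a) = 0"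
      unfolding coeff_wscale by (simp only: sum.empty)
    then have "wscale (inj_weight j) a = 0" by (simp add: wdeg_def)
    then show False using wscale_inj \<open>a \<noteq> 0\<close> by blast
  qed
  then obtain t where t: "t \<in> ?K" by blast
  \<comment> \<open>Monomials of top weight have distinct images, so no cancellation can occur among
    them.\<close>
  have "0 = (\<Sum>s\<in>?K. Poly_Mapping.lookup (Poly_Mapping.single (mon_subst \<mu> s) (Poly_Mapping.lookup a s * mon_eval \<epsilon> s)) (mon_subst \<mu> t))"
    using arg_cong[OF sum0, of "\<lambda>u. Poly_Mapping.lookup u (mon_subst \<mu> t)"] by (simp add: lookup_sum)
  also have "\<dots> = (\<Sum>s\<in>?K. if s = t then Poly_Mapping.lookup a t * mon_eval \<epsilon> t else 0)"
    by (intro sum.cong refl) (auto simp: lookup_single when_def dest: inj)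
  also have "\<dots> = Poly_Mapping.lookup a t * mon_eval \<epsilon> t"
    using t by simp
  finally have "Poly_Mapping.lookup a t * mon_eval \<epsilon> t = 0" by simp
  moreover have "mon_eval \<epsilon> t \<noteq> 0" by (simp add: mon_eval_def \<epsilon>_def)
  ultimately show False using t by (auto simp: in_keys_iff)
qed

end

section \<open>Existence of the universal resultant\<close>

lemma lookup_single_mult:
  "Poly_Mapping.lookup (Poly_Mapping.single s 1 * p) t =
    (\<Sum>\<alpha>\<in>Poly_Mapping.keys p. if s + \<alpha> = t then Poly_Mapping.lookup p \<alpha> else 0 :: 'a::comm_ring_1)"
proof -
  have "Poly_Mapping.single s 1 * p = (\<Sum>\<alpha>\<in>Poly_Mapping.keys p. Poly_Mapping.single (s + \<alpha>) (Poly_Mapping.lookup p \<alpha>))"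
    by (subst pm_sum_single[of p]) (simp add: sum_distrib_left mult_single)
  then show ?thesis by (simp add: lookup_sum lookup_single when_def)
qed

lemma comm_ring_hom_specialize: "comm_ring_hom (specialize g)"
  unfolding specialize_def by (rule comm_ring_hom_mp_eval_of_int)

context degree_vector
begin

text \<open>The least degree in which every monomial in the \<open>m\<close> indeterminates is
  divisible by some \<open>x_i ^ d i\<close>.\<close>

definition crit_deg :: nat where
  "crit_deg = (\<Sum>i\<in>{1..m}. d i - 1) + 1"

text \<open>Macaulay's assignment of the monomials of critical degree to the equations, with \<open>j\<close> used
  only when no other equation is available.\<close>

definition row_class :: "nat \<Rightarrow> (nat \<Rightarrow>\<^sub>0 nat) \<Rightarrow> nat" where
  "row_class j \<alpha> = (if \<exists>i. i \<in> {1..m} - {j} \<and> d i \<le> Poly_Mapping.lookup \<alpha> i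
     then SOME i. i \<in> {1..m} - {j} \<and> d i \<le> Poly_Mapping.lookup \<alpha> i else j)"

definition row_poly :: "nat \<Rightarrow> (nat \<Rightarrow>\<^sub>0 nat) \<Rightarrow> (nat, coeff_ring) mpoly" where
  "row_poly j \<alpha> = Poly_Mapping.single (\<alpha> - Poly_Mapping.single (row_class j \<alpha>) (d (row_class j \<alpha>))) 1 * G (row_class j \<alpha>)"

definition mac_enum :: "nat \<Rightarrow> (nat \<Rightarrow>\<^sub>0 nat)" where
  "mac_enum = (SOME h. bij_betw h {0..<card (exponents m crit_deg)} (exponents m crit_deg))"

text \<open>Macaulay's matrix: its rows are multiples of the equations by monomials, expanded in the
  monomials of critical degree. At a common zero it annihilates the vector of these
  monomials.\<close>

definition mac_mat :: "nat \<Rightarrow> coeff_ring mat" where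
  "mac_mat j = mat (card (exponents m crit_deg)) (card (exponents m crit_deg))
     (\<lambda>(r, c). Poly_Mapping.lookup (row_poly j (mac_enum r)) (mac_enum c))"

definition mac_det :: "nat \<Rightarrow> coeff_ring" where
  "mac_det j = det (mac_mat j)"

lemma mac_enum_bij: "bij_betw mac_enum {0..<card (exponents m crit_deg)} (exponents m crit_deg)"
  unfolding mac_enum_def using ex_bij_betw_nat_finite[OF finite_exponents] by (rule someI_ex)

lemma mac_enum_in: "r < card (exponents m crit_deg) \<Longrightarrow> mac_enum r \<in> exponents m crit_deg"
  using bij_betwE[OF mac_enum_bij] by simp

lemma mac_enum_inj: "r < card (exponents m crit_deg) \<Longrightarrow> c < card (exponents m crit_deg) \<Longrightarrow>
   mac_enum r = mac_enum c \<longleftrightarrow> r = c"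
  using bij_betw_imp_inj_on[OF mac_enum_bij] by (auto simp: inj_on_def)

lemma exponents_sum: "\<alpha> \<in> exponents m e \<Longrightarrow> (\<Sum>i\<in>{1..m}. Poly_Mapping.lookup \<alpha> i) = e"
  using mdeg_superset[of "{1..m}" \<alpha>] by (auto simp: exponents_def)

text \<open>If no index other than \<open>j\<close> qualifies, the remaining exponents are at most
  \<open>d i - 1\<close>, and the critical degree leaves at least \<open>d j\<close> for
  \<open>x_j\<close>.\<close>

lemma row_class:
  assumes j: "j \<in> {1..m}" and \<alpha>: "\<alpha> \<in> exponents m crit_deg"
  shows "row_class j \<alpha> \<in> {1..m}" "d (row_class j \<alpha>) \<le> Poly_Mapping.lookup \<alpha> (row_class j \<alpha>)"
    and "row_class j \<alpha> = j \<longleftrightarrow> (\<forall>i\<in>{1..m} - {j}. Poly_Mapping.lookup \<alpha> i < d i)"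
proof -
  have "row_class j \<alpha> \<in> {1..m} \<and> d (row_class j \<alpha>) \<le> Poly_Mapping.lookup \<alpha> (row_class j \<alpha>) \<and>
    (row_class j \<alpha> = j \<longleftrightarrow> (\<forall>i\<in>{1..m} - {j}. Poly_Mapping.lookup \<alpha> i < d i))"
  proof (cases "\<exists>i. i \<in> {1..m} - {j} \<and> d i \<le> Poly_Mapping.lookup \<alpha> i")
    case True
    then have "row_class j \<alpha> = (SOME i. i \<in> {1..m} - {j} \<and> d i \<le> Poly_Mapping.lookup \<alpha> i)"
      by (simp only: row_class_def if_True)
    with someI_ex[OF True] show ?thesis
      by (metis DiffD1 DiffD2 insertI1 not_le)
  next
    case False
    then have 1: "row_class j \<alpha> = j" by (simp only: row_class_def if_False)
    have small: "Poly_Mapping.lookup \<alpha> i < d i" if "i \<in> {1..m} - {j}" for i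
      using that False not_le by blast
    have "crit_deg = (\<Sum>i\<in>{1..m}. Poly_Mapping.lookup \<alpha> i)"
      using exponents_sum[OF \<alpha>] by simp
    also have "\<dots> = Poly_Mapping.lookup \<alpha> j + (\<Sum>i\<in>{1..m} - {j}. Poly_Mapping.lookup \<alpha> i)"
      using j by (simp add: sum.remove)
    also have "\<dots> \<le> Poly_Mapping.lookup \<alpha> j + (\<Sum>i\<in>{1..m} - {j}. d i - 1)"
      using small by (intro add_left_mono sum_mono) fastforce
    finally have "(\<Sum>i\<in>{1..m}. d i - 1) + 1 \<le> Poly_Mapping.lookup \<alpha> j + (\<Sum>i\<in>{1..m} - {j}. d i - 1)"
      by (simp add: crit_deg_def)
    moreover have "(\<Sum>i\<in>{1..m}. d i - 1) = (d j - 1) + (\<Sum>i\<in>{1..m} - {j}. d i - 1)"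
      using j by (simp add: sum.remove)
    ultimately have "d j \<le> Poly_Mapping.lookup \<alpha> j" by linarith
    then show ?thesis using 1 j small by simp
  qed
  then show "row_class j \<alpha> \<in> {1..m}" "d (row_class j \<alpha>) \<le> Poly_Mapping.lookup \<alpha> (row_class j \<alpha>)"
    "row_class j \<alpha> = j \<longleftrightarrow> (\<forall>i\<in>{1..m} - {j}. Poly_Mapping.lookup \<alpha> i < d i)" by blast+
qed

lemma row_split:
  assumes "j \<in> {1..m}" "\<alpha> \<in> exponents m crit_deg"
  shows "(\<alpha> - Poly_Mapping.single (row_class j \<alpha>) (d (row_class j \<alpha>))) + Poly_Mapping.single (row_class j \<alpha>) (d (row_class j \<alpha>)) = \<alpha>"
  by (rule poly_mapping_eqI)
    (use row_class(2)[OF assms] in \<open>auto simp: lookup_add lookup_minus lookup_single when_def\<close>)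

lemma keys_row_poly:
  assumes "j \<in> {1..m}" "\<alpha> \<in> exponents m crit_deg"
  shows "Poly_Mapping.keys (row_poly j \<alpha>) \<subseteq> exponents m crit_deg"
proof -
  let ?i = "row_class j \<alpha>"
  let ?s = "\<alpha> - Poly_Mapping.single ?i (d ?i)"
  have "Poly_Mapping.keys ?s \<subseteq> Poly_Mapping.keys \<alpha>"
    by (auto simp: in_keys_iff lookup_minus)
  then have "Poly_Mapping.single ?s 1 \<in> (polys {1..m} :: (nat, coeff_ring) mpoly set)"
    using assms(2) by (intro polys_single) (auto simp: exponents_def)
  then have "row_poly j \<alpha> \<in> polys {1..m}"
    unfolding row_poly_def by (intro polys_mult generic_poly_polys)
  moreover have "homogeneous (mdeg ?s + d ?i) (row_poly j \<alpha>)"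
    unfolding row_poly_def by (intro homogeneous_mult homogeneous_single homogeneous_generic_poly refl)
  moreover have "mdeg ?s + d ?i = crit_deg"
    using arg_cong[OF row_split[OF assms], of mdeg] assms(2) by (simp add: mdeg_add exponents_def)
  ultimately show ?thesis by (auto simp: exponents_def polys_def homogeneous_def)
qed

lemma card_exponents_pos: "card (exponents m crit_deg) > 0"
proof -
  have "Poly_Mapping.single 1 crit_deg \<in> exponents m crit_deg"
    by (rule single_in_exponents) (use m_pos in simp)
  then show ?thesis by (auto simp: card_gt_0_iff)
qed

text \<open>The monomials at the generic zero form a nonzero kernel vector over the field of
  fractions.\<close>

lemma inertia_mac_det:
  assumes j: "j \<in> {1..m}"
  shows "inertia (mac_det j)"
proof -
  define N where "N = card (exponents m crit_deg)"
  interpret z: comm_ring_hom "zero_coeff j" by (rule comm_ring_hom_zero_coeff)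
  interpret e: comm_ring_hom "zero_eval j" by (rule comm_ring_hom_zero_eval)
  define v where "v = vec N (\<lambda>c. mon_eval (\<lambda>x. to_fract (Var x)) (mac_enum c) :: (nat, coeff_ring) mpoly fract)"
  have M: "z.mat_hom (mac_mat j) \<in> carrier_mat N N"
    by (simp add: mac_mat_def N_def)
  have "z.mat_hom (mac_mat j) *\<^sub>v v = 0\<^sub>v N"
  proof (rule eq_vecI)
    fix r assume "r < dim_vec (0\<^sub>v N)"
    then have r: "r < N" by simp
    let ?p = "row_poly j (mac_enum r)"
    have \<alpha>: "mac_enum r \<in> exponents m crit_deg" using r mac_enum_in by (simp add: N_def)
    have "(z.mat_hom (mac_mat j) *\<^sub>v v) $ r = (\<Sum>c = 0..<N. zero_coeff j (Poly_Mapping.lookup ?p (mac_enum c)) *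
        mon_eval (\<lambda>x. to_fract (Var x)) (mac_enum c))"
      using r by (simp add: scalar_prod_def mac_mat_def v_def N_def)
    also have "\<dots> = (\<Sum>t\<in>exponents m crit_deg. zero_coeff j (Poly_Mapping.lookup ?p t) * mon_eval (\<lambda>x. to_fract (Var x)) t)"
      using mac_enum_bij unfolding N_def[symmetric] by (rule sum.reindex_bij_betw)
    also have "\<dots> = zero_eval j ?p"
      unfolding zero_eval_def by (rule mp_eval_superset[symmetric]) (use keys_row_poly[OF j \<alpha>] in auto)
    also have "\<dots> = 0"
      unfolding row_poly_def e.hom_mult using zero_eval_G[OF j row_class(1)[OF j \<alpha>]] by simp
    finally show "(z.mat_hom (mac_mat j) *\<^sub>v v) $ r = 0\<^sub>v N $ r" using r by simp
  qed (simp add: mac_mat_def N_def)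
  moreover have "v \<noteq> 0\<^sub>v N"
  proof
    assume "v = 0\<^sub>v N"
    then have "v $ 0 = 0" using card_exponents_pos by (simp add: N_def)
    then show False using card_exponents_pos by (simp add: v_def N_def mon_eval_def)
  qed
  moreover have "v \<in> carrier_vec N" by (simp add: v_def)
  ultimately have "det (z.mat_hom (mac_mat j)) = 0"
    using det_0_iff_vec_prod_zero[OF M] by blast
  then show ?thesis
    unfolding inertia_iff[OF j] mac_det_def by simp
qed

lemma mac_det_U: "j \<in> {1..m} \<Longrightarrow> mac_det j \<in> U_ring m d"
proof -
  assume j: "j \<in> {1..m}"
  interpret rt: comm_ring_hom retract_coeff by (rule comm_ring_hom_retract_coeff)
  have "rt.mat_hom (mac_mat j) = mac_mat j"
  proof (rule eq_matI)
    fix r c assume "r < dim_row (mac_mat j)" "c < dim_col (mac_mat j)"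
    then have rc: "r < card (exponents m crit_deg)" "c < card (exponents m crit_deg)" by (simp_all add: mac_mat_def)
    have i: "row_class j (mac_enum r) \<in> {1..m}" using row_class(1)[OF j mac_enum_in[OF rc(1)]] .
    have "Poly_Mapping.lookup (row_poly j (mac_enum r)) (mac_enum c) \<in> U_ring m d"
      unfolding row_poly_def lookup_single_mult U_ring_def
      by (rule polys_sum) (use i in \<open>auto simp: lookup_generic_poly intro: polys_Var\<close>)
    then show "rt.mat_hom (mac_mat j) $$ (r, c) = mac_mat j $$ (r, c)"
      using rc by (simp add: mac_mat_def retract_coeff_id)
  qed (simp_all add: mac_mat_def)
  then show ?thesis
    unfolding U_ring_iff mac_det_def rt.hom_det[symmetric] by simp
qed

lemma specialize_Var: "specialize g (Var (i, \<alpha>)) = Poly_Mapping.lookup (g i) \<alpha>"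
  unfolding specialize_def by (simp add: comm_ring_hom.mp_eval_Var[OF comm_ring_hom_of_int])

lemma specialize_Const [simp]: "specialize g (Const c) = of_int c"
  unfolding specialize_def by (rule comm_ring_hom.mp_eval_Const[OF comm_ring_hom_of_int])

lemma map_coeffs_specialize_G:
  assumes "g i \<in> polys {1..m}" "homogeneous (d i) (g i)"
  shows "map_coeffs (specialize g) (G i) = g i"
proof (rule poly_mapping_eqI)
  fix \<alpha>
  interpret s: comm_ring_hom "specialize g" by (rule comm_ring_hom_specialize)
  have "Poly_Mapping.lookup (g i) \<alpha> = 0" if "\<alpha> \<notin> exponents m (d i)"
  proof (rule ccontr)
    assume "Poly_Mapping.lookup (g i) \<alpha> \<noteq> 0"
    then have "\<alpha> \<in> Poly_Mapping.keys (g i)" by (simp add: in_keys_iff)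
    then show False using that assms by (auto simp: polys_def homogeneous_def exponents_def)
  qed
  then show "Poly_Mapping.lookup (map_coeffs (specialize g) (G i)) \<alpha> = Poly_Mapping.lookup (g i) \<alpha>"
    by (simp add: lookup_map_coeffs lookup_generic_poly specialize_Var)
qed

abbreviation spec_diag :: "coeff_ring \<Rightarrow> int" where
  "spec_diag \<equiv> specialize (\<lambda>i. Var i ^ d i)"

text \<open>For the equations \<open>x_i ^ d i\<close> the row of a monomial is that monomial, so
  the matrix is the identity.\<close>

lemma spec_diag_mac_det: "j \<in> {1..m} \<Longrightarrow> spec_diag (mac_det j) = 1"
proof -
  assume j: "j \<in> {1..m}"
  define g :: "nat \<Rightarrow> (nat, int) mpoly" where "g = (\<lambda>i. Var i ^ d i)"
  interpret s: comm_ring_hom "specialize g" by (rule comm_ring_hom_specialize)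
  interpret ms: comm_ring_hom "map_coeffs (specialize g) :: (nat, coeff_ring) mpoly \<Rightarrow> _"
    by (rule comm_ring_hom_map_coeffs[OF comm_ring_hom_specialize])
  have "s.mat_hom (mac_mat j) = 1\<^sub>m (card (exponents m crit_deg))"
  proof (rule eq_matI)
    fix r c assume "r < dim_row (1\<^sub>m (card (exponents m crit_deg)) :: int mat)" "c < dim_col (1\<^sub>m (card (exponents m crit_deg)) :: int mat)"
    then have rc: "r < card (exponents m crit_deg)" "c < card (exponents m crit_deg)" by simp_all
    note \<alpha> = mac_enum_in[OF rc(1)]
    let ?i = "row_class j (mac_enum r)"
    have i: "?i \<in> {1..m}" using row_class(1)[OF j \<alpha>] .
    have "g ?i \<in> polys {1..m}" "homogeneous (d ?i) (g ?i)"
      using polys_power[OF polys_Var[OF i]] homogeneous_power[OF homogeneous_Var, of "d ?i" ?i]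
      by (simp_all add: g_def)
    then have "map_coeffs (specialize g) (row_poly j (mac_enum r)) =
        map_coeffs (specialize g) (Poly_Mapping.single (mac_enum r - Poly_Mapping.single ?i (d ?i)) 1) * Var ?i ^ d ?i"
      unfolding row_poly_def ms.hom_mult by (subst map_coeffs_specialize_G) (simp_all add: g_def)
    also have "map_coeffs (specialize g) (Poly_Mapping.single (mac_enum r - Poly_Mapping.single ?i (d ?i)) 1)
        = Poly_Mapping.single (mac_enum r - Poly_Mapping.single ?i (d ?i)) 1"
      by (rule poly_mapping_eqI) (simp add: lookup_map_coeffs lookup_single when_def)
    also have "\<dots> * Var ?i ^ d ?i = Poly_Mapping.single (mac_enum r) 1"
      by (simp add: Var_power mult_single row_split[OF j \<alpha>])
    finally have "specialize g (Poly_Mapping.lookup (row_poly j (mac_enum r)) (mac_enum c)) =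
        Poly_Mapping.lookup (Poly_Mapping.single (mac_enum r) 1) (mac_enum c)"
      using lookup_map_coeffs[of "specialize g", OF s.hom_zero] by metis
    then show "s.mat_hom (mac_mat j) $$ (r, c) = 1\<^sub>m (card (exponents m crit_deg)) $$ (r, c)"
      using rc mac_enum_inj[OF rc] by (auto simp: mac_mat_def lookup_single when_def)
  qed (simp_all add: mac_mat_def)
  then show ?thesis
    unfolding mac_det_def g_def[symmetric] s.hom_det[symmetric] by simp
qed

abbreviation group_weight :: "nat \<Rightarrow> nat \<times> (nat \<Rightarrow>\<^sub>0 nat) \<Rightarrow> nat" where
  "group_weight j \<equiv> \<lambda>z. if fst z = j then 1 else 0"

text \<open>The number of common zeros of the other equations by Bezout; it turns out to be the
  degree of the resultant in the coefficients of the \<open>j\<close>-th equation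
  (\<open>wdeg_R\<close>).\<close>

definition co_deg :: "nat \<Rightarrow> nat" where
  "co_deg j = (\<Prod>i\<in>{1..m} - {j}. d i)"

text \<open>The exponents below \<open>d i\<close> for \<open>i\<close> other than \<open>j\<close>
  can be chosen freely, and the total degree then fixes the exponent of \<open>x_j\<close>. That
  \<open>j\<close> is the last choice in \<open>row_class\<close> is essential here.\<close>

lemma card_row_class:
  assumes j: "j \<in> {1..m}"
  shows "card {\<alpha> \<in> exponents m crit_deg. row_class j \<alpha> = j} = co_deg j"
proof -
  let ?S = "{\<alpha> \<in> exponents m crit_deg. row_class j \<alpha> = j}"
  let ?P = "PiE ({1..m} - {j}) (\<lambda>i. {..<d i})"
  define up where "up f = (\<Sum>i\<in>{1..m} - {j}. Poly_Mapping.single i (f i)) +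
     Poly_Mapping.single j (crit_deg - (\<Sum>i\<in>{1..m} - {j}. f i))" for f :: "nat \<Rightarrow> nat"
  have lookup_up: "Poly_Mapping.lookup (up f) i = (if i = j then crit_deg - (\<Sum>i\<in>{1..m} - {j}. f i)
     else if i \<in> {1..m} then f i else 0)" for f i
    by (auto simp: up_def lookup_add lookup_sum lookup_single when_def)
  have "bij_betw up ?P ?S"
  proof (rule bij_betwI[where g = "\<lambda>\<alpha>. restrict (Poly_Mapping.lookup \<alpha>) ({1..m} - {j})"])
    show "up \<in> ?P \<rightarrow> ?S"
    proof
      fix f assume f: "f \<in> ?P"
      have "(\<Sum>i\<in>{1..m} - {j}. f i) \<le> (\<Sum>i\<in>{1..m} - {j}. d i - 1)"
        using f by (intro sum_mono) (auto simp: PiE_def Pi_def less_imp_diff_less le_diff_conv Suc_le_eq One_nat_def)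
      also have "\<dots> \<le> crit_deg" unfolding crit_deg_def
        by (intro trans_le_add1 sum_mono2) auto
      finally have le: "(\<Sum>i\<in>{1..m} - {j}. f i) \<le> crit_deg" .
      have keys: "Poly_Mapping.keys (up f) \<subseteq> {1..m}"
        using j by (auto simp: in_keys_iff lookup_up split: if_splits)
      have "mdeg (up f) = (\<Sum>i\<in>{1..m}. Poly_Mapping.lookup (up f) i)"
        by (rule mdeg_superset[OF _ keys]) simp
      also have "\<dots> = Poly_Mapping.lookup (up f) j + (\<Sum>i\<in>{1..m} - {j}. Poly_Mapping.lookup (up f) i)"
        using j by (simp add: sum.remove)
      also have "\<dots> = crit_deg" using le by (simp add: lookup_up)
      finally have e: "up f \<in> exponents m crit_deg" using keys by (simp add: exponents_def)
      have "Poly_Mapping.lookup (up f) i < d i" if "i \<in> {1..m} - {j}" for i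
        using f that by (auto simp: lookup_up PiE_def Pi_def)
      then show "up f \<in> ?S" using row_class(3)[OF j e] e by blast
    qed
    show "(\<lambda>\<alpha>. restrict (Poly_Mapping.lookup \<alpha>) ({1..m} - {j})) \<in> ?S \<rightarrow> ?P"
    proof
      fix \<alpha> assume "\<alpha> \<in> ?S"
      then have "\<forall>i\<in>{1..m} - {j}. Poly_Mapping.lookup \<alpha> i < d i" using row_class(3)[OF j] by blast
      then show "restrict (Poly_Mapping.lookup \<alpha>) ({1..m} - {j}) \<in> ?P"
        by (intro PiE_I) (simp_all only: restrict_apply if_True if_False lessThan_iff)
    qed
    show "restrict (Poly_Mapping.lookup (up f)) ({1..m} - {j}) = f" if "f \<in> ?P" for f
      using that by (auto simp: lookup_up PiE_def extensional_def fun_eq_iff restrict_def)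
    show "up (restrict (Poly_Mapping.lookup \<alpha>) ({1..m} - {j})) = \<alpha>" if \<alpha>: "\<alpha> \<in> ?S" for \<alpha>
    proof (rule poly_mapping_eqI)
      fix i
      have "crit_deg = Poly_Mapping.lookup \<alpha> j + (\<Sum>i\<in>{1..m} - {j}. Poly_Mapping.lookup \<alpha> i)"
        using exponents_sum[of \<alpha> crit_deg] \<alpha> j by (simp add: sum.remove)
      moreover have "i \<notin> {1..m} \<Longrightarrow> Poly_Mapping.lookup \<alpha> i = 0"
        using \<alpha> by (auto simp: exponents_def in_keys_iff)
      ultimately show "Poly_Mapping.lookup (up (restrict (Poly_Mapping.lookup \<alpha>) ({1..m} - {j}))) i = Poly_Mapping.lookup \<alpha> i"
        by (auto simp: lookup_up)
    qed
  qed
  then have "card ?S = card ?P" by (simp add: bij_betw_same_card)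
  also have "\<dots> = co_deg j" by (simp add: card_PiE co_deg_def)
  finally show ?thesis .
qed

text \<open>A row is linear in the coefficients of equation \<open>j\<close> if its class is
  \<open>j\<close> and free of them otherwise, so every term of the determinant has the same degree
  in them.\<close>

lemma wscale_mac_det:
  assumes j: "j \<in> {1..m}"
  shows "wscale (group_weight j) (mac_det j) = monom (mac_det j) (co_deg j)"
proof -
  define N where "N = card (exponents m crit_deg)"
  define k where "k r = (if row_class j (mac_enum r) = j then 1 else 0 :: nat)" for r
  interpret s: comm_ring_hom "wscale (group_weight j) :: coeff_ring \<Rightarrow> _" by (rule comm_ring_hom_wscale)
  have entry: "wscale (group_weight j) (mac_mat j $$ (r, c)) = monom (mac_mat j $$ (r, c)) (k r)"
    if "r < N" "c < N" for r c
  proof -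
    have "wscale (group_weight j) (Poly_Mapping.lookup (G i) \<alpha>) = monom (Poly_Mapping.lookup (G i) \<alpha>) (if i = j then 1 else 0)" for i \<alpha>
      by (simp add: lookup_generic_poly)
    note G = this
    have "mac_mat j $$ (r, c) = Poly_Mapping.lookup (row_poly j (mac_enum r)) (mac_enum c)"
      using that by (simp add: mac_mat_def N_def)
    also have "wscale (group_weight j) \<dots> = monom \<dots> (k r)"
      unfolding row_poly_def lookup_single_mult s.hom_sum monom_sum k_def
      by (intro sum.cong refl) (simp only: if_distrib[of "wscale _"] if_distrib[of "\<lambda>q. monom q _"] G s.hom_zero monom_eq_0)
    finally show ?thesis .
  qed
  have carr: "mac_mat j \<in> carrier_mat N N" by (simp add: mac_mat_def N_def)
  have sumk: "(\<Sum>r = 0..<N. k r) = co_deg j"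
  proof -
    have "(\<Sum>r = 0..<N. k r) = (\<Sum>\<alpha>\<in>exponents m crit_deg. if row_class j \<alpha> = j then 1 else 0)"
      unfolding k_def N_def using mac_enum_bij by (rule sum.reindex_bij_betw)
    also have "\<dots> = card {\<alpha> \<in> exponents m crit_deg. row_class j \<alpha> = j}"
      by (simp add: sum.If_cases Int_def)
    finally show ?thesis using card_row_class[OF j] by simp
  qed
  have "wscale (group_weight j) (mac_det j) =
    (\<Sum>p | p permutes {0..<N}. wscale (group_weight j) (signof p) * (\<Prod>r = 0..<N. wscale (group_weight j) (mac_mat j $$ (r, p r))))"
    unfolding mac_det_def det_def'[OF carr] s.hom_sum s.hom_mult s.hom_prod ..
  also have "\<dots> = (\<Sum>p | p permutes {0..<N}. monom (signof p * (\<Prod>r = 0..<N. mac_mat j $$ (r, p r))) (co_deg j))"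
  proof (intro sum.cong refl)
    fix p assume "p \<in> {p. p permutes {0..<N}}"
    then have p: "p permutes {0..<N}" by simp
    have "(\<Prod>r = 0..<N. wscale (group_weight j) (mac_mat j $$ (r, p r))) = (\<Prod>r = 0..<N. monom (mac_mat j $$ (r, p r)) (k r))"
      by (intro prod.cong refl entry) (use permutes_in_image[OF p] in auto)
    also have "\<dots> = monom (\<Prod>r = 0..<N. mac_mat j $$ (r, p r)) (co_deg j)"
      by (simp add: prod_monom sumk)
    finally have 1: "(\<Prod>r = 0..<N. wscale (group_weight j) (mac_mat j $$ (r, p r))) = monom (\<Prod>r = 0..<N. mac_mat j $$ (r, p r)) (co_deg j)" .
    have "wscale (group_weight j) (signof p :: coeff_ring) = monom (signof p) 0"
      by (simp add: sign_def s.hom_uminus monom_0 one_pCons)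
    then show "wscale (group_weight j) (signof p) * (\<Prod>r = 0..<N. wscale (group_weight j) (mac_mat j $$ (r, p r)))
       = monom (signof p * (\<Prod>r = 0..<N. mac_mat j $$ (r, p r))) (co_deg j)"
      unfolding 1 by (simp add: mult_monom)
  qed
  also have "\<dots> = monom (mac_det j) (co_deg j)"
    unfolding mac_det_def det_def'[OF carr] by (simp add: monom_sum)
  finally show ?thesis .
qed

lemma spec_diag_hom: "comm_ring_hom spec_diag"
  by (rule comm_ring_hom_specialize)

text \<open>Divisibility is taken in the full coefficient ring, where prime factorization is
  available; \<open>is_resultant_universal_Res\<close> passes to the ideal of
  \<open>U_ring m d\<close>.\<close>

definition is_resultant :: "coeff_ring \<Rightarrow> bool" where
  "is_resultant r \<longleftrightarrow> prime_elem r \<and> r \<in> U_ring m d \<and> (\<forall>a. inertia a \<longleftrightarrow> r dvd a) \<and> spec_diag r = 1"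

text \<open>Eliminate \<open>v\<close>, the coefficient of \<open>x_1 ^ d 1\<close> in the first
  equation, between \<open>r\<close> and \<open>a\<close>. A nonzero inertia form involves
  \<open>v\<close>, so neither the inertia form \<open>W\<close> has degree 0 in \<open>v\<close>
  nor does \<open>r\<close> divide a power of its leading coefficient. Both alternatives in
  \<open>r dvd T * W\<close> contradict this, given that \<open>r\<close> does not divide
  \<open>a\<close>.\<close>

lemma inertia_principal:
  assumes r: "prime_elem r" "inertia r" and a: "inertia a"
  shows "r dvd a"
proof (rule ccontr)
  assume nd: "\<not> r dvd a"
  have one: "1 \<in> {1..m}" using m_pos by simp
  define v where "v = top_var 1 1"
  have free: "p = 0" if "inertia p" "vdeg v p = 0" for p
  proof -
    have "p \<in> polys (UNIV - {v})" by (rule vdeg_0_polys) (use that in auto)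
    then show ?thesis using inertia_free_eq_0[OF one that(1)] by (simp add: v_def Compl_eq_Diff_UNIV)
  qed
  have r0: "r \<noteq> 0" using r by auto
  obtain W s t T T' k k' where W: "W \<noteq> 0" "W = s * r + t * a"
    and T: "vlc v W ^ k * r = T * W" "vlc v W ^ k' * a = T' * W"
    using elimination[of r UNIV v a] r0 by (metis UNIV_I subset_UNIV_polys)
  have WI: "inertia W"
    unfolding W(2) by (intro inertia_add inertia_mult_left r a)
  have lcfree: "vdeg v (vlc v W ^ k) = 0" for k
  proof -
    have "vlc v W \<in> polys (UNIV - {v})" by (rule vlc_polys) simp
    then show ?thesis by (intro vdeg_free[of _ "UNIV - {v}"] polys_power) auto
  qed
  have lc0: "vlc v W ^ k \<noteq> 0" for k using W(1) by simp
  have nd_lc: "\<not> r dvd vlc v W ^ k" for k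
  proof
    assume "r dvd vlc v W ^ k"
    then obtain b where "vlc v W ^ k = b * r" by (metis dvdE mult.commute)
    then have "inertia (vlc v W ^ k)" using inertia_mult_left[OF r(2)] by simp
    then show False using free lcfree lc0 by blast
  qed
  have "r dvd T * W" by (metis T(1) dvd_triv_right)
  then consider "r dvd T" | "r dvd W" using r(1) by (auto simp: prime_elem_dvd_mult_iff)
  then show False
  proof cases
    case 1
    then obtain T2 where "T = r * T2" by auto
    with T(1) have "r * vlc v W ^ k = r * (T2 * W)" by (simp add: mult_ac)
    then have eq: "vlc v W ^ k = T2 * W" using r0 by (metis mult_left_cancel)
    then have "T2 \<noteq> 0" using lc0[of k] by auto
    then have "vdeg v (T2 * W) = vdeg v T2 + vdeg v W" using W(1) by (rule vdeg_mult)
    then have "vdeg v W = 0" using lcfree[of k] eq by simp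
    then show False using free[OF WI] W(1) by simp
  next
    case 2
    then have "r dvd vlc v W ^ k' * a" unfolding T(2) by (rule dvd_mult)
    then show False using r(1) nd nd_lc by (auto simp: prime_elem_dvd_mult_iff)
  qed
qed

lemma unit_int_mpoly:
  assumes "c * c' = (1 :: coeff_ring)"
  shows "c = Const (Poly_Mapping.lookup c 0)"
proof (rule polys_empty)
  show "c \<in> polys {}" using polys_factor(1)[of c c' "{}"] assms by simp
qed

lemma U_ring_factor: "p * q \<in> U_ring m d \<Longrightarrow> p * q \<noteq> 0 \<Longrightarrow> p \<in> U_ring m d" 
  unfolding U_ring_def by (rule polys_factor(1))

text \<open>Inertia forms are prime, so some prime factor of a Macaulay determinant is one.\<close>

lemma ex_resultant: "\<exists>r. is_resultant r"
proof -
  have one: "1 \<in> {1..m}" using m_pos by simp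
  interpret s: comm_ring_hom spec_diag by (rule spec_diag_hom)
  define \<Delta> where "\<Delta> = mac_det 1"
  have \<Delta>: "inertia \<Delta>" "spec_diag \<Delta> = 1" "\<Delta> \<in> U_ring m d"
    unfolding \<Delta>_def using inertia_mac_det[OF one] spec_diag_mac_det[OF one] mac_det_U[OF one] by auto
  then have \<Delta>0: "\<Delta> \<noteq> 0" by auto
  obtain u A where A: "u dvd 1" "\<forall>q\<in>#A. prime_elem q" "\<Delta> = u * prod_mset A"
    using prime_product_mpoly[OF \<Delta>0] by (auto simp: prime_product_def)
  have nu: "\<not> inertia u"
  proof
    assume "inertia u"
    obtain u' where "1 = u' * u" using A(1) by (metis dvdE mult.commute)
    then show False using inertia_mult_left[OF \<open>inertia u\<close>, of u'] not_inertia_1 by simp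
  qed
  have "\<exists>q\<in>#B. inertia q" if "inertia (prod_mset B)" for B
    using that by (induction B) (use not_inertia_1 inertia_prime in auto)
  then obtain q where q: "q \<in># A" "inertia q"
    using \<Delta>(1) nu inertia_prime unfolding A(3) by blast
  have "q dvd \<Delta>" unfolding A(3) using q(1) by (simp add: dvd_mult dvd_prod_mset)
  then obtain b where b: "\<Delta> = q * b" by auto
  have qU: "q \<in> U_ring m d" using \<Delta>(3) \<Delta>0 unfolding b by (rule U_ring_factor)
  have unit: "spec_diag q * spec_diag b = 1" using \<Delta>(2) unfolding b s.hom_mult .
  then have sq: "spec_diag q * spec_diag q = 1"
    by (auto simp: zmult_eq_1_iff)
  \<comment> \<open>At the diagonal system the determinant is 1, so its factor \<open>q\<close>
    takes the value 1 or -1 there; multiplication by that sign normalizes it.\<close>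
  define r where "r = Const (spec_diag q) * q"
  have qr: "q = Const (spec_diag q) * r"
    using sq by (simp add: r_def mult.assoc[symmetric] Const_mult[symmetric])
  have dvd: "r dvd a \<longleftrightarrow> q dvd a" for a
  proof
    have "q dvd r" "r dvd q" by (subst r_def qr, rule dvd_triv_right)+
    then show "r dvd a \<Longrightarrow> q dvd a" "q dvd a \<Longrightarrow> r dvd a" by (blast intro: dvd_trans)+
  qed
  have "is_resultant r"
    unfolding is_resultant_def
  proof (intro conjI allI)
    have pq: "prime_elem q" using A(2) q(1) by blast
    show "prime_elem r"
    proof (rule prime_elemI)
      show "r \<noteq> 0" using pq qr by auto
      show "\<not> r dvd 1" using pq unfolding dvd by (rule prime_elem_not_unit)
      show "r dvd a \<or> r dvd b" if "r dvd a * b" for a b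
        using that pq unfolding dvd by (simp add: prime_elem_dvd_mult_iff)
    qed
    show "r \<in> U_ring m d"
      unfolding r_def using qU unfolding U_ring_def by (intro polys_mult polys_Const)
    show "spec_diag r = 1"
    proof -
      have "spec_diag (Const (spec_diag q)) = spec_diag q" by simp
      then show ?thesis unfolding r_def s.hom_mult using sq by simp
    qed
    fix a
    show "inertia a \<longleftrightarrow> r dvd a"
      unfolding dvd
    proof
      show "inertia a \<Longrightarrow> q dvd a" using inertia_principal[OF pq q(2)] .
      assume "q dvd a"
      then obtain c where "a = c * q" by (metis dvdE mult.commute)
      then show "inertia a" using inertia_mult_left[OF q(2)] by simp
    qed
  qed
  then show ?thesis by blast
qed

lemma gen_ideal_singleton: "gen_ideal (U_ring m d) {r} = {c * r | c. c \<in> U_ring m d}"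
proof (intro equalityI subsetI)
  fix p assume "p \<in> gen_ideal (U_ring m d) {r}"
  then obtain H c where H: "H \<subseteq> {r}" "\<forall>g\<in>H. c g \<in> U_ring m d" "p = (\<Sum>g\<in>H. c g * g)"
    by (auto simp: gen_ideal_def)
  then consider "H = {}" | "H = {r}" by blast
  then show "p \<in> {c * r | c. c \<in> U_ring m d}"
  proof cases
    case 1
    then show ?thesis using H by (auto simp: U_ring_def intro: exI[of _ 0])
  qed (use H in auto)
next
  fix p assume "p \<in> {c * r | c. c \<in> U_ring m d}"
  then obtain c where "p = c * r" "c \<in> U_ring m d" by blast
  then show "p \<in> gen_ideal (U_ring m d) {r}"
    unfolding gen_ideal_def by (intro CollectI exI[of _ "{r}"] exI[of _ "\<lambda>_. c"]) auto
qed

theorem is_resultant_universal_Res: "is_resultant (universal_Res m d)"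
proof -
  obtain r where r: "is_resultant r" using ex_resultant by blast
  interpret s: comm_ring_hom spec_diag by (rule spec_diag_hom)
  have rU: "r \<in> U_ring m d" and r0: "r \<noteq> 0" using r by (auto simp: is_resultant_def)
  have gen: "inertia_deg0 m d = gen_ideal (U_ring m d) {r}"
  proof (intro equalityI subsetI)
    fix a assume "a \<in> inertia_deg0 m d"
    then have a: "a \<in> U_ring m d" "r dvd a" using r by (auto simp: inertia_deg0_iff is_resultant_def)
    then obtain c where c: "a = c * r" by (metis dvdE mult.commute)
    show "a \<in> gen_ideal (U_ring m d) {r}"
    proof (cases "c = 0")
      case True
      then show ?thesis unfolding gen_ideal_singleton c by (auto simp: U_ring_def intro: exI[of _ 0])
    next
      case False
      then have "c \<in> U_ring m d" using a(1) r0 unfolding c by (intro U_ring_factor[of c r]) auto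
      then show ?thesis unfolding gen_ideal_singleton c by blast
    qed
  next
    fix a assume "a \<in> gen_ideal (U_ring m d) {r}"
    then obtain c where c: "a = c * r" "c \<in> U_ring m d" unfolding gen_ideal_singleton by blast
    then show "a \<in> inertia_deg0 m d"
      using r rU by (auto simp: inertia_deg0_iff is_resultant_def U_ring_def intro: polys_mult)
  qed
  have "universal_Res m d = r"
    unfolding universal_Res_def
  proof (rule the_equality)
    show "r \<in> U_ring m d \<and> inertia_deg0 m d = gen_ideal (U_ring m d) {r} \<and> spec_diag r = 1"
      using gen r by (simp add: is_resultant_def)
    fix r' assume r': "r' \<in> U_ring m d \<and> inertia_deg0 m d = gen_ideal (U_ring m d) {r'} \<and> spec_diag r' = 1"
    have one: "1 \<in> U_ring m d" by (simp add: U_ring_def)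
    have "r \<in> gen_ideal (U_ring m d) {r}" "r' \<in> gen_ideal (U_ring m d) {r'}"
      unfolding gen_ideal_singleton using one by (metis (mono_tags, lifting) mem_Collect_eq mult_1)+
    then have "r \<in> gen_ideal (U_ring m d) {r'}" "r' \<in> gen_ideal (U_ring m d) {r}"
      using gen r' by simp_all
    then obtain c c' where c: "r = c * r'" "r' = c' * r" unfolding gen_ideal_singleton by blast
    then have "(c * c') * r = 1 * r" by (simp add: mult_ac)
    then have "c * c' = 1" using r0 by (metis mult_right_cancel)
    \<comment> \<open>Two generators differ by a unit, hence by an integer, which the normalization
      forces to be 1.\<close>
    then have cc: "c = Const (Poly_Mapping.lookup c 0)" by (rule unit_int_mpoly)
    have "spec_diag r = 1" "spec_diag r' = 1" using r r' by (auto simp: is_resultant_def)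
    then have "spec_diag c = 1" using arg_cong[OF c(1), of spec_diag] unfolding s.hom_mult by simp
    then have "Poly_Mapping.lookup c 0 = 1" using arg_cong[OF cc, of spec_diag] by simp
    then have "c = 1" using cc by simp
    then show "r' = r" using c(1) by simp
  qed
  then show ?thesis using r by simp
qed

end

section \<open>Formal properties of the resultant\<close>

definition system :: "nat \<Rightarrow> (nat \<Rightarrow> nat) \<Rightarrow> (nat \<Rightarrow> (nat, 'a::comm_ring_1) mpoly) \<Rightarrow> bool" where
  "system m d g \<longleftrightarrow> (\<forall>i\<in>{1..m}. g i \<in> polys {1..m} \<and> homogeneous (d i) (g i))"

abbreviation gw :: "nat \<Rightarrow> nat \<times> (nat \<Rightarrow>\<^sub>0 nat) \<Rightarrow> nat" where
  "gw j \<equiv> \<lambda>z. if fst z = j then 1 else 0"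

definition coeff_vars :: "nat \<Rightarrow> (nat \<Rightarrow> nat) \<Rightarrow> (nat \<times> (nat \<Rightarrow>\<^sub>0 nat)) set" where
  "coeff_vars m d = (SIGMA i:{1..m}. exponents m (d i))"

lemma in_U_ring_iff: "p \<in> U_ring m d \<longleftrightarrow> p \<in> polys (coeff_vars m d)"
  by (simp add: U_ring_def coeff_vars_def)

lemma map_coeffs_specialize_generic:
  assumes "g k \<in> polys {1..m}" "homogeneous (e k) (g k)"
  shows "map_coeffs (specialize g) (generic_poly m e k) = g k"
proof (rule poly_mapping_eqI)
  fix \<alpha>
  have s: "comm_ring_hom (specialize g)"
    unfolding specialize_def by (rule comm_ring_hom_mp_eval_of_int)
  interpret s: comm_ring_hom "specialize g" by (rule s)
  have "Poly_Mapping.lookup (g k) \<alpha> = 0" if "\<alpha> \<notin> exponents m (e k)"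
  proof (rule ccontr)
    assume "Poly_Mapping.lookup (g k) \<alpha> \<noteq> 0"
    then have "\<alpha> \<in> Poly_Mapping.keys (g k)" by (simp add: in_keys_iff)
    then show False using that assms by (auto simp: polys_def homogeneous_def exponents_def)
  qed
  moreover have "specialize g (Var (k, \<alpha>)) = Poly_Mapping.lookup (g k) \<alpha>"
    unfolding specialize_def by (simp add: comm_ring_hom.mp_eval_Var[OF comm_ring_hom_of_int])
  ultimately show "Poly_Mapping.lookup (map_coeffs (specialize g) (generic_poly m e k)) \<alpha> = Poly_Mapping.lookup (g k) \<alpha>"
    by (simp add: lookup_map_coeffs lookup_generic_poly)
qed

lemma hom_specialize:
  "comm_ring_hom \<phi> \<Longrightarrow> \<phi> (specialize g a) = specialize (\<lambda>i. map_coeffs \<phi> (g i)) a"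
proof -
  assume \<phi>: "comm_ring_hom \<phi>"
  then interpret comm_ring_hom \<phi> .
  show ?thesis
    unfolding specialize_def hom_mp_eval[OF \<phi>] hom_of_int_eq[OF \<phi>]
    by (simp add: lookup_map_coeffs case_prod_unfold)
qed

lemma hom_Res: "comm_ring_hom \<phi> \<Longrightarrow> \<phi> (Res m d g) = Res m d (\<lambda>i. map_coeffs \<phi> (g i))"
  by (simp add: Res_def hom_specialize)

lemma specialize_cong:
  assumes "a \<in> U_ring m d" "\<And>i. i \<in> {1..m} \<Longrightarrow> g i = g' i"
  shows "specialize g a = specialize g' a"
  unfolding specialize_def
  by (rule mp_eval_cong[OF assms(1)[unfolded in_U_ring_iff]]) (use assms(2) in \<open>auto simp: coeff_vars_def\<close>)

text \<open>Degree vectors are total functions and will differ outside \<open>{1..m}\<close> through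
  updates and changes of \<open>m\<close>.\<close>

lemma universal_Res_cong:
  assumes "\<And>i. i \<in> {1..m} \<Longrightarrow> d i = d' i"
  shows "universal_Res m d = universal_Res m d'"
proof -
  have U: "U_ring m d = U_ring m d'"
    unfolding U_ring_def by (intro arg_cong[of _ _ polys] Sigma_cong refl) (simp add: assms)
  have Ux: "Ux_ring m d = Ux_ring m d'"
    unfolding Ux_ring_def U ..
  have G: "generic_poly m d ` {1..m} = generic_poly m d' ` {1..m}"
    by (intro image_cong refl) (simp add: generic_poly_def assms)
  have I: "inertia_deg0 m d = inertia_deg0 m d'"
    unfolding inertia_deg0_def U Ux G ..
  have "specialize (\<lambda>i. Var i ^ d i :: (nat, int) mpoly) r = specialize (\<lambda>i. Var i ^ d' i) r"
    if "r \<in> U_ring m d'" for r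
    by (rule specialize_cong[OF that]) (simp add: assms)
  then have "r \<in> U_ring m d' \<and> inertia_deg0 m d' = gen_ideal (U_ring m d') {r} \<and>
       specialize (\<lambda>i. Var i ^ d i :: (nat, int) mpoly) r = 1 \<longleftrightarrow>
     r \<in> U_ring m d' \<and> inertia_deg0 m d' = gen_ideal (U_ring m d') {r} \<and>
       specialize (\<lambda>i. Var i ^ d' i :: (nat, int) mpoly) r = 1" for r
    by (metis (no_types, lifting))
  then show ?thesis
    unfolding universal_Res_def U I by simp
qed

lemma wdeg_mp_eval_le_on:
  assumes "p \<in> polys V" "\<And>x. x \<in> V \<Longrightarrow> wdeg w (v x) \<le> w' x" "\<And>c. wdeg w (\<phi> c) = 0"
  shows "wdeg w (mp_eval \<phi> v p :: ('v, 'a::comm_ring_1) mpoly) \<le> wdeg w' p"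
proof -
  have "mp_eval \<phi> v p = mp_eval \<phi> (\<lambda>x. if x \<in> V then v x else 0) p"
    by (rule mp_eval_cong[OF assms(1)]) simp
  moreover have "wdeg w (mp_eval \<phi> (\<lambda>x. if x \<in> V then v x else 0) p) \<le> wdeg w' p"
    by (rule wdeg_mp_eval_le) (use assms in auto)
  ultimately show ?thesis by simp
qed

lemma lookup_mult_keys: "Poly_Mapping.lookup (p * q) t =
   (\<Sum>s\<in>Poly_Mapping.keys p. \<Sum>u\<in>Poly_Mapping.keys q.
      if s + u = t then Poly_Mapping.lookup p s * Poly_Mapping.lookup q u else (0::'a::comm_ring_1))"
proof -
  have "p * q = (\<Sum>s\<in>Poly_Mapping.keys p. \<Sum>u\<in>Poly_Mapping.keys q.
      Poly_Mapping.single (s + u) (Poly_Mapping.lookup p s * Poly_Mapping.lookup q u))"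
    by (subst pm_sum_single[of p], subst pm_sum_single[of q])
      (simp add: sum_distrib_left sum_distrib_right mult_single sum.swap[of _ "Poly_Mapping.keys q"])
  then show ?thesis by (simp add: lookup_sum lookup_single when_def)
qed

lemma wdeg_lookup_mult:
  fixes p q :: "(nat, ('v, 'a::comm_ring_1) mpoly) mpoly"
  assumes "\<And>s. wdeg w (Poly_Mapping.lookup p s) \<le> a" "\<And>s. wdeg w (Poly_Mapping.lookup q s) \<le> b"
  shows "wdeg w (Poly_Mapping.lookup (p * q) t) \<le> a + b"
  unfolding lookup_mult_keys
  by (intro wdeg_sum_le) (auto intro: order.trans[OF wdeg_mult_le] add_mono assms)

lemma wdeg_lookup_generic: "wdeg w (Poly_Mapping.lookup (generic_poly m e k) t) \<le> w (k, t)"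
  by (simp add: lookup_generic_poly wdeg_Var)

lemma wdeg_of_int [simp]: "wdeg w (of_int c :: ('v, 'a::comm_ring_1) mpoly) = 0"
  using wdeg_Const[of w "of_int c"] by (simp only: Const_of_int)

lemma wdeg_specialize_le:
  assumes "a \<in> U_ring m d" "\<And>i \<alpha>. i \<in> {1..m} \<Longrightarrow> wdeg w (Poly_Mapping.lookup (g i) \<alpha>) \<le> w' (i, \<alpha>)"
  shows "wdeg w (specialize g a) \<le> wdeg w' a"
  unfolding specialize_def
  by (rule wdeg_mp_eval_le_on[OF assms(1)[unfolded in_U_ring_iff]])
    (use assms(2) in \<open>auto simp: coeff_vars_def\<close>)

lemma polys_specialize:
  assumes "a \<in> U_ring m d" "\<And>i \<alpha>. i \<in> {1..m} \<Longrightarrow> Poly_Mapping.lookup (g i) \<alpha> \<in> polys V"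
  shows "specialize g a \<in> polys V"
  unfolding specialize_def
proof (rule polys_mp_eval[OF assms(1)[unfolded in_U_ring_iff]])
  show "of_int c \<in> polys V" for c
    using polys_Const[of "of_int c" V] by (simp only: Const_of_int)
qed (use assms(2) in \<open>auto simp: coeff_vars_def\<close>)

text \<open>Degrees add in each group of coefficients, so the cofactor has degree 0 in every group
  that could occur in it.\<close>

lemma const_quotient:
  fixes p q \<kappa> :: coeff_ring
  assumes "p = q * \<kappa>" "p \<noteq> 0" "p \<in> polys {z. fst z \<in> S}"
    and "\<And>k. k \<in> S \<Longrightarrow> wdeg (gw k) p \<le> wdeg (gw k) q"
  shows "\<exists>c. \<kappa> = Const c"
proof -
  have nz: "q \<noteq> 0" "\<kappa> \<noteq> 0" using assms(1,2) by auto
  have \<kappa>: "\<kappa> \<in> polys {z. fst z \<in> S}"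
    using polys_factor(2)[of q \<kappa>] assms by auto
  have "Poly_Mapping.keys t = {}" if t: "t \<in> Poly_Mapping.keys \<kappa>" for t
  proof (rule ccontr)
    assume "Poly_Mapping.keys t \<noteq> {}"
    then obtain z where z: "z \<in> Poly_Mapping.keys t" by blast
    then have "fst z \<in> S" using \<kappa> t by (auto simp: polys_def)
    then have "wdeg (gw (fst z)) (q * \<kappa>) \<le> wdeg (gw (fst z)) q" using assms(1,4) by metis
    then have "wdeg (gw (fst z)) \<kappa> = 0" using wdeg_mult[OF nz, of "gw (fst z)"] by simp
    then have "wt (gw (fst z)) t = 0" using wt_le_wdeg[OF t, of "gw (fst z)"] by simp
    then have "gw (fst z) z * Poly_Mapping.lookup t z = 0"
      using z by (simp only: wt_def sum_eq_0_iff finite_keys)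
    then show False using z by (simp add: in_keys_iff)
  qed
  then have "\<kappa> \<in> polys {}" by (simp add: polys_def)
  then show ?thesis using polys_empty by blast
qed

text \<open>Both the lowest orders and the degrees of the factors add up to \<open>n\<close>, so
  they agree for each factor. It makes factors of homogeneous polynomials homogeneous.\<close>

lemma monom_factor:
  fixes p q :: "'a::idom poly"
  assumes "p * q = monom c n" "c \<noteq> 0"
  shows "p = monom (lead_coeff p) (Polynomial.degree p)"
proof -
  have nz: "p \<noteq> 0" "q \<noteq> 0" using assms by auto
  define i where "i = (LEAST i. Polynomial.coeff p i \<noteq> 0)"
  define j where "j = (LEAST j. Polynomial.coeff q j \<noteq> 0)"
  have ex: "\<exists>i. Polynomial.coeff p i \<noteq> 0" "\<exists>j. Polynomial.coeff q j \<noteq> 0"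
    using nz by (metis leading_coeff_0_iff)+
  have i: "Polynomial.coeff p i \<noteq> 0" "\<And>i'. i' < i \<Longrightarrow> Polynomial.coeff p i' = 0"
    unfolding i_def using LeastI_ex[OF ex(1)] not_less_Least by blast+
  have j: "Polynomial.coeff q j \<noteq> 0" "\<And>j'. j' < j \<Longrightarrow> Polynomial.coeff q j' = 0"
    unfolding j_def using LeastI_ex[OF ex(2)] not_less_Least by blast+
  have "Polynomial.coeff (p * q) (i + j) = (\<Sum>k\<in>{i}. Polynomial.coeff p k * Polynomial.coeff q (i + j - k))"
    unfolding coeff_mult
  proof (rule sum.mono_neutral_right)
    show "\<forall>k\<in>{..i + j} - {i}. Polynomial.coeff p k * Polynomial.coeff q (i + j - k) = 0"
    proof
      fix k assume "k \<in> {..i + j} - {i}"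
      then consider "k < i" | "i + j - k < j" by fastforce
      then show "Polynomial.coeff p k * Polynomial.coeff q (i + j - k) = 0"
        using i(2) j(2) by cases auto
    qed
  qed auto
  then have "Polynomial.coeff (monom c n) (i + j) \<noteq> 0" using i(1) j(1) assms(1) by simp
  then have "i + j = n" by (auto split: if_splits)
  moreover have "Polynomial.degree p + Polynomial.degree q = n"
    using degree_mult_eq[OF nz] assms by (simp add: degree_monom_eq)
  moreover have "i \<le> Polynomial.degree p" "j \<le> Polynomial.degree q"
    using i(1) j(1) by (auto intro: le_degree)
  ultimately have "i = Polynomial.degree p" by simp
  then show ?thesis
    using i(2) by (intro poly_eqI) (metis coeff_eq_0 coeff_monom linorder_neqE_nat)
qed

context degree_vector
begin

abbreviation R where "R \<equiv> universal_Res m d"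

lemma mac_det_nz: "j \<in> {1..m} \<Longrightarrow> mac_det j \<noteq> 0"
proof
  interpret s: comm_ring_hom spec_diag by (rule spec_diag_hom)
  show "j \<in> {1..m} \<Longrightarrow> mac_det j = 0 \<Longrightarrow> False"
    using spec_diag_mac_det[of j] by simp
qed

lemma R_prime: "prime_elem R" and R_U: "R \<in> U_ring m d" and R_iff: "inertia a \<longleftrightarrow> R dvd a"
  and R_diag: "spec_diag R = 1" and R_nz: "R \<noteq> 0"
  using is_resultant_universal_Res by (auto simp: is_resultant_def)

lemma Res_cong: "(\<And>i. i \<in> {1..m} \<Longrightarrow> g i = g' i) \<Longrightarrow> Res m d g = Res m d g'"
  unfolding Res_def by (rule specialize_cong[OF R_U])

lemma Res_diag: "Res m d (\<lambda>i. Var i ^ d i :: (nat, int) mpoly) = 1"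
  unfolding Res_def by (rule R_diag)

text \<open>The hypotheses say that \<open>\<xi>\<close> maps every zero of the generic system to a zero of \<open>g'\<close>.\<close>

theorem universal_Res_dvd:
  assumes "degree_vector m' d'" "system m' d' g'"
    and span: "\<And>i. i \<in> {1..m'} \<Longrightarrow> in_span m G (mp_eval Const \<xi> (g' i))"
    and j: "j \<in> {1..m'}" "\<xi> j = Var x"
  shows "R dvd Res m' d' g'"
proof -
  interpret D': degree_vector m' d' by fact
  have one: "1 \<in> {1..m}" using m_pos by simp
  have s: "comm_ring_hom (specialize g')" by (rule comm_ring_hom_specialize)
  define h where "h p = zero_eval 1 (mp_eval Const \<xi> (map_coeffs (specialize g') p))" for p
  have h: "comm_ring_hom h"
    unfolding h_def
    by (intro comm_ring_hom_compose[OF comm_ring_hom_compose[OF comm_ring_hom_map_coeffs[OF s]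
        comm_ring_hom_mp_eval_Const] comm_ring_hom_zero_eval])
  have "h (Const (universal_Res m' d')) = 0"
  proof (rule D'.inertia_vanish[OF _ h])
    show "D'.inertia (universal_Res m' d')" by (simp add: D'.R_iff)
    show "h (D'.G i) = 0" if "i \<in> {1..m'}" for i
      using assms(2) that zero_eval_in_span[OF one span[OF that]]
      by (simp add: h_def map_coeffs_specialize_generic system_def)
    show "j \<in> {1..m'}" by fact
    show "h (Var j) \<noteq> 0"
      by (simp add: h_def s j comm_ring_hom.mp_eval_Var[OF comm_ring_hom_Const])
  qed
  then have "zero_coeff 1 (Res m' d' g') = 0"
    by (simp add: h_def s comm_ring_hom.mp_eval_Const[OF comm_ring_hom_Const] Res_def)
  then show ?thesis using inertia_iff[OF one] R_iff by blast
qed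

text \<open>The resultant divides \<open>mac_det j\<close>, which has exactly this degree in the
  coefficients of equation \<open>j\<close>; each \<open>j\<close> needs its own
  determinant.\<close>

lemma wdeg_R_le:
  assumes j: "j \<in> {1..m}"
  shows "wdeg (gw j) R \<le> co_deg j"
proof -
  obtain q where q: "mac_det j = R * q"
    using inertia_mac_det[OF j] R_iff by blast
  have nz: "mac_det j \<noteq> 0" by (rule mac_det_nz[OF j])
  then have "wdeg (gw j) (mac_det j) = wdeg (gw j) R + wdeg (gw j) q"
    unfolding q by (intro wdeg_mult) auto
  moreover have "wdeg (gw j) (mac_det j) = co_deg j"
    unfolding wdeg_def wscale_mac_det[OF j] using nz by (simp add: degree_monom_eq)
  ultimately show ?thesis by simp
qed

lemma wdeg_R_pos:
  assumes j: "j \<in> {1..m}"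
  shows "wdeg (gw j) R > 0"
proof (rule ccontr)
  assume "\<not> wdeg (gw j) R > 0"
  then have free: "R \<in> polys {z. gw j z = 0}" by (intro wdeg_0_imp_polys) simp
  moreover have "polys {z. gw j z = 0} \<subseteq> (polys (- {top_var j j}) :: coeff_ring set)"
    by (rule polys_mono) auto
  ultimately have "R \<in> polys (- {top_var j j})" by (rule subsetD[rotated])
  moreover have "inertia R" by (simp add: R_iff)
  ultimately have "R = 0" by (rule inertia_free_eq_0[OF j, rotated])
  with R_nz show False by contradiction
qed

text \<open>Homogeneity in the coefficients of one equation is inherited from the Macaulay
  determinant through \<open>monom_factor\<close>.\<close>

lemma wt_R:
  assumes j: "j \<in> {1..m}" and t: "t \<in> Poly_Mapping.keys R"
  shows "wt (gw j) t = wdeg (gw j) R"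
proof -
  interpret s: comm_ring_hom "wscale (gw j) :: coeff_ring \<Rightarrow> _" by (rule comm_ring_hom_wscale)
  obtain q where q: "mac_det j = R * q"
    using inertia_mac_det[OF j] R_iff by blast
  have nz: "mac_det j \<noteq> 0" by (rule mac_det_nz[OF j])
  have "wscale (gw j) R * wscale (gw j) q = monom (mac_det j) (co_deg j)"
    using wscale_mac_det[OF j] unfolding q s.hom_mult .
  from monom_factor[OF this nz] have "wscale (gw j) R = monom (lead_coeff (wscale (gw j) R)) (wdeg (gw j) R)"
    by (simp only: wdeg_def)
  moreover have "Polynomial.coeff (wscale (gw j) R) (wt (gw j) t) \<noteq> 0"
    using lookup_coeff_wscale[of "gw j" R "wt (gw j) t" t] t by (auto simp: in_keys_iff)
  ultimately show ?thesis by (metis coeff_monom)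
qed

end

section \<open>Multiplicativity and the exact degrees of the resultant\<close>

lemma generic_poly_cong: "d i = e i \<Longrightarrow> generic_poly m d i = generic_poly m e i"
  by (simp add: generic_poly_def)

text \<open>Exchanges the coefficients of two equations. It lets a factor of an equation have
  indeterminate coefficients of its own, in the additional group \<open>m + 1\<close>.\<close>

definition swap_group :: "nat \<Rightarrow> nat \<Rightarrow> coeff_ring \<Rightarrow> coeff_ring" where
  "swap_group a b = mp_eval of_int (\<lambda>z. Var (transpose a b (fst z), snd z))"

lemma comm_ring_hom_swap_group: "comm_ring_hom (swap_group a b)"
  unfolding swap_group_def by (rule comm_ring_hom_mp_eval_of_int)

lemma swap_group_Var: "swap_group a b (Var z) = Var (transpose a b (fst z), snd z)"
  unfolding swap_group_def by (rule comm_ring_hom.mp_eval_Var[OF comm_ring_hom_of_int])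

lemma hom_Const_int: "comm_ring_hom \<phi> \<Longrightarrow> \<phi> (Const (c::int)) = of_int c"
  using fun_cong[OF hom_of_int_eq[OF comm_ring_hom_compose[OF comm_ring_hom_Const]], of \<phi> c] by simp

lemma swap_group_involution: "swap_group a b (swap_group a b p) = p"
  by (rule mpoly_hom_eqI[OF comm_ring_hom_compose[OF comm_ring_hom_swap_group comm_ring_hom_swap_group] comm_ring_hom_id])
    (simp_all add: swap_group_Var hom_Const_int comm_ring_hom_swap_group comm_ring_hom_compose hom_of_int_eq[THEN fun_cong] transpose_involutory
      Const_of_int[of "_::int", symmetric])

lemma map_coeffs_swap_group:
  "map_coeffs (swap_group a b) (generic_poly m d i) = generic_poly m (\<lambda>_. d i) (transpose a b i)"
proof (rule poly_mapping_eqI)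
  interpret s: comm_ring_hom "swap_group a b" by (rule comm_ring_hom_swap_group)
  show "Poly_Mapping.lookup (map_coeffs (swap_group a b) (generic_poly m d i)) \<alpha> =
      Poly_Mapping.lookup (generic_poly m (\<lambda>_. d i) (transpose a b i)) \<alpha>" for \<alpha>
    by (simp add: lookup_map_coeffs lookup_generic_poly swap_group_Var)
qed

lemma wdeg_swap_group:
  "(\<And>z. w (transpose a b (fst z), snd z) \<le> w' z) \<Longrightarrow> wdeg w (swap_group a b p) \<le> wdeg w' p"
  unfolding swap_group_def by (rule wdeg_mp_eval_le) (auto simp: wdeg_Var)

lemma specialize_swap_group: "specialize g (swap_group a b p) = specialize (\<lambda>i. g (transpose a b i)) p"
  unfolding specialize_def swap_group_def
  unfolding hom_mp_eval[OF comm_ring_hom_mp_eval_of_int] hom_of_int_eq[OF comm_ring_hom_mp_eval_of_int]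
  by (simp add: comm_ring_hom.mp_eval_Var[OF comm_ring_hom_of_int] case_prod_unfold)

lemma homogeneous_Var_power: "homogeneous k (Var x ^ k)"
  using homogeneous_power[OF homogeneous_Var, of k x] by simp

lemma polys_Var_power: "x \<in> V \<Longrightarrow> Var x ^ k \<in> polys V"
  by (intro polys_power polys_Var)

lemma wdeg_lookup_generic_0: "w (k, t) = 0 \<Longrightarrow> wdeg w (Poly_Mapping.lookup (generic_poly m e k) t) = 0"
  using wdeg_lookup_generic[of w m e k t] by simp

text \<open>The generic situation of multiplicativity: the \<open>j\<close>-th polynomial is
  \<open>A * B\<close>, where \<open>A\<close> has its coefficients in group \<open>j\<close> and
  \<open>B\<close> in group \<open>m + 1\<close>.\<close>

locale split_degree = degree_vector +
  fixes j a b :: nat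
  assumes j: "j \<in> {1..m}" and dj: "d j = a + b" and a_pos: "a \<ge> 1" and b_pos: "b \<ge> 1"
begin

sublocale DA: degree_vector m "d(j := a)"
  using m_pos d_pos a_pos by unfold_locales auto

sublocale DB: degree_vector m "d(j := b)"
  using m_pos d_pos b_pos by unfold_locales auto

definition A where "A = generic_poly m (\<lambda>_. a) j"
definition B where "B = generic_poly m (\<lambda>_. b) (m + 1)"
definition g' where "g' = G(j := A * B)"
definition rho where "rho = Res m d g'"
definition rB where "rB = swap_group j (m + 1) DB.R"

lemma AB: "A \<in> polys {1..m}" "homogeneous a A" "B \<in> polys {1..m}" "homogeneous b B"
  by (simp_all add: A_def B_def generic_poly_polys homogeneous_generic_poly[of "\<lambda>_. a", simplified]
      homogeneous_generic_poly[of "\<lambda>_. b", simplified])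

lemma sys: "system m d g'"
  using AB homogeneous_mult[OF AB(2,4)] by (auto simp: system_def g'_def dj generic_poly_polys homogeneous_generic_poly polys_mult)

lemma A_eq: "A = DA.G j" and G_eq: "i \<noteq> j \<Longrightarrow> G i = DA.G i" "i \<noteq> j \<Longrightarrow> G i = DB.G i"
  by (auto simp: A_def intro!: generic_poly_cong)

text \<open>A zero of the system with \<open>A\<close> in place \<open>j\<close> is also a zero of
  the system with \<open>A * B\<close> there.\<close>

lemma rA_dvd: "DA.R dvd rho"
  unfolding rho_def
proof (rule DA.universal_Res_dvd[OF degree_vector_axioms sys, where \<xi> = Var])
  show "1 \<in> {1..m}" using m_pos by simp
  show "in_span m DA.G (mp_eval Const Var (g' i))" if "i \<in> {1..m}" for i
  proof (cases "i = j")
    case True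
    then show ?thesis
      using in_span_mult[OF in_span_generator[OF j, of DA.G], of B] by (simp add: g'_def A_eq mult.commute)
  next
    case False
    then show ?thesis using in_span_generator[OF that, of DA.G] by (simp add: g'_def G_eq(1))
  qed
qed simp

lemma swap_rho: "swap_group j (m + 1) rho = Res m d (G(j := generic_poly m (\<lambda>_. a) (m + 1) * DB.G j))"
proof -
  interpret ms: comm_ring_hom "map_coeffs (swap_group j (m + 1)) :: (nat, coeff_ring) mpoly \<Rightarrow> _"
    by (intro comm_ring_hom_map_coeffs comm_ring_hom_swap_group)
  have B: "generic_poly m (\<lambda>_. b) j = DB.G j" by (rule generic_poly_cong) simp
  show ?thesis
    unfolding rho_def hom_Res[OF comm_ring_hom_swap_group]
  proof (rule Res_cong)
    fix i assume i: "i \<in> {1..m}"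
    show "map_coeffs (swap_group j (m + 1)) (g' i) = (G(j := generic_poly m (\<lambda>_. a) (m + 1) * DB.G j)) i"
    proof (cases "i = j")
      case True
      then show ?thesis
        by (simp add: g'_def ms.hom_mult A_def B_def map_coeffs_swap_group B)
    next
      case False
      then have "generic_poly m (\<lambda>_. d i) (transpose j (m + 1) i) = G i"
        using i by (subst transpose_apply_other) (auto intro: generic_poly_cong)
      then show ?thesis using False by (simp add: g'_def map_coeffs_swap_group)
    qed
  qed
qed

text \<open>The same for the factor \<open>B\<close>, after the exchange of groups that makes
  \<open>B\<close> the generic polynomial in place \<open>j\<close>.\<close>

lemma rB_dvd: "rB dvd rho"
proof -
  have sys': "system m d (G(j := generic_poly m (\<lambda>_. a) (m + 1) * DB.G j))"
    using homogeneous_mult[OF homogeneous_generic_poly[of "\<lambda>_. a" "m + 1" m] homogeneous_generic_poly[of "d(j := b)" j m]]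
    by (auto simp: system_def dj generic_poly_polys homogeneous_generic_poly polys_mult)
  interpret s: comm_ring_hom "swap_group j (m + 1)" by (rule comm_ring_hom_swap_group)
  have "DB.R dvd swap_group j (m + 1) rho"
    unfolding swap_rho
  proof (rule DB.universal_Res_dvd[OF degree_vector_axioms sys', where \<xi> = Var])
    show "1 \<in> {1..m}" using m_pos by simp
    show "in_span m DB.G (mp_eval Const Var ((G(j := generic_poly m (\<lambda>_. a) (m + 1) * DB.G j)) i))"
      if "i \<in> {1..m}" for i
    proof (cases "i = j")
      case True
      then show ?thesis using in_span_mult[OF in_span_generator[OF j, of DB.G]] by simp
    next
      case False
      then show ?thesis using in_span_generator[OF that, of DB.G] by (simp add: G_eq(2))
    qed
  qed simp
  then obtain c where "swap_group j (m + 1) rho = DB.R * c" by (elim dvdE)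
  then have "swap_group j (m + 1) (swap_group j (m + 1) rho) = swap_group j (m + 1) (DB.R * c)" by simp
  then have "rho = rB * swap_group j (m + 1) c"
    by (simp add: swap_group_involution s.hom_mult rB_def)
  then show ?thesis by (simp only: dvd_triv_left)
qed

text \<open>The test system: \<open>A * B\<close> becomes \<open>x_j ^ d j\<close>, so that all
  three resultants take the value 1.\<close>

definition gd :: "nat \<Rightarrow> (nat, int) mpoly" where
  "gd i = (if i = j then Var j ^ a else if i = m + 1 then Var j ^ b else Var i ^ d i)"

lemma gd: "specialize gd rho = 1" "specialize gd DA.R = 1" "specialize gd rB = 1"
proof -
  have jm: "j \<noteq> m + 1" using j by auto
  interpret ms: comm_ring_hom "map_coeffs (specialize gd) :: (nat, coeff_ring) mpoly \<Rightarrow> _"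
    by (intro comm_ring_hom_map_coeffs comm_ring_hom_specialize)
  have "map_coeffs (specialize gd) A = gd j"
    unfolding A_def using j
    by (intro map_coeffs_specialize_generic) (auto simp: gd_def homogeneous_Var_power polys_Var_power)
  moreover have "map_coeffs (specialize gd) B = gd (m + 1)"
    unfolding B_def using j jm
    by (intro map_coeffs_specialize_generic) (auto simp: gd_def homogeneous_Var_power polys_Var_power)
  moreover have "map_coeffs (specialize gd) (G i) = gd i" if "i \<in> {1..m}" "i \<noteq> j" for i
    using that
    by (intro map_coeffs_specialize_generic) (auto simp: gd_def homogeneous_Var_power polys_Var_power)
  ultimately have "map_coeffs (specialize gd) (g' i) = Var i ^ d i" if "i \<in> {1..m}" for i
    using that jm by (auto simp: g'_def ms.hom_mult gd_def dj power_add)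
  then have "specialize gd rho = Res m d (\<lambda>i. Var i ^ d i)"
    unfolding rho_def hom_Res[OF comm_ring_hom_specialize] by (rule Res_cong)
  then show "specialize gd rho = 1" using Res_diag by simp
  have "specialize gd DA.R = DA.spec_diag DA.R"
    by (rule specialize_cong[OF DA.R_U]) (auto simp: gd_def)
  then show "specialize gd DA.R = 1" by (simp only: DA.R_diag)
  have "specialize gd rB = DB.spec_diag DB.R"
    unfolding rB_def specialize_swap_group
    by (rule specialize_cong[OF DB.R_U]) (use jm in \<open>auto simp: gd_def transpose_def\<close>)
  then show "specialize gd rB = 1" by (simp only: DB.R_diag)
qed

lemma rho_nz: "rho \<noteq> 0" and rB_nz: "rB \<noteq> 0"
proof -
  interpret s: comm_ring_hom "specialize gd :: coeff_ring \<Rightarrow> int" by (rule comm_ring_hom_specialize)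
  show "rho \<noteq> 0" "rB \<noteq> 0" using gd(1,3) by auto
qed

text \<open>The resultant with \<open>A\<close> involves group \<open>j\<close>, while
  \<open>rB\<close> is free of it.\<close>

lemma rA_not_dvd_rB: "\<not> DA.R dvd rB"
proof
  assume "DA.R dvd rB"
  then obtain c where c: "rB = DA.R * c" by (elim dvdE)
  have "wdeg (gw j) rB \<le> wdeg (gw (m + 1)) DB.R"
    unfolding rB_def by (rule wdeg_swap_group) (auto simp: transpose_def)
  also have "wdeg (gw (m + 1)) DB.R = 0"
    by (rule polys_imp_wdeg_0[OF DB.R_U[unfolded in_U_ring_iff]]) (auto simp: coeff_vars_def)
  finally have "wdeg (gw j) (DA.R * c) = 0" by (simp add: c)
  then have "wdeg (gw j) DA.R = 0" using wdeg_mult[of DA.R c "gw j"] rB_nz c by auto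
  then show False using DA.wdeg_R_pos[OF j] by simp
qed

lemma rho_factor: obtains \<kappa> where "rho = DA.R * rB * \<kappa>"
proof -
  obtain x where x: "rho = rB * x" using rB_dvd by (elim dvdE)
  then have "DA.R dvd x"
    using rA_dvd rA_not_dvd_rB DA.R_prime by (simp add: prime_elem_dvd_mult_iff)
  then obtain y where "x = DA.R * y" by (elim dvdE)
  with x that[of y] show ?thesis by (simp add: mult_ac)
qed

text \<open>The coefficients of \<open>A * B\<close> are linear in each of the groups
  \<open>j\<close> and \<open>m + 1\<close>, so both degrees are bounded by that of \<open>R\<close>
  in group \<open>j\<close>.\<close>

lemma wdeg_rho:
  shows "k \<in> {1..m} - {j} \<Longrightarrow> wdeg (gw k) rho \<le> wdeg (gw k) R"
    and "wdeg (gw j) rho \<le> wdeg (gw j) R" and "wdeg (gw (m + 1)) rho \<le> wdeg (gw j) R"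
proof -
  have AB: "wdeg w (Poly_Mapping.lookup (A * B) \<alpha>) \<le> x + y"
    if "\<And>\<alpha>. w (j, \<alpha>) \<le> x" "\<And>\<alpha>. w (m + 1, \<alpha>) \<le> y" for w :: "nat \<times> (nat \<Rightarrow>\<^sub>0 nat) \<Rightarrow> nat" and x y \<alpha>
    unfolding A_def B_def
    by (intro wdeg_lookup_mult order.trans[OF wdeg_lookup_generic] that)
  have jm: "j \<noteq> m + 1" using j by auto
  show "wdeg (gw k) rho \<le> wdeg (gw k) R" if "k \<in> {1..m} - {j}"
    unfolding rho_def Res_def
    by (rule wdeg_specialize_le[OF R_U])
      (use that AB[of "gw k" 0 0] order.trans[OF wdeg_lookup_generic] in \<open>auto simp: g'_def wdeg_lookup_generic_0\<close>)
  show "wdeg (gw j) rho \<le> wdeg (gw j) R"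
    unfolding rho_def Res_def
    by (rule wdeg_specialize_le[OF R_U])
      (use jm AB[of "gw j" 1 0] order.trans[OF wdeg_lookup_generic] in \<open>auto simp: g'_def wdeg_lookup_generic_0\<close>)
  show "wdeg (gw (m + 1)) rho \<le> wdeg (gw j) R"
    unfolding rho_def Res_def
    by (rule wdeg_specialize_le[OF R_U])
      (use jm AB[of "gw (m + 1)" 0 1] order.trans[OF wdeg_lookup_generic] in \<open>auto simp: g'_def wdeg_lookup_generic_0\<close>)
qed

lemma wdeg_rB:
  shows "k \<in> {1..m} - {j} \<Longrightarrow> wdeg (gw k) DB.R \<le> wdeg (gw k) rB"
    and "wdeg (gw j) DB.R \<le> wdeg (gw (m + 1)) rB"
proof -
  have inv: "DB.R = swap_group j (m + 1) rB" by (simp add: rB_def swap_group_involution)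
  show "wdeg (gw k) DB.R \<le> wdeg (gw k) rB" if "k \<in> {1..m} - {j}"
    by (subst inv, rule wdeg_swap_group) (use that in \<open>auto simp: transpose_def\<close>)
  show "wdeg (gw j) DB.R \<le> wdeg (gw (m + 1)) rB"
    by (subst inv, rule wdeg_swap_group) (auto simp: transpose_def)
qed

text \<open>Divisibility alone gives this inequality. It serves the induction for the lower bound on
  degrees, before equality in \<open>rho_eq\<close> is available. For \<open>k = j\<close> only the
  factor with \<open>A\<close> counts, since \<open>B\<close> has its coefficients in another
  group.\<close>

lemma wdeg_R_ge:
  assumes "k \<in> {1..m}"
  shows "wdeg (gw k) DA.R + (if k = j then 0 else wdeg (gw k) DB.R) \<le> wdeg (gw k) R"
proof -
  obtain \<kappa> where \<kappa>: "rho = DA.R * rB * \<kappa>" by (rule rho_factor)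
  have nz: "DA.R * rB \<noteq> 0" "\<kappa> \<noteq> 0" using rho_nz \<kappa> by auto
  have "wdeg (gw k) rho = wdeg (gw k) DA.R + wdeg (gw k) rB + wdeg (gw k) \<kappa>"
    unfolding \<kappa> using nz rB_nz DA.R_nz by (simp add: wdeg_mult)
  then show ?thesis using wdeg_rho(1)[of k] wdeg_rho(2) wdeg_rB(1)[of k] assms by (cases "k = j") auto
qed

end

lemma co_deg_split:
  assumes "split_degree m d j a b" "k \<in> {1..m}"
  shows "degree_vector.co_deg m (d(j := a)) k + (if k = j then 0 else degree_vector.co_deg m (d(j := b)) k)
    = degree_vector.co_deg m d k"
proof -
  interpret split_degree m d j a b by fact
  have eq: "(\<Prod>i\<in>{1..m} - {k} - {j}. (d(j := x)) i) = (\<Prod>i\<in>{1..m} - {k} - {j}. d i)" for x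
    by (intro prod.cong) auto
  show ?thesis
  proof (cases "k = j")
    case True
    then show ?thesis by (simp add: co_deg_def DA.co_deg_def)
  next
    case False
    then have "j \<in> {1..m} - {k}" using j by simp
    then show ?thesis using False
      by (simp add: co_deg_def DA.co_deg_def DB.co_deg_def prod.remove[of _ j] eq dj distrib_right)
  qed
qed

text \<open>Splitting degree 1 off an equation keeps the bound by \<open>wdeg_R_ge\<close> and
  \<open>co_deg_split\<close>. When all degrees are 1, the bound is 1 and holds because the
  resultant involves every equation.\<close>

lemma co_deg_le_wdeg:
  "degree_vector m d \<Longrightarrow> k \<in> {1..m} \<Longrightarrow> degree_vector.co_deg m d k \<le> wdeg (gw k) (universal_Res m d)"
proof (induction "\<Sum>i\<in>{1..m}. d i" arbitrary: d k rule: less_induct)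
  case less
  interpret degree_vector m d by (rule less.prems)
  show ?case
  proof (cases "\<forall>i\<in>{1..m}. d i = 1")
    case True
    then have "co_deg k = 1" by (simp add: co_deg_def)
    then show ?thesis using wdeg_R_pos[OF less.prems(2)] by linarith
  next
    case False
    then obtain j where j: "j \<in> {1..m}" "d j \<noteq> 1" by blast
    then have two: "d j \<ge> 2" using d_pos[of j] by linarith
    interpret split_degree m d j 1 "d j - 1"
      by unfold_locales (use j two in auto)
    have sum: "(\<Sum>i\<in>{1..m}. (d(j := x)) i) < (\<Sum>i\<in>{1..m}. d i)" if "x < d j" for x
      by (rule sum_strict_mono_ex1) (use that j in auto)
    have "co_deg k = DA.co_deg k + (if k = j then 0 else DB.co_deg k)"
      using co_deg_split[OF split_degree_axioms less.prems(2)] by simp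
    also have "\<dots> \<le> wdeg (gw k) DA.R + (if k = j then 0 else wdeg (gw k) DB.R)"
      using less.hyps[OF sum DA.degree_vector_axioms less.prems(2)] less.hyps[OF sum DB.degree_vector_axioms less.prems(2)] two
      by auto
    also have "\<dots> \<le> wdeg (gw k) R" by (rule wdeg_R_ge[OF less.prems(2)])
    finally show ?thesis .
  qed
qed

context degree_vector
begin

theorem wdeg_R: "k \<in> {1..m} \<Longrightarrow> wdeg (gw k) R = co_deg k"
  using wdeg_R_le co_deg_le_wdeg[OF degree_vector_axioms] by (metis antisym)

end

context split_degree
begin

text \<open>With exact degrees at hand the cofactor of \<open>rho_factor\<close> has degree 0 in all
  groups, so it is an integer, and the test system \<open>gd\<close> gives its value.\<close>

theorem rho_eq: "rho = DA.R * rB"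
proof -
  obtain \<kappa> where \<kappa>: "rho = DA.R * rB * \<kappa>" by (rule rho_factor)
  have "\<exists>c. \<kappa> = Const c"
  proof (rule const_quotient[OF \<kappa> rho_nz, of "{1..m + 1}"])
    have "Poly_Mapping.lookup (A * B) \<alpha> \<in> polys {z. fst z \<in> {1..m + 1}}" for \<alpha>
      unfolding lookup_mult_keys A_def B_def using j
      by (auto simp: lookup_generic_poly intro!: polys_sum polys_mult polys_Var)
    then show "rho \<in> polys {z. fst z \<in> {1..m + 1}}"
      unfolding rho_def Res_def
      by (intro polys_specialize[OF R_U]) (auto simp: g'_def lookup_generic_poly intro!: polys_Var)
    fix k assume k: "k \<in> {1..m + 1}"
    have w: "wdeg (gw k) (DA.R * rB) = wdeg (gw k) DA.R + wdeg (gw k) rB" for k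
      by (rule wdeg_mult[OF DA.R_nz rB_nz])
    consider "k = j" | "k = m + 1" | "k \<in> {1..m} - {j}" using k by fastforce
    then show "wdeg (gw k) rho \<le> wdeg (gw k) (DA.R * rB)"
    proof cases
      case 1
      have "wdeg (gw j) R = wdeg (gw j) DA.R"
        using wdeg_R[OF j] DA.wdeg_R[OF j] co_deg_split[OF split_degree_axioms j] by simp
      then show ?thesis unfolding w 1 using wdeg_rho(2) by simp
    next
      case 2
      have "wdeg (gw j) R = wdeg (gw j) DB.R"
        using wdeg_R[OF j] DB.wdeg_R[OF j] by (simp add: co_deg_def DB.co_deg_def)
      then show ?thesis unfolding w 2 using wdeg_rho(3) wdeg_rB(2) by simp
    next
      case 3
      then have k: "k \<in> {1..m}" "k \<noteq> j" by auto
      have "wdeg (gw k) R = wdeg (gw k) DA.R + wdeg (gw k) DB.R"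
        using wdeg_R[OF k(1)] DA.wdeg_R[OF k(1)] DB.wdeg_R[OF k(1)] co_deg_split[OF split_degree_axioms k(1)] k(2) by simp
      then show ?thesis unfolding w using wdeg_rho(1)[OF 3] wdeg_rB(1)[OF 3] by simp
    qed
  qed
  then obtain c where c: "\<kappa> = Const c" by blast
  interpret s: comm_ring_hom "specialize gd :: coeff_ring \<Rightarrow> int" by (rule comm_ring_hom_specialize)
  have "specialize gd (Const c :: coeff_ring) = (1::int)"
    using gd unfolding \<kappa> c s.hom_mult by simp
  then have "c = 1" by simp
  then show ?thesis using \<kappa> c by simp
qed

end

theorem Res_mult:
  fixes g :: "nat \<Rightarrow> (nat, 'a::comm_ring_1) mpoly"
  assumes "degree_vector m d" "j \<in> {1..m}" "d j = a + b" "a \<ge> 1" "b \<ge> 1"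
    and g: "\<And>i. i \<in> {1..m} - {j} \<Longrightarrow> g i \<in> polys {1..m}" "\<And>i. i \<in> {1..m} - {j} \<Longrightarrow> homogeneous (d i) (g i)"
    and p: "p \<in> polys {1..m}" "homogeneous a p" and q: "q \<in> polys {1..m}" "homogeneous b q"
  shows "Res m d (g(j := p * q)) = Res m (d(j := a)) (g(j := p)) * Res m (d(j := b)) (g(j := q))"
proof -
  interpret degree_vector m d by fact
  interpret split_degree m d j a b by unfold_locales (use assms in auto)
  have jm: "j \<noteq> m + 1" using j by auto
  define \<phi> where "\<phi> = specialize (g(j := p, m + 1 := q))"
  have \<phi>: "comm_ring_hom \<phi>" unfolding \<phi>_def by (rule comm_ring_hom_specialize)
  interpret s: comm_ring_hom \<phi> by (rule \<phi>)
  interpret ms: comm_ring_hom "map_coeffs \<phi> :: (nat, coeff_ring) mpoly \<Rightarrow> _"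
    by (intro comm_ring_hom_map_coeffs \<phi>)
  have "map_coeffs \<phi> A = p"
    unfolding A_def \<phi>_def using p jm by (subst map_coeffs_specialize_generic) auto
  moreover have "map_coeffs \<phi> B = q"
    unfolding B_def \<phi>_def using q jm by (subst map_coeffs_specialize_generic) auto
  moreover have "map_coeffs \<phi> (G i) = g i" if "i \<in> {1..m}" "i \<noteq> j" for i
    unfolding \<phi>_def using g that by (subst map_coeffs_specialize_generic) auto
  ultimately have "\<phi> rho = Res m d (g(j := p * q))"
    unfolding rho_def hom_Res[OF \<phi>] by (intro Res_cong) (auto simp: g'_def ms.hom_mult)
  moreover have "\<phi> DA.R = Res m (d(j := a)) (g(j := p))"
    unfolding \<phi>_def Res_def by (rule specialize_cong[OF DA.R_U]) auto
  moreover have "\<phi> rB = Res m (d(j := b)) (g(j := q))"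
    unfolding \<phi>_def Res_def rB_def specialize_swap_group
    by (rule specialize_cong[OF DB.R_U]) (use jm in \<open>auto simp: transpose_def\<close>)
  ultimately show ?thesis using rho_eq s.hom_mult by simp
qed

text \<open>All monomials of the universal resultant have the same degree in group \<open>j\<close>,
  which is the exponent of \<open>c\<close>.\<close>

theorem Res_scale:
  fixes g :: "nat \<Rightarrow> (nat, 'a::comm_ring_1) mpoly"
  assumes "degree_vector m d" "j \<in> {1..m}"
  shows "Res m d (g(j := Const c * g j)) = c ^ (\<Prod>i\<in>{1..m} - {j}. d i) * Res m d g"
proof -
  interpret degree_vector m d by fact
  define v where "v g = (\<lambda>(i, \<alpha>). Poly_Mapping.lookup (g i :: (nat, 'a) mpoly) \<alpha>)" for g :: "nat \<Rightarrow> _"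
  have lc: "Poly_Mapping.lookup (Const c * p) t = c * Poly_Mapping.lookup p t" for p :: "(nat, 'a) mpoly" and t
    unfolding Const_def by (simp add: lookup_mult_keys keys_single in_keys_iff)
  have v: "v (g(j := Const c * g j)) z = c ^ gw j z * v g z" for z
    by (cases z) (auto simp: v_def lc)
  have "mon_eval (v (g(j := Const c * g j))) t = c ^ wt (gw j) t * mon_eval (v g) t" for t
    by (simp add: mon_eval_def v wt_def power_mult_distrib prod.distrib power_mult[symmetric] power_sum)
  moreover have "wt (gw j) t = co_deg j" if "t \<in> Poly_Mapping.keys R" for t
    using wt_R[OF assms(2) that] wdeg_R[OF assms(2)] by simp
  ultimately have "mp_eval of_int (v (g(j := Const c * g j))) R = c ^ co_deg j * mp_eval of_int (v g) R"
    by (simp add: mp_eval_keys sum_distrib_left mult_ac)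
  then show ?thesis by (simp add: Res_def specialize_def v_def co_deg_def)
qed

section \<open>Elementary operations on the equations\<close>

lemma lookup_Const_mult: "Poly_Mapping.lookup (Const c * p) t = c * Poly_Mapping.lookup p t"
  unfolding Const_def by (simp add: lookup_mult_keys in_keys_iff)

lemma Res_cong':
  assumes "degree_vector m d" "\<And>i. i \<in> {1..m} \<Longrightarrow> d i = d' i" "\<And>i. i \<in> {1..m} \<Longrightarrow> g i = g' i"
  shows "Res m d g = Res m d' g'"
proof -
  interpret degree_vector m d by fact
  have "Res m d' g' = Res m d g'"
    unfolding Res_def using universal_Res_cong[of m d d'] assms(2) by simp
  then show ?thesis using Res_cong[OF assms(3)] by simp
qed

locale elementary_step = degree_vector +
  fixes i j :: nat
  assumes i: "i \<in> {1..m}" and j: "j \<in> {1..m}" and ij: "i \<noteq> j" and dij: "d i \<le> d j"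
begin

definition H where "H = generic_poly m (\<lambda>_. d j - d i) (m + 1)"

text \<open>The morphism that adds \<open>k * H * f_i\<close> to the generic polynomial
  \<open>f_j\<close>. The integer \<open>k\<close> makes the inverse morphism available as the case
  \<open>- k\<close>.\<close>

definition shear :: "int \<Rightarrow> coeff_ring \<Rightarrow> coeff_ring" where
  "shear k = mp_eval of_int (\<lambda>z. if fst z = j then Var z + Const k * Poly_Mapping.lookup (H * G i) (snd z) else Var z)"

lemma comm_ring_hom_shear: "comm_ring_hom (shear k)"
  unfolding shear_def by (rule comm_ring_hom_mp_eval_of_int)

lemma shear_Var: "shear k (Var z) = (if fst z = j then Var z + Const k * Poly_Mapping.lookup (H * G i) (snd z) else Var z)"
  unfolding shear_def by (rule comm_ring_hom.mp_eval_Var[OF comm_ring_hom_of_int])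

lemma HG_polys: "Poly_Mapping.lookup (H * G i) \<alpha> \<in> polys {z. fst z \<noteq> j}"
  unfolding lookup_mult_keys H_def using i j ij
  by (auto simp: lookup_generic_poly intro!: polys_sum polys_mult polys_Var)

lemma shear_free: "p \<in> polys {z. fst z \<noteq> j} \<Longrightarrow> shear k p = p"
proof -
  assume "p \<in> polys {z. fst z \<noteq> j}"
  then have "shear k p = mp_eval of_int Var p"
    unfolding shear_def by (rule mp_eval_cong) auto
  then show ?thesis by simp
qed

lemma shear_inverse: "shear k (shear (- k) p) = p"
proof (rule mpoly_hom_eqI[OF comm_ring_hom_compose[OF comm_ring_hom_shear comm_ring_hom_shear] comm_ring_hom_id])
  interpret s: comm_ring_hom "shear k" by (rule comm_ring_hom_shear)
  show "shear k (shear (- k) (Const c)) = Const c" for c by (simp add: shear_free)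
  show "shear k (shear (- k) (Var z)) = Var z" for z
    by (simp add: shear_Var s.hom_add s.hom_mult s.hom_minus shear_free HG_polys Const_uminus)
qed

lemma shear_R: "shear k R = Res m d (G(j := G j + Const (Const k) * (H * G i)))"
  unfolding shear_def Res_def specialize_def
  by (rule mp_eval_cong[OF R_U[unfolded in_U_ring_iff]])
    (auto simp: coeff_vars_def lookup_add lookup_Const_mult lookup_generic_poly)

lemma R_dvd_shear: "R dvd shear k R"
  unfolding shear_R
proof (rule universal_Res_dvd[OF degree_vector_axioms, where \<xi> = Var])
  have "H * G i \<in> polys {1..m}" "homogeneous (d j) (H * G i)"
    using homogeneous_mult[OF homogeneous_generic_poly[of "\<lambda>_. d j - d i" "m + 1" m] homogeneous_generic_poly[of d i m]] dij
    by (simp_all add: H_def polys_mult generic_poly_polys)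
  then show "system m d (G(j := G j + Const (Const k) * (H * G i)))"
    using homogeneous_mult[OF homogeneous_Const[of "Const k"], of "d j" "H * G i"]
    by (auto simp: system_def generic_poly_polys homogeneous_generic_poly polys_add polys_mult homogeneous_add)
  show "1 \<in> {1..m}" using m_pos by simp
  show "in_span m G (mp_eval Const Var ((G(j := G j + Const (Const k) * (H * G i))) l))" if l: "l \<in> {1..m}" for l
    using in_span_generator[OF l, of G] in_span_mult[OF in_span_generator[OF i, of G], of "Const (Const k) * H"]
    by (auto simp: mult.assoc intro: in_span_add)
qed simp

definition forget :: "coeff_ring \<Rightarrow> coeff_ring" where
  "forget = mp_eval of_int (\<lambda>z. if fst z = m + 1 then 0 else Var z)"

lemma comm_ring_hom_forget: "comm_ring_hom forget"
  unfolding forget_def by (rule comm_ring_hom_mp_eval_of_int)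

lemma forget_Var: "forget (Var z) = (if fst z = m + 1 then 0 else Var z)"
  unfolding forget_def by (rule comm_ring_hom.mp_eval_Var[OF comm_ring_hom_of_int])

lemma forget_U: "p \<in> U_ring m d \<Longrightarrow> forget p = p"
proof -
  assume "p \<in> U_ring m d"
  then have "forget p = mp_eval of_int Var p"
    unfolding forget_def in_U_ring_iff by (rule mp_eval_cong) (auto simp: coeff_vars_def)
  then show ?thesis by simp
qed

lemma forget_shear: "forget (shear k R) = R"
proof -
  interpret f: comm_ring_hom forget by (rule comm_ring_hom_forget)
  have HG: "forget (Poly_Mapping.lookup (H * G i) \<alpha>) = 0" for \<alpha>
    unfolding lookup_mult_keys f.hom_sum
    by (intro sum.neutral ballI) (auto simp: f.hom_mult H_def lookup_generic_poly forget_Var)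
  have "forget (shear k R) = mp_eval of_int (\<lambda>z. forget (if fst z = j then Var z + Const k * Poly_Mapping.lookup (H * G i) (snd z) else Var z)) R"
    unfolding shear_def hom_mp_eval[OF comm_ring_hom_forget] hom_of_int_eq[OF comm_ring_hom_forget] ..
  also have "\<dots> = mp_eval of_int Var R"
    by (rule mp_eval_cong[OF R_U[unfolded in_U_ring_iff]])
      (auto simp: coeff_vars_def f.hom_add f.hom_mult HG forget_Var)
  finally show ?thesis by simp
qed

text \<open>The resultant divides its images under the shear and its inverse, so the cofactor is a
  unit and therefore an integer; putting \<open>H = 0\<close> shows it to be 1. No degrees are
  compared.\<close>

theorem shear_R_eq: "shear 1 R = R"
proof -
  interpret s: comm_ring_hom "shear 1" by (rule comm_ring_hom_shear)
  interpret f: comm_ring_hom forget by (rule comm_ring_hom_forget)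
  obtain x where x: "shear 1 R = R * x" using R_dvd_shear[of 1] by (elim dvdE)
  obtain y where y: "shear (- 1) R = R * y" using R_dvd_shear[of "- 1"] by (elim dvdE)
  have "R = shear 1 (shear (- 1) R)" by (simp only: shear_inverse)
  also have "\<dots> = R * (x * shear 1 y)" unfolding y s.hom_mult x by (simp only: mult.assoc)
  finally have "R * 1 = R * (x * shear 1 y)" by simp
  then have "x * shear 1 y = 1" using R_nz by (metis mult_left_cancel)
  then have xc: "x = Const (Poly_Mapping.lookup x 0)" by (rule unit_int_mpoly)
  have "forget x = x" unfolding forget_def
    by (subst (1 2) xc) (simp add: comm_ring_hom.mp_eval_Const[OF comm_ring_hom_of_int] Const_of_int[of "_::int", symmetric])
  then have "R * 1 = R * x" using forget_shear[of 1] unfolding x f.hom_mult by (simp add: forget_U R_U)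
  then have "x = 1" using R_nz by (metis mult_left_cancel)
  then show ?thesis using x by simp
qed

end

theorem Res_add:
  fixes g :: "nat \<Rightarrow> (nat, 'a::comm_ring_1) mpoly"
  assumes "degree_vector m d" "system m d g" "i \<in> {1..m}" "j \<in> {1..m}" "i \<noteq> j" "d i \<le> d j"
    and h: "h \<in> polys {1..m}" "homogeneous (d j - d i) h"
  shows "Res m d (g(j := g j + h * g i)) = Res m d g"
proof -
  interpret degree_vector m d by fact
  interpret elementary_step m d i j by unfold_locales (use assms in auto)
  define \<phi> where "\<phi> = specialize (g(m + 1 := h))"
  have \<phi>: "comm_ring_hom \<phi>" unfolding \<phi>_def by (rule comm_ring_hom_specialize)
  interpret s: comm_ring_hom \<phi> by (rule \<phi>)
  interpret ms: comm_ring_hom "map_coeffs \<phi> :: (nat, coeff_ring) mpoly \<Rightarrow> _"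
    by (intro comm_ring_hom_map_coeffs \<phi>)
  have H: "map_coeffs \<phi> H = h"
    unfolding H_def \<phi>_def using h by (subst map_coeffs_specialize_generic) auto
  have G: "map_coeffs \<phi> (G l) = g l" if "l \<in> {1..m}" for l
    unfolding \<phi>_def using assms(2) that by (subst map_coeffs_specialize_generic) (auto simp: system_def)
  have "\<phi> (shear 1 R) = Res m d (g(j := g j + h * g i))"
    unfolding shear_R hom_Res[OF \<phi>]
    by (rule Res_cong) (use i j in \<open>auto simp: ms.hom_add ms.hom_mult H G\<close>)
  moreover have "\<phi> R = Res m d g"
    unfolding \<phi>_def Res_def by (rule specialize_cong[OF R_U]) auto
  ultimately show ?thesis by (simp add: shear_R_eq)
qed

text \<open>Linear forms are split off one at a time by multiplicativity. This evaluates the test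
  systems that fix the remaining integer factors and signs.\<close>

lemma Res_powers:
  fixes L :: "nat \<Rightarrow> (nat, 'a::comm_ring_1) mpoly"
  assumes L: "\<And>i. i \<in> {1..m} \<Longrightarrow> L i \<in> polys {1..m}" "\<And>i. i \<in> {1..m} \<Longrightarrow> homogeneous 1 (L i)"
  shows "degree_vector m d \<Longrightarrow> Res m d (\<lambda>i. L i ^ d i) = Res m (\<lambda>_. 1) L ^ (\<Prod>i\<in>{1..m}. d i)"
proof (induction "\<Sum>i\<in>{1..m}. d i" arbitrary: d rule: less_induct)
  case less
  interpret degree_vector m d by (rule less.prems)
  show ?case
  proof (cases "\<forall>i\<in>{1..m}. d i = 1")
    case True
    then have "Res m d (\<lambda>i. L i ^ d i) = Res m (\<lambda>_. 1) L"
      by (intro Res_cong'[OF less.prems]) auto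
    then show ?thesis using True by simp
  next
    case False
    then obtain j where j: "j \<in> {1..m}" "d j \<noteq> 1" by blast
    then have two: "d j \<ge> 2" using d_pos[of j] by linarith
    have sum: "(\<Sum>i\<in>{1..m}. (d(j := x)) i) < (\<Sum>i\<in>{1..m}. d i)" if "x < d j" for x
      by (rule sum_strict_mono_ex1) (use that j in auto)
    have dv: "degree_vector m (d(j := x))" if "x \<ge> 1" for x
      using m_pos d_pos that by unfold_locales auto
    have Lpow: "L i ^ k \<in> polys {1..m}" "homogeneous k (L i ^ k)" if "i \<in> {1..m}" for i k
      using homogeneous_power[OF L(2)[OF that], of k] L(1)[OF that] by (simp_all add: polys_power)
    have split: "Res m d ((\<lambda>i. L i ^ d i)(j := L j ^ 1 * L j ^ (d j - 1))) =
        Res m (d(j := 1)) ((\<lambda>i. L i ^ d i)(j := L j ^ 1)) * Res m (d(j := d j - 1)) ((\<lambda>i. L i ^ d i)(j := L j ^ (d j - 1)))"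
      by (rule Res_mult[OF less.prems j(1)]) (use two Lpow Lpow[of j 1] j in auto)
    have upd: "(\<lambda>i. L i ^ d i)(j := L j ^ x) = (\<lambda>i. L i ^ (d(j := x)) i)" for x
      by (simp add: fun_eq_iff)
    have "L j ^ 1 * L j ^ (d j - 1) = L j ^ (1 + (d j - 1))" by (simp only: power_add)
    also have "1 + (d j - 1) = d j" using two by simp
    finally have "(\<lambda>i. L i ^ d i)(j := L j ^ 1 * L j ^ (d j - 1)) = (\<lambda>i. L i ^ d i)" by (simp add: fun_eq_iff)
    with split have "Res m d (\<lambda>i. L i ^ d i) = Res m (d(j := 1)) (\<lambda>i. L i ^ (d(j := 1)) i) *
        Res m (d(j := d j - 1)) (\<lambda>i. L i ^ (d(j := d j - 1)) i)"
      unfolding upd by simp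
    also have "\<dots> = Res m (\<lambda>_. 1) L ^ ((\<Prod>i\<in>{1..m}. (d(j := 1)) i) + (\<Prod>i\<in>{1..m}. (d(j := d j - 1)) i))"
      using less.hyps[OF sum dv, of 1] less.hyps[OF sum dv, of "d j - 1"] two by (simp add: power_add)
    also have "(\<Prod>i\<in>{1..m}. (d(j := 1)) i) + (\<Prod>i\<in>{1..m}. (d(j := d j - 1)) i) = (\<Prod>i\<in>{1..m}. d i)"
    proof -
      have "(\<Prod>i\<in>{1..m}. (d(j := x)) i) = x * (\<Prod>i\<in>{1..m} - {j}. d i)" for x
      proof -
        have "(\<Prod>i\<in>{1..m}. (d(j := x)) i) = x * (\<Prod>i\<in>{1..m} - {j}. (d(j := x)) i)"
          using j(1) by (simp add: prod.remove)
        also have "(\<Prod>i\<in>{1..m} - {j}. (d(j := x)) i) = (\<Prod>i\<in>{1..m} - {j}. d i)"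
          by (rule prod.cong) auto
        finally show ?thesis .
      qed
      note * = this
      show ?thesis
        unfolding *[of 1] *[of "d j - 1"] *[of "d j", unfolded fun_upd_triv] distrib_right[symmetric]
        using two by simp
    qed
    finally show ?thesis .
  qed
qed

lemma Res_Var: "m \<ge> 1 \<Longrightarrow> Res m (\<lambda>_. 1) (Var :: nat \<Rightarrow> (nat, int) mpoly) = 1"
proof -
  assume "m \<ge> 1"
  then interpret degree_vector m "\<lambda>_. 1" by unfold_locales auto
  show ?thesis using Res_diag by simp
qed

section \<open>Renaming and adding indeterminates\<close>

lemma polys_subst_vars: "p \<in> polys V \<Longrightarrow> (\<And>x. x \<in> V \<Longrightarrow> f x \<in> W) \<Longrightarrow> subst_vars f p \<in> polys W"
  unfolding subst_vars_def by (rule polys_mp_eval) (auto intro: polys_Var)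

lemma homogeneous_subst_vars: "homogeneous e p \<Longrightarrow> homogeneous e (subst_vars f p)"
  unfolding subst_vars_def
  using homogeneous_mp_eval[of e p "\<lambda>x. Var (f x)" Const] by (simp add: One_nat_def)

lemma comm_ring_hom_subst_vars: "comm_ring_hom (subst_vars f)"
  unfolding subst_vars_def by (rule comm_ring_hom_mp_eval_Const)

lemma subst_vars_Var [simp]: "subst_vars f (Var x) = Var (f x)"
  and subst_vars_Const [simp]: "subst_vars f (Const c) = Const c"
  unfolding subst_vars_def
  by (rule comm_ring_hom.mp_eval_Var comm_ring_hom.mp_eval_Const, rule comm_ring_hom_Const)+

lemma subst_vars_compose: "subst_vars f (subst_vars g p) = subst_vars (f \<circ> g) p"
  by (rule mpoly_hom_eqI[OF comm_ring_hom_compose[OF comm_ring_hom_subst_vars comm_ring_hom_subst_vars] comm_ring_hom_subst_vars])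
    simp_all

lemma subst_vars_cong: "p \<in> polys V \<Longrightarrow> (\<And>x. x \<in> V \<Longrightarrow> f x = g x) \<Longrightarrow> subst_vars f p = subst_vars g p"
  unfolding subst_vars_def by (rule mp_eval_cong) auto

lemma subst_vars_id: "subst_vars (\<lambda>x. x) p = p"
  by (simp add: subst_vars_def)

lemma mp_eval_subst_vars: "mp_eval Const (\<lambda>x. Var (f x)) p = subst_vars f p"
  by (simp add: subst_vars_def)

lemma map_coeffs_subst_vars:
  assumes "comm_ring_hom \<phi>"
  shows "map_coeffs \<phi> (subst_vars f p) = subst_vars f (map_coeffs \<phi> p)"
  by (rule mpoly_hom_eqI[OF comm_ring_hom_compose[OF comm_ring_hom_subst_vars comm_ring_hom_map_coeffs[OF assms]]
        comm_ring_hom_compose[OF comm_ring_hom_map_coeffs[OF assms] comm_ring_hom_subst_vars]])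
    (simp_all add: assms)

lemma lookup_subst_vars:
  fixes p :: "('v, 'c::comm_ring_1) mpoly"
  shows "Poly_Mapping.lookup (subst_vars f p) t =
   (\<Sum>s\<in>Poly_Mapping.keys p. if mon_subst (\<lambda>x. Poly_Mapping.single (f x) 1) s = t then Poly_Mapping.lookup p s else 0)"
proof -
  have "mon_eval (\<lambda>x. Var (f x)) s = Poly_Mapping.single (mon_subst (\<lambda>x. Poly_Mapping.single (f x) 1) s) (1 :: 'c)" for s
    using mon_eval_single_subst[of "\<lambda>x. Poly_Mapping.single (f x) 1" "\<lambda>_. 1 :: 'c" s]
    by (simp add: Var_def mon_eval_def)
  then have "subst_vars f p = (\<Sum>s\<in>Poly_Mapping.keys p. Poly_Mapping.single (mon_subst (\<lambda>x. Poly_Mapping.single (f x) 1) s) (Poly_Mapping.lookup p s))"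
    by (simp add: subst_vars_def mp_eval_keys Const_def mult_single)
  then show ?thesis by (simp add: lookup_sum lookup_single when_def)
qed

text \<open>A system of the same degrees that has a zero whenever the generic one does, up to a
  constant factor.\<close>

lemma (in degree_vector) Res_const_multiple:
  fixes g' :: "nat \<Rightarrow> (nat, coeff_ring) mpoly" and \<psi> :: "coeff_ring \<Rightarrow> int"
  assumes dv': "degree_vector m' d'" and "system m' d' g'"
    and span: "\<And>i. i \<in> {1..m'} \<Longrightarrow> in_span m G (mp_eval Const \<xi> (g' i))"
    and j: "j \<in> {1..m'}" "\<xi> j = Var x"
    and \<psi>: "comm_ring_hom \<psi>" "\<psi> (Res m' d' g') \<noteq> 0"
    and vars: "\<And>i \<alpha>. i \<in> {1..m'} \<Longrightarrow> Poly_Mapping.lookup (g' i) \<alpha> \<in> polys {z. fst z \<in> {1..m}}"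
    and degs: "\<And>k i \<alpha>. k \<in> {1..m} \<Longrightarrow> i \<in> {1..m'} \<Longrightarrow> wdeg (gw k) (Poly_Mapping.lookup (g' i) \<alpha>) \<le> gw (\<pi> k) (i, \<alpha>)"
    and \<pi>: "\<And>k. k \<in> {1..m} \<Longrightarrow> \<pi> k \<in> {1..m'}" "\<And>k. k \<in> {1..m} \<Longrightarrow> (\<Prod>i\<in>{1..m'} - {\<pi> k}. d' i) = co_deg k"
  shows "\<exists>c. Res m' d' g' = R * Const c"
proof -
  interpret D': degree_vector m' d' by fact
  interpret \<psi>: comm_ring_hom \<psi> by fact
  have "R dvd Res m' d' g'" by (rule universal_Res_dvd[OF dv' assms(2) span j])
  then obtain \<kappa> where \<kappa>: "Res m' d' g' = R * \<kappa>" by (elim dvdE)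
  have "\<exists>c. \<kappa> = Const c"
  proof (rule const_quotient[OF \<kappa>])
    show "Res m' d' g' \<noteq> 0" using \<psi>(2) by auto
    show "Res m' d' g' \<in> polys {z. fst z \<in> {1..m}}"
      unfolding Res_def by (rule polys_specialize[OF D'.R_U vars])
    fix k assume k: "k \<in> {1..m}"
    have "wdeg (gw k) (Res m' d' g') \<le> wdeg (gw (\<pi> k)) D'.R"
      unfolding Res_def by (rule wdeg_specialize_le[OF D'.R_U degs[OF k]])
    then show "wdeg (gw k) (Res m' d' g') \<le> wdeg (gw k) R"
      using wdeg_R[OF k] D'.wdeg_R[OF \<pi>(1)[OF k]] \<pi>(2)[OF k] by (simp add: D'.co_deg_def)
  qed
  then show ?thesis using \<kappa> by blast
qed

lemma lookup_subst_generic: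
  "\<alpha> \<in> UNIV \<Longrightarrow> k \<in> V \<Longrightarrow> Poly_Mapping.lookup (subst_vars f (generic_poly m d k)) \<alpha> \<in> polys {z. fst z \<in> V}"
  "wdeg (gw l) (Poly_Mapping.lookup (subst_vars f (generic_poly m d k)) \<alpha>) \<le> (if k = l then 1 else 0)"
proof -
  show "\<alpha> \<in> UNIV \<Longrightarrow> k \<in> V \<Longrightarrow> Poly_Mapping.lookup (subst_vars f (generic_poly m d k)) \<alpha> \<in> polys {z. fst z \<in> V}"
    unfolding lookup_subst_vars by (intro polys_sum) (auto simp: lookup_generic_poly intro: polys_Var)
  show "wdeg (gw l) (Poly_Mapping.lookup (subst_vars f (generic_poly m d k)) \<alpha>) \<le> (if k = l then 1 else 0)"
    unfolding lookup_subst_vars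
    by (intro wdeg_sum_le) (auto simp: lookup_generic_poly wdeg_Var)
qed

text \<open>No sign appears because indeterminates and equations are permuted together: the diagonal
  system stays diagonal.\<close>

theorem Res_permute:
  fixes g :: "nat \<Rightarrow> (nat, 'a::comm_ring_1) mpoly"
  assumes "degree_vector m d" "system m d g" and \<pi>: "\<pi> permutes {1..m}"
    and inverses: "\<And>x. \<pi> (\<pi>' x) = x" "\<And>x. \<pi>' (\<pi> x) = x"
  shows "Res m (\<lambda>i. d (\<pi> i)) (\<lambda>i. subst_vars \<pi>' (g (\<pi> i))) = Res m d g"
proof -
  interpret degree_vector m d by fact
  have \<pi>in: "\<pi> i \<in> {1..m} \<longleftrightarrow> i \<in> {1..m}" "\<pi>' i \<in> {1..m} \<longleftrightarrow> i \<in> {1..m}" for i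
    using permutes_in_image[OF \<pi>] inverses by metis+
  interpret D': degree_vector m "\<lambda>i. d (\<pi> i)"
    using m_pos d_pos \<pi>in(1) by unfold_locales blast+
  define g' where "g' i = subst_vars \<pi>' (G (\<pi> i))" for i
  have sys': "system m (\<lambda>i. d (\<pi> i)) g'"
    unfolding system_def g'_def using \<pi>in
    by (auto intro!: polys_subst_vars[OF generic_poly_polys] homogeneous_subst_vars homogeneous_generic_poly)
  have diag: "spec_diag (Res m (\<lambda>i. d (\<pi> i)) g') = 1"
  proof -
    have "map_coeffs spec_diag (g' i) = Var i ^ d (\<pi> i)" if "i \<in> {1..m}" for i
    proof -
      interpret s: comm_ring_hom "subst_vars \<pi>' :: (nat, int) mpoly \<Rightarrow> _" by (rule comm_ring_hom_subst_vars)
      have "map_coeffs spec_diag (G (\<pi> i)) = Var (\<pi> i) ^ d (\<pi> i)"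
        by (rule map_coeffs_specialize_generic) (use that \<pi>in(1) in \<open>auto simp: homogeneous_Var_power intro: polys_Var_power\<close>)
      then show ?thesis
        by (simp add: g'_def map_coeffs_subst_vars comm_ring_hom_specialize s.hom_power inverses)
    qed
    then show ?thesis
      unfolding hom_Res[OF spec_diag_hom] D'.Res_diag[symmetric] by (intro D'.Res_cong)
  qed
  have "\<exists>c. Res m (\<lambda>i. d (\<pi> i)) g' = R * Const c"
  proof (rule Res_const_multiple[OF D'.degree_vector_axioms sys', where \<xi> = "\<lambda>x. Var (\<pi> x)" and \<psi> = spec_diag and \<pi> = "\<pi>'"])
    show "in_span m G (mp_eval Const (\<lambda>x. Var (\<pi> x)) (g' i))" if "i \<in> {1..m}" for i
    proof -
      have "\<pi> \<circ> \<pi>' = (\<lambda>x. x)" using inverses by (simp add: fun_eq_iff)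
      then show ?thesis
        using that \<pi>in(1) by (simp only: mp_eval_subst_vars g'_def subst_vars_compose subst_vars_id in_span_generator)
    qed
    show "1 \<in> {1..m}" using m_pos by simp
    show "Poly_Mapping.lookup (g' i) \<alpha> \<in> polys {z. fst z \<in> {1..m}}" if "i \<in> {1..m}" for i \<alpha>
      unfolding g'_def using that \<pi>in(1) by (intro lookup_subst_generic(1)) auto
    show "wdeg (gw k) (Poly_Mapping.lookup (g' i) \<alpha>) \<le> gw (\<pi>' k) (i, \<alpha>)" for k i \<alpha>
      using lookup_subst_generic(2)[of k "\<pi>'" m d "\<pi> i" \<alpha>] inverses by (auto simp: g'_def split: if_splits)
    show "\<pi>' k \<in> {1..m}" if "k \<in> {1..m}" for k using that \<pi>in(2) by blast
    show "(\<Prod>i\<in>{1..m} - {\<pi>' k}. d (\<pi> i)) = co_deg k" if "k \<in> {1..m}" for k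
      unfolding co_deg_def
    proof (rule prod.reindex_bij_witness[of _ "\<pi>'" \<pi>])
      show "\<pi>' b \<in> {1..m} - {\<pi>' k}" if "b \<in> {1..m} - {k}" for b
        using that \<pi>in(2)[of b] inverses(1) by (metis DiffD1 DiffD2 DiffI singletonD singletonI)
      show "\<pi> a \<in> {1..m} - {k}" if "a \<in> {1..m} - {\<pi>' k}" for a
        using that \<pi>in(1)[of a] inverses(2) by (metis DiffD1 DiffD2 DiffI singletonD singletonI)
    qed (simp_all add: inverses)
  qed (use diag spec_diag_hom in auto)
  then obtain c where c: "Res m (\<lambda>i. d (\<pi> i)) g' = R * Const c" by blast
  interpret sd: comm_ring_hom spec_diag by (rule spec_diag_hom)
  have "c = 1" using diag unfolding c sd.hom_mult R_diag by simp
  with c have eq: "Res m (\<lambda>i. d (\<pi> i)) g' = R" by simp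
  define \<phi> where "\<phi> = specialize g"
  have \<phi>: "comm_ring_hom \<phi>" unfolding \<phi>_def by (rule comm_ring_hom_specialize)
  have "\<phi> (Res m (\<lambda>i. d (\<pi> i)) g') = Res m (\<lambda>i. d (\<pi> i)) (\<lambda>i. subst_vars \<pi>' (g (\<pi> i)))"
    unfolding hom_Res[OF \<phi>]
  proof (rule D'.Res_cong)
    fix i assume "i \<in> {1..m}"
    then have "map_coeffs \<phi> (G (\<pi> i)) = g (\<pi> i)"
      unfolding \<phi>_def using assms(2) \<pi>in(1) by (intro map_coeffs_specialize_generic) (auto simp: system_def)
    then show "map_coeffs \<phi> (g' i) = subst_vars \<pi>' (g (\<pi> i))"
      by (simp add: g'_def map_coeffs_subst_vars[OF \<phi>])
  qed
  then show ?thesis unfolding eq by (simp add: \<phi>_def Res_def)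
qed

text \<open>Exchanging two indeterminates alone multiplies the resultant by a sign raised to the
  product of the degrees.\<close>

theorem Res_transpose_vars:
  fixes g :: "nat \<Rightarrow> (nat, 'a::comm_ring_1) mpoly"
  assumes "degree_vector m d" "system m d g" "a \<in> {1..m}" "b \<in> {1..m}" "even (\<Prod>i\<in>{1..m}. d i)"
  shows "Res m d (\<lambda>i. subst_vars (transpose a b) (g i)) = Res m d g"
proof -
  interpret degree_vector m d by fact
  let ?\<tau> = "transpose a b"
  have \<tau>in: "?\<tau> i \<in> {1..m} \<longleftrightarrow> i \<in> {1..m}" for i using assms(3,4) by (auto simp: transpose_def)
  have inv: "?\<tau> \<circ> ?\<tau> = (\<lambda>x. x)" by (simp add: fun_eq_iff)
  define g' where "g' i = subst_vars ?\<tau> (G i)" for i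
  have sys': "system m d g'"
    unfolding system_def g'_def using \<tau>in
    by (auto intro!: polys_subst_vars[OF generic_poly_polys] homogeneous_subst_vars homogeneous_generic_poly)
  \<comment> \<open>At this specialization the system with exchanged indeterminates becomes
    diagonal.\<close>
  define \<psi> :: "coeff_ring \<Rightarrow> int" where "\<psi> = specialize (\<lambda>i. Var (?\<tau> i) ^ d i)"
  have \<psi>: "comm_ring_hom \<psi>" unfolding \<psi>_def by (rule comm_ring_hom_specialize)
  interpret \<psi>: comm_ring_hom \<psi> by (rule \<psi>)
  have \<psi>1: "\<psi> (Res m d g') = 1"
  proof -
    interpret s: comm_ring_hom "subst_vars ?\<tau> :: (nat, int) mpoly \<Rightarrow> _" by (rule comm_ring_hom_subst_vars)
    have "map_coeffs \<psi> (g' i) = Var i ^ d i" if "i \<in> {1..m}" for i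
    proof -
      have "map_coeffs \<psi> (G i) = Var (?\<tau> i) ^ d i"
        unfolding \<psi>_def
        by (rule map_coeffs_specialize_generic) (use that \<tau>in in \<open>auto simp: homogeneous_Var_power intro: polys_Var_power\<close>)
      then show ?thesis by (simp add: g'_def map_coeffs_subst_vars \<psi> s.hom_power)
    qed
    then show ?thesis unfolding hom_Res[OF \<psi>] Res_diag[symmetric] by (intro Res_cong)
  qed
  have "\<exists>c. Res m d g' = R * Const c"
  proof (rule Res_const_multiple[OF degree_vector_axioms sys', where \<xi> = "\<lambda>x. Var (?\<tau> x)" and \<psi> = \<psi> and \<pi> = "\<lambda>k. k"])
    show "in_span m G (mp_eval Const (\<lambda>x. Var (?\<tau> x)) (g' i))" if "i \<in> {1..m}" for i
      using that by (simp only: mp_eval_subst_vars g'_def subst_vars_compose inv subst_vars_id in_span_generator)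
    show "1 \<in> {1..m}" using m_pos by simp
    show "Poly_Mapping.lookup (g' i) \<alpha> \<in> polys {z. fst z \<in> {1..m}}" if "i \<in> {1..m}" for i \<alpha>
      unfolding g'_def using that by (intro lookup_subst_generic(1)) auto
    show "wdeg (gw k) (Poly_Mapping.lookup (g' i) \<alpha>) \<le> gw k (i, \<alpha>)" for k i \<alpha>
      using lookup_subst_generic(2)[of k ?\<tau> m d i \<alpha>] by (auto simp: g'_def split: if_splits)
    show "(\<Prod>i\<in>{1..m} - {k}. d i) = co_deg k" for k by (simp add: co_deg_def)
  qed (use \<psi>1 \<psi> in auto)
  then obtain c where c: "Res m d g' = R * Const c" by blast
  have X: "\<psi> R = Res m (\<lambda>_. 1) (\<lambda>i. Var (?\<tau> i)) ^ (\<Prod>i\<in>{1..m}. d i)"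
    using Res_powers[OF _ _ degree_vector_axioms, of "\<lambda>i. Var (?\<tau> i) :: (nat, int) mpoly"] \<tau>in
    by (simp add: \<psi>_def Res_def One_nat_def polys_Var)
  have "\<psi> (Const c) = c" by (simp add: \<psi>_def)
  then have 1: "\<psi> R * c = 1" using \<psi>1 unfolding c \<psi>.hom_mult by simp
  obtain N where N: "(\<Prod>i\<in>{1..m}. d i) = 2 * N" using assms(5) by (elim evenE)
  \<comment> \<open>The value of \<open>R\<close> is an even power of an integer, and with
    \<open>c\<close> it multiplies to 1.\<close>
  have "\<psi> R \<ge> 0" unfolding X N by (simp add: power_mult)
  then have "c = 1" using 1 by (auto simp: zmult_eq_1_iff)
  with c have eq: "Res m d g' = R" by simp
  define \<phi> where "\<phi> = specialize g"
  have \<phi>: "comm_ring_hom \<phi>" unfolding \<phi>_def by (rule comm_ring_hom_specialize)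
  have "\<phi> (Res m d g') = Res m d (\<lambda>i. subst_vars ?\<tau> (g i))"
    unfolding hom_Res[OF \<phi>]
  proof (rule Res_cong)
    fix i assume "i \<in> {1..m}"
    then have "map_coeffs \<phi> (G i) = g i"
      unfolding \<phi>_def using assms(2) by (intro map_coeffs_specialize_generic) (auto simp: system_def)
    then show "map_coeffs \<phi> (g' i) = subst_vars ?\<tau> (g i)"
      by (simp add: g'_def map_coeffs_subst_vars[OF \<phi>])
  qed
  then show ?thesis unfolding eq by (simp add: \<phi>_def Res_def)
qed

text \<open>The polynomials \<open>g i\<close> do not involve the new indeterminate, so a zero of
  \<open>g\<close> extends by setting \<open>x_(m + 1)\<close> to \<open>x_k\<close>; the new
  equation has degree 1 and does not change the other degrees.\<close>

theorem Res_eliminate_last: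
  fixes g :: "nat \<Rightarrow> (nat, 'a::comm_ring_1) mpoly"
  assumes "degree_vector m d" "system m d g" "k \<in> {1..m}" "d (m + 1) = 1"
  shows "Res (m + 1) d (g(m + 1 := Var (m + 1) - Var k)) = Res m d g"
proof -
  interpret degree_vector m d by fact
  let ?M = "m + 1"
  have set: "{1..?M} = insert ?M {1..m}" by auto
  interpret D': degree_vector ?M d
    using m_pos d_pos assms(4) unfolding degree_vector_def set by auto
  have up: "(polys {1..m} :: (nat, 'b::comm_ring_1) mpoly set) \<subseteq> polys {1..?M}" by (rule polys_mono) auto
  have k: "k \<noteq> ?M" "k \<in> {1..?M}" using assms(3) by auto
  define lin :: "(nat, coeff_ring) mpoly" where "lin = Var ?M - Var k"
  define g' where "g' = G(?M := lin)"
  have hom1: "homogeneous 1 (Var x)" for x by (simp add: One_nat_def)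
  have sys': "system ?M d g'"
    unfolding system_def
  proof
    fix i assume i: "i \<in> {1..?M}"
    show "g' i \<in> polys {1..?M} \<and> homogeneous (d i) (g' i)"
      using subsetD[OF up generic_poly_polys[of m d i]] k assms(4)
      by (auto simp: g'_def lin_def homogeneous_generic_poly homogeneous_diff[OF hom1 hom1] polys_diff polys_Var)
  qed
  have diag: "spec_diag (Res ?M d g') = 1"
  proof -
    \<comment> \<open>The test system consists of powers of these linear forms, and one elementary
      operation turns \<open>L\<close> into the indeterminates themselves.\<close>
    define L :: "nat \<Rightarrow> (nat, int) mpoly" where "L = Var(?M := Var ?M - Var k)"
    have L: "L i \<in> polys {1..?M}" "homogeneous 1 (L i)" if "i \<in> {1..?M}" for i
      using that k by (auto simp: L_def homogeneous_diff[OF hom1 hom1] hom1 polys_diff polys_Var)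
    interpret D1: degree_vector ?M "\<lambda>_. 1" using m_pos by unfold_locales auto
    have "Res ?M (\<lambda>_. 1) (L(?M := L ?M + 1 * L k)) = Res ?M (\<lambda>_. 1) L"
      by (rule Res_add[OF D1.degree_vector_axioms]) (use L k in \<open>auto simp: system_def\<close>)
    moreover have "L(?M := L ?M + 1 * L k) = Var" using k by (auto simp: L_def fun_eq_iff)
    ultimately have RL: "Res ?M (\<lambda>_. 1) L = 1" using Res_Var[of ?M] by simp
    interpret ms: comm_ring_hom "map_coeffs spec_diag :: (nat, coeff_ring) mpoly \<Rightarrow> _"
      by (intro comm_ring_hom_map_coeffs spec_diag_hom)
    have "map_coeffs spec_diag (g' i) = L i ^ d i" if "i \<in> {1..?M}" for i
    proof (cases "i = ?M")
      case True
      then show ?thesis using assms(4) by (simp add: g'_def L_def lin_def ms.hom_minus spec_diag_hom)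
    next
      case False
      then have "map_coeffs spec_diag (G i) = Var i ^ d i"
        using that by (intro map_coeffs_specialize_generic) (auto simp: homogeneous_Var_power intro: polys_Var_power)
      then show ?thesis using False by (simp add: g'_def L_def)
    qed
    then have "spec_diag (Res ?M d g') = Res ?M d (\<lambda>i. L i ^ d i)"
      unfolding hom_Res[OF spec_diag_hom] by (intro D'.Res_cong)
    also have "\<dots> = 1" using Res_powers[OF L D'.degree_vector_axioms] RL by simp
    finally show ?thesis .
  qed
  have "\<exists>c. Res ?M d g' = R * Const c"
  proof (rule Res_const_multiple[OF D'.degree_vector_axioms sys', where \<xi> = "\<lambda>x. Var (if x = ?M then k else x)" and \<psi> = spec_diag and \<pi> = "\<lambda>k. k"])
    interpret s: comm_ring_hom "subst_vars (\<lambda>x. if x = ?M then k else x) :: (nat, coeff_ring) mpoly \<Rightarrow> _"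
      by (rule comm_ring_hom_subst_vars)
    show "in_span m G (mp_eval Const (\<lambda>x. Var (if x = ?M then k else x)) (g' i))" if i: "i \<in> {1..?M}" for i
      unfolding mp_eval_subst_vars
    proof (cases "i = ?M")
      case True
      then show "in_span m G (subst_vars (\<lambda>x. if x = ?M then k else x) (g' i))"
        using k by (simp add: g'_def lin_def s.hom_minus)
    next
      case False
      then have im: "i \<in> {1..m}" using i by auto
      have "subst_vars (\<lambda>x. if x = ?M then k else x) (G i) = subst_vars (\<lambda>x. x) (G i)"
        by (rule subst_vars_cong[OF generic_poly_polys]) auto
      then show "in_span m G (subst_vars (\<lambda>x. if x = ?M then k else x) (g' i))"
        using False in_span_generator[OF im, of G] by (simp add: g'_def subst_vars_id)
    qed
    show "1 \<in> {1..?M}" by simp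
    have lin: "\<exists>c. Poly_Mapping.lookup lin \<alpha> = Const c" for \<alpha>
    proof -
      have "Poly_Mapping.lookup lin \<alpha> \<in> polys {}"
        unfolding lin_def lookup_minus
        by (intro polys_diff) (auto simp: Var_def lookup_single when_def)
      then show ?thesis using polys_empty by blast
    qed
    show "Poly_Mapping.lookup (g' i) \<alpha> \<in> polys {z. fst z \<in> {1..m}}" if "i \<in> {1..?M}" for i \<alpha>
      using that lin[of \<alpha>] by (auto simp: g'_def lookup_generic_poly intro!: polys_Var)
    show "wdeg (gw k) (Poly_Mapping.lookup (g' i) \<alpha>) \<le> gw k (i, \<alpha>)" for k i \<alpha>
      using lin[of \<alpha>] wdeg_lookup_generic[of "gw k" m d i \<alpha>] by (cases "i = ?M") (auto simp: g'_def)
    show "k \<in> {1..?M}" if "k \<in> {1..m}" for k using that by simp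
    show "(\<Prod>i\<in>{1..?M} - {k}. d i) = co_deg k" if "k \<in> {1..m}" for k
    proof -
      have "{1..?M} - {k} = insert ?M ({1..m} - {k})" using that by auto
      then show ?thesis using assms(4) by (simp add: co_deg_def)
    qed
  qed (use diag spec_diag_hom in auto)
  then obtain c where c: "Res ?M d g' = R * Const c" by blast
  interpret sd: comm_ring_hom spec_diag by (rule spec_diag_hom)
  have "c = 1" using diag unfolding c sd.hom_mult R_diag by simp
  with c have eq: "Res ?M d g' = R" by simp
  define \<phi> where "\<phi> = specialize g"
  have \<phi>: "comm_ring_hom \<phi>" unfolding \<phi>_def by (rule comm_ring_hom_specialize)
  interpret ms: comm_ring_hom "map_coeffs \<phi> :: (nat, coeff_ring) mpoly \<Rightarrow> _"
    by (intro comm_ring_hom_map_coeffs \<phi>)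
  have "\<phi> (Res ?M d g') = Res ?M d (g(?M := Var ?M - Var k))"
    unfolding hom_Res[OF \<phi>]
  proof (rule D'.Res_cong)
    fix i assume "i \<in> {1..?M}"
    then have "i \<noteq> ?M \<Longrightarrow> map_coeffs \<phi> (G i) = g i"
      unfolding \<phi>_def using assms(2) by (intro map_coeffs_specialize_generic) (auto simp: system_def)
    then show "map_coeffs \<phi> (g' i) = (g(?M := Var ?M - Var k)) i"
      by (simp add: g'_def lin_def ms.hom_minus \<phi>)
  qed
  then show ?thesis unfolding eq by (simp add: \<phi>_def Res_def)
qed

section \<open>Divided differences\<close>

text \<open>The difference is monic in \<open>Var i\<close>, hence a nonzerodivisor over any
  commutative ring. All cancellations below rest on this.\<close>

lemma Var_diff_regular:
  fixes p :: "(nat, 'a::comm_ring_1) mpoly"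
  assumes "i \<noteq> a" "(Var i - Var a) * p = 0"
  shows "p = 0"
proof (rule ccontr)
  assume "p \<noteq> 0"
  interpret u: comm_ring_hom "upoly i :: (nat, 'a) mpoly \<Rightarrow> _" by (rule comm_ring_hom_upoly)
  define P where "P = upoly i p"
  have "upoly i (Var i - Var a) * P = upoly i ((Var i - Var a) * p)"
    by (simp add: P_def u.hom_mult)
  then have "[:- Var a, 1:] * P = 0"
    using assms by (simp add: u.hom_minus upoly_Var)
  then have "Polynomial.coeff ([:- Var a, 1:] * P) (Suc (Polynomial.degree P)) = 0" by simp
  then have "lead_coeff P = 0"
    by (simp add: mult_pCons_left coeff_eq_0)
  then show False using \<open>p \<noteq> 0\<close> by (simp add: P_def)
qed

lemma Var_diff_cancel:
  fixes p q :: "(nat, 'a::comm_ring_1) mpoly"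
  assumes "i \<noteq> a" "(Var i - Var a) * p = (Var i - Var a) * q"
  shows "p = q"
  using Var_diff_regular[OF assms(1), of "p - q"] assms(2) by (simp add: right_diff_distrib)

lemma ex_difference_quotient:
  fixes p :: "(nat, 'a::comm_ring_1) mpoly"
  assumes V: "i \<in> V" "a \<in> V" and p: "p \<in> polys V" "homogeneous e p"
  shows "\<exists>q. q \<in> polys V \<and> homogeneous (e - 1) q \<and> p - subst_vars (id(i := a)) p = (Var i - Var a) * q"
proof -
  interpret s: comm_ring_hom "subst_vars (id(i := a)) :: (nat, 'a) mpoly \<Rightarrow> _" by (rule comm_ring_hom_subst_vars)
  have "\<exists>q. q \<in> polys V \<and> homogeneous (e - 1) q \<and>
      Poly_Mapping.single t c - subst_vars (id(i := a)) (Poly_Mapping.single t c) = (Var i - Var a) * q"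
    if t: "Poly_Mapping.keys t \<subseteq> V" "mdeg t = e" for t and c :: 'a
  proof -
    define k where "k = Poly_Mapping.lookup t i"
    define u where "u = t - Poly_Mapping.single i k"
    have tu: "t = Poly_Mapping.single i k + u"
      by (rule poly_mapping_eqI) (auto simp: u_def k_def lookup_add lookup_minus lookup_single when_def)
    have ui: "i \<notin> Poly_Mapping.keys u"
      by (simp add: u_def k_def in_keys_iff lookup_minus)
    have uV: "Poly_Mapping.keys u \<subseteq> V"
      using t(1) by (auto simp: u_def in_keys_iff lookup_minus)
    have e: "e = k + mdeg u" using t(2) tu by (simp add: mdeg_add)
    define m where "m = (Poly_Mapping.single u c :: (nat, 'a) mpoly)"
    have sm: "subst_vars (id(i := a)) m = m"
      using subst_vars_cong[of m "- {i}" "id(i := a)" "\<lambda>x. x"] ui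
      by (auto simp: m_def polys_single subst_vars_id)
    have st: "Poly_Mapping.single t c = Var i ^ k * m"
      by (simp add: tu m_def Var_power mult_single)
    show ?thesis
    proof (cases k)
      case 0
      then show ?thesis using st sm by (intro exI[of _ 0]) simp
    next
      case (Suc k')
      \<comment> \<open>The geometric sum in
        \<open>x_i ^ (k' + 1) - x_a ^ (k' + 1) = (x_i - x_a) * ...\<close>, times the part of the
        monomial free of \<open>x_i\<close>.\<close>
      define q where "q = (\<Sum>l<Suc k'. Var i ^ l * Var a ^ (k' - l)) * m"
      have "Poly_Mapping.single t c - subst_vars (id(i := a)) (Poly_Mapping.single t c) = (Var i ^ Suc k' - Var a ^ Suc k') * m"
        by (simp add: st s.hom_mult s.hom_power sm Suc left_diff_distrib)
      also have "\<dots> = (Var i - Var a) * q"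
        unfolding power_diff_sumr2[of "Var i" "Suc k'"] q_def by (simp add: mult.assoc power_diff_sumr2 mult.commute mult.left_commute)
      finally have 1: "Poly_Mapping.single t c - subst_vars (id(i := a)) (Poly_Mapping.single t c) = (Var i - Var a) * q" .
      have 2: "q \<in> polys V"
        unfolding q_def m_def using V uV
        by (intro polys_mult polys_sum polys_power polys_Var polys_single)
      have "homogeneous (l + (k' - l)) (Var i ^ l * Var a ^ (k' - l) :: (nat, 'a) mpoly)" for l
        by (intro homogeneous_mult homogeneous_Var_power)
      then have "homogeneous k' (\<Sum>l<Suc k'. Var i ^ l * Var a ^ (k' - l) :: (nat, 'a) mpoly)"
        by (intro homogeneous_sum) (metis lessThan_iff less_Suc_eq_le le_add_diff_inverse)
      then have "homogeneous (k' + mdeg u) q"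
        unfolding q_def m_def by (intro homogeneous_mult homogeneous_single) simp_all
      then have "homogeneous (e - 1) q" using e Suc by (simp add: One_nat_def)
      with 1 2 show ?thesis by blast
    qed
  qed
  then have "\<forall>t\<in>Poly_Mapping.keys p. \<exists>q. q \<in> polys V \<and> homogeneous (e - 1) q \<and>
      Poly_Mapping.single t (Poly_Mapping.lookup p t) - subst_vars (id(i := a)) (Poly_Mapping.single t (Poly_Mapping.lookup p t)) = (Var i - Var a) * q"
    using p by (auto simp: polys_def homogeneous_def)
  then obtain q where q: "\<And>t. t \<in> Poly_Mapping.keys p \<Longrightarrow> q t \<in> polys V \<and> homogeneous (e - 1) (q t) \<and>
      Poly_Mapping.single t (Poly_Mapping.lookup p t) - subst_vars (id(i := a)) (Poly_Mapping.single t (Poly_Mapping.lookup p t)) = (Var i - Var a) * q t"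
    by (metis (no_types, lifting))
  have "p - subst_vars (id(i := a)) p = (\<Sum>t\<in>Poly_Mapping.keys p. Poly_Mapping.single t (Poly_Mapping.lookup p t)) -
      subst_vars (id(i := a)) (\<Sum>t\<in>Poly_Mapping.keys p. Poly_Mapping.single t (Poly_Mapping.lookup p t))"
    by (simp flip: pm_sum_single)
  also have "\<dots> = (\<Sum>t\<in>Poly_Mapping.keys p. (Var i - Var a) * q t)"
    unfolding s.hom_sum sum_subtractf[symmetric] using q by (intro sum.cong refl) blast
  also have "\<dots> = (Var i - Var a) * (\<Sum>t\<in>Poly_Mapping.keys p. q t)" by (simp add: sum_distrib_left)
  finally show ?thesis
    using q by (intro exI[of _ "\<Sum>t\<in>Poly_Mapping.keys p. q t"]) (auto intro: polys_sum homogeneous_sum)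
qed

text \<open>The quotient is unique whenever it exists, by \<open>Var_diff_cancel\<close>; its
  existence is supplied by \<open>compatible_step\<close>.\<close>

definition diff_quot :: "nat \<Rightarrow> nat \<Rightarrow> (nat, 'a::comm_ring_1) mpoly \<Rightarrow> (nat, 'a) mpoly" where
  "diff_quot i a p = (SOME q. (Var i - Var a) * q = p)"

lemma diff_quot_eq: "i \<noteq> a \<Longrightarrow> diff_quot i a ((Var i - Var a) * q) = q"
  unfolding diff_quot_def by (rule some_equality) (auto dest: Var_diff_cancel)

text \<open>Newton's recursion: \<open>newton F [a_k, ..., a_1] i\<close> is the divided difference of \<open>F\<close> on
  \<open>a_1, ..., a_k, i\<close>.\<close>

primrec newton :: "(nat \<Rightarrow> (nat, 'a::comm_ring_1) mpoly) \<Rightarrow> nat list \<Rightarrow> nat \<Rightarrow> (nat, 'a) mpoly" where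
  "newton F [] i = F i"
| "newton F (a # as) i = diff_quot i a (newton F as i - newton F as a)"

text \<open>Divisibility of \<open>F i - F j\<close> by \<open>x_i - x_j\<close> appears as
  agreement after the substitution of \<open>x_j\<close> for \<open>x_i\<close>. In this form it
  passes to divided differences and along renamings.\<close>

definition compatible :: "nat set \<Rightarrow> nat set \<Rightarrow> nat \<Rightarrow> (nat \<Rightarrow> (nat, 'a::comm_ring_1) mpoly) \<Rightarrow> bool" where
  "compatible V I e F \<longleftrightarrow> I \<subseteq> V \<and> (\<forall>i\<in>I. F i \<in> polys V \<and> homogeneous e (F i)) \<and>
     (\<forall>i\<in>I. \<forall>j\<in>I. subst_vars (id(i := j)) (F i) = subst_vars (id(i := j)) (F j))"

text \<open>To compare two difference quotients after setting \<open>x_i\<close> to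
  \<open>x_j\<close>, multiply both by \<open>x_j - x_a\<close>: the products are the images of
  \<open>F i - F a\<close> and \<open>F j - F a\<close>, which agree.\<close>

lemma compatible_step:
  assumes "compatible V I e F" "a \<in> I"
  shows "compatible V (I - {a}) (e - 1) (\<lambda>i. diff_quot i a (F i - F a))"
    and "i \<in> I - {a} \<Longrightarrow> (Var i - Var a) * diff_quot i a (F i - F a) = F i - F a"
proof -
  have IV: "I \<subseteq> V" and F: "\<And>i. i \<in> I \<Longrightarrow> F i \<in> polys V" "\<And>i. i \<in> I \<Longrightarrow> homogeneous e (F i)"
    and C: "\<And>i j. i \<in> I \<Longrightarrow> j \<in> I \<Longrightarrow> subst_vars (id(i := j)) (F i) = subst_vars (id(i := j)) (F j)"
    using assms(1) unfolding compatible_def by blast+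
  have Q: "diff_quot i a (F i - F a) \<in> polys V \<and> homogeneous (e - 1) (diff_quot i a (F i - F a)) \<and>
     (Var i - Var a) * diff_quot i a (F i - F a) = F i - F a" if i: "i \<in> I - {a}" for i
  proof -
    interpret s: comm_ring_hom "subst_vars (id(i := a)) :: (nat, 'a) mpoly \<Rightarrow> _" by (rule comm_ring_hom_subst_vars)
    obtain q where q: "q \<in> polys V" "homogeneous (e - 1) q"
      "(F i - F a) - subst_vars (id(i := a)) (F i - F a) = (Var i - Var a) * q"
    proof -
      have "i \<in> V" "a \<in> V" "F i - F a \<in> polys V" "homogeneous e (F i - F a)"
        using i assms(2) IV F by (auto intro: polys_diff homogeneous_diff)
      from ex_difference_quotient[OF this] show ?thesis using that by blast
    qed
    moreover have "subst_vars (id(i := a)) (F i - F a) = 0"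
      using C[of i a] i assms(2) by (simp add: s.hom_minus)
    ultimately have eq: "F i - F a = (Var i - Var a) * q" by simp
    have "diff_quot i a (F i - F a) = q" unfolding eq using i by (intro diff_quot_eq) auto
    then show ?thesis using q eq by simp
  qed
  then show "i \<in> I - {a} \<Longrightarrow> (Var i - Var a) * diff_quot i a (F i - F a) = F i - F a" by blast
  have "subst_vars (id(i := j)) (diff_quot i a (F i - F a)) = subst_vars (id(i := j)) (diff_quot j a (F j - F a))"
    if ij: "i \<in> I - {a}" "j \<in> I - {a}" for i j
  proof (cases "i = j")
    case False
    interpret s: comm_ring_hom "subst_vars (id(i := j)) :: (nat, 'a) mpoly \<Rightarrow> _" by (rule comm_ring_hom_subst_vars)
    let ?s = "subst_vars (id(i := j))"
    let ?Qi = "diff_quot i a (F i - F a)" and ?Qj = "diff_quot j a (F j - F a)"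
    have "?s ((Var i - Var a) * ?Qi) - ?s ((Var j - Var a) * ?Qj) = ?s (F i - F a) - ?s (F j - F a)"
      using Q[OF ij(1)] Q[OF ij(2)] by simp
    also have "\<dots> = 0" using C[of i j] ij by (simp add: s.hom_minus)
    finally have "(Var j - Var a) * (?s ?Qi - ?s ?Qj) = 0"
      using ij False by (simp add: s.hom_mult s.hom_minus right_diff_distrib)
    then have "?s ?Qi - ?s ?Qj = 0" by (rule Var_diff_regular[rotated]) (use ij in auto)
    then show ?thesis by simp
  qed simp
  then show "compatible V (I - {a}) (e - 1) (\<lambda>i. diff_quot i a (F i - F a))"
    using Q IV unfolding compatible_def by blast
qed

lemma compatible_newton:
  assumes "compatible V I e F" "distinct as" "set as \<subseteq> I"
  shows "compatible V (I - set as) (e - length as) (newton F as)"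
  using assms(2,3)
proof (induction as)
  case Nil
  have "newton F [] = F" by (simp add: fun_eq_iff)
  then show ?case using assms(1) by simp
next
  case (Cons a as)
  then have c: "compatible V (I - set as) (e - length as) (newton F as)" and a: "a \<in> I - set as" by auto
  have "I - set as - {a} = I - set (a # as)" by auto
  moreover have "e - length as - 1 = e - length (a # as)" by (simp add: One_nat_def)
  moreover have "newton F (a # as) = (\<lambda>i. diff_quot i a (newton F as i - newton F as a))"
    by (simp add: fun_eq_iff)
  ultimately show ?case using compatible_step(1)[OF c a] by metis
qed

lemma newton_Cons:
  assumes "compatible V I e F" "distinct (a # as)" "set (a # as) \<subseteq> I" "i \<in> I - set (a # as)"
  shows "(Var i - Var a) * newton F (a # as) i = newton F as i - newton F as a"
proof -
  have c: "compatible V (I - set as) (e - length as) (newton F as)"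
    using assms by (intro compatible_newton) auto
  show ?thesis
    using compatible_step(2)[OF c, of a i] assms by auto
qed

lemma newton_polys:
  assumes "compatible V I e F" "distinct as" "set as \<subseteq> I" "i \<in> I - set as"
  shows "newton F as i \<in> polys V" "homogeneous (e - length as) (newton F as i)"
  using compatible_newton[OF assms(1-3)] assms(4) unfolding compatible_def by blast+

lemma newton_append: "newton F (as @ bs) = newton (newton F bs) as"
  by (induction as) (simp_all add: fun_eq_iff)

lemma newton_cong:
  assumes "\<And>i. i \<in> J \<Longrightarrow> F i = G i" "set as \<subseteq> J" "i \<in> J"
  shows "newton F as i = newton G as i"
  using assms(2,3)
proof (induction as arbitrary: i)
  case (Cons a as)
  then show ?case by simp
qed (simp add: assms(1))

lemma newton_swap_last:
  assumes "compatible V I e F" "distinct (i # a # as)" "set (i # a # as) \<subseteq> I"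
  shows "newton F (a # as) i = newton F (i # as) a"
proof (rule Var_diff_cancel[of i a])
  have "(Var i - Var a) * newton F (a # as) i = newton F as i - newton F as a"
    using assms by (intro newton_Cons[OF assms(1)]) auto
  also have "\<dots> = - ((Var a - Var i) * newton F (i # as) a)"
    using assms by (subst newton_Cons[OF assms(1)]) auto
  finally show "(Var i - Var a) * newton F (a # as) i = (Var i - Var a) * newton F (i # as) a"
    by (simp add: algebra_simps)
qed (use assms in auto)

text \<open>After multiplication by the three differences both sides become the same alternating
  expression in the lower divided differences, up to sign. With \<open>newton_swap_last\<close> this
  is all the symmetry that is needed.\<close>

lemma newton_swap_head:
  assumes "compatible V I e F" "distinct (i # a # b # as)" "set (i # a # b # as) \<subseteq> I"
  shows "newton F (a # b # as) i = newton F (b # a # as) i"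
proof -
  have step: "(Var i - Var b) * ((Var a - Var b) * ((Var i - Var a) * newton F (a # b # as) i)) =
      (Var a - Var b) * newton F as i - (Var i - Var b) * newton F as a + (Var i - Var a) * newton F as b"
    if "distinct (i # a # b # as)" "set (i # a # b # as) \<subseteq> I" for a b
  proof -
    have 1: "(Var i - Var a) * newton F (a # b # as) i = newton F (b # as) i - newton F (b # as) a"
      using that by (intro newton_Cons[OF assms(1)]) auto
    have 2: "(Var i - Var b) * newton F (b # as) i = newton F as i - newton F as b"
      using that by (intro newton_Cons[OF assms(1)]) auto
    have 3: "(Var a - Var b) * newton F (b # as) a = newton F as a - newton F as b"
      using that by (intro newton_Cons[OF assms(1)]) auto
    have "(Var i - Var b) * ((Var a - Var b) * ((Var i - Var a) * newton F (a # b # as) i)) =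
      (Var a - Var b) * ((Var i - Var b) * newton F (b # as) i) - (Var i - Var b) * ((Var a - Var b) * newton F (b # as) a)"
      unfolding 1 by (simp add: algebra_simps)
    then show ?thesis unfolding 2 3 by (simp add: algebra_simps)
  qed
  have ne: "i \<noteq> a" "i \<noteq> b" "a \<noteq> b" using assms(2) by auto
  have "distinct (i # b # a # as)" "set (i # b # a # as) \<subseteq> I" using assms(2,3) by auto
  note 1 = step[OF assms(2,3)] and 2 = step[OF this]
  have "(Var i - Var b) * ((Var a - Var b) * ((Var i - Var a) * newton F (a # b # as) i)) =
      - ((Var i - Var a) * ((Var b - Var a) * ((Var i - Var b) * newton F (b # a # as) i)))"
    unfolding 1 2 by (simp add: algebra_simps)
  also have "\<dots> = (Var i - Var b) * ((Var a - Var b) * ((Var i - Var a) * newton F (b # a # as) i))"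
    by (simp add: algebra_simps)
  finally show ?thesis
    using Var_diff_cancel[OF ne(2)] Var_diff_cancel[OF ne(3)] Var_diff_cancel[OF ne(1)] by blast
qed

text \<open>The map \<open>f\<close> has to be injective only on a set \<open>J\<close> containing
  the points of the divided difference. It may identify other indeterminates, as the merging of a
  block does.\<close>

lemma newton_subst:
  fixes F G :: "nat \<Rightarrow> (nat, 'a::comm_ring_1) mpoly"
  assumes "compatible V I e F"
    and "\<And>i. i \<in> J \<Longrightarrow> G (f i) = subst_vars f (F i)" "inj_on f J" "J \<subseteq> I"
    and "distinct (i # as)" "set (i # as) \<subseteq> J"
  shows "newton G (map f as) (f i) = subst_vars f (newton F as i)"
  using assms(5,6)
proof (induction as arbitrary: i)
  case Nil
  then show ?case using assms(2) by simp
next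
  case (Cons a as)
  interpret s: comm_ring_hom "subst_vars f :: (nat, 'a) mpoly \<Rightarrow> _" by (rule comm_ring_hom_subst_vars)
  have ne: "f i \<noteq> f a" using Cons.prems assms(3) by (auto dest: inj_onD)
  have "newton G (map f as) (f i) - newton G (map f as) (f a) = subst_vars f (newton F as i - newton F as a)"
    using Cons by (simp add: s.hom_minus)
  also have "newton F as i - newton F as a = (Var i - Var a) * newton F (a # as) i"
    using Cons.prems assms(4) by (intro newton_Cons[OF assms(1), symmetric]) auto
  finally have "newton G (map f as) (f i) - newton G (map f as) (f a) = (Var (f i) - Var (f a)) * subst_vars f (newton F (a # as) i)"
    by (simp only: s.hom_mult s.hom_minus subst_vars_Var)
  then show ?case by (simp only: list.map newton.simps(2) diff_quot_eq[OF ne])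
qed

text \<open>Coefficients of the powers of an indeterminate in the Newton basis.\<close>

fun newton_coeff :: "nat \<Rightarrow> nat \<Rightarrow> (nat, 'a::comm_ring_1) mpoly" where
  "newton_coeff 0 t = (if t = 0 then 1 else 0)"
| "newton_coeff (Suc s) t = (if t = 0 then 0 else newton_coeff s (t - 1)) + Var (t + 1) * newton_coeff s t"

definition newton_basis :: "nat \<Rightarrow> nat \<Rightarrow> (nat, 'a::comm_ring_1) mpoly" where
  "newton_basis r t = (\<Prod>u<t. Var (r + 1) - Var (u + 1))"

lemma newton_coeff_upper: "s < t \<Longrightarrow> newton_coeff s t = 0"
  by (induction s arbitrary: t) auto

lemma newton_coeff_diag: "newton_coeff s s = 1"
  by (induction s) (simp_all add: newton_coeff_upper)

lemma power_newton_basis: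
  "s < k \<Longrightarrow> Var (r + 1) ^ s = (\<Sum>t<k. newton_coeff s t * (newton_basis r t :: (nat, 'a::comm_ring_1) mpoly))"
proof (induction s)
  case 0
  have "(\<Sum>t<k. newton_coeff 0 t * (newton_basis r t :: (nat, 'a) mpoly)) = (\<Sum>t<k. if t = 0 then 1 else 0)"
    by (intro sum.cong refl) (simp add: newton_basis_def)
  then show ?case using 0 by simp
next
  case (Suc s)
  have basis: "Var (r + 1) * newton_basis r t = newton_basis r (Suc t) + Var (t + 1) * (newton_basis r t :: (nat, 'a) mpoly)" for t
    by (simp add: newton_basis_def algebra_simps)
  have "Var (r + 1) ^ Suc s = (\<Sum>t<k. newton_coeff s t * (Var (r + 1) * (newton_basis r t :: (nat, 'a) mpoly)))"
    using Suc by (simp add: sum_distrib_left mult_ac)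
  also have "\<dots> = (\<Sum>t<k. newton_coeff s t * newton_basis r (Suc t)) + (\<Sum>t<k. Var (t + 1) * newton_coeff s t * newton_basis r t)"
    unfolding basis by (simp add: algebra_simps sum.distrib)
  also have "(\<Sum>t<k. newton_coeff s t * (newton_basis r (Suc t) :: (nat, 'a) mpoly)) =
      (\<Sum>t<k. (if t = 0 then 0 else newton_coeff s (t - 1)) * newton_basis r t)"
  proof -
    obtain k' where k: "k = Suc k'" using Suc.prems by (cases k) auto
    have "(\<Sum>t<k. newton_coeff s t * (newton_basis r (Suc t) :: (nat, 'a) mpoly)) = (\<Sum>t<k'. newton_coeff s t * newton_basis r (Suc t))"
      using Suc.prems by (simp add: k newton_coeff_upper)
    also have "\<dots> = (\<Sum>t<k. (if t = 0 then 0 else newton_coeff s (t - 1)) * newton_basis r t)"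
      unfolding k sum.lessThan_Suc_shift by (simp add: One_nat_def)
    finally show ?thesis .
  qed
  also have "\<dots> + (\<Sum>t<k. Var (t + 1) * newton_coeff s t * newton_basis r t) = (\<Sum>t<k. newton_coeff (Suc s) t * newton_basis r t)"
    unfolding sum.distrib[symmetric] by (intro sum.cong refl) (simp only: newton_coeff.simps distrib_right)
  finally show ?case .
qed

lemma newton_basis_Suc: "newton_basis r (Suc t) = newton_basis r t * (Var (Suc r) - Var (Suc t))"
  unfolding newton_basis_def prod.lessThan_Suc by (simp only: Suc_eq_plus1)

lemma rev_upt_Suc: "rev [1..<Suc (Suc s)] = Suc s # rev [1..<Suc s]"
  by (simp add: One_nat_def)

text \<open>Newton's interpolation formula with remainder. For \<open>s = r\<close> the remainder is
  the next term of the sum.\<close>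

lemma newton_interpolation:
  fixes F :: "nat \<Rightarrow> (nat, 'a::comm_ring_1) mpoly"
  assumes "compatible V I e F" "{1..Suc r} \<subseteq> I"
  shows "s \<le> r \<Longrightarrow> F (Suc r) = (\<Sum>t<s. newton F (rev [1..<Suc t]) (Suc t) * newton_basis r t) +
     newton F (rev [1..<Suc s]) (Suc r) * newton_basis r s"
proof (induction s)
  case 0
  then show ?case by (simp add: newton_basis_def One_nat_def)
next
  case (Suc s)
  have "(Var (Suc r) - Var (Suc s)) * newton F (Suc s # rev [1..<Suc s]) (Suc r) =
      newton F (rev [1..<Suc s]) (Suc r) - newton F (rev [1..<Suc s]) (Suc s)"
    using Suc.prems assms(2) by (intro newton_Cons[OF assms(1)]) (auto simp: One_nat_def)
  then have eq: "newton F (rev [1..<Suc s]) (Suc r) = newton F (rev [1..<Suc s]) (Suc s) +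
      (Var (Suc r) - Var (Suc s)) * newton F (rev [1..<Suc (Suc s)]) (Suc r)"
    unfolding rev_upt_Suc by (simp add: algebra_simps)
  have "F (Suc r) = (\<Sum>t<s. newton F (rev [1..<Suc t]) (Suc t) * newton_basis r t) +
     newton F (rev [1..<Suc s]) (Suc r) * newton_basis r s" using Suc by simp
  also have "newton F (rev [1..<Suc s]) (Suc r) * newton_basis r s =
     newton F (rev [1..<Suc s]) (Suc s) * newton_basis r s + newton F (rev [1..<Suc (Suc s)]) (Suc r) * newton_basis r (Suc s)"
    unfolding eq newton_basis_Suc by (simp only: distrib_right mult.assoc mult.commute[of "newton_basis r s" "Var (Suc r) - Var (Suc s)"] mult.left_commute)
  finally show ?case unfolding sum.lessThan_Suc by (simp only: add.assoc)
qed

text \<open>The matrix is the product of the lower triangular matrix of values of the Newton basis and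
  an upper triangular matrix with diagonal \<open>1, ..., 1, newton F [k - 1, ..., 1] k\<close>.\<close>

lemma newton_det:
  fixes F :: "nat \<Rightarrow> (nat, 'a::comm_ring_1) mpoly"
  assumes "compatible V I e F" "{1..k} \<subseteq> I" "k \<ge> 1"
  shows "det (mat k k (\<lambda>(r, s). if s < k - 1 then Var (r + 1) ^ s else F (r + 1))) =
    (\<Prod>r<k. \<Prod>s<r. Var (r + 1) - Var (s + 1)) * newton F (rev [1..<k]) k"
proof -
  define L where "L = mat k k (\<lambda>(r, t). newton_basis r t :: (nat, 'a) mpoly)"
  define T where "T = mat k k (\<lambda>(t, s). if s < k - 1 then newton_coeff s t else newton F (rev [1..<Suc t]) (Suc t))"
  have LT: "L \<in> carrier_mat k k" "T \<in> carrier_mat k k" by (simp_all add: L_def T_def)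
  have basis0: "newton_basis r t = (0 :: (nat, 'a) mpoly)" if "r < t" for r t
    unfolding newton_basis_def using that by (intro prod_zero) auto
  have "mat k k (\<lambda>(r, s). if s < k - 1 then Var (r + 1) ^ s else F (r + 1)) = L * T"
  proof (rule eq_matI)
    fix r s assume "r < dim_row (L * T)" "s < dim_col (L * T)"
    then have rs: "r < k" "s < k" using LT by auto
    have "(L * T) $$ (r, s) = (\<Sum>t<k. newton_basis r t * (if s < k - 1 then newton_coeff s t else newton F (rev [1..<Suc t]) (Suc t)))"
      using rs by (simp add: L_def T_def scalar_prod_def atLeast0LessThan)
    also have "\<dots> = (if s < k - 1 then Var (r + 1) ^ s else F (r + 1))"
    proof (cases "s < k - 1")
      case True
      then show ?thesis using power_newton_basis[OF rs(2), of r, where 'a = 'a] by (simp add: mult.commute)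
    next
      case False
      have sub: "{1..Suc r} \<subseteq> I" using assms(2) rs by auto
      have "F (Suc r) = (\<Sum>t<Suc r. newton F (rev [1..<Suc t]) (Suc t) * newton_basis r t)"
        using newton_interpolation[OF assms(1) sub order_refl] by (simp only: sum.lessThan_Suc)
      also have "\<dots> = (\<Sum>t<k. newton F (rev [1..<Suc t]) (Suc t) * newton_basis r t)"
        by (rule sum.mono_neutral_left) (use rs basis0 in auto)
      finally show ?thesis using False by (simp add: mult.commute One_nat_def)
    qed
    finally show "mat k k (\<lambda>(r, s). if s < k - 1 then Var (r + 1) ^ s else F (r + 1)) $$ (r, s) = (L * T) $$ (r, s)"
      using rs by simp
  qed (use LT in auto)
  moreover have "det L = (\<Prod>r<k. \<Prod>s<r. Var (r + 1) - Var (s + 1))"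
  proof -
    have "det L = prod_list (diag_mat L)"
      by (rule det_lower_triangular[OF _ LT(1)]) (auto simp: L_def basis0)
    also have "\<dots> = (\<Prod>r<k. newton_basis r r)"
      unfolding prod_list_diag_prod by (auto simp: L_def atLeast0LessThan intro!: prod.cong)
    finally show ?thesis by (simp add: newton_basis_def)
  qed
  moreover have "det T = newton F (rev [1..<k]) k"
  proof -
    obtain k' where k: "k = Suc k'" using assms(3) by (cases k) (auto simp: One_nat_def)
    have "det T = prod_list (diag_mat T)"
      by (rule det_upper_triangular[OF _ LT(2)]) (auto simp: T_def newton_coeff_upper newton_coeff_diag upper_triangular_def)
    also have "\<dots> = (\<Prod>t<k. T $$ (t, t))"
      unfolding prod_list_diag_prod using LT(2) by (simp add: atLeast0LessThan)
    also have "\<dots> = T $$ (k', k')"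
      unfolding k prod.lessThan_Suc by (simp add: T_def k newton_coeff_upper newton_coeff_diag One_nat_def)
    also have "\<dots> = newton F (rev [1..<k]) k" by (simp add: T_def k One_nat_def)
    finally show ?thesis .
  qed
  ultimately show ?thesis using det_mult[OF LT] by simp
qed

text \<open>The Vandermonde factor can be cancelled over any ring, which gives the uniqueness
  required by the description in \<open>divdiff\<close>.\<close>

lemma prod_Var_diff_cancel:
  fixes p q :: "(nat, 'a::comm_ring_1) mpoly"
  assumes "(\<Prod>r<k. \<Prod>s<r. Var (r + 1) - Var (s + 1)) * p = (\<Prod>r<k. \<Prod>s<r. Var (r + 1) - Var (s + 1)) * q"
  shows "p = q"
proof -
  have inner: "p = q" if "(\<Prod>s<l. Var (r + 1) - Var (s + 1)) * p = (\<Prod>s<l. Var (r + 1) - Var (s + 1)) * q" "l \<le> r"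
    for l r and p q :: "(nat, 'a) mpoly"
    using that
  proof (induction l arbitrary: p q)
    case (Suc l)
    have "(Var (r + 1) - Var (l + 1)) * p = (Var (r + 1) - Var (l + 1)) * q"
      by (rule Suc.IH) (use Suc.prems in \<open>simp_all add: mult.assoc\<close>)
    then show ?case by (rule Var_diff_cancel[rotated]) (use Suc.prems in simp)
  qed simp
  show ?thesis using assms
  proof (induction k arbitrary: p q)
    case (Suc k)
    have "(\<Prod>s<k. Var (k + 1) - Var (s + 1)) * p = (\<Prod>s<k. Var (k + 1) - Var (s + 1)) * q"
      by (rule Suc.IH) (use Suc.prems in \<open>simp add: mult.assoc\<close>)
    then show ?case by (rule inner) simp
  qed simp
qed

theorem divdiff_eq_newton:
  fixes F :: "nat \<Rightarrow> (nat, 'a::comm_ring_1) mpoly"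
  assumes F: "compatible {1..m} {1..m} d F" and k: "1 \<le> k" "k \<le> m" "k \<le> d + 1"
  shows "divdiff m d F {1..k} = newton F (rev [1..<k]) k"
proof -
  have sl: "sorted_list_of_set {1..k} = [1..<Suc k]"
    by (metis atLeastLessThanSuc_atLeastAtMost sorted_list_of_set_range)
  have nth: "sorted_list_of_set {1..k} ! r = r + 1" if "r < k" for r
    using that unfolding sl by (simp del: upt_Suc add: One_nat_def)
  show ?thesis
  proof (cases "k = 1")
    case True
    then show ?thesis using nth[of 0] by (simp add: divdiff_def Let_def)
  next
    case False
    let ?V = "\<Prod>r<k. \<Prod>s<r. Var (r + 1) - Var (s + 1) :: (nat, 'a) mpoly"
    have prod_eq: "(\<Prod>r<k. \<Prod>s<r. Var (sorted_list_of_set {1..k} ! r) - Var (sorted_list_of_set {1..k} ! s) :: (nat, 'a) mpoly) = ?V"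
      by (intro prod.cong refl) (auto simp: nth)
    have mat_eq: "mat k k (\<lambda>(r, s). if s < k - 1 then Var (sorted_list_of_set {1..k} ! r) ^ s else F (sorted_list_of_set {1..k} ! r)) =
        mat k k (\<lambda>(r, s). if s < k - 1 then Var (r + 1) ^ s else F (r + 1))"
      by (intro eq_matI) (auto simp: nth)
    have det: "det (mat k k (\<lambda>(r, s). if s < k - 1 then Var (r + 1) ^ s else F (r + 1))) = ?V * newton F (rev [1..<k]) k"
      by (rule newton_det[OF F]) (use k in auto)
    have "newton F (rev [1..<k]) k \<in> polys {1..m}" "homogeneous (d - length (rev [1..<k])) (newton F (rev [1..<k]) k)"
      by (rule newton_polys[OF F]; use k in auto)+
    then have nw: "newton F (rev [1..<k]) k \<in> polys {1..m}" "homogeneous (d + 1 - k) (newton F (rev [1..<k]) k)"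
      using k by simp_all
    have "(THE q. q \<in> polys {1..m} \<and> homogeneous (d + 1 - k) q \<and> (k > d + 1 \<longrightarrow> q = 0) \<and>
       ?V * q = det (mat k k (\<lambda>(r, s). if s < k - 1 then Var (r + 1) ^ s else F (r + 1)))) = newton F (rev [1..<k]) k"
      unfolding det by (rule the_equality) (use nw k in \<open>auto dest: prod_Var_diff_cancel\<close>)
    then show ?thesis
      using False by (simp add: divdiff_def Let_def prod_eq mat_eq)
  qed
qed

section \<open>Counting set partitions\<close>

text \<open>Restricted growth lists of length \<open>n\<close> encode the set partitions of \<open>{1..n}\<close>: the \<open>p\<close>-th
  entry is the number of the block of \<open>p\<close>, blocks being numbered in the order of their least
  elements.\<close>

primrec growth_lists :: "nat \<Rightarrow> nat list set" where
  "growth_lists 0 = {[]}"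
| "growth_lists (Suc n) = (\<Union>xs\<in>growth_lists n. (\<lambda>i. xs @ [i]) ` {1..card (set xs) + 1})"

definition block_sizes :: "nat list \<Rightarrow> nat multiset" where
  "block_sizes xs = image_mset (count_list xs) (mset_set {1..card (set xs)})"

lemma growth_lists_props:
  "xs \<in> growth_lists n \<Longrightarrow> length xs = n \<and> set xs = {1..card (set xs)} \<and> card (set xs) \<le> n"
proof (induction n arbitrary: xs)
  case (Suc n)
  then obtain ys i where ys: "ys \<in> growth_lists n" "xs = ys @ [i]" "i \<in> {1..card (set ys) + 1}" by auto
  note IH = Suc.IH[OF ys(1)]
  define k where "k = card (set ys)"
  have setys: "set ys = {1..k}" and k: "k \<le> n" "length ys = n" using IH by (auto simp: k_def)
  have "i \<in> {1..k} \<or> i = k + 1" using ys(3) unfolding k_def[symmetric] atLeastAtMost_iff by linarith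
  then consider "i \<in> {1..k}" | "i = k + 1" by blast
  then have "\<exists>l\<le>k + 1. set xs = {1..l}"
  proof cases
    case 1
    then have "set xs = {1..k}" by (simp add: ys(2) setys insert_absorb)
    then show ?thesis by (intro exI[of _ k]) simp
  next
    case 2
    have "insert (k + 1) {1..k} = {1..k + 1}" by auto
    then have "set xs = {1..k + 1}" by (simp add: ys(2) setys 2)
    then show ?thesis by (intro exI[of _ "k + 1"]) simp
  qed
  then obtain l where "l \<le> k + 1" "set xs = {1..l}" by blast
  then have "set xs = {1..card (set xs)}" "card (set xs) \<le> k + 1" by simp_all
  then show ?case using ys(2) k by auto
qed simp

lemma finite_growth_lists: "finite (growth_lists n)"
  by (induction n) auto

lemma block_sizes_old:
  assumes "xs \<in> growth_lists n" "i \<in> {1..card (set xs)}"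
  shows "count_list xs i \<in># block_sizes xs"
    and "block_sizes (xs @ [i]) = add_mset (count_list xs i + 1) (block_sizes xs - {#count_list xs i#})"
proof -
  let ?k = "card (set xs)"
  have "i \<in> set xs" using growth_lists_props[OF assms(1)] assms(2) by blast
  then have set: "set (xs @ [i]) = set xs" by auto
  have split: "mset_set {1..?k} = add_mset i (mset_set ({1..?k} - {i}))"
    using assms(2) by (simp add: mset_set.remove)
  have bs: "block_sizes xs = add_mset (count_list xs i) (image_mset (count_list xs) (mset_set ({1..?k} - {i})))"
    unfolding block_sizes_def split by simp
  show "count_list xs i \<in># block_sizes xs" unfolding bs by simp
  have "block_sizes (xs @ [i]) = add_mset (count_list xs i + 1) (image_mset (count_list (xs @ [i])) (mset_set ({1..?k} - {i})))"
    unfolding block_sizes_def set split by simp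
  also have "image_mset (count_list (xs @ [i])) (mset_set ({1..?k} - {i})) = image_mset (count_list xs) (mset_set ({1..?k} - {i}))"
    by (intro image_mset_cong) auto
  finally show "block_sizes (xs @ [i]) = add_mset (count_list xs i + 1) (block_sizes xs - {#count_list xs i#})"
    unfolding bs by simp
qed

lemma block_sizes_new:
  assumes "xs \<in> growth_lists n"
  shows "block_sizes (xs @ [card (set xs) + 1]) = add_mset 1 (block_sizes xs)"
    and "card (set (xs @ [card (set xs) + 1])) = card (set xs) + 1"
proof -
  define k where "k = card (set xs)"
  have set: "set xs = {1..k}" using growth_lists_props[OF assms] by (simp add: k_def)
  then have set': "set (xs @ [k + 1]) = {1..k + 1}" by auto
  then show "card (set (xs @ [card (set xs) + 1])) = card (set xs) + 1" by (simp add: k_def)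
  have split: "mset_set {1..k + 1} = add_mset (k + 1) (mset_set {1..k})"
  proof -
    have "{1..k + 1} = insert (k + 1) {1..k}" by auto
    then show ?thesis by simp
  qed
  have "k + 1 \<notin> set xs" using set by simp
  then have c0: "count_list xs (k + 1) = 0" by (simp add: count_list_0_iff)
  have "block_sizes (xs @ [k + 1]) = image_mset (count_list (xs @ [k + 1])) (mset_set {1..k + 1})"
    by (simp only: block_sizes_def set') simp
  also have "\<dots> = add_mset 1 (image_mset (count_list (xs @ [k + 1])) (mset_set {1..k}))"
    unfolding split by (simp add: c0)
  also have "image_mset (count_list (xs @ [k + 1])) (mset_set {1..k}) = block_sizes xs"
    unfolding block_sizes_def k_def[symmetric]
    by (intro image_mset_cong) auto
  finally show "block_sizes (xs @ [card (set xs) + 1]) = add_mset 1 (block_sizes xs)" by (simp add: k_def)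
qed

definition type_count :: "nat \<Rightarrow> nat multiset \<Rightarrow> nat" where
  "type_count n M = card {xs \<in> growth_lists n. block_sizes xs = M}"

text \<open>The block sizes that remain when the last element is removed from a block of size
  \<open>p\<close>; for \<open>p = 1\<close> the block disappears.\<close>

definition pred_type :: "nat multiset \<Rightarrow> nat \<Rightarrow> nat multiset" where
  "pred_type M p = (if p = 1 then M - {#1#} else add_mset (p - 1) (M - {#p#}))"

text \<open>The number of ways to put the last element back: it opens a block of its own, or joins
  one of the blocks of size \<open>p - 1\<close>, of which \<open>pred_type M p\<close> has one more
  than \<open>M\<close>.\<close>

definition pred_weight :: "nat multiset \<Rightarrow> nat \<Rightarrow> nat" where
  "pred_weight M p = (if p = 1 then 1 else count M (p - 1) + 1)"

lemma block_sizes_pos: "xs \<in> growth_lists n \<Longrightarrow> 0 \<notin># block_sizes xs \<and> sum_mset (block_sizes xs) = n"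
proof (induction n arbitrary: xs)
  case 0
  then show ?case by (simp add: block_sizes_def)
next
  case (Suc n)
  then obtain ys i where ys: "ys \<in> growth_lists n" "xs = ys @ [i]" "i \<in> {1..card (set ys) + 1}" by auto
  note IH = Suc.IH[OF ys(1)]
  have "i \<in> {1..card (set ys)} \<or> i = card (set ys) + 1" using ys(3) unfolding atLeastAtMost_iff by linarith
  then consider "i \<in> {1..card (set ys)}" | "i = card (set ys) + 1" by blast
  then show ?case
  proof cases
    case 1
    obtain B where B: "block_sizes ys = add_mset (count_list ys i) B"
      using block_sizes_old(1)[OF ys(1) 1] by (auto dest: multi_member_split)
    then have "block_sizes xs = add_mset (count_list ys i + 1) B"
      using block_sizes_old(2)[OF ys(1) 1] ys(2) by simp
    then show ?thesis using IH B by simp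
  next
    case 2
    then show ?thesis using block_sizes_new(1)[OF ys(1)] IH ys(2) by simp
  qed
qed

text \<open>Classify the extensions by the size \<open>p\<close> of the block that receives the new
  element.\<close>

lemma card_extensions:
  assumes xs: "xs \<in> growth_lists n" and M: "0 \<notin># M"
  shows "card {i \<in> {1..card (set xs) + 1}. block_sizes (xs @ [i]) = M} =
    (\<Sum>p\<in>set_mset M. if block_sizes xs = pred_type M p then pred_weight M p else 0)"
proof -
  define k where "k = card (set xs)"
  define B where "B = block_sizes xs"
  have nz: "0 \<notin># B" using block_sizes_pos[OF xs] by (simp add: B_def)
  have fiber: "card {i \<in> {1..k}. count_list xs i = c} = count B c" for c
  proof -
    have "count B c = count (image_mset (count_list xs) (mset_set {1..k})) c" by (simp add: B_def block_sizes_def k_def)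
    also have "\<dots> = card {i \<in> {1..k}. count_list xs i = c}"
      by (simp add: count_image_mset vimage_def Int_def conj_commute)
    finally show ?thesis ..
  qed
  have pt: "B = pred_type M p \<longleftrightarrow> M = add_mset p (B - {#p - 1#}) \<and> p - 1 \<in># B" if "p \<in># M" "p \<noteq> 1" for p
  proof
    assume "B = pred_type M p"
    then have B: "B = add_mset (p - 1) (M - {#p#})" using that by (simp add: pred_type_def)
    then show "M = add_mset p (B - {#p - 1#}) \<and> p - 1 \<in># B" using that by simp
  next
    assume "M = add_mset p (B - {#p - 1#}) \<and> p - 1 \<in># B"
    then have "M - {#p#} = B - {#p - 1#}" "p - 1 \<in># B" by auto
    then show "B = pred_type M p" using that by (simp add: pred_type_def)
  qed
  have "{i \<in> {1..k + 1}. block_sizes (xs @ [i]) = M} =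
     (if M = add_mset 1 B then {k + 1} else {}) \<union> (\<Union>p\<in>set_mset M - {1}. if B = pred_type M p then {i \<in> {1..k}. count_list xs i = p - 1} else {})"
    (is "?L = ?A \<union> ?C")
  proof (intro equalityI subsetI)
    fix i assume i: "i \<in> ?L"
    have "i \<in> {1..k + 1}" using i by blast
    then have "i \<in> {1..k} \<or> i = k + 1" unfolding atLeastAtMost_iff by linarith
    then consider "i = k + 1" | "i \<in> {1..k}" by blast
    then show "i \<in> ?A \<union> ?C"
    proof cases
      case 1
      then show ?thesis using i block_sizes_new(1)[OF xs] by (simp add: k_def B_def)
    next
      case 2
      define p where "p = count_list xs i + 1"
      have old: "count_list xs i \<in># B" "M = add_mset p (B - {#p - 1#})"
        using block_sizes_old[OF xs, of i] 2 i by (auto simp: k_def B_def p_def)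
      then have "p \<in># M" "p \<noteq> 1" using nz by (auto simp: p_def intro: gr0I)
      then have "B = pred_type M p" using pt[of p] old by (simp add: p_def)
      then show ?thesis using \<open>p \<in># M\<close> \<open>p \<noteq> 1\<close> 2 by (auto simp: p_def intro!: bexI[of _ p])
    qed
  next
    fix i assume "i \<in> ?A \<union> ?C"
    then show "i \<in> ?L"
    proof
      assume "i \<in> ?A"
      then show ?thesis using block_sizes_new(1)[OF xs] by (auto simp: k_def B_def split: if_splits)
    next
      assume "i \<in> ?C"
      then obtain p where p: "p \<in># M" "p \<noteq> 1" "B = pred_type M p" "i \<in> {1..k}" "count_list xs i = p - 1"
        by (auto split: if_splits)
      have "p \<ge> 1" using p(1) M by (metis less_one not_le)
      then have "count_list xs i + 1 = p" using p(5) by simp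
      then show ?thesis
        using pt[OF p(1,2)] p block_sizes_old(2)[OF xs, of i] by (auto simp: k_def B_def)
    qed
  qed
  then have "card ?L = card ?A + card ?C"
    by (simp only:) (rule card_Un_disjoint, auto split: if_splits)
  also have "card ?C = (\<Sum>p\<in>set_mset M - {1}. card (if B = pred_type M p then {i \<in> {1..k}. count_list xs i = p - 1} else {}))"
  proof (rule card_UN_disjoint)
    show "\<forall>p\<in>set_mset M - {1}. \<forall>q\<in>set_mset M - {1}. p \<noteq> q \<longrightarrow>
      (if B = pred_type M p then {i \<in> {1..k}. count_list xs i = p - 1} else {}) \<inter>
      (if B = pred_type M q then {i \<in> {1..k}. count_list xs i = q - 1} else {}) = {}"
    proof (intro ballI impI)
      fix p q assume "p \<in> set_mset M - {1}" "q \<in> set_mset M - {1}" "p \<noteq> q"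
      then have "p \<noteq> 0" "q \<noteq> 0" using M by (metis DiffD1)+
      with \<open>p \<noteq> q\<close> have "p - 1 \<noteq> q - 1" by linarith
      then show "(if B = pred_type M p then {i \<in> {1..k}. count_list xs i = p - 1} else {}) \<inter>
        (if B = pred_type M q then {i \<in> {1..k}. count_list xs i = q - 1} else {}) = {}" by auto
    qed
  qed auto
  also have "\<dots> = (\<Sum>p\<in>set_mset M - {1}. if B = pred_type M p then pred_weight M p else 0)"
  proof (intro sum.cong refl)
    fix p assume p: "p \<in> set_mset M - {1}"
    show "card (if B = pred_type M p then {i \<in> {1..k}. count_list xs i = p - 1} else {}) = (if B = pred_type M p then pred_weight M p else 0)"
    proof (cases "B = pred_type M p")
      case True
      have "p \<noteq> p - 1" using p M by (metis DiffD1 diff_le_self less_one not_le diff_less gr0I less_irrefl)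
      then have "count B (p - 1) = count M (p - 1) + 1"
        using True p by (simp add: pred_type_def)
      moreover have "pred_weight M p = count M (p - 1) + 1" using p by (simp add: pred_weight_def)
      ultimately show ?thesis unfolding if_P[OF True] fiber by simp
    qed simp
  qed
  also have "card ?A = (if 1 \<in># M \<and> B = pred_type M 1 then pred_weight M 1 else 0)"
  proof -
    have "M = add_mset 1 B \<longleftrightarrow> 1 \<in># M \<and> B = pred_type M 1"
      by (auto simp: pred_type_def)
    then show ?thesis by (simp add: pred_weight_def)
  qed
  also have "(if 1 \<in># M \<and> B = pred_type M 1 then pred_weight M 1 else 0) +
     (\<Sum>p\<in>set_mset M - {1}. if B = pred_type M p then pred_weight M p else 0) =
     (\<Sum>p\<in>set_mset M. if B = pred_type M p then pred_weight M p else 0)"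
    by (cases "1 \<in># M") (simp_all add: sum.remove[of "set_mset M" 1])
  finally show ?thesis by (simp add: B_def k_def)
qed

lemma type_count_Suc:
  assumes "0 \<notin># M"
  shows "type_count (Suc n) M = (\<Sum>p\<in>set_mset M. pred_weight M p * type_count n (pred_type M p))"
proof -
  have "{ys \<in> growth_lists (Suc n). block_sizes ys = M} =
    (\<Union>xs\<in>growth_lists n. (\<lambda>i. xs @ [i]) ` {i \<in> {1..card (set xs) + 1}. block_sizes (xs @ [i]) = M})"
    unfolding growth_lists.simps by blast
  then have "type_count (Suc n) M = card (\<Union>xs\<in>growth_lists n. (\<lambda>i. xs @ [i]) ` {i \<in> {1..card (set xs) + 1}. block_sizes (xs @ [i]) = M})"
    by (simp only: type_count_def)
  also have "\<dots> = (\<Sum>xs\<in>growth_lists n. card ((\<lambda>i. xs @ [i]) ` {i \<in> {1..card (set xs) + 1}. block_sizes (xs @ [i]) = M}))"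
    by (rule card_UN_disjoint) (auto simp: finite_growth_lists)
  also have "\<dots> = (\<Sum>xs\<in>growth_lists n. card {i \<in> {1..card (set xs) + 1}. block_sizes (xs @ [i]) = M})"
    by (intro sum.cong refl card_image) (simp add: inj_on_def)
  also have "\<dots> = (\<Sum>xs\<in>growth_lists n. \<Sum>p\<in>set_mset M. if block_sizes xs = pred_type M p then pred_weight M p else 0)"
    using assms by (intro sum.cong refl card_extensions)
  also have "\<dots> = (\<Sum>p\<in>set_mset M. \<Sum>xs\<in>growth_lists n. if block_sizes xs = pred_type M p then pred_weight M p else 0)"
    by (rule sum.swap)
  also have "\<dots> = (\<Sum>p\<in>set_mset M. pred_weight M p * type_count n (pred_type M p))"
  proof (intro sum.cong refl)
    fix p
    have "(\<Sum>xs\<in>growth_lists n. if block_sizes xs = pred_type M p then pred_weight M p else 0) =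
       (\<Sum>xs\<in>{xs \<in> growth_lists n. block_sizes xs = pred_type M p}. pred_weight M p)"
      using finite_growth_lists by (rule sum.inter_filter[symmetric])
    then show "(\<Sum>xs\<in>growth_lists n. if block_sizes xs = pred_type M p then pred_weight M p else 0) = pred_weight M p * type_count n (pred_type M p)"
      by (simp add: type_count_def mult.commute)
  qed
  finally show ?thesis .
qed

definition type_den :: "nat \<Rightarrow> nat multiset \<Rightarrow> nat" where
  "type_den N M = (\<Prod>j=1..N. fact (count M j)) * (\<Prod>p\<in>#M. fact p)"

lemma type_den_extend: "count M (Suc N) = 0 \<Longrightarrow> type_den (Suc N) M = type_den N M"
proof -
  assume "count M (Suc N) = 0"
  moreover have "{1..Suc N} = insert (Suc N) {1..N}" by auto
  ultimately show ?thesis by (simp add: type_den_def)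
qed

text \<open>Read as a quotient: removal from a block of size \<open>p\<close> accounts for the
  fraction \<open>p * count M p\<close> over the number of elements.\<close>

lemma type_den_pred:
  assumes p: "p \<in># M" "p \<le> N" and M: "0 \<notin># M"
  shows "type_den N (pred_type M p) * (p * count M p) = type_den N M * pred_weight M p"
proof -
  have p0: "p \<ge> 1" using p M by (metis less_one not_le)
  obtain M' where M': "M = add_mset p M'" using p(1) by (metis insert_DiffM)
  show ?thesis
  proof (cases "p = 1")
    case True
    then have pt: "pred_type M p = M'" by (simp add: pred_type_def M')
    have one: "1 \<in> {1..N}" using p True by auto
    have 1: "(\<Prod>j\<in>{1..N} - {1}. fact (count M j) :: nat) = (\<Prod>j\<in>{1..N} - {1}. fact (count M' j))"
      by (intro prod.cong refl) (auto simp: M' True)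
    have A: "(\<Prod>j=1..N. fact (count M' j) :: nat) * count M 1 = (\<Prod>j=1..N. fact (count M j))"
      unfolding prod.remove[OF finite_atLeastAtMost one] 1 by (simp add: M' True algebra_simps)
    have B: "(\<Prod>p\<in>#M. fact p :: nat) = (\<Prod>p\<in>#M'. fact p)" by (simp add: M' True)
    show ?thesis unfolding pt type_den_def B A[symmetric] unfolding True pred_weight_def
      by (simp only: mult_ac if_True simp_thms mult_1)
  next
    case False
    define q where "q = p - 1"
    have pq: "p = q + 1" "q \<noteq> p" "q \<in> {1..N}" "p \<in> {1..N}" using p0 p False by (auto simp: q_def)
    have pt: "pred_type M p = add_mset q M'" using False by (simp add: pred_type_def M' q_def)
    have split: "(\<Prod>j=1..N. g j) = g p * (g q * (\<Prod>j\<in>{1..N} - {p, q}. g j))" for g :: "nat \<Rightarrow> nat"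
    proof -
      have "{1..N} = insert p (insert q ({1..N} - {p, q}))" using pq by auto
      then have "(\<Prod>j=1..N. g j) = prod g (insert p (insert q ({1..N} - {p, q})))" by simp
      also have "\<dots> = g p * (g q * (\<Prod>j\<in>{1..N} - {p, q}. g j))"
        using pq(2) by (subst prod.insert; simp)+
      finally show ?thesis .
    qed
    have 1: "(\<Prod>j\<in>{1..N} - {p, q}. fact (count M j) :: nat) = (\<Prod>j\<in>{1..N} - {p, q}. fact (count (add_mset q M') j))"
      by (intro prod.cong refl) (auto simp: M')
    have A: "(\<Prod>j=1..N. fact (count (add_mset q M') j) :: nat) * count M p = (\<Prod>j=1..N. fact (count M j)) * (count M q + 1)"
      unfolding split using pq(2) by (simp add: 1 M' algebra_simps)
    have B: "(\<Prod>p\<in>#add_mset q M'. fact p :: nat) * p = (\<Prod>p\<in>#M. fact p)"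
      
    proof -
      have "fact p = p * (fact q :: nat)" unfolding pq(1) One_nat_def by simp
      then show ?thesis by (simp add: M' mult_ac)
    qed
    have "type_den N (pred_type M p) * (p * count M p) =
        ((\<Prod>j=1..N. fact (count (add_mset q M') j)) * count M p) * ((\<Prod>p\<in>#add_mset q M'. fact p) * p)"
      unfolding pt type_den_def by (simp only: mult_ac)
    also have "\<dots> = type_den N M * (count M q + 1)"
      unfolding A B type_den_def by (simp only: mult_ac)
    finally show ?thesis using False by (simp add: pred_weight_def q_def)
  qed
qed

lemma sum_mset_eq_sum_count: "sum_mset M = (\<Sum>p\<in>set_mset M. p * count M (p::nat))"
proof -
  have "sum_mset M = (\<Sum>p\<in>X. p * count M p)" if "finite X" "set_mset M \<subseteq> X" for X
    using that(2)
  proof (induction M)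
    case (add x M)
    then have "x \<in> X" "sum_mset M = (\<Sum>p\<in>X. p * count M p)" by auto
    moreover have "p * count (add_mset x M) p = p * count M p + (if p = x then x else 0)" for p
      by simp
    ultimately show ?case using \<open>finite X\<close> by (simp add: sum.distrib del: count_add_mset)
  qed simp
  then show ?thesis by simp
qed

text \<open>Induction on removal of the last element; the contributions \<open>p * count M p\<close>
  of the block sizes add up to the number of elements.\<close>

theorem type_count_den: "0 \<notin># M \<Longrightarrow> sum_mset M = n \<Longrightarrow> type_count n M * type_den n M = fact n"
proof (induction n arbitrary: M)
  case 0
  then have "M = {#}" by (metis multiset_nonemptyE sum_mset_0_iff)
  moreover have "{xs \<in> growth_lists 0. block_sizes xs = {#}} = {[]}" by (auto simp: block_sizes_def)
  ultimately show ?case by (simp add: type_count_def type_den_def)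
next
  case (Suc n)
  have mem_le: "p \<le> sum_mset N" if "p \<in># N" for p and N :: "nat multiset"
    using multi_member_split[OF that] by auto
  have le: "p \<le> Suc n" if "p \<in># M" for p
    using mem_le[OF that] Suc.prems(2) by simp
  have step: "type_count n (pred_type M p) * type_den (Suc n) (pred_type M p) = fact n" if p: "p \<in># M" for p
  proof -
    have "p \<noteq> 0" using p Suc.prems(1) by metis
    obtain M' where M': "M = add_mset p M'" using p by (metis insert_DiffM)
    have 0: "0 \<notin># pred_type M p" using Suc.prems(1) \<open>p \<noteq> 0\<close> by (auto simp: pred_type_def M')
    have s: "sum_mset (pred_type M p) = n"
      using Suc.prems(2) \<open>p \<noteq> 0\<close> by (auto simp: pred_type_def M' One_nat_def)
    have "Suc n \<notin># pred_type M p"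
      using mem_le[of "Suc n" "pred_type M p"] s by auto
    then have "type_den (Suc n) (pred_type M p) = type_den n (pred_type M p)"
      by (intro type_den_extend) (simp add: not_in_iff)
    then show ?thesis using Suc.IH[OF 0 s] by simp
  qed
  have "type_count (Suc n) M * type_den (Suc n) M = (\<Sum>p\<in>set_mset M. type_count n (pred_type M p) * (type_den (Suc n) M * pred_weight M p))"
    unfolding type_count_Suc[OF Suc.prems(1)] sum_distrib_right by (intro sum.cong refl) (simp add: mult_ac)
  also have "\<dots> = (\<Sum>p\<in>set_mset M. fact n * (p * count M p))"
  proof (intro sum.cong refl)
    fix p assume p: "p \<in># M"
    show "type_count n (pred_type M p) * (type_den (Suc n) M * pred_weight M p) = fact n * (p * count M p)"
      unfolding type_den_pred[OF p le[OF p] Suc.prems(1), symmetric] step[OF p, symmetric] by (simp add: mult_ac)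
  qed
  also have "\<dots> = fact n * sum_mset M"
    unfolding sum_mset_eq_sum_count sum_distrib_left ..
  finally show ?case using Suc.prems(2) by (simp add: mult.commute)
qed

section \<open>From set partitions to partitions\<close>

definition shape :: "nat list \<Rightarrow> nat list" where
  "shape xs = rev (sorted_list_of_multiset (block_sizes xs))"

lemma mset_shape: "mset (shape xs) = block_sizes xs"
  by (simp add: shape_def)

lemma shape_partition: "xs \<in> growth_lists n \<Longrightarrow> shape xs \<in> partitions n"
proof -
  assume xs: "xs \<in> growth_lists n"
  have "sorted_wrt (\<ge>) (shape xs)"
    unfolding shape_def sorted_wrt_rev by simp
  moreover have "\<forall>p\<in>set (shape xs). p > 0"
    using block_sizes_pos[OF xs] unfolding set_mset_mset[symmetric] mset_shape by (metis gr0I)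
  moreover have "sum_list (shape xs) = n"
    using block_sizes_pos[OF xs] mset_shape[of xs] by (metis sum_mset_sum_list)
  ultimately show ?thesis by (simp add: partitions_def)
qed

lemma shape_eq_iff: "\<mu> \<in> partitions n \<Longrightarrow> shape xs = \<mu> \<longleftrightarrow> block_sizes xs = mset \<mu>"
proof
  assume "\<mu> \<in> partitions n" "block_sizes xs = mset \<mu>"
  then have "sorted (rev \<mu>)" by (simp add: partitions_def sorted_wrt_rev)
  then have "sorted_list_of_multiset (mset \<mu>) = rev \<mu>"
    by (metis mset_rev sorted_list_of_multiset_mset sorted_sort_id)
  then show "shape xs = \<mu>" using \<open>block_sizes xs = mset \<mu>\<close> by (simp add: shape_def)
qed (simp add: mset_shape[symmetric])

theorem card_shape: "\<mu> \<in> partitions n \<Longrightarrow> card {xs \<in> growth_lists n. shape xs = \<mu>} = m_part \<mu>"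
proof -
  assume \<mu>: "\<mu> \<in> partitions n"
  have 0: "0 \<notin># mset \<mu>" and n: "sum_mset (mset \<mu>) = n" "sum_list \<mu> = n"
    using \<mu> by (auto simp: partitions_def sum_mset_sum_list)
  have "(\<Prod>p\<in>#mset \<mu>. fact p :: nat) = (\<Prod>i<length \<mu>. fact (\<mu> ! i))"
    unfolding mset_map[symmetric] prod_mset_prod_list prod.list_conv_set_nth by (simp add: atLeast0LessThan)
  then have den: "type_den n (mset \<mu>) = (\<Prod>j=1..sum_list \<mu>. fact (count_list \<mu> j)) * (\<Prod>i<length \<mu>. fact (\<mu> ! i))"
    by (simp add: type_den_def n(2) count_mset)
  have "type_den n (mset \<mu>) \<noteq> 0"
  proof
    assume "type_den n (mset \<mu>) = 0"
    with type_count_den[OF 0 n(1)] show False by simp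
  qed
  then have "m_part \<mu> = type_count n (mset \<mu>)"
    unfolding m_part_def den[unfolded n(2), symmetric] n(2) type_count_den[OF 0 n(1), symmetric] by simp
  then show ?thesis using shape_eq_iff[OF \<mu>] by (simp add: type_count_def)
qed

lemma length_shape: "length (shape xs) = card (set xs)"
proof -
  have "length (shape xs) = size (block_sizes xs)" by (simp flip: mset_shape)
  then show ?thesis by (simp add: block_sizes_def)
qed

section \<open>Elimination of linear equations\<close>

lemma ex_permutes_extend:
  fixes f :: "nat \<Rightarrow> nat"
  assumes "inj_on f {1..k}" "f ` {1..k} \<subseteq> {1..n}"
  shows "\<exists>\<pi>. \<pi> permutes {1..n} \<and> (\<forall>i\<in>{1..k}. \<pi> i = f i)"
proof -
  have card: "card (f ` {1..k}) = k" using assms(1) by (simp add: card_image)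
  then have kn: "k \<le> n" using card_mono[OF _ assms(2)] by simp
  have "card {k + 1..n} = card ({1..n} - f ` {1..k})"
    using assms(2) card kn by (subst card_Diff_subset) auto
  then obtain h where h: "bij_betw h {k + 1..n} ({1..n} - f ` {1..k})"
    using finite_same_card_bij[of "{k + 1..n}" "{1..n} - f ` {1..k}"] by auto
  define \<pi> where "\<pi> i = (if i \<in> {1..k} then f i else if i \<in> {k + 1..n} then h i else i)" for i
  have "bij_betw \<pi> {1..k} (f ` {1..k})"
    using assms(1) by (subst bij_betw_cong[of _ \<pi> f]) (auto simp: \<pi>_def bij_betw_def)
  moreover have "bij_betw \<pi> {k + 1..n} ({1..n} - f ` {1..k})"
    using h by (subst bij_betw_cong[of _ \<pi> h]) (auto simp: \<pi>_def)
  ultimately have "bij_betw \<pi> ({1..k} \<union> {k + 1..n}) (f ` {1..k} \<union> ({1..n} - f ` {1..k}))"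
    by (rule bij_betw_combine) blast
  moreover have "{1..k} \<union> {k + 1..n} = {1..n}" using kn by auto
  moreover have "f ` {1..k} \<union> ({1..n} - f ` {1..k}) = {1..n}" using assms(2) by blast
  ultimately have "bij_betw \<pi> {1..n} {1..n}" by simp
  moreover have "\<pi> i = i" if "i \<notin> {1..n}" for i using that kn by (auto simp: \<pi>_def)
  ultimately have "\<pi> permutes {1..n}" by (rule bij_imp_permutes)
  then show ?thesis by (intro exI[of _ \<pi>]) (simp add: \<pi>_def)
qed

lemma system_upd: "system m d g \<Longrightarrow> p \<in> polys {1..m} \<Longrightarrow> homogeneous e p \<Longrightarrow> system m (d(j := e)) (g(j := p))"
  by (auto simp: system_def)

text \<open>The equation \<open>s\<close> is never altered, so the operations can be carried out one
  after the other.\<close>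

lemma Res_add_many:
  fixes g :: "nat \<Rightarrow> (nat, 'a::comm_ring_1) mpoly"
  assumes "degree_vector m d" "system m d g" "s \<in> {1..m}"
    and "finite A" "A \<subseteq> {1..m} - {s}" "\<And>i. i \<in> A \<Longrightarrow> d s \<le> d i"
    and h: "\<And>i. i \<in> A \<Longrightarrow> h i \<in> polys {1..m}" "\<And>i. i \<in> A \<Longrightarrow> homogeneous (d i - d s) (h i)"
  shows "Res m d (\<lambda>i. if i \<in> A then g i + h i * g s else g i) = Res m d g"
  using assms(4-8)
proof (induction A)
  case (insert a A)
  define g' where "g' = (\<lambda>i. if i \<in> A then g i + h i * g s else g i)"
  have sys: "system m d g'"
    unfolding system_def
  proof
    fix i assume i: "i \<in> {1..m}"
    have gi: "g i \<in> polys {1..m}" "homogeneous (d i) (g i)" "g s \<in> polys {1..m}" "homogeneous (d s) (g s)"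
      using assms(2,3) i by (auto simp: system_def)
    have "h i * g s \<in> polys {1..m} \<and> homogeneous (d i) (h i * g s)" if "i \<in> A"
      using insert.prems(2,3,4)[of i] gi that homogeneous_mult[of "d i - d s" "h i" "d s" "g s"]
      by (auto intro: polys_mult)
    then show "g' i \<in> polys {1..m} \<and> homogeneous (d i) (g' i)"
      using gi by (auto simp: g'_def intro: polys_add homogeneous_add)
  qed
  have ne: "a \<noteq> s" "s \<notin> A" "a \<in> {1..m}" using insert.prems(1) by auto
  have "Res m d (g'(a := g' a + h a * g' s)) = Res m d g'"
    using insert.prems ne by (intro Res_add[OF assms(1) sys assms(3)]) auto
  moreover have "g'(a := g' a + h a * g' s) = (\<lambda>i. if i \<in> insert a A then g i + h i * g s else g i)"
    using insert.hyps ne by (auto simp: g'_def fun_eq_iff)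
  moreover have "Res m d g' = Res m d g"
    unfolding g'_def using insert.prems by (intro insert.IH) auto
  ultimately show ?case by simp
qed simp

text \<open>The linear equations come last here. The last indeterminate \<open>x_n\<close> is
  replaced by \<open>x_(b n)\<close> in the first \<open>k\<close> equations by elementary
  operations, after which \<open>Res_eliminate_last\<close> drops it.\<close>

lemma Res_eliminate_tail:
  fixes g :: "nat \<Rightarrow> (nat, 'a::comm_ring_1) mpoly"
  assumes k: "k \<ge> 1" and e: "\<And>i. i \<in> {1..k} \<Longrightarrow> e i \<ge> 1" "\<And>i. i > k \<Longrightarrow> e i = 1"
  shows "k \<le> n \<Longrightarrow> (\<And>i. i \<in> {1..k} \<Longrightarrow> g i \<in> polys {1..n} \<and> homogeneous (e i) (g i)) \<Longrightarrow>
    (\<And>p. p \<in> {k + 1..n} \<Longrightarrow> b p \<in> {1..k}) \<Longrightarrow>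
    Res n e (\<lambda>p. if p \<le> k then g p else Var p - Var (b p)) =
    Res k e (\<lambda>i. subst_vars (\<lambda>p. if p \<le> k then p else b p) (g i))"
proof (induction "n - k" arbitrary: n g)
  case 0
  then have n: "n = k" by simp
  interpret degree_vector k e using k e(1) by unfold_locales auto
  show ?case unfolding n
  proof (rule Res_cong)
    fix i assume i: "i \<in> {1..k}"
    have "subst_vars (\<lambda>p. if p \<le> k then p else b p) (g i) = subst_vars (\<lambda>x. x) (g i)"
      by (rule subst_vars_cong[of _ "{1..k}"]) (use 0(3)[OF i] n in auto)
    then show "(if i \<le> k then g i else Var i - Var (b i)) = subst_vars (\<lambda>p. if p \<le> k then p else b p) (g i)"
      using i by (simp add: subst_vars_id)
  qed
next
  case (Suc l)
  define N where "N = n - 1"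
  have nN: "n = N + 1" "k \<le> N" "l = N - k" using Suc(2) by (auto simp: N_def)
  have bn: "b n \<in> {1..k}" using Suc.prems(3)[of n] nN by auto
  have e_pos: "e i \<ge> 1" if "i \<ge> 1" for i using e(1)[of i] e(2)[of i] that by (cases "i \<le> k") auto
  interpret D: degree_vector n e using nN e_pos k by unfold_locales auto
  interpret D': degree_vector N e using nN e_pos k by unfold_locales auto
  define G where "G p = (if p \<le> k then g p else Var p - Var (b p))" for p
  have hom1: "homogeneous 1 (Var x)" for x by (simp add: One_nat_def)
  have sysG: "system n e G"
    unfolding system_def
  proof
    fix p assume p: "p \<in> {1..n}"
    show "G p \<in> polys {1..n} \<and> homogeneous (e p) (G p)"
    proof (cases "p \<le> k")
      case True
      then show ?thesis using Suc.prems(2)[of p] p by (auto simp: G_def)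
    next
      case False
      then have "b p \<in> {1..k}" using Suc.prems(3)[of p] p by auto
      then have "b p \<in> {1..n}" using nN by auto
      then show ?thesis
        using False p e(2)[of p] by (auto simp: G_def intro!: polys_diff polys_Var homogeneous_diff hom1)
    qed
  qed
  have "\<forall>i\<in>{1..k}. \<exists>q. q \<in> polys {1..n} \<and> homogeneous (e i - 1) q \<and>
      g i - subst_vars (id(n := b n)) (g i) = (Var n - Var (b n)) * q"
    using Suc.prems(2) bn nN by (intro ballI ex_difference_quotient) auto
  then obtain q where q: "\<And>i. i \<in> {1..k} \<Longrightarrow> q i \<in> polys {1..n} \<and> homogeneous (e i - 1) (q i) \<and>
      g i - subst_vars (id(n := b n)) (g i) = (Var n - Var (b n)) * q i"
    by metis
  \<comment> \<open>Modulo the equation \<open>x_n - x_(b n)\<close>, of degree 1, each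
    \<open>g i\<close> equals \<open>g' i\<close>; the multiplier \<open>- q i\<close> has the
    degree \<open>e i - 1\<close> that \<open>Res_add_many\<close> asks for.\<close>
  define g' where "g' i = subst_vars (id(n := b n)) (g i)" for i
  have "Res n e G = Res n e (\<lambda>i. if i \<in> {1..k} then G i + (- q i) * G n else G i)"
  proof (rule Res_add_many[OF D.degree_vector_axioms sysG, symmetric])
    show "n \<in> {1..n}" "{1..k} \<subseteq> {1..n} - {n}" using nN k by auto
    have en: "e n = 1" using e(2) nN by simp
    show "e n \<le> e i" if "i \<in> {1..k}" for i using e(1)[OF that] en by simp
    show "- q i \<in> polys {1..n}" "homogeneous (e i - e n) (- q i)" if "i \<in> {1..k}" for i
      using q[OF that] en by (auto intro: polys_uminus homogeneous_uminus)
  qed simp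
  also have "\<dots> = Res (N + 1) e ((\<lambda>p. if p \<le> k then g' p else Var p - Var (b p))(N + 1 := Var (N + 1) - Var (b n)))"
    unfolding nN(1)[symmetric]
  proof (rule D.Res_cong)
    fix i assume i: "i \<in> {1..n}"
    have kn: "\<not> n \<le> k" using nN by simp
    show "(if i \<in> {1..k} then G i + - q i * G n else G i) =
        ((\<lambda>p. if p \<le> k then g' p else Var p - Var (b p))(n := Var n - Var (b n))) i"
    proof (cases "i \<le> k")
      case True
      then have ik: "i \<in> {1..k}" "i \<noteq> n" using i kn by auto
      have "g' i = g i - (Var n - Var (b n)) * q i" using q[OF ik(1)] by (simp add: g'_def algebra_simps)
      then show ?thesis using True ik kn by (simp add: G_def algebra_simps)
    next
      case False
      then show ?thesis by (simp add: G_def)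
    qed
  qed
  also have "\<dots> = Res N e (\<lambda>p. if p \<le> k then g' p else Var p - Var (b p))"
  proof (rule Res_eliminate_last[OF D'.degree_vector_axioms])
    have g'p: "g' i \<in> polys {1..N} \<and> homogeneous (e i) (g' i)" if "i \<in> {1..k}" for i
      unfolding g'_def using Suc.prems(2)[OF that] bn nN
      by (auto intro!: polys_subst_vars[of _ "{1..n}"] homogeneous_subst_vars)
    show "system N e (\<lambda>p. if p \<le> k then g' p else Var p - Var (b p))"
      unfolding system_def
    proof
      fix p assume p: "p \<in> {1..N}"
      show "(if p \<le> k then g' p else Var p - Var (b p)) \<in> polys {1..N} \<and>
          homogeneous (e p) (if p \<le> k then g' p else Var p - Var (b p))"
      proof (cases "p \<le> k")
        case True
        then show ?thesis using g'p[of p] p by auto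
      next
        case False
        then have "b p \<in> {1..k}" using Suc.prems(3)[of p] p nN by auto
        then have "b p \<in> {1..N}" using nN by auto
        then show ?thesis using False p e(2)[of p] by (auto intro!: polys_diff polys_Var homogeneous_diff hom1)
      qed
    qed
    show "b n \<in> {1..N}" using bn nN by auto
    show "e (N + 1) = 1" using e(2) nN by simp
  qed
  also have "\<dots> = Res k e (\<lambda>i. subst_vars (\<lambda>p. if p \<le> k then p else b p) (g' i))"
  proof (rule Suc.hyps(1)[OF nN(3) nN(2)])
    show "g' i \<in> polys {1..N} \<and> homogeneous (e i) (g' i)" if "i \<in> {1..k}" for i
      unfolding g'_def using Suc.prems(2)[OF that] bn nN
      by (auto intro!: polys_subst_vars[of _ "{1..n}"] homogeneous_subst_vars)
    show "b p \<in> {1..k}" if "p \<in> {k + 1..N}" for p using Suc.prems(3)[of p] that nN by auto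
  qed
  also have "\<dots> = Res k e (\<lambda>i. subst_vars (\<lambda>p. if p \<le> k then p else b p) (g i))"
  proof -
    have "(\<lambda>p. if p \<le> k then p else b p) \<circ> (id(n := b n)) = (\<lambda>p. if p \<le> k then p else b p)"
      using bn nN by (auto simp: fun_eq_iff)
    then show ?thesis by (simp add: g'_def subst_vars_compose)
  qed
  finally show ?case unfolding G_def .
qed

text \<open>Elimination of the linear equations \<open>x_p = x_(rep (b p))\<close> that identify the indeterminates
  of each block \<open>b p = i\<close> with that of its representative \<open>rep i\<close>.\<close>

theorem Res_eliminate:
  fixes g :: "nat \<Rightarrow> (nat, 'a::comm_ring_1) mpoly"
  assumes k: "k \<ge> 1" and e: "\<And>i. i \<in> {1..k} \<Longrightarrow> e i \<ge> 1"
    and g: "\<And>i. i \<in> {1..k} \<Longrightarrow> g i \<in> polys {1..n}" "\<And>i. i \<in> {1..k} \<Longrightarrow> homogeneous (e i) (g i)"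
    and b: "\<And>p. p \<in> {1..n} \<Longrightarrow> b p \<in> {1..k}"
    and rep: "\<And>i. i \<in> {1..k} \<Longrightarrow> rep i \<in> {1..n}" "\<And>i. i \<in> {1..k} \<Longrightarrow> b (rep i) = i"
  shows "Res n (\<lambda>p. if rep (b p) = p then e (b p) else 1) (\<lambda>p. if rep (b p) = p then g (b p) else Var p - Var (rep (b p)))
     = Res k e (\<lambda>i. subst_vars b (g i))"
proof -
  have inj: "inj_on rep {1..k}" using rep(2) by (metis inj_onI)
  have img: "rep ` {1..k} \<subseteq> {1..n}" using rep(1) by blast
  have kn: "k \<le> n" using card_inj_on_le[OF inj img finite_atLeastAtMost] by simp
  \<comment> \<open>Renumbering by \<open>\<pi>\<close> moves the representatives to the first
    \<open>k\<close> places and leaves the linear equations as a tail.\<close>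
  obtain \<pi> where \<pi>: "\<pi> permutes {1..n}" "\<And>i. i \<in> {1..k} \<Longrightarrow> \<pi> i = rep i"
    using ex_permutes_extend[OF inj img] by blast
  define \<pi>' where "\<pi>' = inv_into UNIV \<pi>"
  have inverses: "\<pi> (\<pi>' x) = x" "\<pi>' (\<pi> x) = x" for x
    using permutes_inverses[OF \<pi>(1)] by (simp_all add: \<pi>'_def)
  have \<pi>in: "\<pi> p \<in> {1..n} \<longleftrightarrow> p \<in> {1..n}" for p using permutes_in_image[OF \<pi>(1)] .
  define D where "D p = (if rep (b p) = p then e (b p) else 1)" for p
  define S where "S p = (if rep (b p) = p then g (b p) else Var p - Var (rep (b p)))" for p
  interpret DV: degree_vector n D
    using kn k b e by unfold_locales (auto simp: D_def)
  have hom1: "homogeneous 1 (Var x)" for x by (simp add: One_nat_def)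
  have sys: "system n D S"
    unfolding system_def
  proof
    fix p assume p: "p \<in> {1..n}"
    then show "S p \<in> polys {1..n} \<and> homogeneous (D p) (S p)"
      using b[OF p] g[OF b[OF p]] rep(1)[OF b[OF p]]
      by (auto simp: S_def D_def intro!: polys_diff polys_Var homogeneous_diff hom1)
  qed
  have first: "b (\<pi> p) = p \<and> rep (b (\<pi> p)) = \<pi> p" if "p \<in> {1..k}" for p
    using \<pi>(2)[OF that] rep(2)[OF that] by simp
  have later: "rep (b (\<pi> p)) \<noteq> \<pi> p \<and> b (\<pi> p) \<in> {1..k}" if p: "p \<in> {1..n}" "\<not> p \<le> k" for p
  proof -
    have bk: "b (\<pi> p) \<in> {1..k}" using b \<pi>in p by blast
    have "rep (b (\<pi> p)) \<noteq> \<pi> p"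
    proof
      assume "rep (b (\<pi> p)) = \<pi> p"
      then have "\<pi> (b (\<pi> p)) = \<pi> p" using \<pi>(2)[OF bk] by simp
      then have "b (\<pi> p) = p" using inverses(2) by metis
      then show False using bk p by auto
    qed
    then show ?thesis using bk by blast
  qed
  have \<pi>'rep: "\<pi>' (rep i) = i" if "i \<in> {1..k}" for i
    using \<pi>(2)[OF that] inverses(2) by metis
  define e' where "e' i = (if i \<le> k then e i else 1)" for i
  define g' where "g' i = subst_vars \<pi>' (g i)" for i
  interpret DV': degree_vector n "\<lambda>i. D (\<pi> i)"
    using DV.m_pos DV.d_pos \<pi>in by unfold_locales blast+
  interpret Dk: degree_vector k e' using k e by unfold_locales (auto simp: e'_def)
  have "Res n D S = Res n (\<lambda>i. D (\<pi> i)) (\<lambda>i. subst_vars \<pi>' (S (\<pi> i)))"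
    by (rule Res_permute[OF DV.degree_vector_axioms sys \<pi>(1) inverses, symmetric])
  also have "\<dots> = Res n e' (\<lambda>p. if p \<le> k then g' p else Var p - Var (b (\<pi> p)))"
  proof (rule Res_cong'[OF DV'.degree_vector_axioms])
    fix p assume p: "p \<in> {1..n}"
    show "D (\<pi> p) = e' p"
      using first[of p] later[of p] p by (cases "p \<le> k") (auto simp: D_def e'_def)
    interpret s: comm_ring_hom "subst_vars \<pi>' :: (nat, 'a) mpoly \<Rightarrow> _" by (rule comm_ring_hom_subst_vars)
    show "subst_vars \<pi>' (S (\<pi> p)) = (if p \<le> k then g' p else Var p - Var (b (\<pi> p)))"
    proof (cases "p \<le> k")
      case True
      then show ?thesis using first[of p] \<pi>(2)[of p] p by (simp add: S_def g'_def)
    next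
      case False
      then show ?thesis using later[OF p False] by (simp add: S_def s.hom_minus inverses \<pi>'rep)
    qed
  qed
  also have "\<dots> = Res k e' (\<lambda>i. subst_vars (\<lambda>p. if p \<le> k then p else b (\<pi> p)) (g' i))"
  proof (rule Res_eliminate_tail[OF k _ _ kn])
    show "e' i \<ge> 1" if "i \<in> {1..k}" for i using e that by (simp add: e'_def)
    show "e' i = 1" if "i > k" for i using that by (simp add: e'_def)
    show "g' i \<in> polys {1..n} \<and> homogeneous (e' i) (g' i)" if "i \<in> {1..k}" for i
    proof -
      have "\<pi>' x \<in> {1..n}" if "x \<in> {1..n}" for x using \<pi>in[of "\<pi>' x"] that by (simp add: inverses)
      then show ?thesis using g that
        by (auto simp: g'_def e'_def intro!: polys_subst_vars[of _ "{1..n}"] homogeneous_subst_vars)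
    qed
    show "b (\<pi> p) \<in> {1..k}" if "p \<in> {k + 1..n}" for p using later[of p] that by auto
  qed
  also have "\<dots> = Res k e (\<lambda>i. subst_vars b (g i))"
  proof (rule Res_cong'[OF Dk.degree_vector_axioms])
    fix i assume i: "i \<in> {1..k}"
    show "e' i = e i" using i by (simp add: e'_def)
    have "subst_vars (\<lambda>p. if p \<le> k then p else b (\<pi> p)) (g' i) = subst_vars ((\<lambda>p. if p \<le> k then p else b (\<pi> p)) \<circ> \<pi>') (g i)"
      by (simp add: g'_def subst_vars_compose)
    also have "\<dots> = subst_vars b (g i)"
    proof (rule subst_vars_cong[OF g(1)[OF i]])
      fix x assume x: "x \<in> {1..n}"
      then have "\<pi>' x \<in> {1..n}" using \<pi>in[of "\<pi>' x"] by (simp add: inverses)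
      then show "((\<lambda>p. if p \<le> k then p else b (\<pi> p)) \<circ> \<pi>') x = b x"
        using first[of "\<pi>' x"] by (auto simp: inverses)
    qed
    finally show "subst_vars (\<lambda>p. if p \<le> k then p else b (\<pi> p)) (g' i) = subst_vars b (g i)" .
  qed
  finally show ?thesis unfolding D_def S_def .
qed

section \<open>Splitting the resultant along a tree\<close>

text \<open>Positions are counted from 1. The representative of a block is its least element, so it
  does not change when the list is extended.\<close>

definition rep :: "nat list \<Rightarrow> nat \<Rightarrow> nat" where
  "rep xs i = length (takeWhile (\<lambda>x. x \<noteq> i) xs) + 1"

lemma rep_append: "i \<in> set xs \<Longrightarrow> rep (xs @ ys) i = rep xs i"
  by (simp add: rep_def takeWhile_append1)

lemma rep_new: "i \<notin> set xs \<Longrightarrow> rep (xs @ [i]) i = length xs + 1"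
proof -
  assume "i \<notin> set xs"
  then have "takeWhile (\<lambda>x. x \<noteq> i) (xs @ [i]) = xs @ takeWhile (\<lambda>x. x \<noteq> i) [i]"
    by (intro takeWhile_append2) auto
  then show ?thesis by (simp add: rep_def)
qed

lemma rep_props:
  assumes "i \<in> set xs"
  shows "rep xs i \<in> {1..length xs}" "xs ! (rep xs i - 1) = i"
proof -
  have "takeWhile (\<lambda>x. x \<noteq> i) xs \<noteq> xs" using assms set_takeWhileD by metis
  then have "length (takeWhile (\<lambda>x. x \<noteq> i) xs) < length xs"
    by (metis length_takeWhile_le le_neq_implies_less takeWhile_eq_take take_all_iff order_refl)
  then show "rep xs i \<in> {1..length xs}" "xs ! (rep xs i - 1) = i"
    using nth_length_takeWhile[of "\<lambda>x. x \<noteq> i" xs] by (auto simp: rep_def)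
qed

lemma inj_on_rep: "inj_on (rep xs) (set xs)"
  by (rule inj_onI) (metis rep_props(2))

text \<open>In decreasing order of block numbers, because \<open>newton\<close> has the point added
  last at the head of its list.\<close>

definition reps :: "nat list \<Rightarrow> nat \<Rightarrow> nat list" where
  "reps xs i = rev (map (rep xs) [1..<i + 1])"

lemma reps_0: "reps xs 0 = []"
  by (simp add: reps_def One_nat_def)

lemma reps_Suc: "reps xs (i + 1) = rep xs (i + 1) # reps xs i"
proof -
  have "[1..<i + 1 + 1] = [1..<i + 1] @ [i + 1]" using upt_Suc_append[of 1 "i + 1"] unfolding Suc_eq_plus1 by linarith
  then show ?thesis unfolding reps_def by (simp only: map_append list.map rev_append) simp
qed

lemma set_reps: "set (reps xs i) = rep xs ` {1..i}"
  by (auto simp: reps_def)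

lemma length_reps: "length (reps xs i) = i"
  by (simp add: reps_def)

lemma distinct_reps: "{1..i} \<subseteq> set xs \<Longrightarrow> distinct (reps xs i)"
proof -
  assume "{1..i} \<subseteq> set xs"
  then have "inj_on (rep xs) {1..i}" by (rule inj_on_subset[OF inj_on_rep])
  moreover have "set [1..<i + 1] = {1..i}" by auto
  ultimately show ?thesis unfolding reps_def distinct_rev distinct_map by simp
qed

lemma reps_append: "{1..i} \<subseteq> set xs \<Longrightarrow> reps (xs @ ys) i = reps xs i"
  unfolding reps_def by (intro arg_cong[where f = rev] map_cong refl rep_append) auto

lemma homogeneous_0_eq_Const:
  assumes "homogeneous 0 p"
  shows "p = Const (Poly_Mapping.lookup p 0)"
proof (rule poly_mapping_eqI)
  fix t
  show "Poly_Mapping.lookup p t = Poly_Mapping.lookup (Const (Poly_Mapping.lookup p 0)) t"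
  proof (cases "t = 0")
    case False
    then have "t \<notin> Poly_Mapping.keys p" using assms by (auto simp: homogeneous_def mdeg_eq_0_iff)
    then show ?thesis using False by (simp add: Const_def lookup_single in_keys_iff)
  qed (simp add: Const_def)
qed

locale equivariant_system =
  fixes n d :: nat and F :: "nat \<Rightarrow> (nat, 'a::comm_ring_1) mpoly"
  assumes n_pos: "n \<ge> 1" and d_pos: "d \<ge> 1"
    and F_polys: "i \<in> {1..n} \<Longrightarrow> F i \<in> polys {1..n}"
    and F_homogeneous: "i \<in> {1..n} \<Longrightarrow> homogeneous d (F i)"
    and equivariant: "i \<in> {1..n} \<Longrightarrow> \<sigma> permutes {1..n} \<Longrightarrow> subst_vars \<sigma> (F i) = F (\<sigma> i)"
begin

text \<open>A transposition carries \<open>F i\<close> to \<open>F j\<close>, and setting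
  \<open>x_i\<close> to \<open>x_j\<close> absorbs it.\<close>

lemma compatible_F: "compatible {1..n} {1..n} d F"
  unfolding compatible_def
proof (intro conjI ballI)
  fix i j assume ij: "i \<in> {1..n}" "j \<in> {1..n}"
  have "subst_vars (transpose i j) (F i) = F j"
    using equivariant[OF ij(1) permutes_swap_id[OF ij]] by simp
  then have "subst_vars (id(i := j)) (F j) = subst_vars (id(i := j) \<circ> transpose i j) (F i)"
    by (metis subst_vars_compose)
  also have "id(i := j) \<circ> transpose i j = id(i := j)" by (auto simp: fun_eq_iff transpose_def)
  finally show "subst_vars (id(i := j)) (F i) = subst_vars (id(i := j)) (F j)" by (rule sym)
qed (use F_polys F_homogeneous in auto)

text \<open>The node \<open>xs\<close> of the tree assigns the block \<open>xs ! (p - 1)\<close> to each \<open>p \<le> length xs\<close>.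
  Representatives carry a divided difference, the other members of a block a linear equation.\<close>

definition deg :: "nat list \<Rightarrow> nat \<Rightarrow> nat" where
  "deg xs p = (if p \<le> length xs then if rep xs (xs ! (p - 1)) = p then d + 1 - xs ! (p - 1) else 1 else d)"

definition slot :: "nat list \<Rightarrow> nat \<Rightarrow> (nat, 'a) mpoly" where
  "slot xs p = (if p \<le> length xs
     then if rep xs (xs ! (p - 1)) = p then newton F (reps xs (xs ! (p - 1) - 1)) p
       else Var p - Var (rep xs (xs ! (p - 1)))
     else F p)"

definition W :: "nat list \<Rightarrow> 'a" where
  "W xs = Res n (deg xs) (slot xs)"

lemma W_Nil: "W [] = Res n (\<lambda>_. d) F"
proof -
  interpret degree_vector n "deg []"
    by unfold_locales (use n_pos d_pos in \<open>auto simp: deg_def\<close>)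
  show ?thesis unfolding W_def
    by (rule Res_cong'[OF degree_vector_axioms]) (auto simp: deg_def slot_def)
qed

context
  fixes xs :: "nat list" and j k :: nat
  assumes xs: "xs \<in> growth_lists j" and jn: "j \<le> n" and kd: "card (set xs) \<le> d"
    and k_def: "k = card (set xs)"
begin

lemma len: "length xs = j" and set_xs: "set xs = {1..k}" and kj: "k \<le> j" and k_le_d: "k \<le> d"
  using growth_lists_props[OF xs] kd by (simp_all add: k_def)

lemma entry: "q \<in> {1..j} \<Longrightarrow> xs ! (q - 1) \<in> {1..k}"
proof -
  assume "q \<in> {1..j}"
  then have "q - 1 < length xs" by (auto simp: len)
  then show ?thesis using nth_mem set_xs by blast
qed

lemma rep_in: "i \<in> {1..k} \<Longrightarrow> rep xs i \<in> {1..j}" "i \<in> {1..k} \<Longrightarrow> xs ! (rep xs i - 1) = i"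
  using rep_props[of i xs] by (simp_all add: len set_xs)

lemma newton_reps:
  assumes "i \<le> k" "q \<in> {1..n}" "q \<notin> rep xs ` {1..i}"
  shows "newton F (reps xs i) q \<in> polys {1..n}" "homogeneous (d - i) (newton F (reps xs i) q)"
proof -
  have sub: "{1..i} \<subseteq> set xs" using assms(1) by (auto simp: set_xs)
  have "rep xs ` {1..i} \<subseteq> {1..n}" using rep_in(1) assms(1) jn by fastforce
  then show "newton F (reps xs i) q \<in> polys {1..n}" "homogeneous (d - i) (newton F (reps xs i) q)"
    using newton_polys[OF compatible_F distinct_reps[OF sub], of q] assms(2,3)
    by (auto simp: set_reps length_reps)
qed

lemma rep_fresh: "i \<in> {1..k} \<Longrightarrow> rep xs i \<notin> rep xs ` {1..i - 1}"
proof
  assume i: "i \<in> {1..k}" and "rep xs i \<in> rep xs ` {1..i - 1}"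
  then obtain i' where i': "i' \<in> {1..i - 1}" "rep xs i = rep xs i'" by auto
  then have "i' \<in> {1..k}" using i by auto
  then have "i = i'" using inj_onD[OF inj_on_rep i'(2)] i by (simp add: set_xs)
  then show False using i'(1) i by auto
qed

lemma deg_pos: "q \<in> {1..n} \<Longrightarrow> deg xs q \<ge> 1"
  using entry[of q] k_le_d d_pos by (auto simp: deg_def len)

lemma hom_Var: "homogeneous 1 (Var q :: (nat, 'a) mpoly)"
  by (simp add: One_nat_def)

lemma slot_system: "system n (deg xs) (slot xs)"
  unfolding system_def
proof
  fix q assume q: "q \<in> {1..n}"
  show "slot xs q \<in> polys {1..n} \<and> homogeneous (deg xs q) (slot xs q)"
  proof (cases "q \<le> j")
    case True
    define i where "i = xs ! (q - 1)"
    have i: "i \<in> {1..k}" using entry[of q] q True by (auto simp: i_def)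
    show ?thesis
    proof (cases "rep xs i = q")
      case T: True
      have "i - 1 \<le> k" "d - (i - 1) = d + 1 - i" using i k_le_d by auto
      then show ?thesis using newton_reps[of "i - 1" q] rep_fresh[OF i] q T True
        by (simp add: slot_def deg_def len flip: i_def)
    next
      case False
      have "rep xs i \<in> {1..n}" using rep_in(1)[OF i] jn by auto
      then show ?thesis using False True q
        by (auto simp: slot_def deg_def len simp flip: i_def intro!: polys_diff polys_Var homogeneous_diff hom_Var)
    qed
  next
    case False
    then show ?thesis using F_polys[OF q] F_homogeneous[OF q] by (simp add: slot_def deg_def len)
  qed
qed

lemma append_same:
  assumes i: "i \<in> {1..k + 1}" and q: "q \<in> {1..n}" "q \<noteq> j + 1"
  shows "deg (xs @ [i]) q = deg xs q" "slot (xs @ [i]) q = slot xs q"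
proof -
  have "deg (xs @ [i]) q = deg xs q \<and> slot (xs @ [i]) q = slot xs q"
  proof (cases "q \<le> j")
    case True
    define x where "x = xs ! (q - 1)"
    have x: "x \<in> {1..k}" using entry[of q] q True by (auto simp: x_def)
    have "(xs @ [i]) ! (q - 1) = x" using q True by (auto simp: x_def nth_append len)
    moreover have "rep (xs @ [i]) x = rep xs x" using x by (intro rep_append) (simp add: set_xs)
    moreover have "reps (xs @ [i]) (x - 1) = reps xs (x - 1)" using x by (intro reps_append) (auto simp: set_xs)
    ultimately show ?thesis using True by (simp add: deg_def slot_def len flip: x_def)
  next
    case False
    then show ?thesis using q by (auto simp: deg_def slot_def len)
  qed
  then show "deg (xs @ [i]) q = deg xs q" "slot (xs @ [i]) q = slot xs q" by auto
qed

lemma append_new: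
  assumes i: "i \<in> {1..k + 1}"
  shows "deg (xs @ [i]) (j + 1) = (if i \<le> k then 1 else d - k)"
    "slot (xs @ [i]) (j + 1) = (if i \<le> k then Var (j + 1) - Var (rep xs i) else newton F (reps xs k) (j + 1))"
proof -
  have nth: "(xs @ [i]) ! j = i" by (simp add: len nth_append)
  have "deg (xs @ [i]) (j + 1) = (if i \<le> k then 1 else d - k) \<and>
    slot (xs @ [i]) (j + 1) = (if i \<le> k then Var (j + 1) - Var (rep xs i) else newton F (reps xs k) (j + 1))"
  proof (cases "i \<le> k")
    case True
    then have i: "i \<in> {1..k}" using assms by auto
    have "rep (xs @ [i]) i = rep xs i" using i by (intro rep_append) (simp add: set_xs)
    moreover have "rep xs i \<noteq> j + 1" using rep_in(1)[OF i] by auto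
    ultimately show ?thesis using True by (simp add: deg_def slot_def len nth)
  next
    case False
    then have i: "i = k + 1" using assms by auto
    have "rep (xs @ [i]) i = j + 1" using rep_new[of i xs] by (simp add: i set_xs len)
    moreover have "reps (xs @ [i]) k = reps xs k" by (intro reps_append) (simp add: set_xs)
    ultimately show ?thesis using False by (simp add: deg_def slot_def len nth[unfolded i] i)
  qed
  then show "deg (xs @ [i]) (j + 1) = (if i \<le> k then 1 else d - k)"
    "slot (xs @ [i]) (j + 1) = (if i \<le> k then Var (j + 1) - Var (rep xs i) else newton F (reps xs k) (j + 1))"
    by auto
qed

lemma prod_deg: "(\<Prod>q\<in>{1..n} - {j + 1}. deg xs q) = (\<Prod>q\<in>{1..j}. deg xs q) * d ^ (n - j - 1)" if "j < n"
proof -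
  have "{1..n} - {j + 1} = {1..j} \<union> {j + 2..n}" using that by auto
  moreover have "(\<Prod>q\<in>{1..j} \<union> {j + 2..n}. deg xs q) = (\<Prod>q\<in>{1..j}. deg xs q) * (\<Prod>q\<in>{j + 2..n}. deg xs q)"
    by (rule prod.union_disjoint) auto
  moreover have "(\<Prod>q\<in>{j + 2..n}. deg xs q) = (\<Prod>q\<in>{j + 2..n}. d)"
    by (rule prod.cong) (auto simp: deg_def len)
  moreover have "card {j + 2..n} = n - j - 1" unfolding card_atLeastAtMost by linarith
  ultimately show ?thesis by (simp only: prod_constant)
qed

context
  assumes jn': "j < n"
begin

abbreviation (input) "p \<equiv> j + 1"

text \<open>The intermediate stages at a node: the equation of \<open>p\<close> has been compared
  with the first \<open>i\<close> representatives, and \<open>p\<close> has joined none of their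
  blocks.\<close>

definition V :: "nat \<Rightarrow> 'a" where
  "V i = Res n ((deg xs)(p := d - i)) ((slot xs)(p := newton F (reps xs i) p))"

lemma p_in: "p \<in> {1..n}" and p_fresh: "i \<le> k \<Longrightarrow> p \<notin> rep xs ` {1..i}"
  using jn' rep_in(1) by fastforce+

lemma V_vector: "i < d \<Longrightarrow> degree_vector n ((deg xs)(p := d - i))"
  using deg_pos n_pos by unfold_locales auto

lemma V_system: "i \<le> k \<Longrightarrow> system n ((deg xs)(p := d - i)) ((slot xs)(p := newton F (reps xs i) p))"
  using newton_reps[of i p] p_in p_fresh[of i] by (intro system_upd[OF slot_system]) auto

lemma V_0: "V 0 = W xs"
proof -
  have "deg xs p = d" "slot xs p = F p" by (auto simp: deg_def slot_def len)
  then have "(deg xs)(p := d - 0) = deg xs" "(slot xs)(p := newton F (reps xs 0) p) = slot xs"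
    by (auto simp: fun_eq_iff reps_0)
  then show ?thesis by (simp only: V_def W_def)
qed

lemma W_append_old:
  assumes i: "i \<in> {1..k}"
  shows "W (xs @ [i]) = Res n ((deg xs)(p := 1)) ((slot xs)(p := Var p - Var (rep xs i)))"
proof -
  have i': "i \<in> {1..k + 1}" "i \<le> k" using i by auto
  interpret degree_vector n "(deg xs)(p := 1)" using deg_pos n_pos by unfold_locales auto
  show ?thesis unfolding W_def
  proof (rule Res_cong'[OF degree_vector_axioms, symmetric])
    fix q assume q: "q \<in> {1..n}"
    show "((deg xs)(p := 1)) q = deg (xs @ [i]) q" "((slot xs)(p := Var p - Var (rep xs i))) q = slot (xs @ [i]) q"
      using append_same[OF i'(1) q] append_new[OF i'(1)] i'(2) by (cases "q = p"; simp)+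
  qed
qed

lemma V_k: "V k = W (xs @ [k + 1])" if "k < d"
proof -
  have i': "k + 1 \<in> {1..k + 1}" by auto
  interpret degree_vector n "(deg xs)(p := d - k)" using V_vector[OF that] .
  show ?thesis unfolding W_def V_def
  proof (rule Res_cong'[OF degree_vector_axioms])
    fix q assume q: "q \<in> {1..n}"
    show "((deg xs)(p := d - k)) q = deg (xs @ [k + 1]) q"
      "((slot xs)(p := newton F (reps xs k) p)) q = slot (xs @ [k + 1]) q"
      using append_same[OF i' q] append_new[OF i'] by (cases "q = p"; simp)+
  qed
qed

text \<open>The equation of the representative of block \<open>i + 1\<close> has the same degree
  \<open>d - i\<close>; subtracting it from the equation of \<open>p\<close> gives the product by
  Newton's recursion.\<close>

lemma V_reduce:
  assumes i: "i < k"
  shows "V i = Res n ((deg xs)(p := d - i))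
    ((slot xs)(p := (Var p - Var (rep xs (i + 1))) * newton F (reps xs (i + 1)) p))"
proof -
  define a where "a = rep xs (i + 1)"
  have ik: "i + 1 \<in> {1..k}" and id: "i < d" using i k_le_d by auto
  have a: "a \<in> {1..j}" "xs ! (a - 1) = i + 1" using rep_in[OF ik] by (auto simp: a_def)
  have ap: "a \<noteq> p" "a \<in> {1..n}" using a jn by auto
  have sa: "slot xs a = newton F (reps xs i) a" "deg xs a = d - i"
    using a(1) by (simp_all add: slot_def deg_def len a(2)) (simp_all add: a_def)
  let ?D = "(deg xs)(p := d - i)" and ?g = "(slot xs)(p := newton F (reps xs i) p)"
  have "Res n ?D (?g(p := ?g p + (- 1) * ?g a)) = Res n ?D ?g"
  proof (rule Res_add[OF V_vector[OF id] V_system ap(2) p_in ap(1)])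
    show "- 1 \<in> (polys {1..n} :: (nat, 'a) mpoly set)" "homogeneous (?D p - ?D a) (- 1 :: (nat, 'a) mpoly)"
      using ap sa by (auto intro!: polys_uminus homogeneous_uminus)
  qed (use i ap sa in auto)
  moreover have "?g(p := ?g p + (- 1) * ?g a) =
      (slot xs)(p := (Var p - Var a) * newton F (a # reps xs i) p)"
  proof -
    have sub: "{1..i + 1} \<subseteq> set xs" using i by (auto simp: set_xs)
    have rs: "a # reps xs i = reps xs (i + 1)" by (simp add: a_def reps_Suc)
    have "(Var p - Var a) * newton F (a # reps xs i) p = newton F (reps xs i) p - newton F (reps xs i) a"
    proof (rule newton_Cons[OF compatible_F])
      show "distinct (a # reps xs i)" unfolding rs by (rule distinct_reps[OF sub])
      have "rep xs ` {1..i + 1} \<subseteq> {1..n}" using rep_in(1) i jn by fastforce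
      then show "set (a # reps xs i) \<subseteq> {1..n}" "p \<in> {1..n} - set (a # reps xs i)"
        unfolding rs set_reps using p_in p_fresh[of "i + 1"] i by auto
    qed
    then show ?thesis using ap sa by simp
  qed
  ultimately show ?thesis unfolding V_def a_def reps_Suc by simp
qed

text \<open>In the linear factor \<open>p\<close> joins block \<open>i + 1\<close>, in the other
  factor the comparison continues. The condition \<open>i + 1 < d\<close> keeps the degree of the
  second factor positive, as multiplicativity requires.\<close>

lemma V_step:
  assumes i: "i < k" "i + 1 < d"
  shows "V i = W (xs @ [i + 1]) * V (i + 1)"
proof -
  have ik: "i + 1 \<in> {1..k}" "i + 1 \<le> k" and id: "i < d" using i by auto
  let ?D = "(deg xs)(p := d - i)"
  have a: "rep xs (i + 1) \<in> {1..n}" using rep_in(1)[OF ik(1)] jn by auto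
  have "Res n ?D ((slot xs)(p := (Var p - Var (rep xs (i + 1))) * newton F (reps xs (i + 1)) p)) =
     Res n (?D(p := 1)) ((slot xs)(p := Var p - Var (rep xs (i + 1)))) *
     Res n (?D(p := d - (i + 1))) ((slot xs)(p := newton F (reps xs (i + 1)) p))"
  proof (rule Res_mult[OF V_vector[OF id] p_in])
    show "?D p = 1 + (d - (i + 1))" "d - (i + 1) \<ge> 1" using i by auto
    show "slot xs q \<in> polys {1..n}" "homogeneous (?D q) (slot xs q)" if "q \<in> {1..n} - {p}" for q
      using slot_system that by (auto simp: system_def)
    show "Var p - Var (rep xs (i + 1)) \<in> (polys {1..n} :: (nat, 'a) mpoly set)"
      using p_in a by (intro polys_diff polys_Var)
    show "homogeneous 1 (Var p - Var (rep xs (i + 1)) :: (nat, 'a) mpoly)"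
      by (intro homogeneous_diff hom_Var)
  qed (use newton_reps[OF ik(2) p_in p_fresh[OF ik(2)]] in auto)
  then show ?thesis
    unfolding V_reduce[OF i(1)] W_append_old[OF ik(1)] V_def[of "i + 1"] by simp
qed

text \<open>Here the second factor has degree 0, so it leaves the resultant by
  \<open>Res_scale\<close>, with the product of the degrees of the other equations as
  exponent.\<close>

lemma V_last:
  assumes "k = d"
  shows "V (d - 1) = Poly_Mapping.lookup (newton F (reps xs d) p) 0 ^ ((\<Prod>q\<in>{1..j}. deg xs q) * d ^ (n - j - 1)) * W (xs @ [d])"
proof -
  define c where "c = Poly_Mapping.lookup (newton F (reps xs d) p) 0"
  have dk: "d - 1 < k" "d - 1 + 1 = d" "d \<in> {1..k}" "d - (d - 1) = 1" using d_pos assms by auto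
  have "homogeneous (d - d) (newton F (reps xs d) p)"
    using newton_reps(2)[of d p] p_in p_fresh[of d] assms by auto
  then have c: "newton F (reps xs d) p = Const c"
    unfolding c_def by (intro homogeneous_0_eq_Const) simp
  let ?D = "(deg xs)(p := 1)" and ?g = "(slot xs)(p := Var p - Var (rep xs d))"
  have "degree_vector n ?D" using V_vector[of "d - 1"] dk d_pos by simp
  from Res_scale[OF this p_in, of ?g c]
  have "Res n ?D (?g(p := Const c * ?g p)) = c ^ (\<Prod>i\<in>{1..n} - {p}. ?D i) * W (xs @ [d])"
    unfolding W_append_old[OF dk(3)] .
  moreover have "(\<Prod>i\<in>{1..n} - {p}. ?D i) = (\<Prod>i\<in>{1..n} - {p}. deg xs i)"
    by (rule prod.cong) auto
  ultimately show ?thesis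
    unfolding V_reduce[OF dk(1)] dk(2,4) c prod_deg[OF jn', symmetric]
    by (simp add: mult.commute Const_def)
qed

text \<open>A constant is fixed by renaming, so by equivariance the same element arises at every
  node of the tree.\<close>

lemma newton_constant:
  assumes "k = d"
  shows "Poly_Mapping.lookup (newton F (reps xs d) p) 0 = Poly_Mapping.lookup (divdiff n d F {1..d + 1}) 0"
proof -
  \<comment> \<open>Carries the points \<open>1, ..., d + 1\<close> of the divided difference to the
    representatives and \<open>p\<close>; an extension of it to a permutation allows equivariance to
    be applied.\<close>
  define f where "f i = (if i \<le> d then rep xs i else p)" for i
  have dn: "d + 1 \<le> n" using kj jn' assms by simp
  have fd: "f ` {1..d + 1} \<subseteq> {1..n}"
    using rep_in(1) jn' assms by (force simp: f_def)
  have "inj_on f {1..d + 1}"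
  proof (rule inj_onI)
    fix x y assume xy: "x \<in> {1..d + 1}" "y \<in> {1..d + 1}" "f x = f y"
    have pf: "rep xs z \<noteq> p" if "z \<in> {1..d}" for z using imageI[OF that, of "rep xs"] p_fresh[of d] assms by (metis order_refl)
    show "x = y"
    proof (cases "x \<le> d \<and> y \<le> d")
      case True
      then have "x \<in> set xs" "y \<in> set xs" "rep xs x = rep xs y" using xy assms by (auto simp: f_def set_xs)
      then show ?thesis using inj_onD[OF inj_on_rep] by blast
    next
      case False
      then show ?thesis using xy pf[of x] pf[of y] by (cases "x \<le> d"; cases "y \<le> d") (auto simp: f_def)
    qed
  qed
  from ex_permutes_extend[OF this fd]
  obtain \<pi> where \<pi>: "\<pi> permutes {1..n}" "\<And>i. i \<in> {1..d + 1} \<Longrightarrow> \<pi> i = f i" by blast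
  let ?as = "rev [1..<d + 1]"
  have as: "map \<pi> ?as = reps xs d" "\<pi> (d + 1) = p"
    using \<pi>(2) by (auto simp: reps_def rev_map f_def)
  have "newton F (map \<pi> ?as) (\<pi> (d + 1)) = subst_vars \<pi> (newton F ?as (d + 1))"
  proof (rule newton_subst[OF compatible_F])
    show "F (\<pi> i) = subst_vars \<pi> (F i)" if "i \<in> {1..n}" for i using equivariant[OF that \<pi>(1)] by simp
    show "inj_on \<pi> {1..n}" using permutes_inj_on[OF \<pi>(1)] .
  qed (use dn in auto)
  also have "newton F ?as (d + 1) = divdiff n d F {1..d + 1}"
    using divdiff_eq_newton[OF compatible_F, of "d + 1"] dn by simp
  finally have eq: "newton F (reps xs d) p = subst_vars \<pi> (divdiff n d F {1..d + 1})" by (simp only: as)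
  have "homogeneous (d - length ?as) (newton F ?as (d + 1))"
    using dn by (intro newton_polys(2)[OF compatible_F]) auto
  then have "homogeneous 0 (divdiff n d F {1..d + 1})"
    using divdiff_eq_newton[OF compatible_F, of "d + 1"] dn by simp
  note homogeneous_0_eq_Const[OF this]
  then have "subst_vars \<pi> (divdiff n d F {1..d + 1}) = Const (Poly_Mapping.lookup (divdiff n d F {1..d + 1}) 0)"
    by (metis subst_vars_Const)
  then show ?thesis unfolding eq by (simp add: Const_def)
qed

text \<open>The comparisons with all \<open>k\<close> representatives combined: the children are the
  \<open>k\<close> old blocks and, if \<open>k < d\<close>, a new one.\<close>

lemma W_step:
  "W xs = (if k = d then Poly_Mapping.lookup (divdiff n d F {1..d + 1}) 0 ^ ((\<Prod>q\<in>{1..j}. deg xs q) * d ^ (n - j - 1)) else 1) *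
    (\<Prod>i\<in>{1..min d (k + 1)}. W (xs @ [i]))"
proof -
  have V: "W xs = (\<Prod>i\<in>{1..l}. W (xs @ [i])) * V l" if "l \<le> k" "l < d" for l
    using that
  proof (induction l)
    case 0
    then show ?case by (simp add: V_0)
  next
    case (Suc l)
    then show ?case using V_step[of l] by (simp add: mult.assoc flip: Suc_eq_plus1)
  qed
  show ?thesis
  proof (cases "k = d")
    case True
    have "d = Suc (d - 1)" using d_pos by simp
    then have "(\<Prod>i\<in>{1..d}. W (xs @ [i])) = (\<Prod>i\<in>{1..d - 1}. W (xs @ [i])) * W (xs @ [d])"
      by (metis prod.nat_ivl_Suc' le_add1 mult.commute plus_1_eq_Suc)
    then show ?thesis
      using V[of "d - 1"] V_last[OF True] newton_constant[OF True] True d_pos by (simp add: mult_ac)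
  next
    case False
    then have "k < d" using k_le_d by simp
    moreover from this have "min d (k + 1) = Suc k" by simp
    ultimately show ?thesis using V[of k] V_k False by (simp flip: Suc_eq_plus1)
  qed
qed

end

end

section \<open>The tree and the exponent of the constant\<close>

definition trees :: "nat \<Rightarrow> nat list set" where
  "trees j = {xs \<in> growth_lists j. card (set xs) \<le> d}"

lemma finite_trees: "finite (trees j)"
  by (simp add: trees_def finite_growth_lists)

lemma trees_Suc: "trees (Suc j) = (\<Union>xs\<in>trees j. (\<lambda>i. xs @ [i]) ` {1..min d (card (set xs) + 1)})"
proof -
  have "card (set (xs @ [i])) \<le> d \<longleftrightarrow> card (set xs) \<le> d \<and> i \<in> {1..min d (card (set xs) + 1)}"
    if xs: "xs \<in> growth_lists j" and i: "i \<in> {1..card (set xs) + 1}" for xs i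
  proof -
    have set_xs: "set xs = {1..card (set xs)}" using growth_lists_props[OF xs] by simp
    show ?thesis
    proof (cases "i = card (set xs) + 1")
      case True
      then have "i \<notin> set xs" using set_xs by (metis atLeastAtMost_iff not_add_less1 add_le_same_cancel1 not_one_le_zero)
      then have "card (set (xs @ [i])) = card (set xs) + 1" by simp
      then show ?thesis using True by auto
    next
      case False
      then have i': "i \<in> {1..card (set xs)}" using i unfolding atLeastAtMost_iff by linarith
      then have "i \<in> set xs" using set_xs by blast
      then have "set (xs @ [i]) = set xs" by auto
      then show ?thesis using i' by auto
    qed
  qed
  then show ?thesis unfolding trees_def growth_lists.simps by fastforce
qed

lemma trees_Suc_fold:
  "(\<Prod>ys\<in>trees (Suc j). f ys) = (\<Prod>xs\<in>trees j. \<Prod>i\<in>{1..min d (card (set xs) + 1)}. f (xs @ [i]) :: 'b::comm_monoid_mult)"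
  "(\<Sum>ys\<in>trees (Suc j). g ys) = (\<Sum>xs\<in>trees j. \<Sum>i\<in>{1..min d (card (set xs) + 1)}. g (xs @ [i]) :: 'c::comm_monoid_add)"
proof -
  have disj: "\<forall>xs\<in>trees j. \<forall>ys\<in>trees j. xs \<noteq> ys \<longrightarrow>
      (\<lambda>i. xs @ [i]) ` {1..min d (card (set xs) + 1)} \<inter> (\<lambda>i. ys @ [i]) ` {1..min d (card (set ys) + 1)} = {}"
    by auto
  have inj: "inj_on (\<lambda>i. xs @ [i]) A" for xs :: "nat list" and A by (rule inj_onI) simp
  show "(\<Prod>ys\<in>trees (Suc j). f ys) = (\<Prod>xs\<in>trees j. \<Prod>i\<in>{1..min d (card (set xs) + 1)}. f (xs @ [i]))"
    unfolding trees_Suc by (subst prod.UNION_disjoint) (use disj in \<open>auto simp: finite_trees prod.reindex[OF inj]\<close>)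
  show "(\<Sum>ys\<in>trees (Suc j). g ys) = (\<Sum>xs\<in>trees j. \<Sum>i\<in>{1..min d (card (set xs) + 1)}. g (xs @ [i]))"
    unfolding trees_Suc by (subst sum.UNION_disjoint) (use disj in \<open>auto simp: finite_trees sum.reindex[OF inj]\<close>)
qed

text \<open>The falling factorial of \<open>d\<close>, which is the product of the degrees of the
  equations treated so far at a node with \<open>k\<close> blocks
  (\<open>prod_deg_trees\<close>).\<close>

definition fall :: "nat \<Rightarrow> rat" where
  "fall k = (\<Prod>i<k. of_nat d - of_nat i)"

text \<open>The sum, over the \<open>k\<close> equations of degrees
  \<open>d, ..., d - k + 1\<close>, of the product of the other degrees: the total degree of the
  resultant of a leaf in the coefficients of its equations, and the inner sum of
  \<open>m_zero\<close>.\<close>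

definition leaf_weight :: "nat \<Rightarrow> rat" where
  "leaf_weight k = (\<Sum>j=1..k. (\<Prod>i<k. of_nat d - of_nat i) / (of_nat d - of_nat j + 1))"

text \<open>The exponent with which the constant divided difference and the leaf factors, taken with
  weight \<^const>\<open>leaf_weight\<close>, contribute below a node with \<open>k\<close> blocks at height \<open>q\<close>.\<close>

definition weight :: "nat \<Rightarrow> nat \<Rightarrow> rat" where
  "weight k q = of_nat d ^ q * leaf_weight k + fall k * of_nat q * of_nat d ^ (q - 1)"

lemma leaf_weight_0: "leaf_weight 0 = 0"
  by (simp add: leaf_weight_def)

lemma leaf_weight_Suc: "k < d \<Longrightarrow> leaf_weight (k + 1) = (of_nat d - of_nat k) * leaf_weight k + fall k"
proof -
  assume k: "k < d"
  then have ne: "of_nat d - of_nat k \<noteq> (0 :: rat)" by simp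
  have "leaf_weight (Suc k) = (\<Sum>j=1..k. (\<Prod>i<Suc k. of_nat d - of_nat i) / (of_nat d - of_nat j + 1)) +
      (\<Prod>i<Suc k. of_nat d - of_nat i) / (of_nat d - of_nat (Suc k) + 1)"
    unfolding leaf_weight_def by simp
  also have "(\<Prod>i<Suc k. of_nat d - of_nat i) / (of_nat d - of_nat (Suc k) + 1) = fall k"
    using ne by (simp add: fall_def)
  also have "(\<Sum>j=1..k. (\<Prod>i<Suc k. of_nat d - of_nat i) / (of_nat d - of_nat j + 1)) = (of_nat d - of_nat k) * leaf_weight k"
    unfolding leaf_weight_def sum_distrib_left by (intro sum.cong) auto
  finally show ?thesis by (simp flip: Suc_eq_plus1)
qed

text \<open>Conservation of degree. \<open>weight k q\<close> is the same kind of sum for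
  \<open>k\<close> representatives together with \<open>q\<close> untreated equations of degree
  \<open>d\<close>. One such equation is spent: \<open>k\<close> children keep \<open>k\<close>
  blocks, one more has \<open>k + 1\<close> blocks if \<open>k < d\<close>, and for
  \<open>k = d\<close> the exponent of the constant takes the place of the latter.\<close>

lemma weight_step:
  assumes "k \<le> d"
  shows "weight k (q + 1) = (if k = d then fall d * of_nat d ^ q else 0) + (\<Sum>i\<in>{1..min d (k + 1)}. weight (if i \<le> k then k else k + 1) q)"
proof -
  define X Y :: rat where "X = of_nat d ^ q" and "Y = of_nat q * of_nat d ^ (q - 1)"
  have w: "weight l q = X * leaf_weight l + fall l * Y" for l
    by (simp add: weight_def X_def Y_def mult.assoc)
  have "of_nat q * X = of_nat d * Y" by (cases q) (simp_all add: X_def Y_def)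
  then have w1: "weight k (q + 1) = of_nat d * X * leaf_weight k + fall k * (of_nat d * Y + X)"
    by (simp add: weight_def X_def distrib_right flip: Suc_eq_plus1)
  show ?thesis
  proof (cases "k = d")
    case True
    have "(\<Sum>i\<in>{1..min d (k + 1)}. weight (if i \<le> k then k else k + 1) q) = (\<Sum>i\<in>{1..d}. weight d q)"
      using True by (intro sum.cong) auto
    also have "\<dots> = of_nat d * weight d q" by simp
    finally have "(\<Sum>i\<in>{1..min d (k + 1)}. weight (if i \<le> k then k else k + 1) q) = of_nat d * weight d q" .
    then show ?thesis unfolding w1 using True by (simp add: w algebra_simps flip: X_def)
  next
    case False
    then have k: "k < d" using assms by simp
    have "{1..min d (k + 1)} = insert (k + 1) {1..k}" using k by auto
    then have "(\<Sum>i\<in>{1..min d (k + 1)}. weight (if i \<le> k then k else k + 1) q) = weight (k + 1) q + (\<Sum>i\<in>{1..k}. weight k q)"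
      by simp
    then have s: "(\<Sum>i\<in>{1..min d (k + 1)}. weight (if i \<le> k then k else k + 1) q) = weight (k + 1) q + of_nat k * weight k q"
      by simp
    have f: "fall (k + 1) = (of_nat d - of_nat k) * fall k" by (simp add: fall_def flip: Suc_eq_plus1)
    show ?thesis unfolding if_not_P[OF False] s w1 unfolding w leaf_weight_Suc[OF k] f by (simp add: algebra_simps)
  qed
qed

lemma prod_deg_trees: "j \<le> n \<Longrightarrow> xs \<in> trees j \<Longrightarrow> of_nat (\<Prod>q\<in>{1..j}. deg xs q) = fall (card (set xs))"
proof (induction j arbitrary: xs)
  case 0
  then show ?case by (simp add: fall_def trees_def)
next
  case (Suc j)
  then obtain ys i where ys: "ys \<in> trees j" and xs: "xs = ys @ [i]" and i: "i \<in> {1..min d (card (set ys) + 1)}"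
    unfolding trees_Suc by blast
  define k where "k = card (set ys)"
  have g: "ys \<in> growth_lists j" "card (set ys) \<le> d" "j \<le> n" "i \<in> {1..k + 1}"
    using ys i Suc.prems by (auto simp: trees_def k_def)
  note ctx = g(1,3,2) k_def
  have "(\<Prod>q\<in>{1..Suc j}. deg xs q) = (\<Prod>q\<in>{1..j}. deg xs q) * deg xs (j + 1)"
    by (simp flip: Suc_eq_plus1)
  also have "(\<Prod>q\<in>{1..j}. deg xs q) = (\<Prod>q\<in>{1..j}. deg ys q)"
    unfolding xs using append_same(1)[OF ctx g(4)] Suc.prems by (intro prod.cong) auto
  finally have eq: "of_nat (\<Prod>q\<in>{1..Suc j}. deg xs q) = fall k * of_nat (deg xs (j + 1))"
    using Suc.IH[OF g(3) ys] by (simp add: k_def)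
  have set_ys: "set ys = {1..k}" using growth_lists_props[OF g(1)] by (simp add: k_def)
  show ?case
  proof (cases "i \<le> k")
    case True
    then have "set xs = set ys" using g(4) by (auto simp: xs set_ys)
    then show ?thesis unfolding eq using append_new(1)[OF ctx g(4)] True by (simp add: xs k_def)
  next
    case False
    then have ik: "i = k + 1" using g(4) by auto
    then have "k < d" using i by (auto simp: k_def)
    have "card (set xs) = Suc k" by (simp add: xs set_ys ik)
    then show ?thesis unfolding eq using append_new(1)[OF ctx g(4)] False \<open>k < d\<close>
      by (simp add: xs fall_def of_nat_diff)
  qed
qed

definition const_diff :: 'a where
  "const_diff = Poly_Mapping.lookup (divdiff n d F {1..d + 1}) 0"

text \<open>The right-hand side is the weight of the root, and \<open>M\<close> is what the constant
  has absorbed so far. It stays 0 up to level \<open>d\<close>, since a node with \<open>d\<close>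
  blocks has at least \<open>d\<close> elements.\<close>

theorem Res_trees:
  "j \<le> n \<Longrightarrow> \<exists>M :: nat. of_nat M + (\<Sum>xs\<in>trees j. weight (card (set xs)) (n - j)) = of_nat n * of_nat d ^ (n - 1) \<and>
    Res n (\<lambda>_. d) F = const_diff ^ M * (\<Prod>xs\<in>trees j. W xs) \<and> (j \<le> d \<longrightarrow> M = 0)"
proof (induction j)
  case 0
  have "trees 0 = {[]}" by (auto simp: trees_def)
  then show ?case by (intro exI[of _ 0]) (simp add: W_Nil weight_def leaf_weight_0 fall_def)
next
  case (Suc j)
  then obtain M where M: "of_nat M + (\<Sum>xs\<in>trees j. weight (card (set xs)) (n - j)) = of_nat n * of_nat d ^ (n - 1)"
    "Res n (\<lambda>_. d) F = const_diff ^ M * (\<Prod>xs\<in>trees j. W xs)" "j \<le> d \<longrightarrow> M = 0" by auto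
  have jn: "j < n" "j \<le> n" using Suc.prems by auto
  define E where "E xs = (if card (set xs) = d then (\<Prod>q\<in>{1..j}. deg xs q) * d ^ (n - j - 1) else 0)" for xs
  have T: "xs \<in> growth_lists j \<and> card (set xs) \<le> d" if "xs \<in> trees j" for xs using that by (simp add: trees_def)
  have Wt: "W xs = const_diff ^ E xs * (\<Prod>i\<in>{1..min d (card (set xs) + 1)}. W (xs @ [i]))" if "xs \<in> trees j" for xs
    using W_step[of xs j "card (set xs)"] T[OF that] jn by (auto simp: E_def const_diff_def)
  have "(\<Prod>xs\<in>trees j. W xs) = (\<Prod>xs\<in>trees j. const_diff ^ E xs) * (\<Prod>xs\<in>trees (Suc j). W xs)"
    unfolding trees_Suc_fold prod.distrib[symmetric] by (intro prod.cong refl Wt)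
  then have 1: "Res n (\<lambda>_. d) F = const_diff ^ (M + (\<Sum>xs\<in>trees j. E xs)) * (\<Prod>xs\<in>trees (Suc j). W xs)"
    using M(2) by (simp add: power_add power_sum mult.assoc)
  have wt: "weight (card (set xs)) (n - j) = of_nat (E xs) +
      (\<Sum>i\<in>{1..min d (card (set xs) + 1)}. weight (card (set (xs @ [i]))) (n - Suc j))" if xs: "xs \<in> trees j" for xs
  proof -
    have q: "n - j = (n - Suc j) + 1" "n - j - 1 = n - Suc j" using jn by auto
    have set_xs: "set xs = {1..card (set xs)}" using growth_lists_props T[OF xs] by blast
    have card: "card (set (xs @ [i])) = (if i \<le> card (set xs) then card (set xs) else card (set xs) + 1)"
      if "i \<ge> 1" for i
    proof -
      have "i \<in> set xs \<longleftrightarrow> i \<le> card (set xs)" by (subst set_xs) (use that in auto)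
      then show ?thesis by (simp add: insert_absorb)
    qed
    have "of_nat (E xs) = (if card (set xs) = d then fall d * of_nat d ^ (n - Suc j) else 0)"
      using prod_deg_trees[OF jn(2) xs] unfolding E_def q(2) by (simp del: of_nat_prod)
    moreover have "(\<Sum>i\<in>{1..min d (card (set xs) + 1)}. weight (card (set (xs @ [i]))) (n - Suc j)) =
        (\<Sum>i\<in>{1..min d (card (set xs) + 1)}. weight (if i \<le> card (set xs) then card (set xs) else card (set xs) + 1) (n - Suc j))"
      using card by (intro sum.cong) auto
    ultimately show ?thesis unfolding q(1) using weight_step[of "card (set xs)" "n - Suc j"] T[OF xs] by simp
  qed
  have "(\<Sum>xs\<in>trees j. weight (card (set xs)) (n - j)) =
      of_nat (\<Sum>xs\<in>trees j. E xs) + (\<Sum>xs\<in>trees (Suc j). weight (card (set xs)) (n - Suc j))"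
    unfolding trees_Suc_fold of_nat_sum sum.distrib[symmetric] by (intro sum.cong refl wt)
  then have 2: "of_nat (M + (\<Sum>xs\<in>trees j. E xs)) + (\<Sum>xs\<in>trees (Suc j). weight (card (set xs)) (n - Suc j)) = of_nat n * of_nat d ^ (n - 1)"
    using M(1) by simp
  have 3: "M + (\<Sum>xs\<in>trees j. E xs) = 0" if "Suc j \<le> d"
  proof -
    have "E xs = 0" if "xs \<in> trees j" for xs
      using growth_lists_props[of xs j] T[OF that] \<open>Suc j \<le> d\<close> by (auto simp: E_def)
    then show ?thesis using M(3) that by simp
  qed
  show ?case using 1 2 3 by blast
qed

end

section \<open>The factor of a set partition\<close>

lemma finite_partitions: "finite (partitions n)" and partitions_length: "\<mu> \<in> partitions n \<Longrightarrow> length \<mu> \<le> n"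
proof -
  have length: "length \<mu> \<le> n" if "\<mu> \<in> partitions n" for \<mu>
  proof -
    have "(\<forall>a\<in>set \<mu>. a > 0) \<Longrightarrow> length \<mu> \<le> sum_list \<mu>" by (induction \<mu>) auto
    then show ?thesis using that by (simp add: partitions_def)
  qed
  then show "\<mu> \<in> partitions n \<Longrightarrow> length \<mu> \<le> n" .
  have "partitions n \<subseteq> {xs. set xs \<subseteq> {..n} \<and> length xs \<le> n}"
    using length member_le_sum_list by (fastforce simp: partitions_def)
  then show "finite (partitions n)" by (rule finite_subset) (rule finite_lists_length_le, simp)
qed

lemma upt_snoc: "1 \<le> i \<Longrightarrow> [1..<i + 1] = [1..<i] @ [i]"
  using upt_Suc_append[of 1 i] unfolding Suc_eq_plus1 .

lemma block_eq_iff: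
  assumes "x \<ge> 1" "x \<le> sum_list \<mu>"
  shows "block \<mu> x = i \<longleftrightarrow> i \<in> {1..length \<mu>} \<and> x \<in> {sum_list (take (i - 1) \<mu>) + 1..sum_list (take i \<mu>)}"
proof -
  have mono: "sum_list (take a \<mu>) \<le> sum_list (take b \<mu>)" if "a \<le> b" for a b
  proof -
    have "take b \<mu> = take a \<mu> @ take (b - a) (drop a \<mu>)" using that by (metis le_add_diff_inverse take_add)
    then show ?thesis by simp
  qed
  have ex: "x \<le> sum_list (take (length \<mu>) \<mu>)" using assms by simp
  have least: "block \<mu> x = i \<longleftrightarrow> x \<le> sum_list (take i \<mu>) \<and> (\<forall>l<i. \<not> x \<le> sum_list (take l \<mu>))"
    unfolding block_def using ex by (metis (no_types, lifting) LeastI Least_equality leI not_less_Least)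
  show ?thesis
  proof
    assume "block \<mu> x = i"
    then have i: "x \<le> sum_list (take i \<mu>)" "\<And>l. l < i \<Longrightarrow> \<not> x \<le> sum_list (take l \<mu>)" using least by auto
    have "i \<ge> 1" using i(1) assms(1) by (cases i) (auto simp: One_nat_def)
    moreover have "i \<le> length \<mu>" using i(2)[of "length \<mu>"] ex by (meson not_le)
    ultimately show "i \<in> {1..length \<mu>} \<and> x \<in> {sum_list (take (i - 1) \<mu>) + 1..sum_list (take i \<mu>)}"
      using i(1) i(2)[of "i - 1"] by auto
  next
    assume i: "i \<in> {1..length \<mu>} \<and> x \<in> {sum_list (take (i - 1) \<mu>) + 1..sum_list (take i \<mu>)}"
    have "\<not> x \<le> sum_list (take l \<mu>)" if "l < i" for l
    proof -
      have "l \<le> i - 1" using that by linarith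
      then show ?thesis using mono[of l "i - 1"] i by simp
    qed
    then show "block \<mu> x = i" using least i by auto
  qed
qed

lemma card_block:
  assumes "i \<in> {1..length \<mu>}"
  shows "card {x \<in> {1..sum_list \<mu>}. block \<mu> x = i} = \<mu> ! (i - 1)"
proof -
  have "i - 1 < length \<mu>" "i = Suc (i - 1)" using assms by auto
  then have step: "sum_list (take i \<mu>) = sum_list (take (i - 1) \<mu>) + \<mu> ! (i - 1)"
    by (metis sum_list_append take_Suc_conv_app_nth sum_list.Cons sum_list.Nil add.right_neutral)
  have "sum_list (take i \<mu>) \<le> sum_list \<mu>" by (metis append_take_drop_id le_add1 sum_list_append)
  then have "x \<in> {x \<in> {1..sum_list \<mu>}. block \<mu> x = i} \<longleftrightarrow> x \<in> {sum_list (take (i - 1) \<mu>) + 1..sum_list (take i \<mu>)}" for x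
    using assms block_eq_iff[of x \<mu> i] by (cases "1 \<le> x \<and> x \<le> sum_list \<mu>") auto
  then have "{x \<in> {1..sum_list \<mu>}. block \<mu> x = i} = {sum_list (take (i - 1) \<mu>) + 1..sum_list (take i \<mu>)}"
    by (rule Set.set_eqI)
  then show ?thesis by (simp add: step)
qed

lemma card_positions: "card {x \<in> {1..length xs}. xs ! (x - 1) = i} = count_list xs i"
proof -
  have "{x \<in> {1..length xs}. xs ! (x - 1) = i} = Suc ` {q. q < length xs \<and> i = xs ! q}"
  proof (intro Set.set_eqI iffI)
    fix x assume "x \<in> {x \<in> {1..length xs}. xs ! (x - 1) = i}"
    then have "x - 1 < length xs" "xs ! (x - 1) = i" "1 \<le> x" by auto
    then show "x \<in> Suc ` {q. q < length xs \<and> i = xs ! q}" by (intro image_eqI[of _ _ "x - 1"]) simp_all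
  qed auto
  also have "card \<dots> = card {q. q < length xs \<and> i = xs ! q}" by (rule card_image) simp
  finally show ?thesis
    by (simp only: count_list_eq_length_filter length_filter_conv_card)
qed

definition indexes_blocks :: "nat \<Rightarrow> nat \<Rightarrow> (nat \<Rightarrow> nat) \<Rightarrow> bool" where
  "indexes_blocks n k b \<longleftrightarrow> b ` {1..n} = {1..k}"

lemma indexes_blocks_in: "indexes_blocks n k b \<Longrightarrow> x \<in> {1..n} \<Longrightarrow> b x \<in> {1..k}"
  unfolding indexes_blocks_def by blast

lemma indexes_blocks_ex: "indexes_blocks n k b \<Longrightarrow> i \<in> {1..k} \<Longrightarrow> \<exists>x\<in>{1..n}. b x = i"
  unfolding indexes_blocks_def by (metis imageE)

lemma indexes_blocks_permute: "indexes_blocks n k b \<Longrightarrow> \<pi> permutes {1..k} \<Longrightarrow> indexes_blocks n k (\<pi> \<circ> b)"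
  unfolding indexes_blocks_def by (metis image_comp permutes_image)

context equivariant_system
begin

text \<open>The family of \<open>F_part\<close> for an arbitrary numbering \<open>b\<close> of the
  blocks. Leaves number blocks by their least elements, while \<open>block\<close> has consecutive
  blocks of decreasing size.\<close>

definition pushed :: "(nat \<Rightarrow> nat) \<Rightarrow> nat \<Rightarrow> (nat, 'a) mpoly" where
  "pushed b i = subst_vars b (F (SOME x. x \<in> {1..n} \<and> b x = i))"

text \<open>Two members of a block are exchanged by a transposition, which \<open>b\<close> absorbs;
  so the choice in \<open>pushed\<close> does not matter.\<close>

lemma pushed_eq:
  assumes "x \<in> {1..n}"
  shows "pushed b (b x) = subst_vars b (F x)"
proof -
  define y where "y = (SOME y. y \<in> {1..n} \<and> b y = b x)"
  have y: "y \<in> {1..n}" "b y = b x" unfolding y_def using someI[of "\<lambda>y. y \<in> {1..n} \<and> b y = b x" x] assms by auto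
  have "subst_vars (transpose y x) (F y) = F x"
    using equivariant[OF y(1) permutes_swap_id[OF y(1) assms]] by simp
  then have "subst_vars b (F x) = subst_vars (b \<circ> transpose y x) (F y)" by (metis subst_vars_compose)
  also have "b \<circ> transpose y x = b" using y(2) by (auto simp: fun_eq_iff transpose_def)
  finally show ?thesis by (simp add: pushed_def y_def)
qed

lemma compatible_pushed:
  assumes b: "indexes_blocks n k b"
  shows "compatible {1..k} {1..k} d (pushed b)"
  unfolding compatible_def
proof (intro conjI ballI)
  fix i j assume "i \<in> {1..k}" "j \<in> {1..k}"
  then obtain x y where x: "x \<in> {1..n}" "b x = i" and y: "y \<in> {1..n}" "b y = j"
    using indexes_blocks_ex[OF b] by metis
  have pi: "pushed b i = subst_vars b (F x)" and pj: "pushed b j = subst_vars b (F y)"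
    using pushed_eq[OF x(1), of b] pushed_eq[OF y(1), of b] x y by simp_all
  have "b z \<in> {1..k}" if "z \<in> {1..n}" for z using indexes_blocks_in[OF b that] .
  then show "pushed b i \<in> polys {1..k}" unfolding pi by (rule polys_subst_vars[OF F_polys[OF x(1)]])
  show "homogeneous d (pushed b i)" unfolding pi by (rule homogeneous_subst_vars[OF F_homogeneous[OF x(1)]])
  have "F y = subst_vars (transpose x y) (F x)"
    using equivariant[OF x(1) permutes_swap_id[OF x(1) y(1)]] by simp
  then have "subst_vars (id(i := j)) (pushed b j) = subst_vars ((id(i := j) \<circ> b) \<circ> transpose x y) (F x)"
    unfolding pj by (simp only: subst_vars_compose comp_assoc)
  also have "(id(i := j) \<circ> b) \<circ> transpose x y = id(i := j) \<circ> b"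
    using x y by (auto simp: fun_eq_iff transpose_def)
  also have "subst_vars (id(i := j) \<circ> b) (F x) = subst_vars (id(i := j)) (pushed b i)"
    unfolding pi by (simp only: subst_vars_compose)
  finally show "subst_vars (id(i := j)) (pushed b i) = subst_vars (id(i := j)) (pushed b j)" by (rule sym)
qed simp

definition leaf :: "nat \<Rightarrow> (nat \<Rightarrow> nat) \<Rightarrow> 'a" where
  "leaf k b = Res k (\<lambda>i. d + 1 - i) (\<lambda>i. newton (pushed b) (rev [1..<i]) i)"

lemma leaf_vector: "1 \<le> k \<Longrightarrow> k \<le> d \<Longrightarrow> degree_vector k (\<lambda>i. d + 1 - i)"
  by unfold_locales auto

lemma leaf_system: "indexes_blocks n k b \<Longrightarrow> k \<le> d \<Longrightarrow> system k (\<lambda>i. d + 1 - i) (\<lambda>i. newton (pushed b) (rev [1..<i]) i)"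
proof -
  assume b: "indexes_blocks n k b" and "k \<le> d"
  show ?thesis unfolding system_def
  proof
    fix i assume i: "i \<in> {1..k}"
    then have "newton (pushed b) (rev [1..<i]) i \<in> polys {1..k}"
      "homogeneous (d - length (rev [1..<i])) (newton (pushed b) (rev [1..<i]) i)"
      by (intro newton_polys[OF compatible_pushed[OF b]]; auto)+
    moreover have "d - length (rev [1..<i]) = d + 1 - i" using i by auto
    ultimately show "newton (pushed b) (rev [1..<i]) i \<in> polys {1..k} \<and> homogeneous (d + 1 - i) (newton (pushed b) (rev [1..<i]) i)"
      by simp
  qed
qed

lemma leaf_permute_points:
  assumes b: "indexes_blocks n k b" and k: "1 \<le> k" "k \<le> d"
    and \<sigma>: "\<sigma> permutes {1..n}" and b': "\<And>x. x \<in> {1..n} \<Longrightarrow> b' x = b (\<sigma> x)"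
  shows "leaf k b' = leaf k b"
  unfolding leaf_def
proof (rule Res_cong'[OF leaf_vector[OF k]])
  have *: "pushed b' i = pushed b i" if "i \<in> {1..k}" for i
  proof -
    obtain y where y: "y \<in> {1..n}" "b y = i" using indexes_blocks_ex[OF b \<open>i \<in> {1..k}\<close>] by blast
    obtain x where x: "\<sigma> x = y" using permutes_surj[OF \<sigma>] by (metis surjD)
    then have xn: "x \<in> {1..n}" using y permutes_in_image[OF \<sigma>] by metis
    have "pushed b' i = subst_vars b' (F x)" using pushed_eq[OF xn, of b'] b'[OF xn] x y by simp
    also have "\<dots> = subst_vars (b \<circ> \<sigma>) (F x)"
      by (rule subst_vars_cong[OF F_polys[OF xn]]) (simp add: b')
    also have "\<dots> = subst_vars b (F y)"
      using equivariant[OF xn \<sigma>] x by (simp flip: subst_vars_compose)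
    finally show ?thesis using pushed_eq[OF y(1), of b] y by simp
  qed
  show "newton (pushed b') (rev [1..<i]) i = newton (pushed b) (rev [1..<i]) i" if "i \<in> {1..k}" for i
    by (rule newton_cong[of "{1..k}"]) (use * that in auto)
qed simp

text \<open>Numberings with equal fibre sizes differ by a permutation of the points, and
  equivariance absorbs it.\<close>

lemma leaf_fibres:
  assumes b: "indexes_blocks n k b" and b': "indexes_blocks n k b'" and k: "1 \<le> k" "k \<le> d"
    and fibres: "\<And>i. i \<in> {1..k} \<Longrightarrow> card {x \<in> {1..n}. b x = i} = card {x \<in> {1..n}. b' x = i}"
  shows "leaf k b' = leaf k b"
proof -
  have count: "count (image_mset f (mset_set {1..n})) i = card {x \<in> {1..n}. f x = i}" for f and i :: nat
  proof -
    have "count (image_mset f (mset_set {1..n})) i = card (f -` {i} \<inter> {1..n})"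
      by (simp add: count_image_mset)
    also have "f -` {i} \<inter> {1..n} = {x \<in> {1..n}. f x = i}" by auto
    finally show ?thesis .
  qed
  have "image_mset b' (mset_set {1..n}) = image_mset b (mset_set {1..n})"
  proof (rule multiset_eqI)
    fix i
    have "card {x \<in> {1..n}. b x = i} = card {x \<in> {1..n}. b' x = i}"
    proof (cases "i \<in> {1..k}")
      case False
      then have "{x \<in> {1..n}. b x = i} = {}" "{x \<in> {1..n}. b' x = i} = {}"
        using indexes_blocks_in[OF b] indexes_blocks_in[OF b'] by blast+
      then show ?thesis by (simp only:)
    qed (rule fibres)
    then show "count (image_mset b' (mset_set {1..n})) i = count (image_mset b (mset_set {1..n})) i"
      by (simp only: count)
  qed
  from image_mset_eq_implies_permutes[OF finite_atLeastAtMost this]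
  obtain \<sigma> where "\<sigma> permutes {1..n}" "\<forall>x\<in>{1..n}. b' x = b (\<sigma> x)" by blast
  then show ?thesis using leaf_permute_points[OF b k] by blast
qed

text \<open>Up to the renaming of \<open>x_i\<close> and \<open>x_(i + 1)\<close>, the exchange of
  two adjacent blocks only changes the \<open>i\<close>-th divided difference, and that by a
  multiple of the next one.\<close>

lemma leaf_transpose_adjacent:
  assumes b: "indexes_blocks n k b" and k: "k \<le> d" and i: "1 \<le> i" "i + 1 \<le> k"
  shows "leaf k (transpose i (i + 1) \<circ> b) = leaf k b"
proof -
  define \<tau> where "\<tau> = transpose i (i + 1)"
  have \<tau>: "\<tau> permutes {1..k}" unfolding \<tau>_def using i by (intro permutes_swap_id) auto
  have \<tau>s: "\<tau> i = i + 1" "\<tau> (i + 1) = i" "\<And>l. l \<noteq> i \<Longrightarrow> l \<noteq> i + 1 \<Longrightarrow> \<tau> l = l" "\<And>l. \<tau> (\<tau> l) = l"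
    by (simp_all add: \<tau>_def)
  define G H where "G = pushed b" and "H = pushed (\<tau> \<circ> b)"
  have cG: "compatible {1..k} {1..k} d G" unfolding G_def by (rule compatible_pushed[OF b])
  have k1: "1 \<le> k" using i by simp
  define g where "g l = newton G (rev [1..<l]) l" for l
  have HG: "H (\<tau> l) = subst_vars \<tau> (G l)" if l: "l \<in> {1..k}" for l
  proof -
    obtain x where x: "x \<in> {1..n}" "b x = l" using indexes_blocks_ex[OF b l] by blast
    have "H (\<tau> l) = subst_vars (\<tau> \<circ> b) (F x)" unfolding H_def using pushed_eq[OF x(1), of "\<tau> \<circ> b"] x by simp
    also have "\<dots> = subst_vars \<tau> (G l)" unfolding G_def using pushed_eq[OF x(1), of b] x by (simp add: subst_vars_compose)
    finally show ?thesis .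
  qed
  have sub: "newton H (map \<tau> as) (\<tau> l) = subst_vars \<tau> (newton G as l)"
    if "distinct (l # as)" "set (l # as) \<subseteq> {1..k}" for as l
    by (rule newton_subst[OF cG HG permutes_inj_on[OF \<tau>] order_refl that])
  have low: "map \<tau> (rev [1..<l]) = rev [1..<l]" if "l \<le> i" for l
    by (intro map_idI) (use that \<tau>s(3) in auto)
  have icons: "rev [1..<i + 1] = i # rev [1..<i]" using upt_snoc[OF i(1)] by (simp only: rev_append) simp
  \<comment> \<open>Newton's recursion read backwards: the divided difference with
    \<open>i + 1\<close> in place of \<open>i\<close> is obtained by an elementary
    operation.\<close>
  have hi: "newton G (rev [1..<i]) (i + 1) = g i + (Var (i + 1) - Var i) * g (i + 1)"
  proof -
    have "(Var (i + 1) - Var i) * newton G (i # rev [1..<i]) (i + 1) = newton G (rev [1..<i]) (i + 1) - newton G (rev [1..<i]) i"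
      using i by (intro newton_Cons[OF cG]) auto
    then show ?thesis unfolding g_def icons by simp
  qed
  have H_eq: "newton H (rev [1..<l]) l = subst_vars \<tau> ((g(i := g i + (Var (i + 1) - Var i) * g (i + 1))) l)"
    if l: "l \<in> {1..k}" for l
  proof -
    consider "l < i" | "l = i" | "l = i + 1" | "l > i + 1" by linarith
    then show ?thesis
    proof cases
      case 1
      then have "newton H (map \<tau> (rev [1..<l])) (\<tau> l) = subst_vars \<tau> (newton G (rev [1..<l]) l)"
        using l by (intro sub) auto
      then show ?thesis using 1 low[of l] \<tau>s(3)[of l] by (simp add: g_def)
    next
      case 2
      have "newton H (map \<tau> (rev [1..<i])) (\<tau> (i + 1)) = subst_vars \<tau> (newton G (rev [1..<i]) (i + 1))"
        using i by (intro sub) auto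
      then show ?thesis using 2 low[of i] \<tau>s(2) hi by simp
    next
      case 3
      have map3: "map \<tau> ((i + 1) # rev [1..<i]) = rev [1..<i + 1]"
        unfolding list.map low[OF order_refl] \<tau>s icons ..
      have "newton H (map \<tau> ((i + 1) # rev [1..<i])) (\<tau> i) = subst_vars \<tau> (newton G ((i + 1) # rev [1..<i]) i)"
        using i by (intro sub) auto
      also have "newton G ((i + 1) # rev [1..<i]) i = newton G (i # rev [1..<i]) (i + 1)"
        using i by (intro newton_swap_last[OF cG]) auto
      finally have "newton H (rev [1..<i + 1]) (i + 1) = subst_vars \<tau> (g (i + 1))"
        unfolding map3 \<tau>s(1) g_def icons .
      then show ?thesis using 3 by simp
    next
      \<comment> \<open>Both exchanged points lie among the earlier points of the divided
        difference, so symmetry leaves it unchanged.\<close>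
      case 4
      let ?as = "rev [i + 2..<l]" and ?cs = "rev [1..<i]"
      have split: "rev [1..<l] = ?as @ (i + 1) # i # ?cs"
      proof -
        have l2: "i + 2 + (l - (i + 2)) = l" "1 \<le> i + 2" using 4 by auto
        have "[1..<l] = [1..<i + 2] @ [i + 2..<l]"
          using upt_add_eq_append[OF l2(2), of "l - (i + 2)"] unfolding l2(1) .
        moreover have "[1..<i + 2] = [1..<i] @ [i, i + 1]"
        proof -
          have "i + 1 + 1 = i + 2" "1 \<le> i + 1" by simp_all
          then show ?thesis using upt_snoc[of "i + 1"] unfolding upt_snoc[OF i(1)] by (metis append.assoc append_Cons append_Nil)
        qed
        ultimately have "[1..<l] = [1..<i] @ [i, i + 1] @ [i + 2..<l]" by (simp only: append_assoc)
        then show ?thesis by (simp only: rev_append append_assoc) simp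
      qed
      have map_as: "map \<tau> ?as = ?as" by (intro map_idI) (use \<tau>s(3) in auto)
      have map4: "map \<tau> (?as @ i # (i + 1) # ?cs) = rev [1..<l]"
        unfolding split map_append list.map low[OF order_refl] map_as \<tau>s ..
      have \<tau>l: "\<tau> l = l" using 4 by (intro \<tau>s(3)) auto
      have "newton H (map \<tau> (?as @ i # (i + 1) # ?cs)) (\<tau> l) = subst_vars \<tau> (newton G (?as @ i # (i + 1) # ?cs) l)"
        using i l 4 by (intro sub) auto
      also have "newton G (?as @ i # (i + 1) # ?cs) l = newton G (rev [1..<l]) l"
        unfolding split newton_append
      proof (rule newton_cong[of "{i + 2..l}"])
        show "newton G (i # (i + 1) # ?cs) x = newton G ((i + 1) # i # ?cs) x" if "x \<in> {i + 2..l}" for x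
          using i l that by (intro newton_swap_head[OF cG]) auto
      qed (use 4 in auto)
      finally have "newton H (rev [1..<l]) l = subst_vars \<tau> (g l)" unfolding map4 \<tau>l g_def .
      then show ?thesis using 4 by simp
    qed
  qed
  let ?e = "\<lambda>l. d + 1 - l" and ?g = "g(i := g i + (Var (i + 1) - Var i) * g (i + 1))"
  note dv = leaf_vector[OF k1 k]
  have sys: "system k ?e g" unfolding g_def G_def by (rule leaf_system[OF b k])
  have hom1: "homogeneous 1 (Var x :: (nat, 'a) mpoly)" for x by (simp add: One_nat_def)
  have h: "Var (i + 1) - Var i \<in> (polys {1..k} :: (nat, 'a) mpoly set)" "homogeneous 1 (Var (i + 1) - Var i :: (nat, 'a) mpoly)"
    using i by (auto intro!: polys_diff polys_Var homogeneous_diff hom1)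
  have e1: "?e i - ?e (i + 1) = 1" "?e (i + 1) \<le> ?e i" using i k by auto
  have Res_g: "Res k ?e ?g = Res k ?e g"
    by (rule Res_add[OF dv sys]) (use h e1 i in simp_all)
  have sys': "system k ?e ?g"
  proof -
    have gi: "g i \<in> polys {1..k}" "homogeneous (?e i) (g i)" "g (i + 1) \<in> polys {1..k}" "homogeneous (?e (i + 1)) (g (i + 1))"
    proof -
      have "i \<in> {1..k}" "i + 1 \<in> {1..k}" using i by auto
      then show "g i \<in> polys {1..k}" "homogeneous (?e i) (g i)" "g (i + 1) \<in> polys {1..k}" "homogeneous (?e (i + 1)) (g (i + 1))"
        using sys unfolding system_def by blast+
    qed
    have "1 + ?e (i + 1) = ?e i" using i k by auto
    then have "homogeneous (?e i) ((Var (i + 1) - Var i) * g (i + 1))"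
      using homogeneous_mult[OF h(2) gi(4)] by (simp only:)
    then have "homogeneous (?e i) (g i + (Var (i + 1) - Var i) * g (i + 1))"
      using gi(2) by (intro homogeneous_add)
    then have "system k (?e(i := ?e i)) ?g"
      by (intro system_upd[OF sys] polys_add gi(1) polys_mult h(1) gi(3))
    then show ?thesis by (simp only: fun_upd_triv)
  qed
  have "even (\<Prod>l\<in>{1..k}. ?e l)"
  proof -
    \<comment> \<open>The degrees of equations \<open>i\<close> and \<open>i + 1\<close> are
      consecutive, so the renaming contributes no sign.\<close>
    have "even (?e i) \<or> even (?e (i + 1))"
    proof -
      have "?e i = ?e (i + 1) + 1" using i k by auto
      then show ?thesis by (metis even_plus_one_iff)
    qed
    moreover have "?e i dvd (\<Prod>l\<in>{1..k}. ?e l)" "?e (i + 1) dvd (\<Prod>l\<in>{1..k}. ?e l)"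
      using i by (intro dvd_prodI; simp)+
    ultimately show ?thesis using dvd_trans by blast
  qed
  then have "Res k ?e (\<lambda>l. subst_vars \<tau> (?g l)) = Res k ?e ?g"
    unfolding \<tau>_def using i by (intro Res_transpose_vars[OF dv sys']) auto
  moreover have "leaf k (\<tau> \<circ> b) = Res k ?e (\<lambda>l. subst_vars \<tau> (?g l))"
    unfolding leaf_def H_def[symmetric] by (rule Res_cong'[OF dv]) (use H_eq in auto)
  ultimately show ?thesis using Res_g by (simp add: leaf_def \<tau>_def g_def[abs_def] G_def)
qed

text \<open>Adjacent transpositions generate all permutations; a longer transposition is shortened
  by conjugation with an adjacent one.\<close>

lemma leaf_permute_blocks:
  assumes b: "indexes_blocks n k b" and k: "k \<le> d" and \<pi>: "\<pi> permutes {1..k}"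
  shows "leaf k (\<pi> \<circ> b) = leaf k b"
proof -
  have less: "leaf k (transpose i (i + 1 + l) \<circ> b) = leaf k b" if "indexes_blocks n k b" "1 \<le> i" "i + 1 + l \<le> k" for i l b
    using that(1,3)
  proof (induction l arbitrary: b)
    case 0
    then show ?case using leaf_transpose_adjacent[OF 0(1) k that(2)] by (simp only: add_0_right)
  next
    case (Suc l)
    define m where "m = i + 1 + l"
    have m: "i + 1 + Suc l = m + 1" "1 \<le> m" "m + 1 \<le> k" "i < m" using Suc.prems by (auto simp: m_def)
    let ?\<tau> = "transpose m (m + 1)"
    have \<tau>: "?\<tau> permutes {1..k}" and \<tau>': "transpose i m permutes {1..k}"
      using m that(2) by (auto intro!: permutes_swap_id)
    have b1: "indexes_blocks n k (?\<tau> \<circ> b)" by (rule indexes_blocks_permute[OF Suc.prems(1) \<tau>])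
    have b2: "indexes_blocks n k (transpose i m \<circ> (?\<tau> \<circ> b))" by (rule indexes_blocks_permute[OF b1 \<tau>'])
    have t: "transpose i (m + 1) x = ?\<tau> (transpose i m (?\<tau> x))" for x
      using m(4) by (simp add: transpose_def)
    have "transpose i (m + 1) \<circ> b = ?\<tau> \<circ> (transpose i m \<circ> (?\<tau> \<circ> b))"
      by (rule ext) (simp only: comp_apply t)
    then have "leaf k (transpose i (m + 1) \<circ> b) = leaf k (?\<tau> \<circ> (transpose i m \<circ> (?\<tau> \<circ> b)))"
      by (rule arg_cong)
    also have "\<dots> = leaf k (transpose i m \<circ> (?\<tau> \<circ> b))" by (rule leaf_transpose_adjacent[OF b2 k m(2,3)])
    also have "\<dots> = leaf k (?\<tau> \<circ> b)" by (rule Suc.IH[OF b1, folded m_def]) (use m(3) in simp)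
    also have "\<dots> = leaf k b" by (rule leaf_transpose_adjacent[OF Suc.prems(1) k m(2,3)])
    finally show ?case by (simp only: m(1))
  qed
  have transposition: "leaf k (transpose i j \<circ> b) = leaf k b" if "indexes_blocks n k b" "i \<in> {1..k}" "j \<in> {1..k}" for i j b
  proof -
    have *: "leaf k (transpose i j \<circ> b) = leaf k b" if "i \<in> {1..k}" "j \<in> {1..k}" "i < j" for i j
    proof -
      have "j = i + 1 + (j - i - 1)" using \<open>i < j\<close> by linarith
      then obtain l where "j = i + 1 + l" by blast
      then show ?thesis using less[OF \<open>indexes_blocks n k b\<close>, of i l] that by auto
    qed
    consider "i < j" | "i = j" | "j < i" by linarith
    then show ?thesis
    proof cases
      case 3
      then show ?thesis using *[of j i] that by (simp add: transpose_commute)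
    qed (use * that in auto)
  qed
  show ?thesis using \<pi> finite_atLeastAtMost
  proof (induction rule: permutes_induct)
    case (swap i j p)
    have "leaf k (transpose i j \<circ> (p \<circ> b)) = leaf k (p \<circ> b)"
      by (rule transposition[OF indexes_blocks_permute[OF b swap(4)] swap(1,2)])
    then show ?case using swap(5) by (simp only: comp_assoc)
  qed simp
qed

text \<open>Elimination of the linear equations merges the indeterminates of each block, and
  \<open>newton_subst\<close> carries the divided differences along because the representatives lie
  in different blocks.\<close>

theorem W_eq_leaf:
  assumes xs: "xs \<in> trees n"
  shows "W xs = leaf (card (set xs)) (\<lambda>q. xs ! (q - 1))" "indexes_blocks n (card (set xs)) (\<lambda>q. xs ! (q - 1))"
proof -
  define k where "k = card (set xs)"
  define b where "b q = xs ! (q - 1)" for q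
  have g: "xs \<in> growth_lists n" "card (set xs) \<le> d" using xs by (auto simp: trees_def)
  note ctx = g(1) order_refl g(2) k_def
  note rep = rep_in[OF ctx]
  have len: "length xs = n" using growth_lists_props[OF g(1)] by simp
  have set_xs: "set xs = {1..k}" using growth_lists_props[OF g(1)] by (simp add: k_def)
  have b_in: "b q \<in> {1..k}" if "q \<in> {1..n}" for q unfolding b_def by (rule entry[OF ctx that])
  have b_rep: "b (rep xs i) = i" if "i \<in> {1..k}" for i unfolding b_def by (rule rep(2)[OF that])
  have ib: "indexes_blocks n k b"
    unfolding indexes_blocks_def
  proof
    show "b ` {1..n} \<subseteq> {1..k}" using b_in by blast
    show "{1..k} \<subseteq> b ` {1..n}"
    proof
      fix i assume "i \<in> {1..k}"
      then show "i \<in> b ` {1..n}" using b_rep[of i] rep(1)[of i] by (intro image_eqI[of _ _ "rep xs i"]) simp_all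
    qed
  qed
  then show "indexes_blocks n (card (set xs)) (\<lambda>q. xs ! (q - 1))" unfolding k_def b_def .
  have k: "1 \<le> k" "k \<le> d" using b_in[of 1] n_pos g(2) by (auto simp: k_def)
  have reps_sub: "rep xs ` {1..i} \<subseteq> rep xs ` {1..k}" if "i \<le> k" for i using that by auto
  interpret D: degree_vector n "deg xs"
    using deg_pos[OF ctx] n_pos by unfold_locales auto
  have "W xs = Res n (\<lambda>q. if rep xs (b q) = q then d + 1 - b q else 1)
      (\<lambda>q. if rep xs (b q) = q then newton F (reps xs (b q - 1)) (rep xs (b q)) else Var q - Var (rep xs (b q)))"
    unfolding W_def
    by (rule Res_cong'[OF D.degree_vector_axioms]) (auto simp: deg_def slot_def len b_def)
  also have "\<dots> = Res k (\<lambda>i. d + 1 - i) (\<lambda>i. subst_vars b (newton F (reps xs (i - 1)) (rep xs i)))"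
  proof (rule Res_eliminate[where g = "\<lambda>i. newton F (reps xs (i - 1)) (rep xs i)" and e = "\<lambda>i. d + 1 - i"])
    fix i assume i: "i \<in> {1..k}"
    then have i': "i - 1 \<le> k" "d - (i - 1) = d + 1 - i" using k by auto
    show "newton F (reps xs (i - 1)) (rep xs i) \<in> polys {1..n}"
      "homogeneous (d + 1 - i) (newton F (reps xs (i - 1)) (rep xs i))"
      using newton_reps[OF ctx i'(1) rep(1)[OF i] rep_fresh[OF ctx i]] i'(2) by simp_all
    show "d + 1 - i \<ge> 1" using i k by auto
  qed (use k b_in b_rep rep(1) in simp_all)
  also have "\<dots> = leaf k b"
    unfolding leaf_def
  proof (rule Res_cong'[OF leaf_vector[OF k]])
    fix i assume i: "i \<in> {1..k}"
    then have i1: "i - 1 + 1 = i" "{1..i - 1} \<subseteq> set xs" "i - 1 \<le> k" by (auto simp: set_xs)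
    have "newton (pushed b) (map b (reps xs (i - 1))) (b (rep xs i)) = subst_vars b (newton F (reps xs (i - 1)) (rep xs i))"
    proof (rule newton_subst[OF compatible_F])
      show "pushed b (b x) = subst_vars b (F x)" if "x \<in> rep xs ` {1..k}" for x
        using that rep(1) by (intro pushed_eq) auto
      show "inj_on b (rep xs ` {1..k})" by (rule inj_on_inverseI[of _ "rep xs"]) (use b_rep in auto)
      show "rep xs ` {1..k} \<subseteq> {1..n}" using rep(1) by blast
      show "distinct (rep xs i # reps xs (i - 1))"
        using rep_fresh[OF ctx i] distinct_reps[OF i1(2)] by (simp add: set_reps)
      show "set (rep xs i # reps xs (i - 1)) \<subseteq> rep xs ` {1..k}"
        using i reps_sub[OF i1(3)] by (simp add: set_reps)
    qed
    moreover have "map b (reps xs (i - 1)) = rev [1..<i]"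
    proof -
      have "map b (reps xs (i - 1)) = rev (map (\<lambda>l. b (rep xs l)) [1..<i])"
        unfolding reps_def i1(1) by (simp add: rev_map)
      also have "map (\<lambda>l. b (rep xs l)) [1..<i] = [1..<i]"
        by (rule map_idI) (use i b_rep in auto)
      finally show ?thesis .
    qed
    ultimately show "subst_vars b (newton F (reps xs (i - 1)) (rep xs i)) = newton (pushed b) (rev [1..<i]) i"
      by (simp add: b_rep[OF i])
  qed simp
  finally show "W xs = leaf (card (set xs)) (\<lambda>q. xs ! (q - 1))" unfolding k_def b_def .
qed

lemma indexes_blocks_block:
  assumes "\<mu> \<in> partitions n"
  shows "indexes_blocks n (length \<mu>) (block \<mu>)"
  unfolding indexes_blocks_def
proof
  have sum: "sum_list \<mu> = n" and pos: "\<forall>a\<in>set \<mu>. a > 0" using assms by (auto simp: partitions_def)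
  show "block \<mu> ` {1..n} \<subseteq> {1..length \<mu>}"
  proof
    fix i assume "i \<in> block \<mu> ` {1..n}"
    then obtain x where "x \<in> {1..n}" "block \<mu> x = i" by blast
    then show "i \<in> {1..length \<mu>}" using block_eq_iff[of x \<mu> i] sum by simp
  qed
  show "{1..length \<mu>} \<subseteq> block \<mu> ` {1..n}"
  proof
    fix i assume i: "i \<in> {1..length \<mu>}"
    then have "\<mu> ! (i - 1) > 0" using pos by auto
    then have "card {x \<in> {1..n}. block \<mu> x = i} > 0" using card_block[OF i] unfolding sum by (simp only:)
    then have "{x \<in> {1..n}. block \<mu> x = i} \<noteq> {}" unfolding card_gt_0_iff by (rule conjunct1)
    then show "i \<in> block \<mu> ` {1..n}" by blast
  qed
qed

lemma leaf_block:
  assumes "\<mu> \<in> partitions n" "length \<mu> \<le> d"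
  shows "leaf (length \<mu>) (block \<mu>) = Res_part d F \<mu>"
proof -
  have sum: "sum_list \<mu> = n" using assms by (auto simp: partitions_def)
  then have "length \<mu> \<ge> 1" using n_pos by (cases \<mu>) auto
  have F: "F_part \<mu> F = pushed (block \<mu>)"
    by (simp add: fun_eq_iff F_part_def rho_def pushed_def sum)
  show ?thesis unfolding leaf_def Res_part_def F
  proof (rule Res_cong'[OF leaf_vector[OF \<open>length \<mu> \<ge> 1\<close> assms(2)]])
    fix i assume "i \<in> {1..length \<mu>}"
    then show "newton (pushed (block \<mu>)) (rev [1..<i]) i = divdiff (length \<mu>) d (pushed (block \<mu>)) {1..i}"
      using assms(2) by (intro divdiff_eq_newton[OF compatible_pushed[OF indexes_blocks_block[OF assms(1)]], symmetric]) auto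
  qed simp
qed

text \<open>The permutation \<open>\<pi>\<close> sorts the blocks of the leaf by size. After it the
  fibres of the two numberings have equal sizes, so \<open>leaf_permute_blocks\<close> and
  \<open>leaf_fibres\<close> identify the resultants.\<close>

theorem W_eq_Res_part:
  assumes xs: "xs \<in> trees n"
  shows "W xs = Res_part d F (shape xs)"
proof -
  define \<mu> k b where "\<mu> = shape xs" and "k = card (set xs)" and "b q = xs ! (q - 1)" for q
  have g: "xs \<in> growth_lists n" "k \<le> d" using xs by (auto simp: trees_def k_def)
  have \<mu>: "\<mu> \<in> partitions n" "length \<mu> = k" "sum_list \<mu> = n"
    using shape_partition[OF g(1)] by (auto simp: \<mu>_def k_def length_shape partitions_def)
  have len: "length xs = n" using growth_lists_props[OF g(1)] by simp
  have Wb: "W xs = leaf k b" and ib: "indexes_blocks n k b"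
    using W_eq_leaf[OF xs] unfolding k_def b_def by auto
  have k: "1 \<le> k" using indexes_blocks_in[OF ib, of 1] n_pos by auto
  have "mset \<mu> = image_mset (\<lambda>i. \<mu> ! (i - 1)) (mset_set {1..k})"
  proof -
    have "\<mu> = map (\<lambda>i. \<mu> ! (i - 1)) [1..<k + 1]"
      using \<mu>(2) by (intro nth_equalityI) (simp_all del: upt_Suc)
    then have "mset \<mu> = mset (map (\<lambda>i. \<mu> ! (i - 1)) [1..<k + 1])" by (rule arg_cong)
    also have "\<dots> = image_mset (\<lambda>i. \<mu> ! (i - 1)) (mset_set {1..<k + 1})" by (simp only: mset_map mset_upt)
    also have "{1..<k + 1} = {1..k}" by auto
    finally show ?thesis .
  qed
  then have "image_mset (count_list xs) (mset_set {1..k}) = image_mset (\<lambda>i. \<mu> ! (i - 1)) (mset_set {1..k})"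
    using mset_shape[of xs] by (simp only: \<mu>_def block_sizes_def k_def)
  from image_mset_eq_implies_permutes[OF finite_atLeastAtMost this]
  obtain \<pi> where \<pi>: "\<pi> permutes {1..k}" "\<forall>i\<in>{1..k}. count_list xs i = \<mu> ! (\<pi> i - 1)" by blast
  have "leaf k (block \<mu>) = leaf k (\<pi> \<circ> b)"
  proof (rule leaf_fibres[OF indexes_blocks_permute[OF ib \<pi>(1)] _ k g(2)])
    show "indexes_blocks n k (block \<mu>)" using indexes_blocks_block[OF \<mu>(1)] \<mu>(2) by simp
    fix l assume l: "l \<in> {1..k}"
    then obtain i where i: "i \<in> {1..k}" "\<pi> i = l" using permutes_image[OF \<pi>(1)] by (metis imageE)
    have inj: "\<pi> x = l \<longleftrightarrow> x = i" for x using permutes_inj[OF \<pi>(1)] i(2) by (metis injD)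
    have "card {x \<in> {1..n}. (\<pi> \<circ> b) x = l} = count_list xs i"
      using card_positions[of xs i] by (simp only: comp_apply inj b_def len)
    also have "\<dots> = card {x \<in> {1..n}. block \<mu> x = l}"
      using card_block[of l \<mu>] \<pi>(2) i l \<mu>(2,3) by simp
    finally show "card {x \<in> {1..n}. (\<pi> \<circ> b) x = l} = card {x \<in> {1..n}. block \<mu> x = l}" .
  qed
  then show ?thesis
    using leaf_block[OF \<mu>(1)] leaf_permute_blocks[OF ib g(2) \<pi>(1)] \<mu>(2) g(2) Wb by (simp add: \<mu>_def)
qed

lemma trees_fibre:
  assumes "\<mu> \<in> partitions n" "length \<mu> \<le> d"
  shows "card {xs \<in> trees n. shape xs = \<mu>} = m_part \<mu>"
proof -
  have "{xs \<in> trees n. shape xs = \<mu>} = {xs \<in> growth_lists n. shape xs = \<mu>}"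
    using assms(2) length_shape by (auto simp: trees_def)
  then show ?thesis using card_shape[OF assms(1)] by simp
qed

lemma shape_trees: "shape ` trees n \<subseteq> {\<mu> \<in> partitions n. length \<mu> \<le> d}"
  using shape_partition length_shape by (auto simp: trees_def)

lemma finite_short_partitions: "finite {\<mu> \<in> partitions n. length \<mu> \<le> d}"
  using finite_partitions by simp

lemma prod_W: "(\<Prod>xs\<in>trees n. W xs) = (\<Prod>\<mu> | \<mu> \<in> partitions n \<and> length \<mu> \<le> d. Res_part d F \<mu> ^ m_part \<mu>)"
proof -
  have "(\<Prod>xs\<in>trees n. W xs) = (\<Prod>xs\<in>trees n. Res_part d F (shape xs))"
    by (rule prod.cong) (simp_all add: W_eq_Res_part)
  also have "\<dots> = (\<Prod>\<mu> | \<mu> \<in> partitions n \<and> length \<mu> \<le> d. \<Prod>xs | xs \<in> trees n \<and> shape xs = \<mu>. Res_part d F (shape xs))"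
    by (rule prod.group[OF finite_trees finite_short_partitions shape_trees, symmetric])
  also have "\<dots> = (\<Prod>\<mu> | \<mu> \<in> partitions n \<and> length \<mu> \<le> d. Res_part d F \<mu> ^ m_part \<mu>)"
    by (rule prod.cong) (simp_all add: trees_fibre)
  finally show ?thesis .
qed

lemma sum_leaf_weight:
  "(\<Sum>xs\<in>trees n. leaf_weight (card (set xs))) =
   (\<Sum>\<mu> | \<mu> \<in> partitions n \<and> length \<mu> \<le> d. of_nat (m_part \<mu>) * leaf_weight (length \<mu>))"
proof -
  have "(\<Sum>xs\<in>trees n. leaf_weight (card (set xs))) = (\<Sum>xs\<in>trees n. leaf_weight (length (shape xs)))"
    by (simp add: length_shape)
  also have "\<dots> = (\<Sum>\<mu> | \<mu> \<in> partitions n \<and> length \<mu> \<le> d. \<Sum>xs | xs \<in> trees n \<and> shape xs = \<mu>. leaf_weight (length (shape xs)))"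
    by (rule sum.group[OF finite_trees finite_short_partitions shape_trees, symmetric])
  also have "\<dots> = (\<Sum>\<mu> | \<mu> \<in> partitions n \<and> length \<mu> \<le> d. of_nat (m_part \<mu>) * leaf_weight (length \<mu>))"
    by (rule sum.cong) (simp_all add: trees_fibre)
  finally show ?thesis .
qed

text \<open>At height 0 the weight of a node is its \<open>leaf_weight\<close>; summed over the
  leaves and grouped by shape it is the sum subtracted in \<open>m_zero\<close>.\<close>

theorem Res_factorization:
  "\<exists>M :: nat. of_nat M = m_zero n d \<and> (n \<le> d \<longrightarrow> M = 0) \<and>
     Res n (\<lambda>_. d) F = Poly_Mapping.lookup (divdiff n d F {1..d + 1}) 0 ^ M *
       (\<Prod>\<mu> | \<mu> \<in> partitions n \<and> length \<mu> \<le> d. Res_part d F \<mu> ^ m_part \<mu>)"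
proof -
  obtain M :: nat where M: "of_nat M + (\<Sum>xs\<in>trees n. weight (card (set xs)) (n - n)) = of_nat n * of_nat d ^ (n - 1)"
    "Res n (\<lambda>_. d) F = const_diff ^ M * (\<Prod>xs\<in>trees n. W xs)" "n \<le> d \<longrightarrow> M = 0"
    using Res_trees[OF order_refl] by blast
  have "(\<Sum>xs\<in>trees n. weight (card (set xs)) (n - n)) = (\<Sum>xs\<in>trees n. leaf_weight (card (set xs)))"
    by (simp add: weight_def)
  also have "\<dots> = of_nat n * of_nat d ^ (n - 1) - m_zero n d"
    unfolding sum_leaf_weight unfolding m_zero_def leaf_weight_def by simp
  finally have "of_nat M = m_zero n d" using M(1) by simp
  then show ?thesis using M(2,3) unfolding prod_W const_diff_def by blast
qed

end

theorem theorem3p3: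
  fixes n d :: nat
    and F :: "nat \<Rightarrow> (nat, 'r::comm_ring_1) mpoly"
  assumes "n \<ge> 2" and "d \<ge> 1"
    and "\<And>i. i \<in> {1..n} \<Longrightarrow> F i \<in> polys {1..n}"
    and "\<And>i. i \<in> {1..n} \<Longrightarrow> homogeneous d (F i)"
    and "\<And>i \<sigma>. i \<in> {1..n} \<Longrightarrow> \<sigma> permutes {1..n} \<Longrightarrow> subst_vars \<sigma> (F i) = F (\<sigma> i)"
  shows "(d \<ge> n \<longrightarrow>
           Res n (\<lambda>_. d) F = (\<Prod>\<mu>\<in>partitions n. Res_part d F \<mu> ^ m_part \<mu>))
       \<and> (d < n \<longrightarrow>
           (\<exists>m0 :: nat. of_nat m0 = m_zero n d \<and>
             Res n (\<lambda>_. d) F =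
               Poly_Mapping.lookup (divdiff n d F {1..d+1}) 0 ^ m0 *
               (\<Prod>\<mu> | \<mu> \<in> partitions n \<and> length \<mu> \<le> d. Res_part d F \<mu> ^ m_part \<mu>)))"
proof -
  interpret equivariant_system n d F
    using assms by unfold_locales auto
  obtain M :: nat where M: "of_nat M = m_zero n d" "n \<le> d \<longrightarrow> M = 0"
    "Res n (\<lambda>_. d) F = Poly_Mapping.lookup (divdiff n d F {1..d + 1}) 0 ^ M *
       (\<Prod>\<mu> | \<mu> \<in> partitions n \<and> length \<mu> \<le> d. Res_part d F \<mu> ^ m_part \<mu>)"
    using Res_factorization by blast
  \<comment> \<open>A partition of \<open>n\<close> has at most \<open>n\<close> parts, so for
    \<open>n \<le> d\<close> the bound on the length excludes nothing; the constant then has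
    exponent 0.\<close>
  have "{\<mu>. \<mu> \<in> partitions n \<and> length \<mu> \<le> d} = partitions n" if "n \<le> d"
    using partitions_length that by fastforce
  then show ?thesis using M by auto
qed

end
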